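(* The global dimension of the graded Hecke algebra $\mathbb H$ (with arbitrary complex parameters $k_\alpha$) equals $\dim_{\mathbb C}(\mathfrak t^* )$.
   Context: Let $\mathfrak a$ be a finite dimensional real inner product space with dual $\mathfrak a^*$, $R\subset\mathfrak a^*$ a reduced crystallographic root system (possibly empty, not necessarily spanning $\mathfrak a^*$) with dual root system $R^\vee\subset\mathfrak a$, basis $\Pi$ and Weyl group $W$. Let $\mathfrak t^*$ be the complexification of $\mathfrak a^*$. Let $k_\alpha\in\mathbb C$ ($\alpha\in\Pi$) be parameters with $k_\alpha=k_\beta$ if $\alpha,\beta$ are $W$-conjugate. The graded Hecke algebra $\mathbb H$ is $\mathbb C[W]\otimes S(\mathfrak t^* )$ as a vector space, with $\mathbb C[W]$ and $S(\mathfrak t^* )$ embedded as subalgebras and the cross relation $x\cdot s_\alpha-s_\alpha\cdot s_\alpha(x)=k_\alpha\langle x,\alpha^\vee\rangle$ for $x\in\mathfrak t^*$, $\alpha\in\Pi$. The global dimension of an algebra $A$ is the largest integer $d\ge0$ such that the functor $\mathrm{Ext}^d_A$ is not identically zero, or $\infty$ if no such integer exists. *)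

theory Defs
  imports
    "HOL-Analysis.Analysis"
    "HOL-Library.Poly_Mapping"
    "HOL-Library.Extended_Nat"
    "HOL-Algebra.Module"
    "HOL-Algebra.QuotRing"
    "HOL-Algebra.Algebraic_Closure_Type"
begin

section \<open>Left modules, Ext and global dimension\<close>

text \<open>
  The locale \<open>module\<close> of HOL-Algebra requires a commutative base ring. As there, the
  multiplicative fields of the record carrying the module are irrelevant.
\<close>

locale left_module = R?: ring R + M?: abelian_group M
  for R :: "('r, 'x) ring_scheme" (structure)
    and M :: "('r, 'm, 'y) module_scheme" (structure) +
  assumes smult_closed:
      "\<lbrakk>a \<in> carrier R; x \<in> carrier M\<rbrakk> \<Longrightarrow> a \<odot>\<^bsub>M\<^esub> x \<in> carrier M"
    and smult_l_distr:
      "\<lbrakk>a \<in> carrier R; b \<in> carrier R; x \<in> carrier M\<rbrakk> \<Longrightarrow>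
       (a \<oplus>\<^bsub>R\<^esub> b) \<odot>\<^bsub>M\<^esub> x = a \<odot>\<^bsub>M\<^esub> x \<oplus>\<^bsub>M\<^esub> b \<odot>\<^bsub>M\<^esub> x"
    and smult_r_distr:
      "\<lbrakk>a \<in> carrier R; x \<in> carrier M; y \<in> carrier M\<rbrakk> \<Longrightarrow>
       a \<odot>\<^bsub>M\<^esub> (x \<oplus>\<^bsub>M\<^esub> y) = a \<odot>\<^bsub>M\<^esub> x \<oplus>\<^bsub>M\<^esub> a \<odot>\<^bsub>M\<^esub> y"
    and smult_assoc:
      "\<lbrakk>a \<in> carrier R; b \<in> carrier R; x \<in> carrier M\<rbrakk> \<Longrightarrow>
       (a \<otimes>\<^bsub>R\<^esub> b) \<odot>\<^bsub>M\<^esub> x = a \<odot>\<^bsub>M\<^esub> (b \<odot>\<^bsub>M\<^esub> x)"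
    and smult_one: "x \<in> carrier M \<Longrightarrow> \<one>\<^bsub>R\<^esub> \<odot>\<^bsub>M\<^esub> x = x"

definition module_hom ::
    "('r, 'x) ring_scheme \<Rightarrow> ('r, 'm) module \<Rightarrow> ('r, 'n) module \<Rightarrow> ('m \<Rightarrow> 'n) set" where
  "module_hom A M N = {f \<in> carrier M \<rightarrow>\<^sub>E carrier N.
     (\<forall>x\<in>carrier M. \<forall>y\<in>carrier M. f (x \<oplus>\<^bsub>M\<^esub> y) = f x \<oplus>\<^bsub>N\<^esub> f y) \<and>
     (\<forall>a\<in>carrier A. \<forall>x\<in>carrier M. f (a \<odot>\<^bsub>M\<^esub> x) = a \<odot>\<^bsub>N\<^esub> f x)}"

text \<open>
  Higher-order logic has no quantification over types inside a formula, so the category of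
  left modules is rendered as that of the modules with carrier in a type \<open>'m\<close>. All notions
  below (projectivity, resolutions, Ext) live in this category. Once \<open>'m\<close> is infinite and
  at least as large as the ring, it contains up to isomorphism all modules of cardinality at
  most that of \<open>'m\<close>, and every such module has a free resolution in it.
\<close>

definition projective_module :: "('r, 'x) ring_scheme \<Rightarrow> ('r, 'm) module \<Rightarrow> bool" where
  "projective_module A P \<longleftrightarrow> left_module A P \<and>
     (\<forall>(M :: ('r, 'm) module) (N :: ('r, 'm) module). \<forall>g\<in>module_hom A M N. \<forall>f\<in>module_hom A P N.
        left_module A M \<and> left_module A N \<and> g ` carrier M = carrier N \<longrightarrow>
        (\<exists>h\<in>module_hom A P M. compose (carrier P) g h = f))"

text \<open>\<open>(P, d, e)\<close> stands for \<open>\<dots> \<rightarrow> P 2 \<rightarrow> P 1 \<rightarrow> P 0 \<rightarrow> M \<rightarrow> 0\<close>,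
  with \<open>d n\<close> from \<open>P (n + 1)\<close> to \<open>P n\<close> and augmentation \<open>e\<close>.\<close>

definition projective_resolution ::
    "('r, 'x) ring_scheme \<Rightarrow> ('r, 'm) module \<Rightarrow>
     (nat \<Rightarrow> ('r, 'm) module) \<times> (nat \<Rightarrow> 'm \<Rightarrow> 'm) \<times> ('m \<Rightarrow> 'm) \<Rightarrow> bool" where
  "projective_resolution A M = (\<lambda>(P, d, e).
     (\<forall>n. projective_module A (P n)) \<and>
     (\<forall>n. d n \<in> module_hom A (P (Suc n)) (P n)) \<and>
     e \<in> module_hom A (P 0) M \<and>
     e ` carrier (P 0) = carrier M \<and>
     d 0 ` carrier (P (Suc 0)) = {x \<in> carrier (P 0). e x = \<zero>\<^bsub>M\<^esub>} \<and>
     (\<forall>n. d (Suc n) ` carrier (P (Suc (Suc n))) = {x \<in> carrier (P (Suc n)). d n x = \<zero>\<^bsub>P n\<^esub>}))"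

definition ext_cocycles ::
    "('r, 'x) ring_scheme \<Rightarrow> (nat \<Rightarrow> ('r, 'm) module) \<Rightarrow> (nat \<Rightarrow> 'm \<Rightarrow> 'm) \<Rightarrow>
     ('r, 'm) module \<Rightarrow> nat \<Rightarrow> ('m \<Rightarrow> 'm) monoid" where
  "ext_cocycles A P d N n =
     \<lparr>carrier = {f \<in> module_hom A (P n) N. \<forall>x\<in>carrier (P (Suc n)). f (d n x) = \<zero>\<^bsub>N\<^esub>},
      monoid.mult = (\<lambda>f g. \<lambda>x\<in>carrier (P n). f x \<oplus>\<^bsub>N\<^esub> g x),
      one = (\<lambda>x\<in>carrier (P n). \<zero>\<^bsub>N\<^esub>)\<rparr>"

primrec ext_coboundaries ::
    "('r, 'x) ring_scheme \<Rightarrow> (nat \<Rightarrow> ('r, 'm) module) \<Rightarrow> (nat \<Rightarrow> 'm \<Rightarrow> 'm) \<Rightarrow>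
     ('r, 'm) module \<Rightarrow> nat \<Rightarrow> ('m \<Rightarrow> 'm) set" where
  "ext_coboundaries A P d N 0 = {\<lambda>x\<in>carrier (P 0). \<zero>\<^bsub>N\<^esub>}"
| "ext_coboundaries A P d N (Suc n) =
     (\<lambda>g. compose (carrier (P (Suc n))) g (d n)) ` module_hom A (P n) N"

definition Ext ::
    "('r, 'x) ring_scheme \<Rightarrow> nat \<Rightarrow> ('r, 'm) module \<Rightarrow> ('r, 'm) module \<Rightarrow> ('m \<Rightarrow> 'm) set monoid" where
  "Ext A n M N = (case (SOME r. projective_resolution A M r) of (P, d, e) \<Rightarrow>
     ext_cocycles A P d N n Mod ext_coboundaries A P d N n)"

definition Ext_not_zero :: "'m itself \<Rightarrow> ('r, 'x) ring_scheme \<Rightarrow> nat \<Rightarrow> bool" where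
  "Ext_not_zero _ A n \<longleftrightarrow> (\<exists>(M :: ('r, 'm) module) (N :: ('r, 'm) module).
     left_module A M \<and> left_module A N \<and> carrier (Ext A n M N) \<noteq> {\<one>\<^bsub>Ext A n M N\<^esub>})"

definition global_dimension :: "'m itself \<Rightarrow> ('r, 'x) ring_scheme \<Rightarrow> enat" where
  "global_dimension U A =
     (if \<exists>n. Ext_not_zero U A n \<and> (\<forall>m. Ext_not_zero U A m \<longrightarrow> m \<le> n)
      then enat (GREATEST n. Ext_not_zero U A n) else \<infinity>)"


section \<open>Root systems\<close>

text \<open>
  The space \<open>\<aa>\<close> is a type \<open>'a\<close> of class \<^class>\<open>real_inner\<close>, to be assumed finite dimensional
  (\<^class>\<open>euclidean_space\<close> would exclude dimension 0). Hence linear maps on \<open>'a\<close> are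
  automatically bounded, \<open>\<aa>\<^sup>*\<close> is \<^typ>\<open>'a \<Rightarrow>\<^sub>L real\<close>, and its complexification
  \<open>\<tt>\<^sup>*\<close> is the space \<^typ>\<open>'a \<Rightarrow>\<^sub>L complex\<close> of real-linear maps from \<open>\<aa>\<close> to the complex
  numbers, with pairing \<open>blinfun_apply\<close>.
\<close>

definition coroot :: "('a::real_inner \<Rightarrow>\<^sub>L real) \<Rightarrow> 'a" where
  "coroot \<alpha> = (let a = (THE a. \<forall>v. blinfun_apply \<alpha> v = inner a v) in (2 / inner a a) *\<^sub>R a)"

definition reflection :: "('a::real_inner \<Rightarrow>\<^sub>L real) \<Rightarrow> 'a \<Rightarrow> 'a" where
  "reflection \<alpha> v = v - blinfun_apply \<alpha> v *\<^sub>R coroot \<alpha>"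

text \<open>The contragredient action, on both \<open>\<aa>\<^sup>*\<close> and \<open>\<tt>\<^sup>*\<close>.\<close>

definition dual_action ::
    "('a::real_inner \<Rightarrow> 'a) \<Rightarrow> ('a \<Rightarrow>\<^sub>L 'b::real_normed_vector) \<Rightarrow> ('a \<Rightarrow>\<^sub>L 'b)" where
  "dual_action w x = Blinfun (\<lambda>v. blinfun_apply x (inv_into UNIV w v))"

definition reduced_root_system :: "('a::real_inner \<Rightarrow>\<^sub>L real) set \<Rightarrow> bool" where
  "reduced_root_system R \<longleftrightarrow> finite R \<and> 0 \<notin> R \<and>
     (\<forall>\<alpha>\<in>R. dual_action (reflection \<alpha>) ` R = R) \<and>
     (\<forall>\<alpha>\<in>R. \<forall>\<beta>\<in>R. blinfun_apply \<beta> (coroot \<alpha>) \<in> \<int>) \<and>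
     (\<forall>\<alpha>\<in>R. \<forall>c. c *\<^sub>R \<alpha> \<in> R \<longrightarrow> c = 1 \<or> c = - 1)"

definition root_basis :: "('a::real_inner \<Rightarrow>\<^sub>L real) set \<Rightarrow> ('a \<Rightarrow>\<^sub>L real) set \<Rightarrow> bool" where
  "root_basis R \<Delta> \<longleftrightarrow> \<Delta> \<subseteq> R \<and> independent \<Delta> \<and>
     (\<forall>\<beta>\<in>R. \<exists>n :: ('a \<Rightarrow>\<^sub>L real) \<Rightarrow> nat.
        \<beta> = (\<Sum>\<alpha>\<in>\<Delta>. real (n \<alpha>) *\<^sub>R \<alpha>) \<or> \<beta> = - (\<Sum>\<alpha>\<in>\<Delta>. real (n \<alpha>) *\<^sub>R \<alpha>))"

text \<open>Reflections being involutions, the monoid they generate is a group.\<close>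

inductive_set weyl_group :: "('a::real_inner \<Rightarrow>\<^sub>L real) set \<Rightarrow> ('a \<Rightarrow> 'a) set"
  for R :: "('a \<Rightarrow>\<^sub>L real) set" where
  "id \<in> weyl_group R"
| "\<alpha> \<in> R \<Longrightarrow> w \<in> weyl_group R \<Longrightarrow> reflection \<alpha> \<circ> w \<in> weyl_group R"


section \<open>The symmetric algebra\<close>

definition cscale :: "complex \<Rightarrow> ('a::real_normed_vector \<Rightarrow>\<^sub>L complex) \<Rightarrow> ('a \<Rightarrow>\<^sub>L complex)" where
  "cscale c x = blinfun_mult_right c o\<^sub>L x"

lemma vector_space_cscale: "vector_space cscale"
  by unfold_locales
    (auto simp: cscale_def algebra_simps blinfun.bilinear_simps intro!: blinfun_eqI)

text \<open>
  For a complex vector space with scalar multiplication \<open>scl\<close> on the type \<open>'v\<close>, the symmetric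
  algebra is the polynomial ring on indeterminates \<open>X v\<close> for all vectors \<open>v\<close>, modulo the
  relations making \<open>v \<mapsto> X v\<close> linear.
\<close>

type_synonym 'v free_comm = "('v \<Rightarrow>\<^sub>0 nat) \<Rightarrow>\<^sub>0 complex"

abbreviation indet :: "'v \<Rightarrow> 'v free_comm" where
  "indet v \<equiv> Poly_Mapping.single (Poly_Mapping.single v 1) 1"

abbreviation const_poly :: "complex \<Rightarrow> 'v free_comm" where
  "const_poly c \<equiv> Poly_Mapping.single 0 c"

definition sym_ideal :: "(complex \<Rightarrow> 'v::ab_group_add \<Rightarrow> 'v) \<Rightarrow> 'v free_comm set" where
  "sym_ideal scl = genideal ring_of_type_algebra
     ({indet (u + v) - (indet u + indet v) |u v. True} \<union>
      {indet (scl c v) - const_poly c * indet v |c v. True})"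

definition symmetric_algebra ::
    "(complex \<Rightarrow> 'v::ab_group_add \<Rightarrow> 'v) \<Rightarrow> 'v free_comm set ring" where
  "symmetric_algebra scl = ring_of_type_algebra Quot sym_ideal scl"

definition sym_incl :: "(complex \<Rightarrow> 'v::ab_group_add \<Rightarrow> 'v) \<Rightarrow> 'v \<Rightarrow> 'v free_comm set" where
  "sym_incl scl v = sym_ideal scl +>\<^bsub>ring_of_type_algebra\<^esub> indet v"

definition sym_const :: "(complex \<Rightarrow> 'v::ab_group_add \<Rightarrow> 'v) \<Rightarrow> complex \<Rightarrow> 'v free_comm set" where
  "sym_const scl c = sym_ideal scl +>\<^bsub>ring_of_type_algebra\<^esub> const_poly c"


section \<open>Graded Hecke algebras\<close>

text \<open>HOL-Algebra's locale \<open>algebra\<close> is restricted to commutative algebras.\<close>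

locale complex_algebra = ring H + Module.module "ring_of_type_algebra :: complex ring" H
  for H :: "(complex, 'h) module" (structure) +
  assumes smult_mult_left:
      "\<lbrakk>x \<in> carrier H; y \<in> carrier H\<rbrakk> \<Longrightarrow> (c \<odot> x) \<otimes> y = c \<odot> (x \<otimes> y)"
    and smult_mult_right:
      "\<lbrakk>x \<in> carrier H; y \<in> carrier H\<rbrakk> \<Longrightarrow> x \<otimes> (c \<odot> y) = c \<odot> (x \<otimes> y)"

text \<open>
  \<open>H\<close> is a complex algebra with algebra homomorphisms from \<open>\<complex>[W]\<close> (given by the
  multiplicative map \<open>T\<close> on the basis \<open>W\<close>) and from \<open>S(\<tt>\<^sup>*)\<close> (the map \<open>j\<close>), such that
  multiplication \<open>\<complex>[W] \<otimes> S(\<tt>\<^sup>*) \<rightarrow> H\<close> is a linear bijection. As \<open>W\<close> is a basis of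
  \<open>\<complex>[W]\<close>, an element of this tensor product is a family \<open>f\<close> in \<open>S(\<tt>\<^sup>*)\<close> indexed by \<open>W\<close>,
  standing for the sum of the \<open>w \<otimes> f w\<close>. In particular \<open>\<complex>[W]\<close> and \<open>S(\<tt>\<^sup>*)\<close> embed in \<open>H\<close>.
  These data and the cross relation determine \<open>H\<close> up to isomorphism.
\<close>

locale graded_hecke_algebra = complex_algebra H
  for R \<Delta> :: "('a::real_inner \<Rightarrow>\<^sub>L real) set"
    and k :: "('a \<Rightarrow>\<^sub>L real) \<Rightarrow> complex"
    and H :: "(complex, 'h) module" (structure)
    and T :: "('a \<Rightarrow> 'a) \<Rightarrow> 'h"
    and j :: "('a \<Rightarrow>\<^sub>L complex) free_comm set \<Rightarrow> 'h" +
  assumes T_closed: "w \<in> weyl_group R \<Longrightarrow> T w \<in> carrier H"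
    and T_id: "T id = \<one>"
    and T_comp: "\<lbrakk>u \<in> weyl_group R; w \<in> weyl_group R\<rbrakk> \<Longrightarrow> T (u \<circ> w) = T u \<otimes> T w"
    and j_hom: "j \<in> ring_hom (symmetric_algebra cscale) H"
    and j_const: "j (sym_const cscale c) = c \<odot> \<one>"
    and tensor_bij:
      "bij_betw (\<lambda>f. \<Oplus>w\<in>weyl_group R. T w \<otimes> j (f w))
         (weyl_group R \<rightarrow>\<^sub>E carrier (symmetric_algebra cscale)) (carrier H)"
    and cross_relation:
      "\<alpha> \<in> \<Delta> \<Longrightarrow>
       j (sym_incl cscale x) \<otimes> T (reflection \<alpha>)
         \<ominus> T (reflection \<alpha>) \<otimes> j (sym_incl cscale (dual_action (reflection \<alpha>) x))
       = (k \<alpha> * blinfun_apply x (coroot \<alpha>)) \<odot> \<one>"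

end

theory Submission
  imports Defs "HOL-Library.Function_Algebras" "HOL-Algebra.Free_Abelian_Groups"
begin

text \<open>
  For a projective resolution \<open>P\<close> of \<open>M\<close>, consider the double complex of \<open>W\<close>-equivariant alternating
  forms on \<open>\<tt>\<^sup>*\<close> with values in the complex-linear maps from \<open>P\<close> to \<open>N\<close>, with the Koszul differential
  given by \<open>(D\<^sub>x v)(p) = v(x p) - x v(p)\<close> in one direction. By the cross relation this differential
  preserves equivariance. The Koszul direction is exact except in degree 0, where it leaves the module
  homomorphisms from \<open>P\<close> to \<open>N\<close>; the other direction is exact by averaging over \<open>W\<close>. Since forms vanish
  above degree \<open>dim \<tt>\<^sup>*\<close>, a diagram chase shows that so does Ext. For \<open>M = N\<close> the principal series
  module induced from the trivial character of the symmetric algebra, a volume form yields a nonzero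
  class in the top degree, because the elements of \<open>\<tt>\<^sup>*\<close> act nilpotently on \<open>N\<close>.
\<close>

section \<open>Alternating forms on lists and the Koszul differential\<close>

text \<open>Classically \<open>M\<close> is resolved by modules induced from C[W], namely from
  exterior powers of the complexified dual space tensored with \<open>M\<close>. Homomorphisms from
  the n-th such module to \<open>N\<close> are the equivariant alternating n-forms with values in
  the linear maps from \<open>M\<close> to \<open>N\<close>; working with these forms avoids
  exterior powers and tensor products over C[W]. \<open>Ext\<close>, however, is computed from an
  arbitrarily chosen projective resolution, so the forms must be compared with that one: hence the
  double complex. A projective term matters only through the exactness of its Koszul column, which
  reduces to free modules and there to polynomials, one variable at a time. The parameters enter
  twice, when a simple reflection passes the differential and when the filtration of the principal
  series is computed; the extra term is cancelled in the first case and is of lower order in the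
  second. Forms take values in a type of class \<open>ab_group_add\<close>, whereas modules are
  records with a carrier, so every coefficient module is first embedded into such a type.\<close>

primrec kd :: "('t \<Rightarrow> 'v \<Rightarrow> 'v) \<Rightarrow> 't list \<Rightarrow> ('t list \<Rightarrow> 'v::ab_group_add) \<Rightarrow> 'v" where
  "kd D [] \<phi> = 0"
| "kd D (x # xs) \<phi> = D x (\<phi> xs) - kd D xs (\<lambda>ys. \<phi> (x # ys))"

lemma kd_zero: "(\<And>x. D x 0 = 0) \<Longrightarrow> kd D xs (\<lambda>_. 0) = 0"
  by (induction xs) simp_all

text \<open>The values of a form lie in a subgroup \<open>G\<close> of a type, so sums and
  differences are those of the type and only the scalar action is a parameter. The same lemmas then
  serve linear maps on a module, families indexed by monomials, and complex numbers.\<close>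

locale form_space = vector_space scl
  for scl :: "complex \<Rightarrow> 't::ab_group_add \<Rightarrow> 't" +
  fixes G :: "'v::ab_group_add set" and sc :: "complex \<Rightarrow> 'v \<Rightarrow> 'v"
  assumes G_zero: "0 \<in> G"
    and G_diff: "u \<in> G \<Longrightarrow> v \<in> G \<Longrightarrow> u - v \<in> G"
    and G_sc: "u \<in> G \<Longrightarrow> sc c u \<in> G"
    and sc_diff: "u \<in> G \<Longrightarrow> v \<in> G \<Longrightarrow> sc c (u - v) = sc c u - sc c v"
    and sc_ladd: "u \<in> G \<Longrightarrow> sc (c + c') u = sc c u + sc c' u"
    and sc_mult: "u \<in> G \<Longrightarrow> sc (c * c') u = sc c (sc c' u)"
begin

lemma G_minus: "u \<in> G \<Longrightarrow> - u \<in> G"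
  using G_diff[OF G_zero] by simp

lemma sc_zero: "sc c 0 = 0"
  using sc_diff[OF G_zero G_zero] by simp

lemma sc_minus: "u \<in> G \<Longrightarrow> sc c (- u) = - sc c u"
  using sc_diff[OF G_zero, of u c] sc_zero by simp

text \<open>An alternating \<open>n\<close>-form is encoded as a function on all lists, zero off lists of length \<open>n\<close>.\<close>

primrec alt :: "nat \<Rightarrow> ('t list \<Rightarrow> 'v) \<Rightarrow> bool" where
  "alt 0 \<phi> \<longleftrightarrow> \<phi> [] \<in> G \<and> (\<forall>x xs. \<phi> (x # xs) = 0)"
| "alt (Suc n) \<phi> \<longleftrightarrow> \<phi> [] = 0 \<and> (\<forall>x. alt n (\<lambda>xs. \<phi> (x # xs))) \<and>
     (\<forall>x y xs. \<phi> ((x + y) # xs) = \<phi> (x # xs) + \<phi> (y # xs)) \<and>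
     (\<forall>c x xs. \<phi> (scl c x # xs) = sc c (\<phi> (x # xs))) \<and>
     (\<forall>x xs. \<phi> (x # x # xs) = 0)"

lemma alt_G: "alt n \<phi> \<Longrightarrow> \<phi> xs \<in> G"
proof (induction n arbitrary: \<phi> xs)
  case 0
  then show ?case by (cases xs) (auto simp: G_zero)
next
  case (Suc n)
  then show ?case by (cases xs) (auto simp: G_zero)
qed

lemma alt_zero: "alt n (\<lambda>_. 0)"
  by (induction n) (auto simp: G_zero sc_zero)

lemma alt_diff: "alt n \<phi> \<Longrightarrow> alt n \<psi> \<Longrightarrow> alt n (\<lambda>xs. \<phi> xs - \<psi> xs)"
proof (induction n arbitrary: \<phi> \<psi>)
  case 0
  then show ?case by (auto simp: G_diff)
next
  case (Suc n)
  then show ?case using alt_G[OF Suc.prems(1)] alt_G[OF Suc.prems(2)] by (auto simp: sc_diff)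
qed

lemma alt_minus: "alt n \<phi> \<Longrightarrow> alt n (\<lambda>xs. - \<phi> xs)"
  using alt_diff[OF alt_zero, of n \<phi>] by simp

lemma alt_add: "alt n \<phi> \<Longrightarrow> alt n \<psi> \<Longrightarrow> alt n (\<lambda>xs. \<phi> xs + \<psi> xs)"
  using alt_diff[OF _ alt_minus, of n \<phi> \<psi>] by simp

lemma alt_sum: "(\<And>i. i \<in> I \<Longrightarrow> alt n (\<phi> i)) \<Longrightarrow> alt n (\<lambda>xs. \<Sum>i\<in>I. \<phi> i xs)"
  by (induction I rule: infinite_finite_induct) (auto simp: alt_zero alt_add)

lemma alt_add_head: "alt n \<phi> \<Longrightarrow> \<phi> ((x + y) # xs) = \<phi> (x # xs) + \<phi> (y # xs)"
  by (cases n) auto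

lemma alt_scl_head: "alt n \<phi> \<Longrightarrow> \<phi> (scl c x # xs) = sc c (\<phi> (x # xs))"
  by (cases n) (auto simp: sc_zero)

lemma alt_diff_head: "alt n \<phi> \<Longrightarrow> \<phi> ((x - y) # xs) = \<phi> (x # xs) - \<phi> (y # xs)"
  using alt_add_head[of n \<phi> "x - y" y xs] by simp

lemma alt_double: "alt n \<phi> \<Longrightarrow> \<phi> (x # x # xs) = 0"
  by (cases n) auto

lemma alt_tail: "alt n \<phi> \<Longrightarrow> alt (n - 1) (\<lambda>xs. \<phi> (x # xs))"
  by (cases n) (auto simp: G_zero)

text \<open>Polarisation of the vanishing on two equal leading arguments.\<close>

lemma alt_swap:
  assumes "alt n \<phi>"
  shows "\<phi> (x # y # xs) = - \<phi> (y # x # xs)"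
proof -
  have "\<phi> ((x + y) # (x + y) # xs) = \<phi> (x # x # xs) + \<phi> (x # y # xs) + (\<phi> (y # x # xs) + \<phi> (y # y # xs))"
    using assms alt_add_head[OF alt_tail[OF assms]] by (simp add: alt_add_head)
  then show ?thesis
    by (simp add: alt_double[OF assms] eq_neg_iff_add_eq_0)
qed

lemma alt_comp_linear:
  assumes "\<And>x y. f (x + y) = f x + f y" "\<And>c x. f (scl c x) = scl c (f x)"
  shows "alt n \<phi> \<Longrightarrow> alt n (\<lambda>xs. \<phi> (map f xs))"
proof (induction n arbitrary: \<phi>)
  case (Suc n)
  then show ?case by (auto simp: assms)
qed auto

text \<open>A form vanishing on a basis in its first slot is zero; iterating kills degrees above the dimension.\<close>

lemma alt_zero_on_basis:
  assumes "alt (Suc n) \<phi>" "span B = UNIV" "\<And>b xs. b \<in> B \<Longrightarrow> \<phi> (b # xs) = 0"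
  shows "\<phi> xs = 0"
proof (cases xs)
  case Nil
  then show ?thesis using assms(1) by simp
next
  case (Cons x ys)
  have "x \<in> span B" using assms(2) by simp
  then have "\<phi> (x # ys) = 0"
  proof (induction rule: span_induct_alt)
    case base
    show ?case using alt_add_head[OF assms(1), of 0 0 ys] by simp
  next
    case (step c x y)
    then show ?case
      using assms(3)[of x ys] by (simp add: alt_add_head[OF assms(1)] alt_scl_head[OF assms(1)] sc_zero)
  qed
  then show ?thesis using Cons by simp
qed

text \<open>To move \<open>b\<close> from \<open>C\<close> to \<open>B\<close>: the contraction with
  \<open>b\<close> has degree one less and vanishes on \<open>b\<close> by alternation and on
  \<open>B\<close> by a swap, so it is zero by the induction hypothesis. Then the form itself
  vanishes on \<open>b\<close>, and the hypothesis applies a second time. The bound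
  \<open>card C < n\<close> survives both uses.\<close>

lemma alt_above_dim_aux:
  assumes "finite C" "span (C \<union> B) = UNIV"
  shows "alt n \<phi> \<Longrightarrow> card C < n \<Longrightarrow> (\<And>b xs. b \<in> B \<Longrightarrow> \<phi> (b # xs) = 0) \<Longrightarrow> \<phi> xs = 0"
  using assms
proof (induction C arbitrary: B n \<phi> xs rule: finite_induct)
  case empty
  then show ?case by (cases n) (auto intro: alt_zero_on_basis)
next
  case (insert b C)
  obtain m where m: "n = Suc m" using insert.prems(2) by (cases n) auto
  have sp: "span (C \<union> insert b B) = UNIV" using insert.prems(4) by simp
  have tail: "\<phi> (b # ys) = 0" for ys
  proof (rule insert.IH[of m "\<lambda>ys. \<phi> (b # ys)" "insert b B"])
    show "alt m (\<lambda>ys. \<phi> (b # ys))" using insert.prems(1) m by simp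
    show "card C < m" using insert m by simp
    show "\<phi> (b # c # zs) = 0" if "c \<in> insert b B" for c zs
      using that insert.prems(3) alt_swap[OF insert.prems(1), of b c zs] alt_double[OF insert.prems(1)]
      by (cases "c = b") auto
    show "span (C \<union> insert b B) = UNIV" by (fact sp)
  qed
  show ?case
  proof (rule insert.IH[of n \<phi> "insert b B"])
    show "alt n \<phi>" by (fact insert.prems(1))
    show "card C < n" using insert by simp
    show "\<phi> (c # zs) = 0" if "c \<in> insert b B" for c zs
      using that insert.prems(3) tail by auto
    show "span (C \<union> insert b B) = UNIV" by (fact sp)
  qed
qed

lemma alt_above_dim:
  assumes "finite B" "span B = UNIV" "alt n \<phi>" "card B < n"
  shows "\<phi> = (\<lambda>_. 0)"
  using alt_above_dim_aux[of B "{}" n \<phi>] assms by auto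

text \<open>The effect of a reflection on an alternating form is a wedge product with the functional \<open>c\<close>.\<close>

lemma alt_map_reflection:
  assumes "\<And>x. s x = x - scl (c x) \<alpha>"
  shows "alt n \<phi> \<Longrightarrow> \<phi> (map s xs) = \<phi> xs - kd (\<lambda>x. sc (c x)) xs (\<lambda>ys. \<phi> (\<alpha> # ys))"
proof (induction xs arbitrary: n \<phi>)
  case (Cons x xs)
  have h: "\<phi> (s x # ys) = \<phi> (x # ys) - sc (c x) (\<phi> (\<alpha> # ys))" for ys
    by (simp add: assms alt_diff_head[OF Cons.prems] alt_scl_head[OF Cons.prems])
  \<comment> \<open>In front of \<alpha> the vector \<open>s x\<close> may be replaced by
    \<open>x\<close>, their difference being a multiple of \<alpha>. This keeps the correction
    linear in \<open>c\<close>.\<close>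
  have "\<phi> (s x # \<alpha> # ys) = - \<phi> (\<alpha> # x # ys)" for ys
    using h[of "\<alpha> # ys"] alt_double[OF Cons.prems] alt_swap[OF Cons.prems, of x \<alpha>] sc_zero by simp
  moreover have "kd (\<lambda>x. sc (c x)) xs (\<lambda>ys. - \<psi> ys) = - kd (\<lambda>x. sc (c x)) xs \<psi>
     \<and> kd (\<lambda>x. sc (c x)) xs \<psi> \<in> G" if "\<And>ys. \<psi> ys \<in> G" for \<psi>
    using that by (induction xs arbitrary: \<psi>) (auto simp: sc_minus sc_zero G_zero G_diff G_sc)
  ultimately show ?case
    using Cons.IH[OF alt_tail[OF Cons.prems], of "s x"] h[of xs] alt_G[OF Cons.prems] by simp
qed simp

end

text \<open>\<open>K\<close> may be smaller than \<open>G\<close>: the map \<open>f\<close> need only be linear on the values of the form.\<close>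

lemma alt_map:
  assumes "form_space scl G sc" "form_space scl G' sc'"
    and "\<And>u v. u \<in> K \<Longrightarrow> v \<in> K \<Longrightarrow> f (u + v) = f u + f v"
    and "\<And>c u. u \<in> K \<Longrightarrow> f (sc c u) = sc' c (f u)"
    and "\<And>u. u \<in> K \<Longrightarrow> f u \<in> G'" and "f 0 = 0"
  shows "form_space.alt scl G sc n \<phi> \<Longrightarrow> (\<And>xs. \<phi> xs \<in> K) \<Longrightarrow> form_space.alt scl G' sc' n (\<lambda>xs. f (\<phi> xs))"
proof (induction n arbitrary: \<phi>)
  case 0
  then show ?case using assms by (auto simp: form_space.alt.simps)
next
  case (Suc n)
  then show ?case using assms by (auto simp: form_space.alt.simps)
qed

text \<open>The differential is assembled from values of \<open>D\<close>, which lie in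
  \<open>K\<close>, by subtracting elements of \<open>G\<close>; additivity of \<open>f\<close> is
  asked for just there. Membership in \<open>G\<close> is proved along with the identity because the
  induction uses it.\<close>

lemma kd_map:
  assumes "\<And>u v. u \<in> K \<Longrightarrow> v \<in> G \<Longrightarrow> f (u - v) = f u - f v" "f 0 = 0"
    and "\<And>x v. v \<in> G \<Longrightarrow> f (D x v) = D' x (f v)"
    and "\<And>x v. v \<in> G \<Longrightarrow> D x v \<in> K" "\<And>u v. u \<in> K \<Longrightarrow> v \<in> G \<Longrightarrow> u - v \<in> G" "0 \<in> G"
  shows "(\<And>ys. \<phi> ys \<in> G) \<Longrightarrow> f (kd D xs \<phi>) = kd D' xs (\<lambda>ys. f (\<phi> ys)) \<and> kd D xs \<phi> \<in> G"
  by (induction xs arbitrary: \<phi>) (auto simp: assms)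

text \<open>Commuting operators, linear in \<open>x\<close>, make \<open>G\<close> a module over the
  symmetric algebra, and \<open>kd D\<close> is the alternating sum of \<open>D x\<close> applied to
  the form with \<open>x\<close> deleted. Its recursion is Cartan's formula: contracting the
  differential of a form with \<open>x\<close> gives \<open>D x\<close> of the form minus the
  differential of the contraction. The proofs below contract with the head of the list and use this
  formula.\<close>

locale koszul = form_space scl G sc
  for scl :: "complex \<Rightarrow> 't::ab_group_add \<Rightarrow> 't" and G :: "'v::ab_group_add set" and sc +
  fixes D :: "'t \<Rightarrow> 'v \<Rightarrow> 'v"
  assumes D_closed: "v \<in> G \<Longrightarrow> D x v \<in> G"
    and D_diff: "u \<in> G \<Longrightarrow> v \<in> G \<Longrightarrow> D x (u - v) = D x u - D x v"
    and D_sc: "v \<in> G \<Longrightarrow> D x (sc c v) = sc c (D x v)"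
    and D_ladd: "v \<in> G \<Longrightarrow> D (x + y) v = D x v + D y v"
    and D_lscl: "v \<in> G \<Longrightarrow> D (scl c x) v = sc c (D x v)"
    and D_comm: "v \<in> G \<Longrightarrow> D x (D y v) = D y (D x v)"
begin

lemma D_zero: "D x 0 = 0"
  using D_diff[OF G_zero G_zero] by simp

lemma D_add: "u \<in> G \<Longrightarrow> v \<in> G \<Longrightarrow> D x (u + v) = D x u + D x v"
  using D_diff[of u "- v" x] D_diff[OF G_zero, of v x] G_minus D_zero by simp

lemma kd_null: "kd D xs (\<lambda>_. 0) = 0"
  using kd_zero[of D] D_zero by blast

lemma kd_G: "(\<And>ys. \<phi> ys \<in> G) \<Longrightarrow> kd D xs \<phi> \<in> G"
  by (induction xs arbitrary: \<phi>) (auto simp: G_zero G_diff D_closed)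

lemma kd_diff:
  "(\<And>ys. \<phi> ys \<in> G) \<Longrightarrow> (\<And>ys. \<psi> ys \<in> G) \<Longrightarrow> kd D xs (\<lambda>ys. \<phi> ys - \<psi> ys) = kd D xs \<phi> - kd D xs \<psi>"
  by (induction xs arbitrary: \<phi> \<psi>) (auto simp: D_diff)

lemma kd_add:
  "(\<And>ys. \<phi> ys \<in> G) \<Longrightarrow> (\<And>ys. \<psi> ys \<in> G) \<Longrightarrow> kd D xs (\<lambda>ys. \<phi> ys + \<psi> ys) = kd D xs \<phi> + kd D xs \<psi>"
  by (induction xs arbitrary: \<phi> \<psi>) (auto simp: D_add)

lemma kd_D: "(\<And>ys. \<phi> ys \<in> G) \<Longrightarrow> D x (kd D xs \<phi>) = kd D xs (\<lambda>ys. D x (\<phi> ys))"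
  by (induction xs arbitrary: \<phi>) (auto simp: D_zero D_diff D_closed kd_G intro: D_comm)

lemma kd_sc: "(\<And>ys. \<phi> ys \<in> G) \<Longrightarrow> sc c (kd D xs \<phi>) = kd D xs (\<lambda>ys. sc c (\<phi> ys))"
  by (induction xs arbitrary: \<phi>) (auto simp: sc_zero sc_diff D_closed kd_G D_sc)

text \<open>By Cartan's formula the contraction with \<open>x\<close> consists of \<open>D x\<close>
  of the differential, minus the differential of \<open>D x\<close> of the form, plus a twofold
  differential of the contraction. The first two cancel because the operators commute, the last is
  zero by induction.\<close>

lemma kd_kd: "(\<And>ys. \<phi> ys \<in> G) \<Longrightarrow> kd D xs (\<lambda>ys. kd D ys \<phi>) = 0"
proof (induction xs arbitrary: \<phi>)
  case (Cons x xs)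
  have "kd D (x # xs) (\<lambda>ys. kd D ys \<phi>)
      = D x (kd D xs \<phi>) - (kd D xs (\<lambda>ys. D x (\<phi> ys)) - kd D xs (\<lambda>ys. kd D ys (\<lambda>zs. \<phi> (x # zs))))"
    by (simp add: kd_diff D_closed kd_G Cons.prems)
  also have "\<dots> = 0"
    using Cons.IH[of "\<lambda>zs. \<phi> (x # zs)"] Cons.prems by (simp add: kd_D)
  finally show ?case .
qed simp

lemma alt_D: "alt n \<phi> \<Longrightarrow> alt n (\<lambda>xs. D x (\<phi> xs))"
  by (rule alt_map[OF form_space_axioms form_space_axioms, of G])
    (auto simp: D_add D_sc D_closed D_zero alt_G)

text \<open>Contracted with \<open>x\<close>, the differential is \<open>D x\<close> of the form
  minus the differential of a form of lower degree, hence alternating by induction on the degree. On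
  two equal leading arguments the two terms with \<open>D x\<close> cancel and the differential of a
  zero form remains.\<close>

lemma alt_kd: "alt n \<phi> \<Longrightarrow> alt (Suc n) (\<lambda>xs. kd D xs \<phi>)"
proof (induction n arbitrary: \<phi>)
  case 0
  have z: "(\<lambda>ys. \<phi> (x # ys)) = (\<lambda>_. 0)" for x using 0 by auto
  have g: "\<phi> ys \<in> G" for ys using alt_G[OF 0] .
  have "alt 0 (\<lambda>xs. D x (\<phi> xs))" for x using alt_D[OF 0] .
  then show ?case
    by (simp add: z kd_null D_zero D_ladd D_lscl g)
next
  case (Suc n)
  have g: "\<phi> ys \<in> G" for ys using alt_G[OF Suc.prems] .
  have "alt (Suc n) (\<lambda>xs. kd D xs (\<lambda>ys. \<phi> (x # ys)))" for x
    by (rule Suc.IH) (use Suc.prems in simp)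
  then have 1: "alt (Suc n) (\<lambda>xs. D x (\<phi> xs) - kd D xs (\<lambda>ys. \<phi> (x # ys)))" for x
    using alt_diff alt_D[OF Suc.prems] by blast
  have 2: "kd D xs (\<lambda>ys. \<phi> ((x + y) # ys)) = kd D xs (\<lambda>ys. \<phi> (x # ys)) + kd D xs (\<lambda>ys. \<phi> (y # ys))" for x y xs
    using Suc.prems g by (simp add: kd_add)
  have 3: "kd D xs (\<lambda>ys. \<phi> (scl c x # ys)) = sc c (kd D xs (\<lambda>ys. \<phi> (x # ys)))" for c x xs
    using Suc.prems g by (simp add: kd_sc)
  have 4: "kd D xs (\<lambda>ys. \<phi> (x # x # ys)) = 0" for x xs
    using alt_double[OF Suc.prems] by (simp add: kd_null)
  show ?case
    unfolding alt.simps(2)[of "Suc n"]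
    using 1 by (simp add: 2 3 4 D_ladd D_lscl g sc_diff D_closed kd_G)
qed

text \<open>Exactness when the operators of a basis have linear right inverses commuting with the other
  operators: subtracting the differential of \<open>S b\<close> applied to the contraction by \<open>b\<close> makes a
  cocycle vanish on \<open>b\<close>, one basis vector after the other.\<close>

lemma koszul_exact:
  assumes B: "finite B" "span B = UNIV"
    and S_closed: "\<And>b v. b \<in> B \<Longrightarrow> v \<in> G \<Longrightarrow> S b v \<in> G"
    and S_add: "\<And>b u v. b \<in> B \<Longrightarrow> u \<in> G \<Longrightarrow> v \<in> G \<Longrightarrow> S b (u + v) = S b u + S b v"
    and S_sc: "\<And>b c v. b \<in> B \<Longrightarrow> v \<in> G \<Longrightarrow> S b (sc c v) = sc c (S b v)"
    and DS: "\<And>b v. b \<in> B \<Longrightarrow> v \<in> G \<Longrightarrow> D b (S b v) = v"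
    and DS_comm: "\<And>b b' v. b \<in> B \<Longrightarrow> b' \<in> B \<Longrightarrow> b \<noteq> b' \<Longrightarrow> v \<in> G \<Longrightarrow> D b' (S b v) = S b (D b' v)"
    and \<phi>: "alt (Suc n) \<phi>" "\<And>xs. kd D xs \<phi> = 0"
  shows "\<exists>\<psi>. alt n \<psi> \<and> (\<forall>xs. kd D xs \<psi> = \<phi> xs)"
proof -
  have S0: "S b 0 = 0" if "b \<in> B" for b using S_add[OF that G_zero G_zero] by simp
  have step: "\<exists>\<psi>. alt n \<psi> \<and> (\<forall>b\<in>C. \<forall>xs. \<phi> (b # xs) = kd D (b # xs) \<psi>)" if "finite C" "C \<subseteq> B" for C
    using that
  proof (induction C rule: finite_induct)
    case empty
    show ?case using alt_zero by blast
  next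
    case (insert b C)
    then obtain \<psi>0 where \<psi>0: "alt n \<psi>0" "\<And>b xs. b \<in> C \<Longrightarrow> \<phi> (b # xs) = kd D (b # xs) \<psi>0" by auto
    have bB: "b \<in> B" and CB: "C \<subseteq> B" using insert by auto
    define \<phi>' where "\<phi>' = (\<lambda>xs. \<phi> xs - kd D xs \<psi>0)"
    have alt': "alt (Suc n) \<phi>'" unfolding \<phi>'_def using alt_diff \<phi>(1) alt_kd \<psi>0(1) by blast
    have G': "\<phi>' xs \<in> G" for xs using alt_G[OF alt'] .
    have G0: "\<psi>0 xs \<in> G" for xs using alt_G[OF \<psi>0(1)] .
    have cl: "kd D xs \<phi>' = 0" for xs
      unfolding \<phi>'_def using \<phi>(2) alt_G[OF \<phi>(1)] by (simp add: kd_diff kd_G G0 kd_kd)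
    have C0: "\<phi>' (c # xs) = 0" if "c \<in> C" for c xs
      unfolding \<phi>'_def using \<psi>0(2)[OF that] by simp
    \<comment> \<open>The form is closed and its contraction with \<open>c\<close> is zero, so
      Cartan's formula leaves only \<open>D c\<close>.\<close>
    have DC: "D c (\<phi>' xs) = 0" if "c \<in> C" for c xs
      using cl[of "c # xs"] C0[OF that] kd_null by simp
    \<comment> \<open>The differential of \<open>\<omega>\<close>, contracted with \<open>b\<close>,
      is \<open>D b\<close> of \<open>S b\<close> of the contraction of \<open>\<phi>'\<close>,
      because \<open>\<omega>\<close> itself vanishes on \<open>b\<close>. Contracted with an
      earlier vector \<open>c\<close> it is zero, since \<open>S b\<close> commutes with
      \<open>D c\<close>; what has been achieved on \<open>C\<close> is not disturbed.\<close>
    define \<omega> where "\<omega> = (\<lambda>xs. S b (\<phi>' (b # xs)))"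
    have alt_w: "alt n \<omega>" unfolding \<omega>_def
      by (rule alt_map[OF form_space_axioms form_space_axioms, of G])
        (use alt' bB in \<open>auto simp: S_add S_sc S_closed G' S0\<close>)
    have bchi: "\<omega> (b # xs) = 0" for xs
      unfolding \<omega>_def using alt_double[OF alt'] S0[OF bB] by simp
    have cchi: "\<omega> (c # xs) = 0" if "c \<in> C" for c xs
      unfolding \<omega>_def using alt_swap[OF alt', of b c xs] C0[OF that] S0[OF bB] by simp
    have Dchi: "D c (\<omega> xs) = 0" if "c \<in> C" for c xs
    proof -
      have "b \<noteq> c" using insert that by auto
      then show ?thesis
        unfolding \<omega>_def using DS_comm[OF bB, of c] that CB G' DC[OF that] S0[OF bB] by auto
    qed
    show ?case
    proof (intro exI[of _ "\<lambda>xs. \<psi>0 xs + \<omega> xs"] conjI ballI allI)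
      show "alt n (\<lambda>xs. \<psi>0 xs + \<omega> xs)" using alt_add \<psi>0(1) alt_w by blast
      fix c xs assume c: "c \<in> insert b C"
      have "kd D (c # xs) (\<lambda>xs. \<psi>0 xs + \<omega> xs) = kd D (c # xs) \<psi>0 + kd D (c # xs) \<omega>"
        using kd_add[of \<psi>0 \<omega>] G0 alt_G[OF alt_w] by blast
      also have "\<dots> = \<phi> (c # xs)"
      proof (cases "c = b")
        case True
        have "kd D (b # xs) \<omega> = \<phi>' (b # xs)"
          using bchi kd_null DS[OF bB G'] by (simp add: \<omega>_def)
        then show ?thesis using True by (simp add: \<phi>'_def)
      next
        case False
        then have "c \<in> C" using c by simp
        then show ?thesis using cchi Dchi kd_null \<psi>0(2) by simp
      qed
      finally show "\<phi> (c # xs) = kd D (c # xs) (\<lambda>xs. \<psi>0 xs + \<omega> xs)" by simp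
    qed
  qed
  obtain \<psi> where \<psi>: "alt n \<psi>" "\<And>b xs. b \<in> B \<Longrightarrow> \<phi> (b # xs) = kd D (b # xs) \<psi>"
    using step[OF B(1)] by auto
  have "alt (Suc n) (\<lambda>xs. \<phi> xs - kd D xs \<psi>)" using alt_diff \<phi>(1) alt_kd \<psi>(1) by blast
  then have "\<phi> xs - kd D xs \<psi> = 0" for xs
    using alt_zero_on_basis[OF _ B(2), of n "\<lambda>xs. \<phi> xs - kd D xs \<psi>"] \<psi>(2) by fastforce
  then show ?thesis using \<psi>(1) by auto
qed

end

text \<open>When \<open>D x\<close> is multiplication by the number \<open>c x\<close>, the Koszul
  differential is the wedge product with the functional \<open>c\<close>. The general facts then say
  that wedging twice with \<open>c\<close> gives zero, which removes the error term of the cross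
  relation, and they build volume forms by repeated wedging.\<close>

lemma (in form_space) koszul_wedge:
  assumes "\<And>x y. c (x + y) = c x + c y" "\<And>k x. c (scl k x) = k * c x"
  shows "koszul scl G sc (\<lambda>x. sc (c x))"
proof
  fix x y v assume v: "v \<in> G"
  show "sc (c x) (sc (c y) v) = sc (c y) (sc (c x) v)"
    using sc_mult[OF v, of "c x" "c y"] sc_mult[OF v, of "c y" "c x"] by (simp add: mult.commute)
  then show "sc (c x) (sc d v) = sc d (sc (c x) v)" for d
    using sc_mult[OF v, of "c x" d] sc_mult[OF v, of d "c x"] by (simp add: mult.commute)
qed (auto simp: assms G_sc sc_diff sc_ladd sc_mult)

section \<open>Complements in complex vector spaces\<close>

text \<open>Complements are needed inside modules, which are records with a carrier and whose
  scalars act through the algebra. The linear algebra is therefore done relative to a carrier, with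
  the scalar action as the parameter \<open>m\<close>.\<close>

locale complex_space = abelian_group P for P :: "('p, 'y) ring_scheme" (structure) +
  fixes m :: "complex \<Rightarrow> 'p \<Rightarrow> 'p"
  assumes m_closed: "p \<in> carrier P \<Longrightarrow> m c p \<in> carrier P"
    and m_add: "p \<in> carrier P \<Longrightarrow> q \<in> carrier P \<Longrightarrow> m c (p \<oplus> q) = m c p \<oplus> m c q"
    and m_ladd: "p \<in> carrier P \<Longrightarrow> m (c + d) p = m c p \<oplus> m d p"
    and m_mult: "p \<in> carrier P \<Longrightarrow> m (c * d) p = m c (m d p)"
    and m_one: "p \<in> carrier P \<Longrightarrow> m 1 p = p"
begin

definition vsubspace :: "'p set \<Rightarrow> bool" where
  "vsubspace U \<longleftrightarrow> U \<subseteq> carrier P \<and> \<zero> \<in> U \<and> (\<forall>u\<in>U. \<forall>v\<in>U. u \<oplus> v \<in> U) \<and> (\<forall>c. \<forall>u\<in>U. m c u \<in> U)"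

lemma m_zero_left: assumes p: "p \<in> carrier P" shows "m 0 p = \<zero>"
proof -
  have "m 0 p \<oplus> m 0 p = m 0 p \<oplus> \<zero>" using m_ladd[OF p, of 0 0] m_closed[OF p] by simp
  then show ?thesis using m_closed[OF p] add.l_cancel by blast
qed

lemma m_zero_right: "m c \<zero> = \<zero>"
proof -
  have "m c \<zero> \<oplus> m c \<zero> = m c \<zero> \<oplus> \<zero>" using m_add[of \<zero> \<zero> c] m_closed by simp
  then show ?thesis using m_closed add.l_cancel zero_closed by blast
qed

lemma m_minus: assumes p: "p \<in> carrier P" shows "m (- 1) p = \<ominus> p"
proof -
  have "p \<oplus> m (- 1) p = \<zero>" using m_ladd[OF p, of 1 "- 1"] m_one[OF p] m_zero_left[OF p] by simp
  then show ?thesis using m_closed[OF p] p by (metis add.inv_equality a_comm)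
qed

lemma vsubspace_minus: "vsubspace U \<Longrightarrow> u \<in> U \<Longrightarrow> \<ominus> u \<in> U"
  using m_minus unfolding vsubspace_def by (metis subsetD)

lemma vsubspace_span1: "p \<in> carrier P \<Longrightarrow> vsubspace (range (\<lambda>c. m c p))"
  unfolding vsubspace_def
  by (auto simp: m_closed m_ladd[symmetric] m_mult[symmetric])
    (metis m_zero_left rangeI)

text \<open>A subspace maximal with trivial intersection, from Zorn's lemma, is a complement: if
  \<open>p\<close> were not in the sum, adjoining the line through \<open>p\<close> would keep the
  intersection trivial, because a vector of \<open>U\<close> involving a nonzero multiple of
  \<open>p\<close> would express \<open>p\<close> as such a sum.\<close>

lemma complement_exists:
  assumes U: "vsubspace U"
  shows "\<exists>C. vsubspace C \<and> U \<inter> C = {\<zero>} \<and> (\<forall>p\<in>carrier P. \<exists>u\<in>U. \<exists>c\<in>C. p = u \<oplus> c)"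
proof -
  let ?A = "{C. vsubspace C \<and> U \<inter> C = {\<zero>}}"
  have z: "\<zero> \<in> U" using U by (simp add: vsubspace_def)
  have "\<exists>M\<in>?A. \<forall>Y\<in>?A. M \<subseteq> Y \<longrightarrow> Y = M"
  proof (rule subset_Zorn_nonempty)
    have "vsubspace {\<zero>}" by (auto simp: vsubspace_def m_zero_right)
    then show "?A \<noteq> {}" using z by blast
    fix Ch assume ne: "Ch \<noteq> {}" and ch: "subset.chain ?A Ch"
    then have Ch: "\<And>C. C \<in> Ch \<Longrightarrow> vsubspace C \<and> U \<inter> C = {\<zero>}"
      and lin: "\<And>C D. C \<in> Ch \<Longrightarrow> D \<in> Ch \<Longrightarrow> C \<subseteq> D \<or> D \<subseteq> C"
      by (auto simp: subset.chain_def)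
    have clo: "u \<oplus> v \<in> \<Union>Ch" if h: "u \<in> C" "C \<in> Ch" "v \<in> D" "D \<in> Ch" for u v C D
    proof -
      obtain E where "E \<in> Ch" "u \<in> E" "v \<in> E" using lin[OF h(2,4)] h by blast
      then show ?thesis using Ch[of E] unfolding vsubspace_def by (meson UnionI)
    qed
    have pr: "C \<subseteq> carrier P" "\<zero> \<in> C" "\<And>c u. u \<in> C \<Longrightarrow> m c u \<in> C" if "C \<in> Ch" for C
      using Ch[OF that] by (simp_all add: vsubspace_def)
    obtain C0 where C0: "C0 \<in> Ch" using ne by blast
    have "vsubspace (\<Union>Ch)"
      unfolding vsubspace_def
    proof (intro conjI ballI allI)
      show "\<Union>Ch \<subseteq> carrier P" using pr(1) by (rule Union_least)
      show "\<zero> \<in> \<Union>Ch" using C0 pr(2)[OF C0] by (rule UnionI)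
    next
      fix u v assume "u \<in> \<Union>Ch" "v \<in> \<Union>Ch"
      then show "u \<oplus> v \<in> \<Union>Ch" using clo by (elim UnionE)
    next
      fix c u assume "u \<in> \<Union>Ch"
      then show "m c u \<in> \<Union>Ch" using pr(3) by (elim UnionE) (rule UnionI)
    qed
    moreover have "U \<inter> \<Union>Ch = {\<zero>}" using Ch ne by blast
    ultimately show "\<Union>Ch \<in> ?A" by blast
  qed
  then obtain C where "C \<in> ?A" and mx0: "\<forall>Y\<in>?A. C \<subseteq> Y \<longrightarrow> Y = C" by (rule bexE)
  then have C: "vsubspace C" "U \<inter> C = {\<zero>}" by simp_all
  have mx: "Y = C" if "vsubspace Y" "U \<inter> Y = {\<zero>}" "C \<subseteq> Y" for Y
    using mx0 that by simp
  have UC: "U \<subseteq> carrier P" "C \<subseteq> carrier P" using U C by (auto simp: vsubspace_def)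
  have "\<exists>u\<in>U. \<exists>c\<in>C. p = u \<oplus> c" if p: "p \<in> carrier P" for p
  proof (rule ccontr)
    assume no: "\<not> ?thesis"
    define Y where "Y = {c \<oplus> m k p |c k. c \<in> C}"
    have Ys: "vsubspace Y"
      unfolding vsubspace_def
    proof (intro conjI ballI allI)
      show "Y \<subseteq> carrier P" using UC p m_closed by (auto simp: Y_def)
      show "\<zero> \<in> Y" unfolding Y_def using C(1) m_zero_left[OF p]
        by (auto simp: vsubspace_def intro!: exI[of _ \<zero>] exI[of _ 0])
      fix u v assume "u \<in> Y" "v \<in> Y"
      then obtain c k d l where e: "c \<in> C" "d \<in> C" "u = c \<oplus> m k p" "v = d \<oplus> m l p" by (auto simp: Y_def)
      have "u \<oplus> v = (c \<oplus> d) \<oplus> m (k + l) p"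
        using e(3,4) subsetD[OF UC(2) e(1)] subsetD[OF UC(2) e(2)] p m_closed[OF p]
        by (simp add: m_ladd a_ac)
      moreover have "c \<oplus> d \<in> C" using C(1) e by (simp add: vsubspace_def)
      ultimately show "u \<oplus> v \<in> Y" unfolding Y_def by blast
    next
      fix r u assume "u \<in> Y"
      then obtain c k where e: "c \<in> C" "u = c \<oplus> m k p" by (auto simp: Y_def)
      have "m r u = m r c \<oplus> m (r * k) p" using e UC p by (auto simp: m_add m_closed m_mult)
      moreover have "m r c \<in> C" using C(1) e by (simp add: vsubspace_def)
      ultimately show "m r u \<in> Y" unfolding Y_def by blast
    qed
    have "U \<inter> Y = {\<zero>}"
    proof -
      have "u = \<zero>" if u: "u \<in> U" "u \<in> Y" for u
      proof -
        obtain c k where e: "c \<in> C" "u = c \<oplus> m k p" using u by (auto simp: Y_def)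
        have cc: "c \<in> carrier P" "u \<in> carrier P" using e u UC by auto
        show ?thesis
        proof (cases "k = 0")
          case True
          then show ?thesis using e u C(2) m_zero_left[OF p] cc by auto
        next
          case False
          have "m k p = u \<oplus> \<ominus> c"
            using e cc m_closed[OF p] by (metis a_comm a_inv_closed r_neg2 minus_minus)
          then have "m (1 / k) (m k p) = m (1 / k) u \<oplus> m (1 / k) (\<ominus> c)" using cc by (simp add: m_add)
          then have "p = m (1 / k) u \<oplus> m (1 / k) (\<ominus> c)"
            using False m_mult[OF p, of "1 / k" k] m_one[OF p] by simp
          moreover have "m (1 / k) u \<in> U" "m (1 / k) (\<ominus> c) \<in> C"
            using U C(1) u e vsubspace_minus[OF C(1)] by (auto simp: vsubspace_def)
          ultimately show ?thesis using no by blast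
        qed
      qed
      moreover have "\<zero> \<in> Y" using Ys by (simp add: vsubspace_def)
      ultimately show ?thesis using z by blast
    qed
    moreover have "C \<subseteq> Y"
    proof
      fix c assume c: "c \<in> C"
      then have "c = c \<oplus> m 0 p" using UC m_zero_left[OF p] by auto
      then show "c \<in> Y" unfolding Y_def using c by blast
    qed
    ultimately have "Y = C" using mx Ys by blast
    moreover have "p = \<zero> \<oplus> m 1 p" using p m_one[OF p] by simp
    then have "p \<in> Y" unfolding Y_def using C(1) unfolding vsubspace_def by blast
    ultimately show False using no z p by (metis l_zero)
  qed
  then show ?thesis using C by blast
qed

lemma projection_exists:
  assumes U: "vsubspace U"
  obtains \<pi> where "\<And>p. p \<in> carrier P \<Longrightarrow> \<pi> p \<in> U" "\<And>u. u \<in> U \<Longrightarrow> \<pi> u = u"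
    "\<And>p q. p \<in> carrier P \<Longrightarrow> q \<in> carrier P \<Longrightarrow> \<pi> (p \<oplus> q) = \<pi> p \<oplus> \<pi> q"
    "\<And>c p. p \<in> carrier P \<Longrightarrow> \<pi> (m c p) = m c (\<pi> p)"
proof -
  obtain C where C: "vsubspace C" "U \<inter> C = {\<zero>}" and ex: "\<And>p. p \<in> carrier P \<Longrightarrow> \<exists>u\<in>U. \<exists>c\<in>C. p = u \<oplus> c"
    using complement_exists[OF U] by blast
  have UC: "U \<subseteq> carrier P" "C \<subseteq> carrier P" using U C by (auto simp: vsubspace_def)
  have uniq: "u = u'" if "u \<in> U" "u' \<in> U" "c \<in> C" "c' \<in> C" "u \<oplus> c = u' \<oplus> c'" for u u' c c'
  proof -
    have m: "u \<in> carrier P" "u' \<in> carrier P" "c \<in> carrier P" "c' \<in> carrier P" using that UC by auto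
    have "\<ominus> u' \<oplus> (u \<oplus> c) = \<ominus> u' \<oplus> (u' \<oplus> c')" using that by simp
    then have "(\<ominus> u' \<oplus> u) \<oplus> c = c'" using m by (simp add: a_assoc r_neg1)
    then have "\<ominus> u' \<oplus> u = c' \<oplus> \<ominus> c" using m by (metis a_inv_closed add.inv_solve_right' add.m_closed)
    moreover have "\<ominus> u' \<oplus> u \<in> U" "c' \<oplus> \<ominus> c \<in> C"
      using that vsubspace_minus[OF U] vsubspace_minus[OF C(1)] U C(1) by (auto simp: vsubspace_def)
    ultimately have "\<ominus> u' \<oplus> u = \<zero>" using C(2) by auto
    then show ?thesis using m by (metis a_inv_closed minus_equality minus_minus)
  qed
  define \<pi> where "\<pi> p = (SOME u. u \<in> U \<and> (\<exists>c\<in>C. p = u \<oplus> c))" for p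
  have \<pi>: "\<pi> p \<in> U \<and> (\<exists>c\<in>C. p = \<pi> p \<oplus> c)" if "p \<in> carrier P" for p
    unfolding \<pi>_def by (rule someI_ex) (use ex[OF that] in blast)
  have \<pi>_eq: "\<pi> p = u" if "p \<in> carrier P" "u \<in> U" "c \<in> C" "p = u \<oplus> c" for p u c
    using \<pi>[OF that(1)] uniq that by metis
  show thesis
  proof
    show "\<pi> p \<in> U" if "p \<in> carrier P" for p using \<pi>[OF that] by simp
    show "\<pi> u = u" if "u \<in> U" for u
      using \<pi>_eq[of u u \<zero>] that UC C by (auto simp: vsubspace_def)
    show "\<pi> (p \<oplus> q) = \<pi> p \<oplus> \<pi> q" if pq: "p \<in> carrier P" "q \<in> carrier P" for p q
    proof -
      obtain c d where e: "c \<in> C" "d \<in> C" "p = \<pi> p \<oplus> c" "q = \<pi> q \<oplus> d" using \<pi> pq by blast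
      have m: "\<pi> p \<in> carrier P" "\<pi> q \<in> carrier P" "c \<in> carrier P" "d \<in> carrier P" using e \<pi> pq UC by auto
      have "p \<oplus> q = (\<pi> p \<oplus> c) \<oplus> (\<pi> q \<oplus> d)" using e by simp
      also have "\<dots> = (\<pi> p \<oplus> \<pi> q) \<oplus> (c \<oplus> d)"
        using m by (simp add: a_ac)
      finally have "p \<oplus> q = (\<pi> p \<oplus> \<pi> q) \<oplus> (c \<oplus> d)" .
      moreover have "\<pi> p \<oplus> \<pi> q \<in> U" "c \<oplus> d \<in> C"
        using U C(1) e \<pi>[OF pq(1)] \<pi>[OF pq(2)] unfolding vsubspace_def by blast+
      ultimately show ?thesis using \<pi>_eq pq add.m_closed by blast
    qed
    show "\<pi> (m k p) = m k (\<pi> p)" if p: "p \<in> carrier P" for k p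
    proof -
      obtain c where e: "c \<in> C" "p = \<pi> p \<oplus> c" using \<pi> p by blast
      have mm: "\<pi> p \<in> carrier P" "c \<in> carrier P" using e \<pi>[OF p] UC by auto
      have "m k p = m k (\<pi> p) \<oplus> m k c" using m_add[OF mm, of k] e(2) by simp
      moreover have "m k (\<pi> p) \<in> U" "m k c \<in> C"
        using U C(1) e \<pi>[OF p] unfolding vsubspace_def by blast+
      ultimately show ?thesis using \<pi>_eq m_closed[OF p] by blast
    qed
  qed
qed

text \<open>The coordinate of a projection onto the line through \<open>q\<close>. Functionals that
  separate points make the embedding of a module by evaluation injective.\<close>

lemma functional_exists:
  assumes q: "q \<in> carrier P" "q \<noteq> \<zero>"
  obtains f :: "'p \<Rightarrow> complex" where "f q = 1"
    "\<And>p p'. p \<in> carrier P \<Longrightarrow> p' \<in> carrier P \<Longrightarrow> f (p \<oplus> p') = f p + f p'"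
    "\<And>c p. p \<in> carrier P \<Longrightarrow> f (m c p) = c * f p"
proof -
  obtain \<pi> where \<pi>: "\<And>p. p \<in> carrier P \<Longrightarrow> \<pi> p \<in> range (\<lambda>c. m c q)" "\<And>u. u \<in> range (\<lambda>c. m c q) \<Longrightarrow> \<pi> u = u"
    "\<And>p p'. p \<in> carrier P \<Longrightarrow> p' \<in> carrier P \<Longrightarrow> \<pi> (p \<oplus> p') = \<pi> p \<oplus> \<pi> p'"
    "\<And>c p. p \<in> carrier P \<Longrightarrow> \<pi> (m c p) = m c (\<pi> p)"
    using projection_exists[OF vsubspace_span1[OF q(1)]] by blast
  have inj: "c = d" if "m c q = m d q" for c d
  proof (rule ccontr)
    assume ne: "c \<noteq> d"
    have "m (c - d) q = m (c + (- 1) * d) q" by simp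
    also have "\<dots> = m c q \<oplus> \<ominus> m d q"
      using q(1) m_closed m_minus by (simp only: m_ladd m_mult)
    also have "\<dots> = \<zero>" using that q(1) m_closed by (simp add: r_neg)
    finally have "m (1 / (c - d)) (m (c - d) q) = \<zero>" by (simp add: m_zero_right)
    then have "q = \<zero>" using m_mult[OF q(1), of "1 / (c - d)" "c - d"] ne m_one[OF q(1)] by simp
    then show False using q(2) by simp
  qed
  define f where "f p = (SOME c. \<pi> p = m c q)" for p
  have f: "\<pi> p = m (f p) q" if "p \<in> carrier P" for p
    unfolding f_def using \<pi>(1)[OF that] by (auto intro: someI)
  show thesis
  proof
    show "f q = 1" using f[OF q(1)] \<pi>(2)[of q] inj m_one[OF q(1)] by (metis rangeI)
    show "f (p \<oplus> p') = f p + f p'" if "p \<in> carrier P" "p' \<in> carrier P" for p p'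
      using f[of "p \<oplus> p'"] f[OF that(1)] f[OF that(2)] \<pi>(3)[OF that] that m_ladd[OF q(1)] inj by simp
    show "f (m c p) = c * f p" if "p \<in> carrier P" for c p
      using f[OF m_closed[OF that], of c] f[OF that] \<pi>(4)[OF that] m_mult[OF q(1)] inj by simp
  qed
qed

end

section \<open>Equivariant alternating forms on modules over a graded Hecke algebra\<close>

text \<open>The structure of a graded Hecke algebra used by the homological argument: \<open>S0\<close> are the simple
  reflections, \<open>y x\<close> is the image of a vector \<open>x\<close>, \<open>B\<close> a basis of the space of vectors, \<open>Y m\<close> the
  monomial with exponents \<open>m\<close>, and \<open>cf h w m\<close> the coefficient of \<open>h\<close> at \<open>T w \<otimes> Y m\<close>.\<close>

definition Mon :: "'t set \<Rightarrow> ('t \<Rightarrow> nat) set" where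
  "Mon B = {m. \<forall>b. b \<notin> B \<longrightarrow> m b = 0}"

locale pbw_hecke = ring H
  for H :: "('h, 'x) ring_scheme" (structure) +
  fixes sca :: "complex \<Rightarrow> 'h"
    and W S0 :: "('a \<Rightarrow> 'a) set"
    and T :: "('a \<Rightarrow> 'a) \<Rightarrow> 'h"
    and av :: "('a \<Rightarrow> 'a) \<Rightarrow> 't::ab_group_add \<Rightarrow> 't"
    and scl :: "complex \<Rightarrow> 't \<Rightarrow> 't"
    and cr :: "('a \<Rightarrow> 'a) \<Rightarrow> 't \<Rightarrow> complex"
    and rt :: "('a \<Rightarrow> 'a) \<Rightarrow> 't"
    and \<kappa> :: "('a \<Rightarrow> 'a) \<Rightarrow> complex"
    and y :: "'t \<Rightarrow> 'h"
    and B :: "'t set"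
    and Y :: "('t \<Rightarrow> nat) \<Rightarrow> 'h"
    and cf :: "'h \<Rightarrow> ('a \<Rightarrow> 'a) \<Rightarrow> ('t \<Rightarrow> nat) \<Rightarrow> complex"
  assumes vs: "vector_space scl"
    and sca_closed [simp, intro]: "sca c \<in> carrier H"
    and sca_add: "sca (c + d) = sca c \<oplus> sca d"
    and sca_mult: "sca (c * d) = sca c \<otimes> sca d"
    and sca_one: "sca 1 = \<one>"
    and sca_central: "h \<in> carrier H \<Longrightarrow> h \<otimes> sca c = sca c \<otimes> h"
    and W_fin: "finite W" and W_id: "id \<in> W"
    and W_comp: "u \<in> W \<Longrightarrow> w \<in> W \<Longrightarrow> u \<circ> w \<in> W"
    and W_inv: "w \<in> W \<Longrightarrow> \<exists>u\<in>W. u \<circ> w = id \<and> w \<circ> u = id"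
    and T_closed: "w \<in> W \<Longrightarrow> T w \<in> carrier H"
    and T_id: "T id = \<one>"
    and T_comp: "u \<in> W \<Longrightarrow> w \<in> W \<Longrightarrow> T (u \<circ> w) = T u \<otimes> T w"
    and av_id: "av id x = x"
    and av_comp: "u \<in> W \<Longrightarrow> w \<in> W \<Longrightarrow> av (u \<circ> w) x = av u (av w x)"
    and av_add: "w \<in> W \<Longrightarrow> av w (x + x') = av w x + av w x'"
    and av_scl: "w \<in> W \<Longrightarrow> av w (scl c x) = scl c (av w x)"
    and S0_W: "s \<in> S0 \<Longrightarrow> s \<in> W"
    and S0_inv: "s \<in> S0 \<Longrightarrow> s \<circ> s = id"
    and S0_av: "s \<in> S0 \<Longrightarrow> av s x = x - scl (cr s x) (rt s)"
    and cr_add: "cr s (x + x') = cr s x + cr s x'"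
    and cr_scl: "cr s (scl c x) = c * cr s x"
    and cr_av: "s \<in> S0 \<Longrightarrow> cr s (av s x) = - cr s x"
    and W_gen: "id \<in> K \<Longrightarrow> (\<And>s w. s \<in> S0 \<Longrightarrow> w \<in> W \<Longrightarrow> w \<in> K \<Longrightarrow> s \<circ> w \<in> K) \<Longrightarrow> W \<subseteq> K"
    and y_closed: "y x \<in> carrier H"
    and y_add: "y (x + x') = y x \<oplus> y x'"
    and y_scl: "y (scl c x) = sca c \<otimes> y x"
    and y_comm: "y x \<otimes> y x' = y x' \<otimes> y x"
    and cross: "s \<in> S0 \<Longrightarrow> y x \<otimes> T s = T s \<otimes> y (av s x) \<oplus> sca (\<kappa> s * cr s x)"
    and B_fin: "finite B" and B_span: "Modules.module.span scl B = UNIV"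
    and B_indep: "\<not> Modules.module.dependent scl B"
    and Y_closed: "m \<in> Mon B \<Longrightarrow> Y m \<in> carrier H"
    and Y_zero: "Y (\<lambda>_. 0) = \<one>"
    and Y_Suc: "m \<in> Mon B \<Longrightarrow> b \<in> B \<Longrightarrow> Y (m(b := Suc (m b))) = y b \<otimes> Y m"
    and cf_add: "h \<in> carrier H \<Longrightarrow> h' \<in> carrier H \<Longrightarrow> cf (h \<oplus> h') w m = cf h w m + cf h' w m"
    and cf_smult: "h \<in> carrier H \<Longrightarrow> cf (sca c \<otimes> h) w m = c * cf h w m"
    and cf_fin: "h \<in> carrier H \<Longrightarrow> finite {(w, m). w \<in> W \<and> m \<in> Mon B \<and> cf h w m \<noteq> 0}"
    and cf_basis: "u \<in> W \<Longrightarrow> n \<in> Mon B \<Longrightarrow> w \<in> W \<Longrightarrow> m \<in> Mon B \<Longrightarrow>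
      cf (T u \<otimes> Y n) w m = (if w = u \<and> m = n then 1 else 0)"
    and pbw_induct: "(\<And>h h'. h \<in> K' \<Longrightarrow> h' \<in> K' \<Longrightarrow> h \<oplus> h' \<in> K') \<Longrightarrow>
      (\<And>c w m. w \<in> W \<Longrightarrow> m \<in> Mon B \<Longrightarrow> sca c \<otimes> (T w \<otimes> Y m) \<in> K') \<Longrightarrow> carrier H \<subseteq> K'"
begin

sublocale vec: vector_space scl by (rule vs)

lemma sca_zero: "sca 0 = \<zero>"
proof -
  have "sca 0 \<oplus> sca 0 = sca 0" using sca_add[of 0 0] by simp
  then show ?thesis using add.l_cancel_one[of "sca 0" "sca 0"] by simp
qed

lemma sca_minus: "sca (- c) = \<ominus> sca c"
proof -
  have "sca c \<oplus> sca (- c) = \<zero>" using sca_add[of c "- c"] by (simp add: sca_zero)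
  then show ?thesis using minus_equality[of "sca (- c)" "sca c"] by (simp add: a_comm)
qed

lemma inv_W: assumes "w \<in> W" shows "inv_into UNIV w \<in> W" "inv_into UNIV w \<circ> w = id" "w \<circ> inv_into UNIV w = id"
proof -
  obtain u where u: "u \<in> W" "u \<circ> w = id" "w \<circ> u = id" using W_inv assms by blast
  then have "inv_into UNIV w = u" by (metis Hilbert_Choice.inv_unique_comp)
  with u show "inv_into UNIV w \<in> W" "inv_into UNIV w \<circ> w = id" "w \<circ> inv_into UNIV w = id" by auto
qed

lemma av_inv: "w \<in> W \<Longrightarrow> av w (av (inv_into UNIV w) x) = x" "w \<in> W \<Longrightarrow> av (inv_into UNIV w) (av w x) = x"
  using av_comp[of w "inv_into UNIV w" x] av_comp[of "inv_into UNIV w" w x] inv_W[of w] av_id by auto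

lemma T_inv: "w \<in> W \<Longrightarrow> T w \<otimes> T (inv_into UNIV w) = \<one>" "w \<in> W \<Longrightarrow> T (inv_into UNIV w) \<otimes> T w = \<one>"
  using T_comp[of w "inv_into UNIV w"] T_comp[of "inv_into UNIV w" w] inv_W[of w] T_id by auto

lemma map_av_inv: "w \<in> W \<Longrightarrow> map (av w) (map (av (inv_into UNIV w)) xs) = xs"
  "w \<in> W \<Longrightarrow> map (av (inv_into UNIV w)) (map (av w) xs) = xs"
  by (simp_all add: comp_def av_inv)

lemma S0_av_av: "s \<in> S0 \<Longrightarrow> av s (av s x) = x"
  using av_comp[of s s x] S0_inv[of s] S0_W[of s] av_id by simp

lemma cf_zero: "cf \<zero> w m = 0"
  using cf_smult[of \<zero> 0 w m] by simp

lemma one_not_zero: "\<one> \<noteq> \<zero>"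
proof
  assume "\<one> = \<zero>"
  then have "T id \<otimes> Y (\<lambda>_. 0) = \<zero>" using T_id Y_zero by simp
  moreover have "(\<lambda>_. 0) \<in> Mon B" by (simp add: Mon_def)
  ultimately show False using cf_basis[of id "\<lambda>_. 0" id "\<lambda>_. 0"] W_id cf_zero by simp
qed

lemma module_complex_space:
  assumes "left_module H P"
  shows "complex_space P (\<lambda>c p. sca c \<odot>\<^bsub>P\<^esub> p)"
proof -
  interpret P: left_module H P by fact
  show ?thesis
    by unfold_locales
      (auto simp: P.smult_closed P.smult_r_distr P.smult_l_distr P.smult_assoc P.smult_one sca_add sca_mult sca_one)
qed

end

lemma (in left_module) smult_zero_right: "a \<in> carrier R \<Longrightarrow> a \<odot>\<^bsub>M\<^esub> \<zero>\<^bsub>M\<^esub> = \<zero>\<^bsub>M\<^esub>"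
  using smult_r_distr[of a "\<zero>\<^bsub>M\<^esub>" "\<zero>\<^bsub>M\<^esub>"] smult_closed[of a "\<zero>\<^bsub>M\<^esub>"] by simp

lemma (in left_module) smult_zero_left: "x \<in> carrier M \<Longrightarrow> \<zero>\<^bsub>R\<^esub> \<odot>\<^bsub>M\<^esub> x = \<zero>\<^bsub>M\<^esub>"
  using smult_l_distr[of "\<zero>\<^bsub>R\<^esub>" "\<zero>\<^bsub>R\<^esub>" x] smult_closed[of "\<zero>\<^bsub>R\<^esub>" x] by simp

text \<open>The coefficient module of the forms is a subgroup of a type of class \<^class>\<open>ab_group_add\<close>, the
  image of the idempotent \<open>act \<one>\<close>; the action need not be unital on the whole type.\<close>

locale pbw_rep = pbw_hecke H sca W S0 T av scl cr rt \<kappa> y B Y cf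
  for H :: "('h, 'x) ring_scheme" (structure) and sca
    and W S0 :: "('a \<Rightarrow> 'a) set" and T
    and av :: "('a \<Rightarrow> 'a) \<Rightarrow> 't::ab_group_add \<Rightarrow> 't" and scl cr rt \<kappa> y B Y cf +
  fixes act :: "'h \<Rightarrow> 'n::ab_group_add \<Rightarrow> 'n"
  assumes act_ladd: "h \<in> carrier H \<Longrightarrow> h' \<in> carrier H \<Longrightarrow> act (h \<oplus> h') v = act h v + act h' v"
    and act_add: "h \<in> carrier H \<Longrightarrow> act h (u + v) = act h u + act h v"
    and act_mult: "h \<in> carrier H \<Longrightarrow> h' \<in> carrier H \<Longrightarrow> act (h \<otimes> h') v = act h (act h' v)"
begin

lemma act_zero: "h \<in> carrier H \<Longrightarrow> act h 0 = 0"
  using act_add[of h 0 0] by simp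

lemma act_minus: "h \<in> carrier H \<Longrightarrow> act h (- v) = - act h v"
  using act_add[of h v "- v"] act_zero by (simp add: eq_neg_iff_add_eq_0 add.commute)

lemma act_diff: "h \<in> carrier H \<Longrightarrow> act h (u - v) = act h u - act h v"
  using act_add[of h u "- v"] act_minus by simp

lemma act_sum: "h \<in> carrier H \<Longrightarrow> act h (sum f I) = (\<Sum>i\<in>I. act h (f i))"
  by (induction I rule: infinite_finite_induct) (auto simp: act_add act_zero)

lemma act_lzero: "act \<zero> v = 0"
  using act_ladd[of \<zero> \<zero> v] by simp

lemma act_lminus: "h \<in> carrier H \<Longrightarrow> act (\<ominus> h) v = - act h v"
  using act_ladd[of h "\<ominus> h" v] act_lzero by (simp add: r_neg eq_neg_iff_add_eq_0 add.commute)

lemma act_one_act: "h \<in> carrier H \<Longrightarrow> act \<one> (act h v) = act h v"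
  using act_mult[of \<one> h v] by simp

lemma act_sca_comm: "h \<in> carrier H \<Longrightarrow> act (sca c) (act h v) = act h (act (sca c) v)"
  using act_mult[of "sca c" h v] act_mult[of h "sca c" v] by (simp add: sca_central)

lemma act_sca_sca: "act (sca c) (act (sca d) v) = act (sca d) (act (sca c) v)"
  using act_sca_comm[of "sca d"] by simp

lemma act_sca_y: "act (sca c) (act (y x) v) = act (y x) (act (sca c) v)"
  using act_sca_comm[OF y_closed] .

text \<open>The complex-linear maps from \<open>P\<close> to the coefficient module. Being zero off
  the carrier makes equality of linear maps equality of functions, and the last condition confines
  the values to the image of the idempotent \<open>act \<one>\<close>, which is the coefficient
  module.\<close>

definition VG :: "('h, 'p) module \<Rightarrow> ('p \<Rightarrow> 'n) set" where
  "VG P = {v. (\<forall>p. p \<notin> carrier P \<longrightarrow> v p = 0) \<and>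
     (\<forall>p\<in>carrier P. \<forall>q\<in>carrier P. v (p \<oplus>\<^bsub>P\<^esub> q) = v p + v q) \<and>
     (\<forall>c. \<forall>p\<in>carrier P. v (sca c \<odot>\<^bsub>P\<^esub> p) = act (sca c) (v p)) \<and> (\<forall>p. act \<one> (v p) = v p)}"

definition vsc :: "complex \<Rightarrow> ('p \<Rightarrow> 'n) \<Rightarrow> 'p \<Rightarrow> 'n" where
  "vsc c v = (\<lambda>p. act (sca c) (v p))"

definition VD :: "('h, 'p) module \<Rightarrow> 't \<Rightarrow> ('p \<Rightarrow> 'n) \<Rightarrow> 'p \<Rightarrow> 'n" where
  "VD P x v = (\<lambda>p. if p \<in> carrier P then v (y x \<odot>\<^bsub>P\<^esub> p) - act (y x) (v p) else 0)"

lemma form_space_unital: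
  assumes "\<And>v i. v \<in> G \<Longrightarrow> act \<one> (v i) = v i" "0 \<in> G" "\<And>u v. u \<in> G \<Longrightarrow> v \<in> G \<Longrightarrow> u - v \<in> G"
    "\<And>u c. u \<in> G \<Longrightarrow> vsc c u \<in> G"
  shows "form_space scl G vsc"
  by unfold_locales
    (auto simp: assms(1-3) assms(4)[unfolded vsc_def] vsc_def act_diff act_ladd sca_add act_mult sca_mult)

lemma form_space_VG:
  assumes "left_module H P" shows "form_space scl (VG P) vsc"
proof (rule form_space_unital)
  show "vsc c u \<in> VG P" if "u \<in> VG P" for u c
    using that unfolding VG_def vsc_def by (auto simp: act_zero act_add act_sca_sca act_one_act)
qed (auto simp: VG_def act_zero act_diff)

text \<open>\<open>VD P x\<close> is the difference of two commuting actions of \<open>y x\<close>,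
  by precomposition on \<open>P\<close> and by postcomposition on the coefficients; different
  \<open>x\<close> commute because the \<open>y x\<close> do.\<close>

lemma koszul_VG:
  assumes P: "left_module H P" shows "koszul scl (VG P) vsc (VD P)"
proof -
  interpret P: left_module H P by fact
  interpret form_space scl "VG P" vsc by (rule form_space_VG[OF P])
  have yc: "y x \<odot>\<^bsub>P\<^esub> (sca c \<odot>\<^bsub>P\<^esub> p) = sca c \<odot>\<^bsub>P\<^esub> (y x \<odot>\<^bsub>P\<^esub> p)" if "p \<in> carrier P" for x c p
    using that by (simp add: P.smult_assoc[symmetric] y_closed sca_central)
  have yy: "y x \<odot>\<^bsub>P\<^esub> (y x' \<odot>\<^bsub>P\<^esub> p) = y x' \<odot>\<^bsub>P\<^esub> (y x \<odot>\<^bsub>P\<^esub> p)" if "p \<in> carrier P" for x x' p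
    using that by (simp add: P.smult_assoc[symmetric] y_closed y_comm[of x x'])
  show ?thesis
  proof
    fix x x' v c assume v: "v \<in> VG P"
    have va: "v (p \<oplus>\<^bsub>P\<^esub> q) = v p + v q" if "p \<in> carrier P" "q \<in> carrier P" for p q
      using v that by (simp add: VG_def)
    have vc: "v (sca c \<odot>\<^bsub>P\<^esub> p) = act (sca c) (v p)" if "p \<in> carrier P" for p c
      using v that by (simp add: VG_def)
    have v1: "act \<one> (v p) = v p" for p using v by (simp add: VG_def)
    note cl = P.smult_closed[OF y_closed] P.smult_closed[OF sca_closed] y_closed
    show "VD P x v \<in> VG P"
      unfolding VG_def
      by (auto simp: VD_def cl va vc yc P.smult_r_distr act_diff act_add act_zero act_one_act v1 act_sca_y)
    show "VD P x (vsc c v) = vsc c (VD P x v)"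
      by (auto simp: VD_def vsc_def cl act_diff act_sca_y act_zero)
    show "VD P (x + x') v = VD P x v + VD P x' v"
      by (auto simp: VD_def cl y_add P.smult_l_distr act_ladd va)
    show "VD P (scl c x) v = vsc c (VD P x v)"
      by (rule ext) (auto simp: VD_def vsc_def cl P.smult_assoc vc y_scl act_mult act_diff act_zero)
    have "act (y x) (act (y x') u) = act (y x') (act (y x) u)" for u
      using act_mult[of "y x" "y x'" u] act_mult[of "y x'" "y x" u] by (simp add: cl y_comm[of x])
    then show "VD P x (VD P x' v) = VD P x' (VD P x v)"
      by (rule_tac ext) (auto simp: VD_def cl act_diff yy)
  qed (auto simp: VD_def act_diff P.smult_closed y_closed)
qed

section \<open>The complex of equivariant forms on a module\<close>

definition equi :: "('h, 'p) module \<Rightarrow> ('t list \<Rightarrow> 'p \<Rightarrow> 'n) \<Rightarrow> bool" where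
  "equi P \<phi> \<longleftrightarrow> (\<forall>w\<in>W. \<forall>xs. \<forall>p\<in>carrier P. \<phi> (map (av w) xs) (T w \<odot>\<^bsub>P\<^esub> p) = act (T w) (\<phi> xs p))"

definition forms :: "('h, 'p) module \<Rightarrow> nat \<Rightarrow> ('t list \<Rightarrow> 'p \<Rightarrow> 'n) set" where
  "forms P n = {\<phi>. form_space.alt scl (VG P) vsc n \<phi> \<and> equi P \<phi>}"

abbreviation kosz :: "('h, 'p) module \<Rightarrow> ('t list \<Rightarrow> 'p \<Rightarrow> 'n) \<Rightarrow> 't list \<Rightarrow> 'p \<Rightarrow> 'n" where
  "kosz P \<phi> \<equiv> \<lambda>xs. kd (VD P) xs \<phi>"

text \<open>The cross relation is available for simple reflections, and these generate the group.
  The identity element is covered by the unit condition, as \<open>act \<one>\<close> is merely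
  idempotent.\<close>

lemma equi_simple:
  assumes P: "left_module H P" and v1: "\<And>xs p. act \<one> (\<phi> xs p) = \<phi> xs p"
    and s: "\<And>s xs p. s \<in> S0 \<Longrightarrow> p \<in> carrier P \<Longrightarrow> \<phi> (map (av s) xs) (T s \<odot>\<^bsub>P\<^esub> p) = act (T s) (\<phi> xs p)"
  shows "equi P \<phi>"
proof -
  interpret P: left_module H P by fact
  let ?K = "{w \<in> W. \<forall>xs. \<forall>p\<in>carrier P. \<phi> (map (av w) xs) (T w \<odot>\<^bsub>P\<^esub> p) = act (T w) (\<phi> xs p)}"
  have "W \<subseteq> ?K"
  proof (rule W_gen)
    have "map (av id) xs = xs" for xs by (simp add: av_id map_idI)
    then show "id \<in> ?K" by (simp add: W_id T_id P.smult_one v1)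
    fix s w assume sw: "s \<in> S0" "w \<in> W" "w \<in> ?K"
    have sW: "s \<in> W" using sw S0_W by blast
    have avc: "av (s \<circ> w) = av s \<circ> av w" using av_comp[OF sW sw(2)] by auto
    have "\<phi> (map (av (s \<circ> w)) xs) (T (s \<circ> w) \<odot>\<^bsub>P\<^esub> p) = act (T (s \<circ> w)) (\<phi> xs p)"
      if p: "p \<in> carrier P" for xs p
    proof -
      have wp: "T w \<odot>\<^bsub>P\<^esub> p \<in> carrier P" using P.smult_closed[OF T_closed[OF sw(2)] p] .
      have "\<phi> (map (av (s \<circ> w)) xs) (T (s \<circ> w) \<odot>\<^bsub>P\<^esub> p)
          = \<phi> (map (av s) (map (av w) xs)) (T s \<odot>\<^bsub>P\<^esub> (T w \<odot>\<^bsub>P\<^esub> p))"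
        using p T_comp[OF sW sw(2)] sW sw by (simp add: P.smult_assoc T_closed avc)
      also have "\<dots> = act (T s) (\<phi> (map (av w) xs) (T w \<odot>\<^bsub>P\<^esub> p))" using s[OF sw(1) wp] .
      also have "\<dots> = act (T (s \<circ> w)) (\<phi> xs p)"
        using T_comp[OF sW sw(2)] sW sw p by (simp add: act_mult T_closed)
      finally show ?thesis .
    qed
    then show "s \<circ> w \<in> ?K" using W_comp[OF sW sw(2)] by simp
  qed
  then show ?thesis by (auto simp: equi_def)
qed

text \<open>Commuting a simple reflection past the Koszul differential produces, through the cross relation,
  an error term \<open>c \<and> c \<and> \<phi>(\<alpha>, \<dots>)\<close>, which vanishes.\<close>

lemma kosz_equi:
  assumes P: "left_module H P" and \<phi>: "\<phi> \<in> forms P n"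
  shows "equi P (kosz P \<phi>)"
proof -
  interpret P: left_module H P by fact
  interpret K: koszul scl "VG P" vsc "VD P" by (rule koszul_VG[OF P])
  have alt: "K.alt n \<phi>" and eq: "equi P \<phi>" using \<phi> by (auto simp: forms_def)
  have G: "\<phi> xs \<in> VG P" for xs using K.alt_G[OF alt] .
  show ?thesis
  proof (rule equi_simple[OF P])
    show "act \<one> (kosz P \<phi> xs p) = kosz P \<phi> xs p" for xs p
      using K.kd_G[of \<phi> xs] G by (simp add: VG_def)
  next
    fix s xs p assume s: "s \<in> S0" and p: "p \<in> carrier P"
    \<comment> \<open>\<open>l\<close> precomposes and \<open>r\<close> postcomposes with
      \<open>T s\<close>, so equivariance for \<open>s\<close> says that \<open>l\<close> of the
      form at reflected arguments is \<open>r\<close> of the form. Neither commutes with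
      \<open>VD\<close>; both are compared with the twisted operator \<open>Ds\<close>, in which
      \<open>y x\<close> acts on the source and \<open>y (av s x)\<close> on the target.\<close>
    define l :: "('b \<Rightarrow> 'n) \<Rightarrow> 'b \<Rightarrow> 'n"
      where "l = (\<lambda>v p. if p \<in> carrier P then v (T s \<odot>\<^bsub>P\<^esub> p) else 0)"
    define r :: "('b \<Rightarrow> 'n) \<Rightarrow> 'b \<Rightarrow> 'n" where "r = (\<lambda>v p. act (T s) (v p))"
    define Ds :: "'t \<Rightarrow> ('b \<Rightarrow> 'n) \<Rightarrow> 'b \<Rightarrow> 'n"
      where "Ds = (\<lambda>x u p. if p \<in> carrier P then u (y x \<odot>\<^bsub>P\<^esub> p) - act (y (av s x)) (u p) else 0)"
    define E :: "'t \<Rightarrow> ('b \<Rightarrow> 'n) \<Rightarrow> 'b \<Rightarrow> 'n" where "E = (\<lambda>x. vsc (cr s x))"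
    interpret E: koszul scl "VG P" vsc E
      unfolding E_def by (rule K.koszul_wedge) (auto simp: cr_add cr_scl)
    have Ts: "T s \<in> carrier H" using T_closed S0_W s by blast
    note cl = P.smult_closed[OF y_closed] P.smult_closed[OF sca_closed] y_closed Ts P.smult_closed[OF Ts]
    \<comment> \<open>The cross relation at \<open>av s x\<close>; the minus sign arises because the
      reflection negates the functional \<open>cr s\<close>.\<close>
    have cross': "y (av s x) \<otimes> T s = T s \<otimes> y x \<oplus> \<ominus> sca (\<kappa> s * cr s x)" for x
      using cross[OF s, of "av s x"] by (simp add: S0_av_av s cr_av sca_minus[symmetric])
    have l: "l (VD P (av s x) v) = Ds x (l v) - vsc (\<kappa> s) (E x v)" if v: "v \<in> VG P" for x v
    proof
      fix p
      show "l (VD P (av s x) v) p = (Ds x (l v) - vsc (\<kappa> s) (E x v)) p"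
      proof (cases "p \<in> carrier P")
        case True
        have "y (av s x) \<odot>\<^bsub>P\<^esub> (T s \<odot>\<^bsub>P\<^esub> p) = (y (av s x) \<otimes> T s) \<odot>\<^bsub>P\<^esub> p"
          using True by (simp add: P.smult_assoc cl)
        also have "\<dots> = T s \<odot>\<^bsub>P\<^esub> (y x \<odot>\<^bsub>P\<^esub> p) \<oplus>\<^bsub>P\<^esub> sca (- (\<kappa> s * cr s x)) \<odot>\<^bsub>P\<^esub> p"
          using True by (simp add: P.smult_assoc P.smult_l_distr cl cross' sca_minus)
        finally have "v (y (av s x) \<odot>\<^bsub>P\<^esub> (T s \<odot>\<^bsub>P\<^esub> p))
            = v (T s \<odot>\<^bsub>P\<^esub> (y x \<odot>\<^bsub>P\<^esub> p)) + act (sca (- (\<kappa> s * cr s x))) (v p)"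
          using v True by (simp add: VG_def cl)
        then show ?thesis
          using True by (simp add: l_def VD_def Ds_def E_def vsc_def cl sca_minus act_lminus sca_mult act_mult)
      next
        case False
        then have "v p = 0" using v by (simp add: VG_def)
        then show ?thesis using False by (simp add: l_def Ds_def E_def vsc_def act_zero)
      qed
    qed
    have r: "r (VD P x v) = Ds x (r v) - vsc (\<kappa> s) (E x v)" if v: "v \<in> VG P" for x v
    proof
      fix p
      show "r (VD P x v) p = (Ds x (r v) - vsc (\<kappa> s) (E x v)) p"
      proof (cases "p \<in> carrier P")
        case True
        have "act (y (av s x)) (act (T s) (v p)) = act (T s) (act (y x) (v p)) - act (sca (\<kappa> s)) (act (sca (cr s x)) (v p))"
          using act_mult[of "y (av s x)" "T s" "v p"] 
          by (simp add: cl cross' act_ladd act_lminus act_mult sca_mult)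
        then show ?thesis
          using True by (simp add: r_def VD_def Ds_def E_def vsc_def cl act_diff)
      next
        case False
        then have "v p = 0" using v by (simp add: VG_def)
        then show ?thesis using False by (simp add: r_def VD_def Ds_def E_def vsc_def act_zero cl)
      qed
    qed
    \<comment> \<open>Collected over all arguments, the error is \<kappa> times the wedge of
      \<open>cr s\<close> with the reflected form; in \<open>R\<close> below it is \<kappa> times
      the wedge with the form itself.\<close>
    have L: "l (kd (VD P) (map (av s) xs) \<psi>)
        = kd Ds xs (\<lambda>ys. l (\<psi> (map (av s) ys))) - vsc (\<kappa> s) (kd E xs (\<lambda>ys. \<psi> (map (av s) ys)))"
      if "\<And>ys. \<psi> ys \<in> VG P" for \<psi>
      using that
    proof (induction xs arbitrary: \<psi>)
      case Nil
      show ?case by (auto simp: l_def vsc_def act_zero)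
    next
      case (Cons x xs)
      have lm: "l (u - v) = l u - l v" for u v by (auto simp: l_def)
      have vm: "vsc (\<kappa> s) (u - v) = vsc (\<kappa> s) u - vsc (\<kappa> s) v" for u v :: "'b \<Rightarrow> 'n"
        by (auto simp: vsc_def act_diff)
      show ?case
        unfolding list.map kd.simps lm vm l[OF Cons.prems] Cons.IH[of "\<lambda>ys. \<psi> (av s x # ys)", OF Cons.prems]
        by (rule ext) simp
    qed
    have R: "r (kd (VD P) xs \<psi>) = kd Ds xs (\<lambda>ys. r (\<psi> ys)) - vsc (\<kappa> s) (kd E xs \<psi>)"
      if "\<And>ys. \<psi> ys \<in> VG P" for \<psi>
      using that
    proof (induction xs arbitrary: \<psi>)
      case Nil
      show ?case by (auto simp: r_def vsc_def act_zero cl)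
    next
      case (Cons x xs)
      have rm: "r (u - v) = r u - r v" for u v by (auto simp: r_def act_diff cl)
      have vm: "vsc (\<kappa> s) (u - v) = vsc (\<kappa> s) u - vsc (\<kappa> s) v" for u v :: "'b \<Rightarrow> 'n"
        by (auto simp: vsc_def act_diff)
      show ?case
        unfolding kd.simps rm vm r[OF Cons.prems] Cons.IH[of "\<lambda>ys. \<psi> (x # ys)", OF Cons.prems]
        by (rule ext) simp
    qed
    have lr: "l (\<phi> (map (av s) ys)) = r (\<phi> ys)" for ys
      using eq S0_W[OF s] G[of ys] by (auto simp: l_def r_def equi_def VG_def act_zero cl)
    \<comment> \<open>The two errors agree: the reflected form differs from the form by a wedge with
      \<open>cr s\<close>, and a second wedge with \<open>cr s\<close> kills the difference.\<close>
    have "kd E xs (\<lambda>ys. \<phi> (map (av s) ys)) = kd E xs (\<lambda>ys. \<phi> ys - kd E ys (\<lambda>zs. \<phi> (rt s # zs)))"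
      using K.alt_map_reflection[of "av s" "cr s" "rt s", OF S0_av[OF s] alt] by (simp add: E_def)
    also have "\<dots> = kd E xs \<phi>"
      by (simp add: E.kd_diff E.kd_G G E.kd_kd)
    finally have "l (kd (VD P) (map (av s) xs) \<phi>) = r (kd (VD P) xs \<phi>)"
      using L[of \<phi>] R[of \<phi>] G lr by simp
    from fun_cong[OF this, of p] show "kosz P \<phi> (map (av s) xs) (T s \<odot>\<^bsub>P\<^esub> p) = act (T s) (kosz P \<phi> xs p)"
      using p by (simp add: l_def r_def)
  qed
qed

lemma forms_kosz: "left_module H P \<Longrightarrow> \<phi> \<in> forms P n \<Longrightarrow> kosz P \<phi> \<in> forms P (Suc n)"
  using kosz_equi[of P \<phi> n] koszul.alt_kd[OF koszul_VG, of P n \<phi>] by (simp add: forms_def)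

end

section \<open>Pullback of forms along module homomorphisms\<close>

lemma module_homD:
  assumes "f \<in> module_hom A P Q"
  shows "p \<in> carrier P \<Longrightarrow> f p \<in> carrier Q"
    and "p \<in> carrier P \<Longrightarrow> q \<in> carrier P \<Longrightarrow> f (p \<oplus>\<^bsub>P\<^esub> q) = f p \<oplus>\<^bsub>Q\<^esub> f q"
    and "a \<in> carrier A \<Longrightarrow> p \<in> carrier P \<Longrightarrow> f (a \<odot>\<^bsub>P\<^esub> p) = a \<odot>\<^bsub>Q\<^esub> f p"
  using assms by (auto simp: module_hom_def)

lemma module_hom_zero:
  assumes "left_module A P" "left_module A Q" "f \<in> module_hom A P Q"
  shows "f \<zero>\<^bsub>P\<^esub> = \<zero>\<^bsub>Q\<^esub>"
proof -
  interpret P: left_module A P by fact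
  interpret Q: left_module A Q by fact
  have "f (\<zero>\<^bsub>A\<^esub> \<odot>\<^bsub>P\<^esub> \<zero>\<^bsub>P\<^esub>) = \<zero>\<^bsub>A\<^esub> \<odot>\<^bsub>Q\<^esub> f \<zero>\<^bsub>P\<^esub>"
    using module_homD(3)[OF assms(3)] by simp
  then show ?thesis using module_homD(1)[OF assms(3)] by (simp add: P.smult_zero_left Q.smult_zero_left)
qed

lemma sum_fun_app: "(sum F I) q = (\<Sum>i\<in>I. F i q :: 'b::comm_monoid_add)"
  by (induction I rule: infinite_finite_induct) auto

context pbw_rep
begin

definition pull :: "('h, 'p) module \<Rightarrow> ('p \<Rightarrow> 'q) \<Rightarrow> ('t list \<Rightarrow> 'q \<Rightarrow> 'n) \<Rightarrow> 't list \<Rightarrow> 'p \<Rightarrow> 'n" where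
  "pull P f \<phi> = (\<lambda>xs p. if p \<in> carrier P then \<phi> xs (f p) else 0)"

definition closed_form :: "('h, 'p) module \<Rightarrow> ('t list \<Rightarrow> 'p \<Rightarrow> 'n) \<Rightarrow> bool" where
  "closed_form P \<phi> \<longleftrightarrow> (\<forall>xs. kosz P \<phi> xs = 0)"

definition acyclic_module :: "('h, 'p) module \<Rightarrow> bool" where
  "acyclic_module P \<longleftrightarrow> (\<forall>n. \<forall>\<phi>\<in>forms P (Suc n). closed_form P \<phi> \<longrightarrow> (\<exists>\<psi>\<in>forms P n. kosz P \<psi> = \<phi>))"

lemma forms_VG: "left_module H P \<Longrightarrow> \<phi> \<in> forms P n \<Longrightarrow> \<phi> xs \<in> VG P"
  using form_space.alt_G[OF form_space_VG, of P n \<phi> xs] by (simp add: forms_def)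

lemma VG_outside: "v \<in> VG P \<Longrightarrow> p \<notin> carrier P \<Longrightarrow> v p = 0"
  by (simp add: VG_def)

lemma forms_diff:
  assumes "left_module H P" "\<phi> \<in> forms P n" "\<psi> \<in> forms P n"
  shows "(\<lambda>xs. \<phi> xs - \<psi> xs) \<in> forms P n"
  using form_space.alt_diff[OF form_space_VG[OF assms(1)], of n \<phi> \<psi>] assms(2,3)
  by (auto simp: forms_def equi_def act_diff T_closed)

lemma kosz_diff:
  assumes "left_module H P" "\<phi> \<in> forms P n" "\<psi> \<in> forms P n'"
  shows "kosz P (\<lambda>xs. \<phi> xs - \<psi> xs) xs = kosz P \<phi> xs - kosz P \<psi> xs"
  using koszul.kd_diff[OF koszul_VG[OF assms(1)], of \<phi> \<psi>] forms_VG[OF assms(1)] assms(2,3) by blast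

lemma closed_kosz: "left_module H P \<Longrightarrow> \<phi> \<in> forms P n \<Longrightarrow> closed_form P (kosz P \<phi>)"
  unfolding closed_form_def using koszul.kd_kd[OF koszul_VG, of P \<phi>] forms_VG[of P \<phi> n] by blast

lemma pull_forms:
  assumes P: "left_module H P" and Q: "left_module H Q" and f: "f \<in> module_hom H P Q" and \<phi>: "\<phi> \<in> forms Q n"
  shows "pull P f \<phi> \<in> forms P n"
proof -
  interpret P: left_module H P by fact
  note fD = module_homD[OF f]
  let ?g = "\<lambda>v p. if p \<in> carrier P then v (f p) else 0"
  have "form_space.alt scl (VG P) vsc n (\<lambda>xs. ?g (\<phi> xs))"
  proof (rule alt_map[OF form_space_VG[OF Q] form_space_VG[OF P], of "VG Q"])
    show "?g u \<in> VG P" if "u \<in> VG Q" for u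
      using that by (auto simp: VG_def fD P.smult_closed act_zero)
    show "?g (vsc c u) = vsc c (?g u)" for c u by (auto simp: vsc_def act_zero)
  qed (use \<phi> forms_VG[OF Q \<phi>] in \<open>auto simp: forms_def\<close>)
  then show ?thesis
    using \<phi> by (auto simp: forms_def pull_def equi_def fD P.smult_closed T_closed)
qed

lemma kosz_pull:
  assumes P: "left_module H P" and Q: "left_module H Q" and f: "f \<in> module_hom H P Q" and \<phi>: "\<phi> \<in> forms Q n"
  shows "kosz P (pull P f \<phi>) = pull P f (kosz Q \<phi>)"
proof
  fix xs
  interpret P: left_module H P by fact
  interpret Q: koszul scl "VG Q" vsc "VD Q" by (rule koszul_VG[OF Q])
  note fD = module_homD[OF f]
  let ?g = "\<lambda>v p. if p \<in> carrier P then v (f p) else 0"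
  have "?g (kd (VD Q) xs \<phi>) = kd (VD P) xs (\<lambda>ys. ?g (\<phi> ys)) \<and> kd (VD Q) xs \<phi> \<in> VG Q"
  proof (rule kd_map[where K = "VG Q"])
    show "?g (VD Q x v) = VD P x (?g v)" for x v
      by (auto simp: VD_def fD P.smult_closed y_closed)
  qed (auto simp: forms_VG[OF Q \<phi>] Q.D_closed Q.G_diff Q.G_zero)
  then show "kosz P (pull P f \<phi>) xs = pull P f (kosz Q \<phi>) xs" by (simp add: pull_def)
qed

lemma closed_pull:
  assumes "left_module H P" "left_module H Q" "f \<in> module_hom H P Q" "\<phi> \<in> forms Q n" "closed_form Q \<phi>"
  shows "closed_form P (pull P f \<phi>)"
  using fun_cong[OF kosz_pull[OF assms(1-4)]] assms(5) by (auto simp: closed_form_def pull_def)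

text \<open>A closed form is pulled back along \<open>r\<close>, given a primitive on
  \<open>F\<close>, and the primitive is pulled back along \<open>i\<close>. This reduces projective
  modules to free ones.\<close>

lemma acyclic_retract:
  assumes P: "left_module H P" and F: "left_module H F" and i: "i \<in> module_hom H P F" and r: "r \<in> module_hom H F P"
    and ri: "\<And>p. p \<in> carrier P \<Longrightarrow> r (i p) = p" and ac: "acyclic_module F"
  shows "acyclic_module P"
  unfolding acyclic_module_def
proof (intro allI ballI impI)
  fix n \<phi> assume \<phi>: "\<phi> \<in> forms P (Suc n)" "closed_form P \<phi>"
  have "pull F r \<phi> \<in> forms F (Suc n)" "closed_form F (pull F r \<phi>)"
    using pull_forms[OF F P r] closed_pull[OF F P r] \<phi> by auto
  then obtain \<psi> where \<psi>: "\<psi> \<in> forms F n" "kosz F \<psi> = pull F r \<phi>" using ac by (auto simp: acyclic_module_def)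
  have "kosz P (pull P i \<psi>) = pull P i (pull F r \<phi>)" using kosz_pull[OF P F i \<psi>(1)] \<psi>(2) by simp
  also have "\<dots> = \<phi>"
    using module_homD(1)[OF i] ri VG_outside[OF forms_VG[OF P \<phi>(1)]] by (auto simp: pull_def fun_eq_iff)
  finally show "\<exists>\<psi>\<in>forms P n. kosz P \<psi> = \<phi>" using pull_forms[OF P F i \<psi>(1)] by blast
qed

section \<open>Exactness in the direction of the resolution\<close>

lemma inv_W_comp: "u \<in> W \<Longrightarrow> w \<in> W \<Longrightarrow> u \<circ> inv_into UNIV (w \<circ> u) = inv_into UNIV w"
proof -
  assume uw: "u \<in> W" "w \<in> W"
  have "w \<circ> (u \<circ> inv_into UNIV (w \<circ> u)) = id" using inv_W(3)[OF W_comp[OF uw(2,1)]] by (simp add: comp_assoc)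
  then have "inv_into UNIV w \<circ> (w \<circ> (u \<circ> inv_into UNIV (w \<circ> u))) = inv_into UNIV w" by simp
  then show ?thesis using inv_W(2)[OF uw(2)] by (simp add: comp_assoc[symmetric])
qed

lemma bij_betw_W_right: assumes u: "u \<in> W" shows "bij_betw (\<lambda>w. w \<circ> u) W W"
proof (rule bij_betw_byWitness[where f' = "\<lambda>w. w \<circ> inv_into UNIV u"])
qed (use inv_W[OF u] u W_comp in \<open>auto simp: comp_assoc\<close>)

lemma sum_act_sca: "(\<Sum>i\<in>I. act (sca c) u) = act (sca (of_nat (card I) * c)) u"
  by (induction I rule: infinite_finite_induct) (auto simp: sca_zero act_lzero algebra_simps sca_add act_ladd)

text \<open>Linear extension along a complement of the image, followed by averaging over the Weyl group.\<close>

lemma forms_extend: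
  assumes Q: "left_module H Q" and Q': "left_module H Q'" and f: "f \<in> module_hom H Q Q'"
    and \<phi>: "\<phi> \<in> forms Q n"
    and van: "\<And>p xs. p \<in> carrier Q \<Longrightarrow> f p = \<zero>\<^bsub>Q'\<^esub> \<Longrightarrow> \<phi> xs p = 0"
  shows "\<exists>\<psi>\<in>forms Q' n. pull Q f \<psi> = \<phi>"
proof -
  interpret Q: left_module H Q by fact
  interpret Q': left_module H Q' by fact
  interpret C': complex_space Q' "\<lambda>c p. sca c \<odot>\<^bsub>Q'\<^esub> p" by (rule module_complex_space[OF Q'])
  interpret A: form_space scl "VG Q'" vsc by (rule form_space_VG[OF Q'])
  note fD = module_homD[OF f]
  note Gphi = forms_VG[OF Q \<phi>]
  have f0: "f \<zero>\<^bsub>Q\<^esub> = \<zero>\<^bsub>Q'\<^esub>" using module_hom_zero[OF Q Q' f] .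
  have sub: "C'.vsubspace (f ` carrier Q)"
    unfolding C'.vsubspace_def
  proof (intro conjI ballI allI)
    show "f ` carrier Q \<subseteq> carrier Q'" using fD(1) by auto
    show "\<zero>\<^bsub>Q'\<^esub> \<in> f ` carrier Q" using f0 by (intro image_eqI[of _ f "\<zero>\<^bsub>Q\<^esub>"]) simp_all
    fix u v assume "u \<in> f ` carrier Q" "v \<in> f ` carrier Q"
    then obtain p q where "p \<in> carrier Q" "q \<in> carrier Q" "u = f p" "v = f q" by (elim imageE)
    then show "u \<oplus>\<^bsub>Q'\<^esub> v \<in> f ` carrier Q" using fD(2)[of p q] Q.M.a_closed[of p q] by (metis image_eqI)
  next
    fix c u assume "u \<in> f ` carrier Q"
    then obtain p where "p \<in> carrier Q" "u = f p" by (elim imageE)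
    then show "sca c \<odot>\<^bsub>Q'\<^esub> u \<in> f ` carrier Q"
      using fD(3)[of "sca c" p] Q.smult_closed[of "sca c" p] sca_closed by (metis image_eqI)
  qed
  obtain \<pi> where \<pi>: "\<And>p. p \<in> carrier Q' \<Longrightarrow> \<pi> p \<in> f ` carrier Q" "\<And>u. u \<in> f ` carrier Q \<Longrightarrow> \<pi> u = u"
    "\<And>p q. p \<in> carrier Q' \<Longrightarrow> q \<in> carrier Q' \<Longrightarrow> \<pi> (p \<oplus>\<^bsub>Q'\<^esub> q) = \<pi> p \<oplus>\<^bsub>Q'\<^esub> \<pi> q"
    "\<And>c p. p \<in> carrier Q' \<Longrightarrow> \<pi> (sca c \<odot>\<^bsub>Q'\<^esub> p) = sca c \<odot>\<^bsub>Q'\<^esub> \<pi> p"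
  proof (rule C'.projection_exists[OF sub], goal_cases)
    case (1 \<pi>)
    show ?case by (rule 1(1)[of \<pi>]) (fact 1)+
  qed
  \<comment> \<open>A lift of the projected vector, chosen without any linearity. Linearity returns
    after composition with a map in \<open>K\<close>: such maps vanish on the kernel of
    \<open>f\<close> and do not see which lift was taken.\<close>
  define s where "s q = (SOME p. p \<in> carrier Q \<and> f p = \<pi> q)" for q
  have s: "s q \<in> carrier Q \<and> f (s q) = \<pi> q" if q: "q \<in> carrier Q'" for q
  proof -
    obtain p where "\<pi> q = f p" "p \<in> carrier Q" using \<pi>(1)[OF q] by (elim imageE)
    then show ?thesis unfolding s_def by (metis (mono_tags, lifting) someI_ex)
  qed
  define K where "K = {v \<in> VG Q. \<forall>p\<in>carrier Q. f p = \<zero>\<^bsub>Q'\<^esub> \<longrightarrow> v p = 0}"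
  have act_m1: "act (sca (- 1)) u = - u" if "act \<one> u = u" for u
    using that by (simp add: sca_minus act_lminus sca_one)
  have K_eq: "v p = v p'" if v: "v \<in> K" and pp: "p \<in> carrier Q" "p' \<in> carrier Q" "f p = f p'" for v p p'
  proof -
    have q: "sca (- 1) \<odot>\<^bsub>Q\<^esub> p' \<in> carrier Q" using pp Q.smult_closed by blast
    have "f (p \<oplus>\<^bsub>Q\<^esub> sca (- 1) \<odot>\<^bsub>Q\<^esub> p') = f p' \<oplus>\<^bsub>Q'\<^esub> sca (- 1) \<odot>\<^bsub>Q'\<^esub> f p'"
      using pp q by (simp add: fD)
    also have "\<dots> = \<zero>\<^bsub>Q'\<^esub>" using C'.m_minus fD(1)[OF pp(2)] by (simp add: Q'.r_neg)
    finally have "v (p \<oplus>\<^bsub>Q\<^esub> sca (- 1) \<odot>\<^bsub>Q\<^esub> p') = 0" using v pp q by (simp add: K_def)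
    then have "v p + act (sca (- 1)) (v p') = 0" using v pp q by (simp add: K_def VG_def)
    then show ?thesis using v act_m1[of "v p'"] by (simp add: K_def VG_def)
  qed
  define g where "g v = (\<lambda>q. if q \<in> carrier Q' then v (s q) else 0)" for v :: "'b \<Rightarrow> 'n"
  have gG: "g v \<in> VG Q'" if v: "v \<in> K" for v
  proof -
    have "v (s (p \<oplus>\<^bsub>Q'\<^esub> q)) = v (s p) + v (s q)" if pq: "p \<in> carrier Q'" "q \<in> carrier Q'" for p q
    proof -
      have "v (s (p \<oplus>\<^bsub>Q'\<^esub> q)) = v (s p \<oplus>\<^bsub>Q\<^esub> s q)"
        using K_eq[OF v] s[of "p \<oplus>\<^bsub>Q'\<^esub> q"] s[of p] s[of q] pq by (simp add: fD \<pi>)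
      then show ?thesis using v s[of p] s[of q] pq by (simp add: K_def VG_def)
    qed
    moreover have "v (s (sca c \<odot>\<^bsub>Q'\<^esub> p)) = act (sca c) (v (s p))" if p: "p \<in> carrier Q'" for c p
    proof -
      have "v (s (sca c \<odot>\<^bsub>Q'\<^esub> p)) = v (sca c \<odot>\<^bsub>Q\<^esub> s p)"
        using K_eq[OF v] s[of "sca c \<odot>\<^bsub>Q'\<^esub> p"] s[of p] p by (simp add: fD \<pi> Q.smult_closed Q'.smult_closed)
      then show ?thesis using v s[of p] p by (simp add: K_def VG_def)
    qed
    ultimately show ?thesis
      using v by (auto simp: VG_def g_def K_def Q'.smult_closed act_zero)
  qed
  have phiK: "\<phi> xs \<in> K" for xs using Gphi van by (simp add: K_def)
  define \<psi>0 where "\<psi>0 = (\<lambda>xs. g (\<phi> xs))"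
  have alt0: "A.alt n \<psi>0"
    unfolding \<psi>0_def
  proof (rule alt_map[OF form_space_VG[OF Q] form_space_VG[OF Q'], of K])
    show "form_space.alt scl (VG Q) vsc n \<phi>" using \<phi> by (simp add: forms_def)
    show "g u \<in> VG Q'" if "u \<in> K" for u using gG[OF that] .
    show "\<phi> xs \<in> K" for xs by (rule phiK)
  qed (auto simp: g_def vsc_def act_zero)
  have \<psi>0: "\<psi>0 xs (f p) = \<phi> xs p" if "p \<in> carrier Q" for xs p
    using K_eq[OF phiK, of "s (f p)" p xs] s[of "f p"] \<pi>(2)[of "f p"] that fD(1)[of p] by (simp add: \<psi>0_def g_def)
  \<comment> \<open>The normalisation of the average. Dividing by the order of the group means
    acting by \<open>sca N\<close>, so the factor is built into the algebra elements
    \<open>a w\<close>.\<close>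
  define N where "N = (1 / of_nat (card W) :: complex)"
  define a where "a w = sca N \<otimes> T (inv_into UNIV w)" for w
  have a: "a w \<in> carrier H" if "w \<in> W" for w using that inv_W T_closed by (simp add: a_def)
  define Av where "Av w v = (\<lambda>q. if q \<in> carrier Q' then act (a w) (v (T w \<odot>\<^bsub>Q'\<^esub> q)) else 0)"
    for w and v :: "'c \<Rightarrow> 'n"
  define \<psi> where "\<psi> = (\<lambda>xs. \<Sum>w\<in>W. Av w (\<psi>0 (map (av w) xs)))"
  note Tc = Q'.smult_closed[OF T_closed] Q'.smult_closed[OF sca_closed]
  have Tsca: "T w \<odot>\<^bsub>Q'\<^esub> (sca c \<odot>\<^bsub>Q'\<^esub> q) = sca c \<odot>\<^bsub>Q'\<^esub> (T w \<odot>\<^bsub>Q'\<^esub> q)" if "w \<in> W" "q \<in> carrier Q'" for w c q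
    using that sca_central[OF T_closed, of w c] by (simp add: Q'.smult_assoc[symmetric] T_closed)
  have "A.alt n (\<lambda>xs. Av w (\<psi>0 (map (av w) xs)))" if w: "w \<in> W" for w
  proof (rule alt_map[OF form_space_VG[OF Q'] form_space_VG[OF Q'],
        where K = "VG Q'" and f = "Av w" and \<phi> = "\<lambda>xs. \<psi>0 (map (av w) xs)"])
    show "A.alt n (\<lambda>xs. \<psi>0 (map (av w) xs))" using A.alt_comp_linear[OF av_add[OF w] av_scl[OF w] alt0] .
    then show "\<psi>0 (map (av w) xs) \<in> VG Q'" for xs using A.alt_G by blast
    show "Av w u \<in> VG Q'" if "u \<in> VG Q'" for u
      using that w a[OF w] by (auto simp: VG_def Av_def Tc Tsca Q'.smult_r_distr T_closed act_add act_zero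
          act_sca_comm[OF a[OF w], symmetric] act_one_act)
    show "Av w (vsc c u) = vsc c (Av w u)" for c u
      using act_sca_comm[OF a[OF w]] by (auto simp: Av_def vsc_def act_zero)
  qed (auto simp: Av_def act_add act_zero a[OF w])
  then have alt\<psi>: "A.alt n \<psi>" unfolding \<psi>_def by (rule A.alt_sum)
  have \<psi>q: "\<psi> xs q = (\<Sum>w\<in>W. act (a w) (\<psi>0 (map (av w) xs) (T w \<odot>\<^bsub>Q'\<^esub> q)))" if "q \<in> carrier Q'" for xs q
    using that by (simp add: \<psi>_def sum_fun_app Av_def)
  have eq: "equi Q' \<psi>"
    unfolding equi_def
  proof (intro ballI allI)
    fix u xs q assume u: "u \<in> W" and q: "q \<in> carrier Q'"
    have "act (a w) (\<psi>0 (map (av w) (map (av u) xs)) (T w \<odot>\<^bsub>Q'\<^esub> (T u \<odot>\<^bsub>Q'\<^esub> q)))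
      = act (T u) (act (a (w \<circ> u)) (\<psi>0 (map (av (w \<circ> u)) xs) (T (w \<circ> u) \<odot>\<^bsub>Q'\<^esub> q)))" if w: "w \<in> W" for w
    proof -
      have wu: "w \<circ> u \<in> W" "inv_into UNIV (w \<circ> u) \<in> W" using W_comp[OF w u] inv_W by auto
      have "T (inv_into UNIV w) = T u \<otimes> T (inv_into UNIV (w \<circ> u))"
        using T_comp[OF u wu(2)] inv_W_comp[OF u w] by simp
      then have "a w = T u \<otimes> a (w \<circ> u)"
        using sca_central[OF T_closed[OF u], of N] T_closed u wu by (simp add: a_def m_assoc[symmetric])
      moreover have "av (w \<circ> u) = av w \<circ> av u" using av_comp[OF w u] by auto
      moreover have "T (w \<circ> u) \<odot>\<^bsub>Q'\<^esub> q = T w \<odot>\<^bsub>Q'\<^esub> (T u \<odot>\<^bsub>Q'\<^esub> q)"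
        using T_comp[OF w u] q T_closed w u by (simp add: Q'.smult_assoc)
      ultimately show ?thesis using a[OF wu(1)] T_closed[OF u] by (simp add: act_mult)
    qed
    then have "\<psi> (map (av u) xs) (T u \<odot>\<^bsub>Q'\<^esub> q)
      = (\<Sum>w\<in>W. act (T u) (act (a (w \<circ> u)) (\<psi>0 (map (av (w \<circ> u)) xs) (T (w \<circ> u) \<odot>\<^bsub>Q'\<^esub> q))))"
      using \<psi>q[of "T u \<odot>\<^bsub>Q'\<^esub> q" "map (av u) xs"] Tc(1)[OF u q] by simp
    also have "\<dots> = (\<Sum>w\<in>W. act (T u) (act (a w) (\<psi>0 (map (av w) xs) (T w \<odot>\<^bsub>Q'\<^esub> q))))"
      by (rule sum.reindex_bij_betw[OF bij_betw_W_right[OF u]])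
    also have "\<dots> = act (T u) (\<psi> xs q)" by (simp add: \<psi>q[OF q] act_sum[OF T_closed[OF u]])
    finally show "\<psi> (map (av u) xs) (T u \<odot>\<^bsub>Q'\<^esub> q) = act (T u) (\<psi> xs q)" .
  qed
  have "pull Q f \<psi> = \<phi>"
  proof (intro ext)
    fix xs p
    show "pull Q f \<psi> xs p = \<phi> xs p"
    proof (cases "p \<in> carrier Q")
      case True
      \<comment> \<open>On the image of \<open>f\<close> the unaveraged extension agrees with
        \<open>\<phi>\<close>, which is equivariant; there all summands are equal and averaging
        changes nothing.\<close>
      have "act (a w) (\<psi>0 (map (av w) xs) (T w \<odot>\<^bsub>Q'\<^esub> f p)) = act (sca N) (\<phi> xs p)" if w: "w \<in> W" for w
      proof -
        have "\<psi>0 (map (av w) xs) (T w \<odot>\<^bsub>Q'\<^esub> f p) = \<phi> (map (av w) xs) (T w \<odot>\<^bsub>Q\<^esub> p)"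
          using \<psi>0[of "T w \<odot>\<^bsub>Q\<^esub> p"] fD(3)[OF T_closed[OF w] True] Q.smult_closed[OF T_closed[OF w] True] by simp
        also have "\<dots> = act (T w) (\<phi> xs p)" using \<phi> w True by (simp add: forms_def equi_def)
        finally have "act (a w) (\<psi>0 (map (av w) xs) (T w \<odot>\<^bsub>Q'\<^esub> f p)) = act (a w \<otimes> T w) (\<phi> xs p)"
          using a[OF w] T_closed[OF w] by (simp add: act_mult)
        also have "a w \<otimes> T w = sca N" using T_inv(2)[OF w] T_closed[OF w] T_closed[OF inv_W(1)[OF w]]
          by (simp add: a_def m_assoc)
        finally show ?thesis .
      qed
      then have "\<psi> xs (f p) = act (sca (of_nat (card W) * N)) (\<phi> xs p)"
        using \<psi>q[OF fD(1)[OF True]] sum_act_sca[of N "\<phi> xs p" W] by simp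
      moreover have "of_nat (card W) * N = 1" using W_fin W_id by (auto simp: N_def)
      ultimately show ?thesis using True Gphi[of xs] by (simp add: pull_def sca_one VG_def)
    next
      case False
      then show ?thesis using VG_outside[OF Gphi] by (simp add: pull_def)
    qed
  qed
  moreover have "\<psi> \<in> forms Q' n" using alt\<psi> eq by (simp add: forms_def)
  ultimately show ?thesis by blast
qed

text \<open>The resolution together with its augmentation: \<open>Q 0\<close> is the resolved module
  and \<open>dl 0\<close> the augmentation, so exactness at the bottom is surjectivity, and exact
  Koszul columns are demanded of the terms \<open>Q (Suc n)\<close> only. The term of degree n of
  the resolution sits at index n + 1.\<close>

definition acyclic_resolution :: "(nat \<Rightarrow> ('h, 'm) module) \<Rightarrow> (nat \<Rightarrow> 'm \<Rightarrow> 'm) \<Rightarrow> bool" where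
  "acyclic_resolution Q dl \<longleftrightarrow> (\<forall>n. left_module H (Q n)) \<and> (\<forall>n. dl n \<in> module_hom H (Q (Suc n)) (Q n)) \<and>
     dl 0 ` carrier (Q (Suc 0)) = carrier (Q 0) \<and>
     (\<forall>n. dl (Suc n) ` carrier (Q (Suc (Suc n))) = {x \<in> carrier (Q (Suc n)). dl n x = \<zero>\<^bsub>Q n\<^esub>}) \<and>
     (\<forall>n. acyclic_module (Q (Suc n)))"

section \<open>The diagram chase in the double complex\<close>

lemma forms_above_dim:
  assumes P: "left_module H P" and \<phi>: "\<phi> \<in> forms P n" and n: "card B < n"
  shows "\<phi> = (\<lambda>_. 0)"
  using form_space.alt_above_dim[OF form_space_VG[OF P] B_fin B_span _ n] \<phi> by (simp add: forms_def)

text \<open>Exactness of the rows: a form killed by the next pullback vanishes on the image of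
  \<open>dl (Suc n)\<close>, which is the kernel of \<open>dl n\<close>, so it factors through
  \<open>dl n\<close> and extends to \<open>Q n\<close>.\<close>

lemma descend:
  assumes R: "acyclic_resolution Q dl" and \<phi>: "\<phi> \<in> forms (Q (Suc n)) j"
    and van: "pull (Q (Suc (Suc n))) (dl (Suc n)) \<phi> = (\<lambda>_. 0)"
  shows "\<exists>\<psi>\<in>forms (Q n) j. pull (Q (Suc n)) (dl n) \<psi> = \<phi>"
proof (rule forms_extend)
  show "left_module H (Q (Suc n))" "left_module H (Q n)" "dl n \<in> module_hom H (Q (Suc n)) (Q n)"
    using R by (auto simp: acyclic_resolution_def)
  show "\<phi> xs p = 0" if p: "p \<in> carrier (Q (Suc n))" "dl n p = \<zero>\<^bsub>Q n\<^esub>" for p xs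
  proof -
    have "p \<in> dl (Suc n) ` carrier (Q (Suc (Suc n)))" using R p by (auto simp: acyclic_resolution_def)
    then obtain q where "q \<in> carrier (Q (Suc (Suc n)))" "p = dl (Suc n) q" by blast
    then show ?thesis using fun_cong[OF fun_cong[OF van, of xs], of q] by (simp add: pull_def)
  qed
qed (fact \<phi>)

lemma pull_pull_zero:
  assumes R: "acyclic_resolution Q dl" and \<phi>: "\<phi> \<in> forms (Q n) j"
  shows "pull (Q (Suc (Suc n))) (dl (Suc n)) (pull (Q (Suc n)) (dl n) \<phi>) = (\<lambda>_. 0)"
proof (intro ext)
  fix xs p
  have lm: "left_module H (Q n)" using R by (auto simp: acyclic_resolution_def)
  interpret Qn: left_module H "Q n" by fact
  have "\<phi> xs (p \<oplus>\<^bsub>Q n\<^esub> q) = \<phi> xs p + \<phi> xs q" if "p \<in> carrier (Q n)" "q \<in> carrier (Q n)" for p q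
    using forms_VG[OF lm \<phi>, of xs] that by (simp add: VG_def)
  from this[of "\<zero>\<^bsub>Q n\<^esub>" "\<zero>\<^bsub>Q n\<^esub>"] have "\<phi> xs \<zero>\<^bsub>Q n\<^esub> + \<phi> xs \<zero>\<^bsub>Q n\<^esub> = \<phi> xs \<zero>\<^bsub>Q n\<^esub>"
    by simp
  moreover have "dl (Suc n) p \<in> {x \<in> carrier (Q (Suc n)). dl n x = \<zero>\<^bsub>Q n\<^esub>}" if "p \<in> carrier (Q (Suc (Suc n)))"
  proof -
    have "dl (Suc n) ` carrier (Q (Suc (Suc n))) = {x \<in> carrier (Q (Suc n)). dl n x = \<zero>\<^bsub>Q n\<^esub>}"
      using R by (simp add: acyclic_resolution_def)
    then show ?thesis using that by blast
  qed
  ultimately show "pull (Q (Suc (Suc n))) (dl (Suc n)) (pull (Q (Suc n)) (dl n) \<phi>) xs p = (\<lambda>_. 0) xs p"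
    by (simp add: pull_def)
qed

lemma pull_diff: "pull P f (\<lambda>xs. \<phi> xs - \<psi> xs) = (\<lambda>xs. pull P f \<phi> xs - pull P f \<psi> xs)"
  by (auto simp: pull_def fun_eq_iff)

lemma pull_kosz_inj:
  assumes "pull P f \<phi> = pull P f \<psi>" "p \<in> carrier P"
  shows "\<phi> xs (f p) = \<psi> xs (f p)"
  using fun_cong[OF fun_cong[OF assms(1), of xs], of p] assms(2) by (simp add: pull_def)

text \<open>A zigzag along constant n + j. A lift of the form to \<open>Q n\<close> need not be
  closed, but its differential is killed by the pullback and has higher form degree; by induction it
  descends to a closed form on the term below, where it has a primitive. Subtracting the pulled back
  primitive makes the lift closed and does not change its pullback. The zigzag ends when the form
  degree reaches the dimension.\<close>

lemma chase_upper:
  assumes R: "acyclic_resolution Q dl"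
  shows "1 \<le> n \<Longrightarrow> card B < n + j \<Longrightarrow> \<phi> \<in> forms (Q (Suc n)) j \<Longrightarrow> closed_form (Q (Suc n)) \<phi> \<Longrightarrow>
    pull (Q (Suc (Suc n))) (dl (Suc n)) \<phi> = (\<lambda>_. 0) \<Longrightarrow>
    \<exists>\<psi>\<in>forms (Q n) j. closed_form (Q n) \<psi> \<and> pull (Q (Suc n)) (dl n) \<psi> = \<phi>"
proof (induction "card B - j" arbitrary: n j \<phi> rule: less_induct)
  case less
  have lm: "left_module H (Q i)" and dl: "dl i \<in> module_hom H (Q (Suc i)) (Q i)" for i
    using R by (auto simp: acyclic_resolution_def)
  obtain b where b: "b \<in> forms (Q n) j" "pull (Q (Suc n)) (dl n) b = \<phi>"
    using descend[OF R less.prems(3,5)] by blast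
  have kb: "kosz (Q n) b \<in> forms (Q n) (Suc j)" using forms_kosz[OF lm b(1)] .
  show ?case
  proof (cases "card B \<le> j")
    case True
    then have "kosz (Q n) b = (\<lambda>_. 0)" using forms_above_dim[OF lm kb] by simp
    then show ?thesis using b by (auto simp: closed_form_def fun_eq_iff)
  next
    case False
    \<comment> \<open>The bound on n + j enters here: as long as the form degree is below the
      dimension, the term below still belongs to the resolution and is not the resolved module,
      whose column need not be exact.\<close>
    then have "2 \<le> n" using less.prems(2) by linarith
    then obtain k where k: "n = Suc k" "1 \<le> k" by (cases n) auto
    have van: "pull (Q (Suc n)) (dl n) (kosz (Q n) b) = (\<lambda>_. 0)"
      using kosz_pull[OF lm lm dl b(1)] b(2) less.prems(4) by (simp add: closed_form_def)
    have "\<exists>\<psi>\<in>forms (Q k) (Suc j). closed_form (Q k) \<psi> \<and> pull (Q (Suc k)) (dl k) \<psi> = kosz (Q (Suc k)) b"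
    proof (rule less.hyps)
      show "card B - Suc j < card B - j" "1 \<le> k" "card B < k + Suc j" using False k less.prems(2) by simp_all
      show "kosz (Q (Suc k)) b \<in> forms (Q (Suc k)) (Suc j)" "closed_form (Q (Suc k)) (kosz (Q (Suc k)) b)"
        "pull (Q (Suc (Suc k))) (dl (Suc k)) (kosz (Q (Suc k)) b) = (\<lambda>_. 0)"
        using kb closed_kosz[OF lm b(1)] van k(1) by simp_all
    qed
    then obtain b' where b': "b' \<in> forms (Q k) (Suc j)" "closed_form (Q k) b'" "pull (Q n) (dl k) b' = kosz (Q n) b"
      using k(1) by blast
    have "acyclic_module (Q k)" using R k by (cases k) (auto simp: acyclic_resolution_def)
    then obtain a where a: "a \<in> forms (Q k) j" "kosz (Q k) a = b'" using b' by (auto simp: acyclic_module_def)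
    let ?a = "pull (Q n) (dl k) a"
    have pa: "?a \<in> forms (Q n) j" using pull_forms[OF lm lm dl a(1)] k by simp
    have "kosz (Q n) ?a = kosz (Q n) b" using kosz_pull[OF lm lm dl a(1)] a(2) b'(3) k by simp
    then have "closed_form (Q n) (\<lambda>xs. b xs - ?a xs)"
      using kosz_diff[OF lm b(1) pa] fun_cong[OF \<open>kosz (Q n) ?a = kosz (Q n) b\<close>] by (simp add: closed_form_def)
    moreover have "pull (Q (Suc n)) (dl n) (\<lambda>xs. b xs - ?a xs) = \<phi>"
      using pull_diff[of "Q (Suc n)" "dl n" b ?a] b(2) pull_pull_zero[OF R a(1)] k(1) by simp
    ultimately show ?thesis using forms_diff[OF lm b(1) pa] by blast
  qed
qed

text \<open>The zigzag in the opposite direction: the form has a primitive on its own term. The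
  pullback of the primitive is closed, so by the assumption in form degree j it comes from a closed
  form. Subtracting this form from the primitive keeps the differential and makes the primitive
  descend to \<open>Q n\<close>.\<close>

lemma chase_step:
  assumes R: "acyclic_resolution Q dl"
    and \<phi>: "\<phi> \<in> forms (Q (Suc n)) (Suc j)" "closed_form (Q (Suc n)) \<phi>"
      "pull (Q (Suc (Suc n))) (dl (Suc n)) \<phi> = (\<lambda>_. 0)"
    and IH: "\<And>\<phi>. \<phi> \<in> forms (Q (Suc (Suc n))) j \<Longrightarrow> closed_form (Q (Suc (Suc n))) \<phi> \<Longrightarrow>
      pull (Q (Suc (Suc (Suc n)))) (dl (Suc (Suc n))) \<phi> = (\<lambda>_. 0) \<Longrightarrow>
      \<exists>\<psi>\<in>forms (Q (Suc n)) j. closed_form (Q (Suc n)) \<psi> \<and> pull (Q (Suc (Suc n))) (dl (Suc n)) \<psi> = \<phi>"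
  shows "\<exists>\<psi>\<in>forms (Q n) j. pull (Q (Suc n)) (dl n) (kosz (Q n) \<psi>) = \<phi>"
proof -
  have lm: "left_module H (Q i)" and dl: "dl i \<in> module_hom H (Q (Suc i)) (Q i)" for i
    using R by (auto simp: acyclic_resolution_def)
  have "acyclic_module (Q (Suc n))" using R by (auto simp: acyclic_resolution_def)
  then obtain a where a: "a \<in> forms (Q (Suc n)) j" "kosz (Q (Suc n)) a = \<phi>" using \<phi> by (auto simp: acyclic_module_def)
  let ?a = "pull (Q (Suc (Suc n))) (dl (Suc n)) a"
  have "closed_form (Q (Suc (Suc n))) ?a"
    using fun_cong[OF kosz_pull[OF lm lm dl a(1)]] a(2) \<phi>(3) by (simp add: closed_form_def)
  then obtain \<psi> where \<psi>: "\<psi> \<in> forms (Q (Suc n)) j" "closed_form (Q (Suc n)) \<psi>"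
      "pull (Q (Suc (Suc n))) (dl (Suc n)) \<psi> = ?a"
    using IH[OF pull_forms[OF lm lm dl a(1)] _ pull_pull_zero[OF R a(1)]] by blast
  have "pull (Q (Suc (Suc n))) (dl (Suc n)) (\<lambda>xs. a xs - \<psi> xs) = (\<lambda>_. 0)"
    using \<psi>(3) by (simp add: pull_diff)
  then obtain a' where a': "a' \<in> forms (Q n) j" "pull (Q (Suc n)) (dl n) a' = (\<lambda>xs. a xs - \<psi> xs)"
    using descend[OF R forms_diff[OF lm a(1) \<psi>(1)]] by blast
  have "pull (Q (Suc n)) (dl n) (kosz (Q n) a') = \<phi>"
    using kosz_pull[OF lm lm dl a'(1)] a'(2) kosz_diff[OF lm a(1) \<psi>(1)] fun_cong[OF a(2)] \<psi>(2)
    by (simp add: closed_form_def)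
  then show ?thesis using a'(1) by blast
qed

text \<open>The base is the vanishing of Ext in degree d, expressed by closed 0-forms; every round
  raises the form degree by one and lowers the index by one. The conclusion provides a Koszul
  differential, which is in particular closed and so feeds the next round; at index 0 it is what
  contradicts the choice of a form that is not a differential.\<close>

lemma chase_lower:
  assumes R: "acyclic_resolution Q dl"
    and base: "\<And>\<phi>. \<phi> \<in> forms (Q (Suc d)) 0 \<Longrightarrow> closed_form (Q (Suc d)) \<phi> \<Longrightarrow>
      pull (Q (Suc (Suc d))) (dl (Suc d)) \<phi> = (\<lambda>_. 0) \<Longrightarrow>
      \<exists>\<psi>\<in>forms (Q d) 0. closed_form (Q d) \<psi> \<and> pull (Q (Suc d)) (dl d) \<psi> = \<phi>"
  shows "n + Suc j = d \<Longrightarrow> \<phi> \<in> forms (Q (Suc n)) (Suc j) \<Longrightarrow> closed_form (Q (Suc n)) \<phi> \<Longrightarrow>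
    pull (Q (Suc (Suc n))) (dl (Suc n)) \<phi> = (\<lambda>_. 0) \<Longrightarrow>
    \<exists>\<psi>\<in>forms (Q n) j. pull (Q (Suc n)) (dl n) (kosz (Q n) \<psi>) = \<phi>"
proof (induction j arbitrary: n \<phi>)
  case (0 n \<phi>)
  have *: "\<exists>\<psi>\<in>forms (Q (Suc n)) 0. closed_form (Q (Suc n)) \<psi> \<and> pull (Q (Suc (Suc n))) (dl (Suc n)) \<psi> = \<phi>"
    if "\<phi> \<in> forms (Q (Suc (Suc n))) 0" "closed_form (Q (Suc (Suc n))) \<phi>"
      "pull (Q (Suc (Suc (Suc n)))) (dl (Suc (Suc n))) \<phi> = (\<lambda>_. 0)" for \<phi>
    using base 0(1) that by auto
  show ?case by (rule chase_step[OF R 0(2-4) *])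
next
  case (Suc j)
  have *: "\<exists>\<psi>\<in>forms (Q (Suc n)) (Suc j). closed_form (Q (Suc n)) \<psi> \<and> pull (Q (Suc (Suc n))) (dl (Suc n)) \<psi> = \<phi>"
    if \<phi>: "\<phi> \<in> forms (Q (Suc (Suc n))) (Suc j)" "closed_form (Q (Suc (Suc n))) \<phi>"
      "pull (Q (Suc (Suc (Suc n)))) (dl (Suc (Suc n))) \<phi> = (\<lambda>_. 0)" for \<phi>
  proof -
    have lm: "left_module H (Q (Suc n))" using R by (auto simp: acyclic_resolution_def)
    obtain \<psi> where "\<psi> \<in> forms (Q (Suc n)) j" "pull (Q (Suc (Suc n))) (dl (Suc n)) (kosz (Q (Suc n)) \<psi>) = \<phi>"
      using Suc.IH[OF _ \<phi>] Suc.prems(1) by auto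
    then show ?thesis using forms_kosz[OF lm] closed_kosz[OF lm] by blast
  qed
  show ?case by (rule chase_step[OF R Suc.prems(2-4) *])
qed

end

section \<open>Free modules\<close>

definition free_module :: "('h, 'x) ring_scheme \<Rightarrow> 'i set \<Rightarrow> ('h, 'i \<Rightarrow> 'h) module" where
  "free_module A I = \<lparr>carrier = {f. (\<forall>i. f i \<in> carrier A) \<and> (\<forall>i. i \<notin> I \<longrightarrow> f i = \<zero>\<^bsub>A\<^esub>) \<and> finite {i. f i \<noteq> \<zero>\<^bsub>A\<^esub>}},
     monoid.mult = undefined, monoid.one = undefined, ring.zero = (\<lambda>_. \<zero>\<^bsub>A\<^esub>),
     ring.add = (\<lambda>f g i. f i \<oplus>\<^bsub>A\<^esub> g i), module.smult = (\<lambda>a f i. a \<otimes>\<^bsub>A\<^esub> f i)\<rparr>"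

definition fgen :: "('h, 'x) ring_scheme \<Rightarrow> 'i \<Rightarrow> 'h \<Rightarrow> 'i \<Rightarrow> 'h" where
  "fgen A i h = (\<lambda>i'. if i' = i then h else \<zero>\<^bsub>A\<^esub>)"

context ring
begin

lemma free_module_simps [simp]:
  "f \<oplus>\<^bsub>free_module R I\<^esub> g = (\<lambda>i. f i \<oplus> g i)" "\<zero>\<^bsub>free_module R I\<^esub> = (\<lambda>_. \<zero>)"
  "a \<odot>\<^bsub>free_module R I\<^esub> f = (\<lambda>i. a \<otimes> f i)"
  by (simp_all add: free_module_def)

lemma free_module_carrier:
  "f \<in> carrier (free_module R I) \<longleftrightarrow> (\<forall>i. f i \<in> carrier R) \<and> (\<forall>i. i \<notin> I \<longrightarrow> f i = \<zero>) \<and> finite {i. f i \<noteq> \<zero>}"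
  by (simp add: free_module_def)

lemma left_module_free: "left_module R (free_module R I)"
proof -
  let ?F = "free_module R I"
  have add: "(\<lambda>i. f i \<oplus> g i) \<in> carrier ?F" if "f \<in> carrier ?F" "g \<in> carrier ?F" for f g
  proof -
    have "{i. f i \<oplus> g i \<noteq> \<zero>} \<subseteq> {i. f i \<noteq> \<zero>} \<union> {i. g i \<noteq> \<zero>}" by auto
    then show ?thesis using that by (auto simp: free_module_carrier intro: finite_subset)
  qed
  have sm: "(\<lambda>i. a \<otimes> f i) \<in> carrier ?F" if "f \<in> carrier ?F" "a \<in> carrier R" for f a
  proof -
    have "{i. a \<otimes> f i \<noteq> \<zero>} \<subseteq> {i. f i \<noteq> \<zero>}" using that by auto
    then show ?thesis using that by (auto simp: free_module_carrier intro: finite_subset)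
  qed
  have "abelian_group ?F"
  proof (rule abelian_groupI)
    show "\<zero>\<^bsub>?F\<^esub> \<in> carrier ?F" by (simp add: free_module_carrier)
    show "\<exists>g\<in>carrier ?F. g \<oplus>\<^bsub>?F\<^esub> f = \<zero>\<^bsub>?F\<^esub>" if f: "f \<in> carrier ?F" for f
    proof
      show "(\<lambda>i. \<ominus> \<one> \<otimes> f i) \<in> carrier ?F" using sm[OF f, of "\<ominus> \<one>"] by simp
      show "(\<lambda>i. \<ominus> \<one> \<otimes> f i) \<oplus>\<^bsub>?F\<^esub> f = \<zero>\<^bsub>?F\<^esub>" using f by (simp add: free_module_carrier l_minus l_neg)
    qed
  qed (use add in \<open>auto simp: free_module_carrier a_ac\<close>)
  then show ?thesis
    by (intro left_module.intro left_module_axioms.intro ring_axioms)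
      (use sm in \<open>auto simp: free_module_carrier l_distr r_distr m_assoc\<close>)
qed

lemma fgen_carrier: "i \<in> I \<Longrightarrow> h \<in> carrier R \<Longrightarrow> fgen R i h \<in> carrier (free_module R I)"
  by (auto simp: free_module_carrier fgen_def)

lemma free_module_induct:
  assumes f: "f \<in> carrier (free_module R I)" and zero: "K (\<lambda>_. \<zero>)"
    and add: "\<And>f g. f \<in> carrier (free_module R I) \<Longrightarrow> g \<in> carrier (free_module R I) \<Longrightarrow> K f \<Longrightarrow> K g \<Longrightarrow> K (\<lambda>i. f i \<oplus> g i)"
    and gen: "\<And>i h. i \<in> I \<Longrightarrow> h \<in> carrier R \<Longrightarrow> K (fgen R i h)"
  shows "K f"
proof -
  have "finite S \<Longrightarrow> f \<in> carrier (free_module R I) \<Longrightarrow> {i. f i \<noteq> \<zero>} \<subseteq> S \<Longrightarrow> K f" for S f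
  proof (induction S arbitrary: f rule: finite_induct)
    case empty
    then have "f = (\<lambda>_. \<zero>)" by auto
    then show ?case using zero by simp
  next
    case (insert i S)
    show ?case
    proof (cases "i \<in> I")
      case True
      let ?g = "f(i := \<zero>)"
      have g: "?g \<in> carrier (free_module R I)"
      proof -
        have "{j. ?g j \<noteq> \<zero>} \<subseteq> {j. f j \<noteq> \<zero>}" by auto
        then show ?thesis using insert.prems(1) by (auto simp: free_module_carrier intro: finite_subset)
      qed
      have fi: "f i \<in> carrier R" using insert.prems(1) by (simp add: free_module_carrier)
      have Kg: "K ?g" by (rule insert.IH[OF g]) (use insert.prems(2) in auto)
      have "f = (\<lambda>j. fgen R i (f i) j \<oplus> ?g j)"
        using insert.prems(1) by (auto simp: fgen_def free_module_carrier fun_eq_iff)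
      then show ?thesis using add[OF fgen_carrier[OF True fi] g gen[OF True fi] Kg] by simp
    next
      case False
      then have "f i = \<zero>" using insert.prems(1) by (simp add: free_module_carrier)
      then have "{j. f j \<noteq> \<zero>} \<subseteq> S" using insert.prems(2) by auto
      then show ?thesis using insert by simp
    qed
  qed
  then show ?thesis using f by (auto simp: free_module_carrier)
qed

end

section \<open>Acyclicity of free modules\<close>

context pbw_rep
begin

lemma free_pbw_induct:
  assumes f: "f \<in> carrier (free_module H I)" and zero: "K (\<lambda>_. \<zero>)"
    and add: "\<And>f g. f \<in> carrier (free_module H I) \<Longrightarrow> g \<in> carrier (free_module H I) \<Longrightarrow> K f \<Longrightarrow> K g \<Longrightarrow> K (\<lambda>i. f i \<oplus> g i)"
    and gen: "\<And>i c w m. i \<in> I \<Longrightarrow> w \<in> W \<Longrightarrow> m \<in> Mon B \<Longrightarrow> K (fgen H i (sca c \<otimes> (T w \<otimes> Y m)))"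
  shows "K f"
proof (rule free_module_induct[OF f, of K])
  fix i h assume i: "i \<in> I" and h: "h \<in> carrier H"
  have "carrier H \<subseteq> {h \<in> carrier H. K (fgen H i h)}"
  proof (rule pbw_induct)
    fix h h' assume hh: "h \<in> {h \<in> carrier H. K (fgen H i h)}" "h' \<in> {h \<in> carrier H. K (fgen H i h)}"
    then have "K (\<lambda>j. fgen H i h j \<oplus> fgen H i h' j)" using add fgen_carrier[OF i] by simp
    moreover have "(\<lambda>j. fgen H i h j \<oplus> fgen H i h' j) = fgen H i (h \<oplus> h')" by (auto simp: fgen_def)
    ultimately show "h \<oplus> h' \<in> {h \<in> carrier H. K (fgen H i h)}" using hh by simp
  qed (use gen[OF i] T_closed Y_closed in auto)
  then show "K (fgen H i h)" using h by auto
qed (fact zero, fact add)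

lemma VG_add: "v \<in> VG P \<Longrightarrow> p \<in> carrier P \<Longrightarrow> q \<in> carrier P \<Longrightarrow> v (p \<oplus>\<^bsub>P\<^esub> q) = v p + v q"
  and VG_sca: "v \<in> VG P \<Longrightarrow> p \<in> carrier P \<Longrightarrow> v (sca c \<odot>\<^bsub>P\<^esub> p) = act (sca c) (v p)"
  by (simp_all add: VG_def)

text \<open>Equivariance determines a form on a free module by its values on the elements
  \<open>Y m\<close> in each copy of the algebra, and on these it imposes nothing. Such values are
  families indexed by a generator and a monomial, in other words linear maps from a free module over
  a polynomial ring. Neither the group nor the parameters occur any more.\<close>

definition MG :: "'i set \<Rightarrow> ('i \<times> ('t \<Rightarrow> nat) \<Rightarrow> 'n) set" where
  "MG I = {v. (\<forall>i m. i \<notin> I \<or> m \<notin> Mon B \<longrightarrow> v (i, m) = 0) \<and> (\<forall>a. act \<one> (v a) = v a)}"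

abbreviation "coord \<equiv> vec.representation B"

text \<open>\<open>VD\<close> in these coordinates: in the product of \<open>y x\<close> with a
  monomial, \<open>x\<close> is expanded in the basis and each term raises one exponent.\<close>

definition MD :: "'i set \<Rightarrow> 't \<Rightarrow> ('i \<times> ('t \<Rightarrow> nat) \<Rightarrow> 'n) \<Rightarrow> 'i \<times> ('t \<Rightarrow> nat) \<Rightarrow> 'n" where
  "MD I x v = (\<lambda>(i, m). if i \<in> I \<and> m \<in> Mon B
     then (\<Sum>b\<in>B. act (sca (coord x b)) (v (i, m(b := Suc (m b))))) - act (y x) (v (i, m)) else 0)"

lemma Mon_upd: "b \<in> B \<Longrightarrow> m \<in> Mon B \<Longrightarrow> m(b := k) \<in> Mon B"
  by (auto simp: Mon_def)

lemma coord_add: "coord (x + x') b = coord x b + coord x' b"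
  using vec.representation_add[of B x' x] B_indep B_span by simp

lemma coord_scl: "coord (scl c x) b = c * coord x b"
  using vec.representation_scale[of B x c] B_indep B_span by simp

lemma coord_basis: "b \<in> B \<Longrightarrow> coord b b' = (if b' = b then 1 else 0)"
  using vec.representation_basis[of B b] B_indep by auto

lemma coord_sum: "(\<Sum>b\<in>B. scl (coord x b) b) = x"
  using vec.sum_representation_eq[of B x B] B_indep B_span B_fin by simp

lemma linear_coord:
  fixes f :: "'t \<Rightarrow> 'n"
  assumes add: "\<And>x x'. f (x + x') = f x + f x'" and sc: "\<And>c x. f (scl c x) = act (sca c) (f x)"
  shows "f x = (\<Sum>b\<in>B. act (sca (coord x b)) (f b))"
proof -
  have f0: "f 0 = 0" using add[of 0 0] by simp
  have "f (\<Sum>b\<in>C. scl (coord x b) b) = (\<Sum>b\<in>C. act (sca (coord x b)) (f b))" for C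
    by (induction C rule: infinite_finite_induct) (auto simp: f0 add sc)
  from this[of B] show ?thesis using coord_sum by simp
qed

lemma form_space_MG: "form_space scl (MG I) vsc"
proof (rule form_space_unital)
  show "vsc c u \<in> MG I" if "u \<in> MG I" for u c
    using that unfolding MG_def vsc_def by (auto simp: act_zero act_one_act)
qed (auto simp: MG_def act_zero act_diff)

lemma koszul_MG:
  fixes I :: "'i set"
  shows "koszul scl (MG I) vsc (MD I)"
proof -
  interpret form_space scl "MG I" vsc by (rule form_space_MG)
  have sum_add: "(\<Sum>b\<in>B. act (sca (coord (x + x') b)) (g b)) = (\<Sum>b\<in>B. act (sca (coord x b)) (g b)) + (\<Sum>b\<in>B. act (sca (coord x' b)) (g b))" for x x' g
    by (simp add: coord_add sca_add act_ladd sum.distrib)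
  show ?thesis
  proof
    fix v :: "'i \<times> ('t \<Rightarrow> nat) \<Rightarrow> 'n" and x x' c assume v: "v \<in> MG I"
    have v1: "act \<one> (v a) = v a" for a using v unfolding MG_def by blast
    show "MD I x v \<in> MG I"
      unfolding MG_def by (auto simp: MD_def act_diff act_sum act_one_act act_zero y_closed)
    show "MD I x (vsc c v) = vsc c (MD I x v)"
      by (auto simp: MD_def vsc_def act_diff act_sum act_zero act_sca_y fun_eq_iff intro!: sum.cong act_sca_sca)
    show "MD I (x + x') v = MD I x v + MD I x' v"
      by (auto simp: MD_def sum_add y_add act_ladd y_closed fun_eq_iff)
    show "MD I (scl c x) v = vsc c (MD I x v)"
      by (auto simp: MD_def vsc_def coord_scl sca_mult y_scl act_mult act_sum act_diff act_zero y_closed fun_eq_iff)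
    have yy: "act (y x) (act (y x') u) = act (y x') (act (y x) u)" for u
      using act_mult[of "y x" "y x'" u] act_mult[of "y x'" "y x" u] y_closed by (simp add: y_comm[of x])
    show "MD I x (MD I x' v) = MD I x' (MD I x v)"
    proof
      fix a show "MD I x (MD I x' v) a = MD I x' (MD I x v) a"
      proof (cases a)
        case (Pair i m)
        show ?thesis
        proof (cases "i \<in> I \<and> m \<in> Mon B")
          case True
          let ?m = "\<lambda>b b'. (m(b := Suc (m b)))(b' := Suc ((m(b := Suc (m b))) b'))"
          have mm: "?m b b' = ?m b' b" for b b' by (auto simp: fun_eq_iff)
          have exp: "MD I x (MD I x' v) (i, m) = (\<Sum>b\<in>B. \<Sum>b'\<in>B. act (sca (coord x b)) (act (sca (coord x' b')) (v (i, ?m b b'))))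
              - (\<Sum>b\<in>B. act (sca (coord x b)) (act (y x') (v (i, m(b := Suc (m b))))))
              - ((\<Sum>b\<in>B. act (y x) (act (sca (coord x' b)) (v (i, m(b := Suc (m b)))))) - act (y x) (act (y x') (v (i, m))))"
            for x x'
            using True by (simp add: MD_def Mon_upd act_diff act_sum y_closed sum_subtractf)
          have "(\<Sum>b\<in>B. \<Sum>b'\<in>B. act (sca (coord x b)) (act (sca (coord x' b')) (v (i, ?m b b'))))
              = (\<Sum>b\<in>B. \<Sum>b'\<in>B. act (sca (coord x' b)) (act (sca (coord x b')) (v (i, ?m b b'))))"
            by (subst sum.swap) (simp only: mm act_sca_sca)
          then show ?thesis
            unfolding Pair exp by (simp add: yy act_sca_y)
        next
          case False
          then show ?thesis by (auto simp: Pair MD_def)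
        qed
      qed
    qed
  qed (auto simp: MD_def act_diff sum_subtractf y_closed fun_eq_iff)
qed

text \<open>The right inverse of \<open>MD I b\<close> solves u(m + b) - y b u(m) = v(m), starting
  from zero where the exponent of \<open>b\<close> is zero. The counter is that exponent; the
  recursion sums powers of \<open>y b\<close> applied to the values of \<open>v\<close> at smaller
  exponents.\<close>

primrec sec :: "'t \<Rightarrow> ('i \<times> ('t \<Rightarrow> nat) \<Rightarrow> 'n) \<Rightarrow> 'i \<Rightarrow> ('t \<Rightarrow> nat) \<Rightarrow> nat \<Rightarrow> 'n" where
  "sec b v i m 0 = 0"
| "sec b v i m (Suc k) = act (y b) (sec b v i m k) + v (i, m(b := k))"

definition MS :: "'i set \<Rightarrow> 't \<Rightarrow> ('i \<times> ('t \<Rightarrow> nat) \<Rightarrow> 'n) \<Rightarrow> 'i \<times> ('t \<Rightarrow> nat) \<Rightarrow> 'n" where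
  "MS I b v = (\<lambda>(i, m). if i \<in> I \<and> m \<in> Mon B then sec b v i m (m b) else 0)"

lemma sec_unital: "(\<And>a. act \<one> (v a) = v a) \<Longrightarrow> act \<one> (sec b v i m k) = sec b v i m k"
  by (induction k) (auto simp: act_zero act_add act_one_act y_closed)

lemma sec_add: "sec b (\<lambda>a. u a + v a) i m k = sec b u i m k + sec b v i m k"
  by (induction k) (auto simp: act_add y_closed)

lemma sec_vsc: "sec b (\<lambda>a. act (sca c) (v a)) i m k = act (sca c) (sec b v i m k)"
  by (induction k) (auto simp: act_zero act_add y_closed act_sca_y)

lemma sec_upd: "sec b v i (m(b := l)) k = sec b v i m k"
  by (induction k) (simp_all only: sec.simps fun_upd_upd)

lemma MD_basis:
  assumes "b \<in> B" "i \<in> I" "m \<in> Mon B" "\<And>a. act \<one> (v a) = v a"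
  shows "MD I b v (i, m) = v (i, m(b := Suc (m b))) - act (y b) (v (i, m))"
proof -
  have "act (sca (coord b b')) u = (if b' = b then act \<one> u else 0)" for b' u
    using assms(1) by (simp add: coord_basis sca_one sca_zero act_lzero)
  then show ?thesis using assms B_fin by (simp add: MD_def)
qed

text \<open>The recursion touches only the exponent of \<open>b\<close> and applies only
  \<open>y b\<close>, so it commutes with a shift of another exponent and with \<open>y b'\<close>.
  This independence of the variables is the commutation that \<open>koszul_exact\<close> asks
  for.\<close>

lemma sec_MD:
  assumes "b \<in> B" "b' \<in> B" "b \<noteq> b'" "i \<in> I" "m \<in> Mon B" and v: "\<And>a. act \<one> (v a) = v a"
  shows "sec b (MD I b' v) i m k = sec b v i (m(b' := Suc (m b'))) k - act (y b') (sec b v i m k)"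
proof (induction k)
  case 0
  show ?case by (simp add: act_zero y_closed)
next
  case (Suc k)
  have yy: "act (y b) (act (y b') u) = act (y b') (act (y b) u)" for u
    using act_mult[of "y b" "y b'" u] act_mult[of "y b'" "y b" u] y_closed by (simp add: y_comm[of b])
  have "(m(b := k))(b' := Suc ((m(b := k)) b')) = (m(b' := Suc (m b')))(b := k)"
    using assms(3) by (auto simp: fun_eq_iff)
  then have M: "MD I b' v (i, m(b := k)) = v (i, (m(b' := Suc (m b')))(b := k)) - act (y b') (v (i, m(b := k)))"
    using MD_basis[OF assms(2,4) Mon_upd[OF assms(1,5), of k] v] by (simp only:)
  have "p - q + (r - s) = p + r - (q + s)" for p q r s :: 'n by simp
  then show ?case
    by (simp only: sec.simps Suc M act_diff[OF y_closed] act_add[OF y_closed] yy)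
qed

lemma MG_exact:
  fixes I :: "'i set"
  assumes "form_space.alt scl (MG I) vsc (Suc n) \<phi>" "\<And>xs. kd (MD I) xs \<phi> = 0"
  shows "\<exists>\<psi>. form_space.alt scl (MG I) vsc n \<psi> \<and> (\<forall>xs. kd (MD I) xs \<psi> = \<phi> xs)"
proof (rule koszul.koszul_exact[OF koszul_MG B_fin B_span _ _ _ _ _ assms, of "MS I"])
  fix b and v :: "'i \<times> ('t \<Rightarrow> nat) \<Rightarrow> 'n" assume b: "b \<in> B" and v: "v \<in> MG I"
  have v1: "act \<one> (v a) = v a" for a using v unfolding MG_def by blast
  show "MS I b v \<in> MG I" by (auto simp: MG_def MS_def sec_unital[OF v1] act_zero)
  show "MS I b (vsc c v) = vsc c (MS I b v)" for c
    by (auto simp: MS_def vsc_def sec_vsc act_zero fun_eq_iff)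
  show "MS I b (u + v) = MS I b u + MS I b v" for u by (auto simp: MS_def plus_fun_def sec_add fun_eq_iff)
  have S1: "act \<one> (MS I b v a) = MS I b v a" for a by (auto simp: MS_def sec_unital[OF v1] act_zero split: prod.split)
  show "MD I b (MS I b v) = v"
  proof
    fix a show "MD I b (MS I b v) a = v a"
    proof (cases a)
      case (Pair i m)
      show ?thesis
      proof (cases "i \<in> I \<and> m \<in> Mon B")
        case True
        then show ?thesis
          using MD_basis[where v = "MS I b v" and i = i and I = I and m = m, OF b _ _ S1] b by (simp add: Pair MS_def Mon_upd sec_upd)
      next
        case False
        then show ?thesis using v by (auto simp: Pair MD_def MG_def)
      qed
    qed
  qed
  show "MD I b' (MS I b v) = MS I b (MD I b' v)" if b': "b' \<in> B" "b \<noteq> b'" for b'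
  proof
    fix a show "MD I b' (MS I b v) a = MS I b (MD I b' v) a"
    proof (cases a)
      case (Pair i m)
      show ?thesis
      proof (cases "i \<in> I \<and> m \<in> Mon B")
        case True
        then show ?thesis
          using MD_basis[where v = "MS I b v" and i = i and I = I and m = m, OF b'(1) _ _ S1]
            sec_MD[where v = v and i = i and I = I and m = m and k = "m b", OF b b' _ _ v1] b b' 
          by (simp add: Pair MS_def Mon_upd)
      next
        case False
        then show ?thesis by (auto simp: Pair MD_def MS_def)
      qed
    qed
  qed
qed

definition res :: "'i set \<Rightarrow> (('i \<Rightarrow> 'h) \<Rightarrow> 'n) \<Rightarrow> 'i \<times> ('t \<Rightarrow> nat) \<Rightarrow> 'n" where
  "res I v = (\<lambda>(i, m). if i \<in> I \<and> m \<in> Mon B then v (fgen H i (Y m)) else 0)"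

lemma fgen_smult: "a \<in> carrier H \<Longrightarrow> a \<odot>\<^bsub>free_module H I\<^esub> fgen H i h = fgen H i (a \<otimes> h)"
  by (auto simp: fgen_def fun_eq_iff)

lemma fgen_add: "fgen H i h \<oplus>\<^bsub>free_module H I\<^esub> fgen H i h' = fgen H i (h \<oplus> h')"
  by (auto simp: fgen_def fun_eq_iff)

lemma res_MG: "v \<in> VG (free_module H I) \<Longrightarrow> res I v \<in> MG I"
  by (auto simp: res_def MG_def VG_def act_zero)

text \<open>The span of the monomials \<open>Y m\<close> is stable under left multiplication by
  \<open>y x\<close>, so restriction to it carries \<open>VD\<close> to \<open>MD\<close>.\<close>

lemma res_VD:
  assumes v: "v \<in> VG (free_module H I)"
  shows "res I (VD (free_module H I) x v) = MD I x (res I v)"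
proof
  fix a show "res I (VD (free_module H I) x v) a = MD I x (res I v) a"
  proof (cases a)
    case (Pair i m)
    show ?thesis
    proof (cases "i \<in> I \<and> m \<in> Mon B")
      case True
      then have i: "i \<in> I" and m: "m \<in> Mon B" by auto
      note g = fgen_carrier[OF i]
      have Ym: "Y m \<in> carrier H" using Y_closed[OF m] .
      have va: "v (fgen H i (h \<oplus> h')) = v (fgen H i h) + v (fgen H i h')" if "h \<in> carrier H" "h' \<in> carrier H" for h h'
        using VG_add[OF v g[OF that(1)] g[OF that(2)]] by (simp only: fgen_add)
      have vc: "v (fgen H i (sca c \<otimes> h)) = act (sca c) (v (fgen H i h))" if "h \<in> carrier H" for c h
        using VG_sca[OF v g[OF that], of c] by (simp only: fgen_smult[OF sca_closed])
      have "v (fgen H i (y x \<otimes> Y m)) = (\<Sum>b\<in>B. act (sca (coord x b)) (v (fgen H i (y b \<otimes> Y m))))"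
        by (rule linear_coord)
          (simp_all add: y_add y_scl l_distr y_closed Ym va vc m_assoc)
      also have "\<dots> = (\<Sum>b\<in>B. act (sca (coord x b)) (res I v (i, m(b := Suc (m b)))))"
        using i m by (intro sum.cong refl) (simp add: res_def Mon_upd Y_Suc)
      finally show ?thesis
        using i m g[OF Ym] by (simp add: Pair res_def VD_def MD_def fgen_smult[OF y_closed, unfolded free_module_simps] )
    next
      case False
      then show ?thesis by (auto simp: Pair res_def MD_def)
    qed
  qed
qed

text \<open>The part belonging to \<open>w\<close> of an inverse of \<open>res\<close>: the
  coefficient of \<open>T w\<close> times \<open>Y m\<close> in each component is read off, and this
  basis element is replaced by \<open>T w\<close> acting on the value of \<open>v\<close>. The parts
  are kept apart because an equivariant form evaluates its \<open>w\<close>-part at arguments moved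
  by the inverse of \<open>w\<close>.\<close>

definition fext_term :: "'i set \<Rightarrow> ('a \<Rightarrow> 'a) \<Rightarrow> ('i \<times> ('t \<Rightarrow> nat) \<Rightarrow> 'n) \<Rightarrow> ('i \<Rightarrow> 'h) \<Rightarrow> 'i \<times> ('t \<Rightarrow> nat) \<Rightarrow> 'n" where
  "fext_term I w v f = (\<lambda>(i, m). if i \<in> I \<and> m \<in> Mon B then act (sca (cf (f i) w m) \<otimes> T w) (v (i, m)) else 0)"

definition fext :: "'i set \<Rightarrow> ('a \<Rightarrow> 'a) \<Rightarrow> ('i \<times> ('t \<Rightarrow> nat) \<Rightarrow> 'n) \<Rightarrow> ('i \<Rightarrow> 'h) \<Rightarrow> 'n" where
  "fext I w v f = (if f \<in> carrier (free_module H I) then Sum_any (fext_term I w v f) else 0)"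

lemma fext_finite:
  assumes w: "w \<in> W" and f: "f \<in> carrier (free_module H I)"
  shows "finite {a. fext_term I w v f a \<noteq> 0}"
proof (rule finite_subset)
  have Tw: "T w \<in> carrier H" using T_closed[OF w] .
  let ?S = "\<lambda>i. {m. m \<in> Mon B \<and> cf (f i) w m \<noteq> 0}"
  show "{a. fext_term I w v f a \<noteq> 0} \<subseteq> (SIGMA i:{i. f i \<noteq> \<zero>}. ?S i)"
    by (auto simp: fext_term_def sca_zero act_lzero Tw cf_zero split: if_splits)
  have "finite (?S i)" for i
  proof (rule finite_subset)
    have "f i \<in> carrier H" using f by (simp add: free_module_carrier)
    then show "finite (snd ` {(w, m). w \<in> W \<and> m \<in> Mon B \<and> cf (f i) w m \<noteq> 0})" using cf_fin by blast
    show "?S i \<subseteq> snd ` {(w, m). w \<in> W \<and> m \<in> Mon B \<and> cf (f i) w m \<noteq> 0}"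
    proof
      fix m assume "m \<in> ?S i"
      then show "m \<in> snd ` {(w, m). w \<in> W \<and> m \<in> Mon B \<and> cf (f i) w m \<noteq> 0}"
        using w by (intro image_eqI[of _ _ "(w, m)"]) auto
    qed
  qed
  moreover have "finite {i. f i \<noteq> \<zero>}" using f by (simp add: free_module_carrier)
  ultimately show "finite (SIGMA i:{i. f i \<noteq> \<zero>}. ?S i)" by (rule finite_SigmaI[rotated])
qed

lemma Sum_any_act:
  assumes "finite {a. g a \<noteq> 0}" "h \<in> carrier H"
  shows "Sum_any (\<lambda>a. act h (g a)) = act h (Sum_any g)"
proof -
  have "{a. act h (g a) \<noteq> 0} \<subseteq> {a. g a \<noteq> 0}" using act_zero[OF assms(2)] by auto
  then have "Sum_any (\<lambda>a. act h (g a)) = (\<Sum>a\<in>{a. g a \<noteq> 0}. act h (g a))"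
    using Sum_any.expand_superset[OF assms(1), of "\<lambda>a. act h (g a)"] by simp
  then show ?thesis by (simp add: act_sum[OF assms(2)] Sum_any.expand_set)
qed

lemma fext_VG:
  assumes w: "w \<in> W" and v: "v \<in> MG I"
  shows "fext I w v \<in> VG (free_module H I)"
proof -
  interpret F: left_module H "free_module H I" by (rule left_module_free)
  have Tw: "T w \<in> carrier H" using T_closed[OF w] .
  note fin = fext_finite[OF w]
  have fc: "f i \<in> carrier H" if "f \<in> carrier (free_module H I)" for f i using that by (simp add: free_module_carrier)
  have "fext I w v (f \<oplus>\<^bsub>free_module H I\<^esub> g) = fext I w v f + fext I w v g"
    if f: "f \<in> carrier (free_module H I)" and g: "g \<in> carrier (free_module H I)" for f g
  proof -
    have "fext_term I w v (f \<oplus>\<^bsub>free_module H I\<^esub> g) = (\<lambda>a. fext_term I w v f a + fext_term I w v g a)"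
      by (auto simp: fext_term_def fc[OF f] fc[OF g] cf_add sca_add l_distr act_ladd Tw fun_eq_iff)
    then show ?thesis
      using f g F.M.a_closed[OF f g] Sum_any.distrib[OF fin[OF f] fin[OF g]] by (simp only: fext_def if_True)
  qed
  moreover have "fext I w v (sca c \<odot>\<^bsub>free_module H I\<^esub> f) = act (sca c) (fext I w v f)"
    if f: "f \<in> carrier (free_module H I)" for f c
  proof -
    have "fext_term I w v (sca c \<odot>\<^bsub>free_module H I\<^esub> f) = (\<lambda>a. act (sca c) (fext_term I w v f a))"
      by (auto simp: fext_term_def fc[OF f] cf_smult sca_mult m_assoc act_mult Tw act_zero fun_eq_iff)
    then show ?thesis
      using f F.smult_closed[OF sca_closed f] Sum_any_act[OF fin[OF f] sca_closed] by (simp only: fext_def if_True)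
  qed
  moreover have "act \<one> (fext I w v f) = fext I w v f" for f
  proof (cases "f \<in> carrier (free_module H I)")
    case True
    have "act \<one> (fext_term I w v f a) = fext_term I w v f a" for a
      by (auto simp: fext_term_def act_one_act Tw act_zero split: prod.split)
    then show ?thesis using Sum_any_act[OF fin[OF True] one_closed, of v] True by (simp add: fext_def)
  next
    case False
    then show ?thesis by (simp add: fext_def act_zero)
  qed
  ultimately show ?thesis unfolding VG_def by (simp del: free_module_simps add: fext_def)
qed

lemma fext_add:
  assumes w: "w \<in> W" shows "fext I w (u + v) = fext I w u + fext I w v"
proof
  fix f
  have Tw: "T w \<in> carrier H" using T_closed[OF w] .
  have "fext_term I w (u + v) f = (\<lambda>a. fext_term I w u f a + fext_term I w v f a)"
    by (auto simp: fext_term_def act_add Tw fun_eq_iff)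
  then show "fext I w (u + v) f = (fext I w u + fext I w v) f"
    using Sum_any.distrib[OF fext_finite[OF w, of f I u] fext_finite[OF w, of f I v]] by (simp add: fext_def)
qed

lemma fext_vsc:
  assumes w: "w \<in> W" shows "fext I w (vsc c v) = vsc c (fext I w v)"
proof
  fix f
  have Tw: "T w \<in> carrier H" using T_closed[OF w] .
  have "fext_term I w (vsc c v) f = (\<lambda>a. act (sca c) (fext_term I w v f a))"
    using act_sca_comm[OF m_closed[OF sca_closed Tw]] by (auto simp: fext_term_def vsc_def act_zero fun_eq_iff)
  then show "fext I w (vsc c v) f = vsc c (fext I w v) f"
    using Sum_any_act[OF fext_finite[OF w, of f I v] sca_closed, of c] by (simp add: fext_def vsc_def act_zero)
qed

lemma fext_gen:
  fixes I :: "'b set"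
  assumes w: "w \<in> W" and u: "u \<in> W" and i: "i \<in> I" and n: "n \<in> Mon B"
  shows "fext I w v (fgen H i (sca c \<otimes> (T u \<otimes> Y n))) = (if w = u then act (sca c \<otimes> T u) (v (i, n)) else 0)"
proof -
  have cl: "T w \<in> carrier H" "T u \<otimes> Y n \<in> carrier H" using T_closed w u Y_closed n by auto
  have "fext_term I w v (fgen H i (sca c \<otimes> (T u \<otimes> Y n)))
      = (\<lambda>a. if a = (i, n) then (if w = u then act (sca c \<otimes> T u) (v a) else 0) else 0)"
  proof
    fix a :: "'b \<times> ('t \<Rightarrow> nat)"
    obtain i' m where a: "a = (i', m)" by (cases a)
    show "fext_term I w v (fgen H i (sca c \<otimes> (T u \<otimes> Y n))) a
      = (if a = (i, n) then (if w = u then act (sca c \<otimes> T u) (v a) else 0) else 0)"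
    proof (cases "i' = i \<and> m \<in> Mon B")
      case True
      then show ?thesis using i n
        by (simp add: a fext_term_def fgen_def cf_smult cl cf_basis[OF u n w] sca_zero act_lzero)
    next
      case False
      then show ?thesis using n cl(1) by (auto simp: a fext_term_def fgen_def cf_zero sca_zero act_lzero)
    qed
  qed
  moreover have "fgen H i (sca c \<otimes> (T u \<otimes> Y n)) \<in> carrier (free_module H I)"
    by (rule fgen_carrier[OF i]) (use cl in auto)
  ultimately show ?thesis unfolding fext_def by (simp only: if_True Sum_any.delta)
qed

text \<open>Equivariance moves \<open>T w\<close> out: the value on \<open>T w\<close> times
  \<open>Y m\<close> is \<open>T w\<close> acting on the value on \<open>Y m\<close>, at arguments
  moved back by \<open>w\<close>. Since these products span the algebra, the restriction
  decides.\<close>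

lemma forms_free_eqI:
  assumes \<phi>: "\<phi> \<in> forms (free_module H I) n" and \<psi>: "\<psi> \<in> forms (free_module H I) n'"
    and eq: "\<And>xs. res I (\<phi> xs) = res I (\<psi> xs)"
  shows "\<phi> = \<psi>"
proof (intro ext)
  fix xs f
  note lm = left_module_free[of I]
  note G\<phi> = forms_VG[OF lm \<phi>] and G\<psi> = forms_VG[OF lm \<psi>]
  have gen: "\<chi>' xs (fgen H i (sca c \<otimes> (T w \<otimes> Y m))) = act (sca c) (act (T w) (res I (\<chi>' (map (av (inv_into UNIV w)) xs)) (i, m)))"
    if \<chi>': "\<chi>' \<in> forms (free_module H I) k" and i: "i \<in> I" and w: "w \<in> W" and m: "m \<in> Mon B" for \<chi>' k i c w m
  proof -
    have Tw: "T w \<in> carrier H" and Ym: "Y m \<in> carrier H" using T_closed w Y_closed m by auto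
    note gc = fgen_carrier[OF i]
    have "\<chi>' xs (fgen H i (sca c \<otimes> (T w \<otimes> Y m))) = \<chi>' xs (sca c \<odot>\<^bsub>free_module H I\<^esub> fgen H i (T w \<otimes> Y m))"
      by (simp only: fgen_smult[OF sca_closed])
    also have "\<dots> = act (sca c) (\<chi>' xs (fgen H i (T w \<otimes> Y m)))"
      by (rule VG_sca[OF forms_VG[OF lm \<chi>'] gc[OF m_closed[OF Tw Ym]]])
    also have "\<chi>' xs (fgen H i (T w \<otimes> Y m))
        = \<chi>' (map (av w) (map (av (inv_into UNIV w)) xs)) (T w \<odot>\<^bsub>free_module H I\<^esub> fgen H i (Y m))"
      by (simp only: fgen_smult[OF Tw] map_av_inv[OF w])
    also have "\<dots> = act (T w) (\<chi>' (map (av (inv_into UNIV w)) xs) (fgen H i (Y m)))"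
      using \<chi>' w gc[OF Ym] unfolding forms_def equi_def by blast
    finally show ?thesis using i m by (simp add: res_def)
  qed
  show "\<phi> xs f = \<psi> xs f"
  proof (cases "f \<in> carrier (free_module H I)")
    case True
    then show ?thesis
    proof (rule free_pbw_induct)
      have v0: "v (\<lambda>_. \<zero>) = 0" if "v \<in> VG (free_module H I)" for v
      proof -
        have z: "(\<lambda>_. \<zero>) \<in> carrier (free_module H I)" by (simp add: free_module_carrier)
        have "v ((\<lambda>_. \<zero>) \<oplus>\<^bsub>free_module H I\<^esub> (\<lambda>_. \<zero>)) = v (\<lambda>_. \<zero>) + v (\<lambda>_. \<zero>)"
          by (rule VG_add[OF that z z])
        then show ?thesis by simp
      qed
      show "\<phi> xs (\<lambda>_. \<zero>) = \<psi> xs (\<lambda>_. \<zero>)" by (simp only: v0[OF G\<phi>] v0[OF G\<psi>])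
    next
      fix f g assume fg: "f \<in> carrier (free_module H I)" "g \<in> carrier (free_module H I)" "\<phi> xs f = \<psi> xs f" "\<phi> xs g = \<psi> xs g"
      have "v (f \<oplus>\<^bsub>free_module H I\<^esub> g) = v f + v g" if "v \<in> VG (free_module H I)" for v
        by (rule VG_add[OF that fg(1,2)])
      from this[OF G\<phi>, of xs] this[OF G\<psi>, of xs] show "\<phi> xs (\<lambda>i. f i \<oplus> g i) = \<psi> xs (\<lambda>i. f i \<oplus> g i)" using fg by simp
    next
      fix i c w m assume "i \<in> I" "w \<in> W" "m \<in> Mon B"
      then show "\<phi> xs (fgen H i (sca c \<otimes> (T w \<otimes> Y m))) = \<psi> xs (fgen H i (sca c \<otimes> (T w \<otimes> Y m)))"
        by (simp only: gen[OF \<phi>] gen[OF \<psi>] eq)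
    qed
  next
    case False
    then show ?thesis using VG_outside[OF G\<phi>] VG_outside[OF G\<psi>] by simp
  qed
qed

text \<open>Restriction identifies the Koszul complex of equivariant forms with that of polynomial
  families, which is exact. A primitive found there is extended to an equivariant form.\<close>

lemma acyclic_free: "acyclic_module (free_module H (I :: 'i set))"
  unfolding acyclic_module_def
proof (intro allI ballI impI)
  fix n and \<phi> :: "'t list \<Rightarrow> ('i \<Rightarrow> 'h) \<Rightarrow> 'n"
  let ?F = "free_module H I"
  assume \<phi>: "\<phi> \<in> forms ?F (Suc n)" and cl: "closed_form ?F \<phi>"
  note lm = left_module_free[of I]
  interpret F: left_module H ?F by (rule lm)
  interpret K: koszul scl "VG ?F" vsc "VD ?F" by (rule koszul_VG[OF lm])
  have res0: "res I 0 = 0" "res I (\<lambda>_. 0) = 0" by (auto simp: res_def fun_eq_iff)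
  have res_kd: "res I (kd (VD ?F) xs \<psi>) = kd (MD I) xs (\<lambda>ys. res I (\<psi> ys))" if "\<And>ys. \<psi> ys \<in> VG ?F" for xs \<psi>
  proof -
    have "res I (kd (VD ?F) xs \<psi>) = kd (MD I) xs (\<lambda>ys. res I (\<psi> ys)) \<and> kd (VD ?F) xs \<psi> \<in> VG ?F"
    proof (rule kd_map[where K = "VG ?F"])
      show "res I (VD ?F x v) = MD I x (res I v)" if "v \<in> VG ?F" for x v by (rule res_VD[OF that])
      show "res I (u - v) = res I u - res I v" for u v by (auto simp: res_def fun_eq_iff)
    qed (auto simp: res0 that K.D_closed K.G_diff K.G_zero simp del: fun_diff_def)
    then show ?thesis ..
  qed
  have "form_space.alt scl (MG I) vsc (Suc n) (\<lambda>xs. res I (\<phi> xs))"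
  proof (rule alt_map[OF form_space_VG[OF lm] form_space_MG, where K = "VG ?F"])
    show "res I (u + v) = res I u + res I v" for u v by (auto simp: res_def fun_eq_iff)
    show "res I (vsc c u) = vsc c (res I u)" for c u by (auto simp: res_def vsc_def act_zero fun_eq_iff)
    show "form_space.alt scl (VG ?F) vsc (Suc n) \<phi>" using \<phi> by (simp add: forms_def)
    show "\<phi> xs \<in> VG ?F" for xs by (rule forms_VG[OF lm \<phi>])
  qed (auto simp: res0 res_MG)
  moreover have "kd (MD I) xs (\<lambda>ys. res I (\<phi> ys)) = 0" for xs
    using res_kd[of \<phi> xs, OF forms_VG[OF lm \<phi>]] cl res0 by (simp add: closed_form_def)
  ultimately obtain \<psi>' where \<psi>': "form_space.alt scl (MG I) vsc n \<psi>'" "\<And>xs. kd (MD I) xs \<psi>' = res I (\<phi> xs)"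
    using MG_exact[of I n "\<lambda>xs. res I (\<phi> xs)"] by blast
  have G': "\<psi>' xs \<in> MG I" for xs using form_space.alt_G[OF form_space_MG \<psi>'(1)] .
  \<comment> \<open>The extension forced by equivariance. The summands live on different parts of
    the basis, so this is no average and carries no factor.\<close>
  define \<Psi> where "\<Psi> = (\<lambda>xs. \<Sum>w\<in>W. fext I w (\<psi>' (map (av (inv_into UNIV w)) xs)))"
  have alt: "K.alt n (\<lambda>xs. fext I w (\<psi>' (map (av (inv_into UNIV w)) xs)))" if w: "w \<in> W" for w
  proof (rule alt_map[OF form_space_MG form_space_VG[OF lm],
        where K = "MG I" and f = "fext I w" and \<phi> = "\<lambda>xs. \<psi>' (map (av (inv_into UNIV w)) xs)"])
    note iw = inv_W(1)[OF w]
    show "form_space.alt scl (MG I) vsc n (\<lambda>xs. \<psi>' (map (av (inv_into UNIV w)) xs))"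
      by (rule form_space.alt_comp_linear[OF form_space_MG av_add[OF iw] av_scl[OF iw] \<psi>'(1)])
    show "fext I w 0 = 0" using fext_add[OF w, of I 0 0] by simp
    show "fext I w (u + v) = fext I w u + fext I w v" for u v by (rule fext_add[OF w])
    show "fext I w (vsc c u) = vsc c (fext I w u)" for c u by (rule fext_vsc[OF w])
    show "fext I w u \<in> VG ?F" if "u \<in> MG I" for u by (rule fext_VG[OF w that])
    show "\<psi>' (map (av (inv_into UNIV w)) xs) \<in> MG I" for xs by (rule G')
  qed
  have alt\<Psi>: "K.alt n \<Psi>" unfolding \<Psi>_def by (rule K.alt_sum[OF alt])
  have G\<Psi>: "\<Psi> xs \<in> VG ?F" for xs using K.alt_G[OF alt\<Psi>] .
  have gen: "\<Psi> xs (fgen H i (sca c \<otimes> (T u \<otimes> Y m))) = act (sca c \<otimes> T u) (\<psi>' (map (av (inv_into UNIV u)) xs) (i, m))"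
    if "i \<in> I" "u \<in> W" "m \<in> Mon B" for xs i c u m
    using that W_fin by (simp add: \<Psi>_def sum_fun_app fext_gen)
  have "equi ?F \<Psi>"
    unfolding equi_def
  proof (intro ballI allI)
    fix u xs f assume u: "u \<in> W" and f: "f \<in> carrier ?F"
    have Tu: "T u \<in> carrier H" using T_closed[OF u] .
    have va: "v (f \<oplus>\<^bsub>?F\<^esub> g) = v f + v g" if "v \<in> VG ?F" "f \<in> carrier ?F" "g \<in> carrier ?F" for v f g
      by (rule VG_add[OF that])
    have v0: "v (\<lambda>_. \<zero>) = 0" if "v \<in> VG ?F" for v
      using va[OF that F.M.zero_closed F.M.zero_closed] by simp
    show "\<Psi> (map (av u) xs) (T u \<odot>\<^bsub>?F\<^esub> f) = act (T u) (\<Psi> xs f)"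
      using f
    proof (rule free_pbw_induct)
      show "\<Psi> (map (av u) xs) (T u \<odot>\<^bsub>?F\<^esub> (\<lambda>_. \<zero>)) = act (T u) (\<Psi> xs (\<lambda>_. \<zero>))"
        using v0[OF G\<Psi>] Tu by (simp add: act_zero)
    next
      fix f g assume fg: "f \<in> carrier ?F" "g \<in> carrier ?F"
        and h: "\<Psi> (map (av u) xs) (T u \<odot>\<^bsub>?F\<^esub> f) = act (T u) (\<Psi> xs f)"
          "\<Psi> (map (av u) xs) (T u \<odot>\<^bsub>?F\<^esub> g) = act (T u) (\<Psi> xs g)"
      have "\<Psi> (map (av u) xs) (T u \<odot>\<^bsub>?F\<^esub> (f \<oplus>\<^bsub>?F\<^esub> g)) = act (T u) (\<Psi> xs (f \<oplus>\<^bsub>?F\<^esub> g))"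
        by (simp only: F.smult_r_distr[OF Tu fg] va[OF G\<Psi> F.smult_closed[OF Tu fg(1)] F.smult_closed[OF Tu fg(2)]]
            va[OF G\<Psi> fg] h act_add[OF Tu])
      then show "\<Psi> (map (av u) xs) (T u \<odot>\<^bsub>?F\<^esub> (\<lambda>i. f i \<oplus> g i)) = act (T u) (\<Psi> xs (\<lambda>i. f i \<oplus> g i))" by simp
    next
      fix i c w m assume i: "i \<in> I" and w: "w \<in> W" and m: "m \<in> Mon B"
      have Tw: "T w \<in> carrier H" and Ym: "Y m \<in> carrier H" using T_closed w Y_closed m by auto
      have uw: "u \<circ> w \<in> W" using W_comp[OF u w] .
      have "T u \<otimes> (sca c \<otimes> (T w \<otimes> Y m)) = sca c \<otimes> (T (u \<circ> w) \<otimes> Y m)"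
        using Tu Tw Ym sca_central[OF Tu, of c] T_comp[OF u w] by (simp add: m_assoc[symmetric])
      then have "\<Psi> (map (av u) xs) (T u \<odot>\<^bsub>?F\<^esub> fgen H i (sca c \<otimes> (T w \<otimes> Y m)))
          = act (sca c \<otimes> T (u \<circ> w)) (\<psi>' (map (av (inv_into UNIV (u \<circ> w))) (map (av u) xs)) (i, m))"
        by (simp only: fgen_smult[OF Tu] gen[OF i uw m])
      also have "map (av (inv_into UNIV (u \<circ> w))) (map (av u) xs) = map (av (inv_into UNIV w)) xs"
      proof -
        have "inv_into UNIV (u \<circ> w) \<circ> u = inv_into UNIV w"
        proof -
          have "inv_into UNIV (u \<circ> w) \<circ> (u \<circ> w) = id" using inv_W(2)[OF uw] .
          then have "(inv_into UNIV (u \<circ> w) \<circ> u) \<circ> (w \<circ> inv_into UNIV w) = inv_into UNIV w"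
            by (simp only: comp_assoc[symmetric] id_comp)
          then show ?thesis by (simp only: inv_W(3)[OF w] comp_id)
        qed
        then have "av (inv_into UNIV (u \<circ> w)) (av u x) = av (inv_into UNIV w) x" for x
          using av_comp[OF inv_W(1)[OF uw] u, of x] by simp
        then show ?thesis by (simp add: comp_def)
      qed
      also have "sca c \<otimes> T (u \<circ> w) = T u \<otimes> (sca c \<otimes> T w)"
        using Tu Tw sca_central[OF Tu, of c] T_comp[OF u w] by (simp add: m_assoc[symmetric])
      also have "act (T u \<otimes> (sca c \<otimes> T w)) v = act (T u) (act (sca c \<otimes> T w) v)" for v
        using Tu Tw by (simp add: act_mult)
      finally show "\<Psi> (map (av u) xs) (T u \<odot>\<^bsub>?F\<^esub> fgen H i (sca c \<otimes> (T w \<otimes> Y m)))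
          = act (T u) (\<Psi> xs (fgen H i (sca c \<otimes> (T w \<otimes> Y m))))"
        by (simp only: gen[OF i w m])
    qed
  qed
  then have F\<Psi>: "\<Psi> \<in> forms ?F n" using alt\<Psi> by (simp add: forms_def)
  have res\<Psi>: "res I (\<Psi> xs) = \<psi>' xs" for xs
  proof
    fix a show "res I (\<Psi> xs) a = \<psi>' xs a"
    proof (cases a)
      case (Pair i m)
      show ?thesis
      proof (cases "i \<in> I \<and> m \<in> Mon B")
        case True
        have Ym: "Y m \<in> carrier H" using Y_closed True by blast
        have "inv_into UNIV id = (id :: 'a \<Rightarrow> 'a)" by simp
        then have e: "map (av (inv_into UNIV id)) xs = xs" by (simp only: map_idI av_id)
        have "\<Psi> xs (fgen H i (Y m)) = act \<one> (\<psi>' xs (i, m))"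
          using gen[of i id m xs 1] True W_id Ym by (simp add: T_id sca_one map_idI av_id)
        then show ?thesis using True G'[of xs] by (simp add: Pair res_def MG_def)
      next
        case False
        then show ?thesis using G'[of xs] by (auto simp: Pair res_def MG_def)
      qed
    qed
  qed
  \<comment> \<open>The differential of \<open>\<Psi>\<close> is computed on monomials only;
    elsewhere its equivariance decides, which rests on the cross relation.\<close>
  have "kosz ?F \<Psi> = \<phi>"
    by (rule forms_free_eqI[OF forms_kosz[OF lm F\<Psi>] \<phi>]) (simp only: res_kd[of \<Psi>, OF G\<Psi>] res\<Psi> \<psi>'(2))
  then show "\<exists>\<psi>\<in>forms ?F n. kosz ?F \<psi> = \<phi>" using F\<Psi> by blast
qed

end

section \<open>Projective resolutions\<close>

text \<open>The structure carried over along a map \<open>\<pi>\<close> whose fibres are the classes of a congruence.\<close>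

definition image_module :: "('h, 'p) module \<Rightarrow> ('p \<Rightarrow> 'm) \<Rightarrow> ('h, 'm) module" where
  "image_module P \<pi> = (let s = inv_into (carrier P) \<pi> in
     \<lparr>carrier = \<pi> ` carrier P, monoid.mult = undefined, monoid.one = undefined, ring.zero = \<pi> \<zero>\<^bsub>P\<^esub>,
      ring.add = (\<lambda>x z. \<pi> (s x \<oplus>\<^bsub>P\<^esub> s z)), module.smult = (\<lambda>a x. \<pi> (a \<odot>\<^bsub>P\<^esub> s x))\<rparr>)"

locale module_quotient = left_module R P
  for R :: "('h, 'x) ring_scheme" (structure) and P :: "('h, 'p) module" +
  fixes \<pi> :: "'p \<Rightarrow> 'm"
  assumes cong_add: "\<lbrakk>p \<in> carrier P; q \<in> carrier P; p' \<in> carrier P; q' \<in> carrier P; \<pi> p = \<pi> p'; \<pi> q = \<pi> q'\<rbrakk>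
      \<Longrightarrow> \<pi> (p \<oplus>\<^bsub>P\<^esub> q) = \<pi> (p' \<oplus>\<^bsub>P\<^esub> q')"
    and cong_smult: "\<lbrakk>a \<in> carrier R; p \<in> carrier P; p' \<in> carrier P; \<pi> p = \<pi> p'\<rbrakk> \<Longrightarrow> \<pi> (a \<odot>\<^bsub>P\<^esub> p) = \<pi> (a \<odot>\<^bsub>P\<^esub> p')"
begin

abbreviation "Qm \<equiv> image_module P \<pi>"

lemma image_section: "p \<in> carrier P \<Longrightarrow> inv_into (carrier P) \<pi> (\<pi> p) \<in> carrier P \<and> \<pi> (inv_into (carrier P) \<pi> (\<pi> p)) = \<pi> p"
  by (simp add: inv_into_into f_inv_into_f)

lemma image_carrier: "carrier Qm = \<pi> ` carrier P"
  and image_zero: "\<zero>\<^bsub>Qm\<^esub> = \<pi> \<zero>\<^bsub>P\<^esub>"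
  by (simp_all add: image_module_def Let_def)

lemma image_add: "p \<in> carrier P \<Longrightarrow> q \<in> carrier P \<Longrightarrow> \<pi> p \<oplus>\<^bsub>Qm\<^esub> \<pi> q = \<pi> (p \<oplus>\<^bsub>P\<^esub> q)"
proof -
  assume pq: "p \<in> carrier P" "q \<in> carrier P"
  note s = image_section[OF pq(1)] image_section[OF pq(2)]
  have "\<pi> (inv_into (carrier P) \<pi> (\<pi> p) \<oplus>\<^bsub>P\<^esub> inv_into (carrier P) \<pi> (\<pi> q)) = \<pi> (p \<oplus>\<^bsub>P\<^esub> q)"
    by (rule cong_add) (use s pq in simp_all)
  then show ?thesis by (simp add: image_module_def Let_def)
qed

lemma image_smult: "a \<in> carrier R \<Longrightarrow> p \<in> carrier P \<Longrightarrow> a \<odot>\<^bsub>Qm\<^esub> \<pi> p = \<pi> (a \<odot>\<^bsub>P\<^esub> p)"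
proof -
  assume ap: "a \<in> carrier R" "p \<in> carrier P"
  note s = image_section[OF ap(2)]
  have "\<pi> (a \<odot>\<^bsub>P\<^esub> inv_into (carrier P) \<pi> (\<pi> p)) = \<pi> (a \<odot>\<^bsub>P\<^esub> p)"
    by (rule cong_smult) (use s ap in simp_all)
  then show ?thesis by (simp add: image_module_def Let_def)
qed

lemma left_module_image: "left_module R Qm"
proof -
  have "abelian_group Qm"
  proof (rule abelian_groupI)
    show "\<exists>z\<in>carrier Qm. z \<oplus>\<^bsub>Qm\<^esub> x = \<zero>\<^bsub>Qm\<^esub>" if x: "x \<in> carrier Qm" for x
    proof -
      obtain p where p: "p \<in> carrier P" "x = \<pi> p" using x unfolding image_carrier by (elim imageE)
      have "\<pi> (\<ominus>\<^bsub>P\<^esub> p) \<oplus>\<^bsub>Qm\<^esub> x = \<zero>\<^bsub>Qm\<^esub>" using p by (simp add: image_add image_zero M.l_neg)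
      moreover have "\<pi> (\<ominus>\<^bsub>P\<^esub> p) \<in> carrier Qm" using p by (simp add: image_carrier)
      ultimately show ?thesis by blast
    qed
  qed (auto simp: image_carrier image_zero image_add M.a_ac)
  then show ?thesis
    by (intro left_module.intro left_module_axioms.intro ring_axioms)
      (auto simp: image_carrier image_add image_smult smult_closed smult_l_distr smult_r_distr smult_assoc smult_one)
qed

end

lemma module_quotient_inj:
  assumes "left_module A P" "inj_on \<tau> (carrier P)" shows "module_quotient A P \<tau>"
  by (intro module_quotient.intro assms module_quotient_axioms.intro) (auto dest!: inj_onD[OF assms(2)])

definition kernel_module :: "('h, 'm) module \<Rightarrow> ('h, 'n) module \<Rightarrow> ('m \<Rightarrow> 'n) \<Rightarrow> ('h, 'm) module" where
  "kernel_module P M f = P\<lparr>carrier := {x \<in> carrier P. f x = \<zero>\<^bsub>M\<^esub>}\<rparr>"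

lemma kernel_module_simps [simp]:
  "carrier (kernel_module P M f) = {x \<in> carrier P. f x = \<zero>\<^bsub>M\<^esub>}"
  "x \<oplus>\<^bsub>kernel_module P M f\<^esub> z = x \<oplus>\<^bsub>P\<^esub> z" "\<zero>\<^bsub>kernel_module P M f\<^esub> = \<zero>\<^bsub>P\<^esub>"
  "a \<odot>\<^bsub>kernel_module P M f\<^esub> x = a \<odot>\<^bsub>P\<^esub> x"
  by (simp_all add: kernel_module_def)

lemma left_module_kernel:
  assumes P: "left_module A P" and M: "left_module A M" and f: "f \<in> module_hom A P M"
  shows "left_module A (kernel_module P M f)"
proof -
  interpret P: left_module A P by fact
  interpret M: left_module A M by fact
  note fD = module_homD[OF f]
  have f0: "f \<zero>\<^bsub>P\<^esub> = \<zero>\<^bsub>M\<^esub>" using module_hom_zero[OF P M f] .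
  have neg: "f (\<ominus>\<^bsub>P\<^esub> x) = \<zero>\<^bsub>M\<^esub>" if x: "x \<in> carrier P" "f x = \<zero>\<^bsub>M\<^esub>" for x
    using fD(2)[of x "\<ominus>\<^bsub>P\<^esub> x"] fD(1)[of "\<ominus>\<^bsub>P\<^esub> x"] x f0 by (simp add: P.M.r_neg)
  have "abelian_group (kernel_module P M f)"
  proof (rule abelian_groupI)
    show "\<exists>z\<in>carrier (kernel_module P M f). z \<oplus>\<^bsub>kernel_module P M f\<^esub> x = \<zero>\<^bsub>kernel_module P M f\<^esub>"
      if "x \<in> carrier (kernel_module P M f)" for x
      using that neg[of x] by (intro bexI[of _ "\<ominus>\<^bsub>P\<^esub> x"]) (auto simp: P.M.l_neg)
  qed (auto simp: f0 fD P.M.a_ac)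
  then show ?thesis
    by (intro left_module.intro left_module_axioms.intro P.ring_axioms)
      (auto simp: fD P.smult_closed P.smult_l_distr P.smult_r_distr P.smult_assoc P.smult_one M.smult_zero_right)
qed

section \<open>The universal property of free modules\<close>

definition feval :: "('h, 'x) ring_scheme \<Rightarrow> ('h, 'p, 'y) module_scheme \<Rightarrow> ('i \<Rightarrow> 'p) \<Rightarrow> ('i \<Rightarrow> 'h) \<Rightarrow> 'p" where
  "feval A P u f = finsum P (\<lambda>i. f i \<odot>\<^bsub>P\<^esub> u i) {i. f i \<noteq> \<zero>\<^bsub>A\<^esub>}"

context left_module
begin

context
  fixes I :: "'i set" and u :: "'i \<Rightarrow> 'm"
  assumes u: "\<And>i. i \<in> I \<Longrightarrow> u i \<in> carrier M"
begin

lemma feval_term: "f \<in> carrier (free_module R I) \<Longrightarrow> f i \<noteq> \<zero> \<Longrightarrow> f i \<odot>\<^bsub>M\<^esub> u i \<in> carrier M"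
  using u by (auto simp: R.free_module_carrier intro!: smult_closed)

text \<open>The support varies under addition and scalar multiplication; sums become comparable over
  a common finite superset.\<close>

lemma feval_superset:
  assumes f: "f \<in> carrier (free_module R I)" and S: "finite S" "{i. f i \<noteq> \<zero>} \<subseteq> S" "S \<subseteq> I"
  shows "feval R M u f = finsum M (\<lambda>i. f i \<odot>\<^bsub>M\<^esub> u i) S"
  unfolding feval_def
proof (rule M.add.finprod_mono_neutral_cong_left[OF S(1,2)])
  show "f i \<odot>\<^bsub>M\<^esub> u i = \<zero>\<^bsub>M\<^esub>" if "i \<in> S - {i. f i \<noteq> \<zero>}" for i
    using that u[of i] S(3) by (auto simp: smult_zero_left)
  show "(\<lambda>i. f i \<odot>\<^bsub>M\<^esub> u i) \<in> S \<rightarrow> carrier M"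
    using f S(3) u by (auto simp: R.free_module_carrier intro!: smult_closed)
qed simp

lemma feval_support: "f \<in> carrier (free_module R I) \<Longrightarrow> finite {i. f i \<noteq> \<zero>} \<and> {i. f i \<noteq> \<zero>} \<subseteq> I"
  by (auto simp: R.free_module_carrier)

lemma feval_closed: "f \<in> carrier (free_module R I) \<Longrightarrow> feval R M u f \<in> carrier M"
  unfolding feval_def using feval_term by (intro M.finsum_closed) auto

lemma feval_add:
  assumes f: "f \<in> carrier (free_module R I)" and g: "g \<in> carrier (free_module R I)"
  shows "feval R M u (f \<oplus>\<^bsub>free_module R I\<^esub> g) = feval R M u f \<oplus>\<^bsub>M\<^esub> feval R M u g"
proof -
  interpret F: left_module R "free_module R I" by (rule R.left_module_free)
  let ?S = "{i. f i \<noteq> \<zero>} \<union> {i. g i \<noteq> \<zero>}"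
  have S: "finite ?S" "?S \<subseteq> I" using feval_support f g by auto
  have c: "f i \<in> carrier R" "g i \<in> carrier R" for i using f g by (auto simp: R.free_module_carrier)
  have cu: "f i \<odot>\<^bsub>M\<^esub> u i \<in> carrier M" "g i \<odot>\<^bsub>M\<^esub> u i \<in> carrier M" "u i \<in> carrier M" if "i \<in> ?S" for i
    using u c subsetD[OF S(2) that] smult_closed by auto
  have "feval R M u (f \<oplus>\<^bsub>free_module R I\<^esub> g) = finsum M (\<lambda>i. (f \<oplus>\<^bsub>free_module R I\<^esub> g) i \<odot>\<^bsub>M\<^esub> u i) ?S"
    by (rule feval_superset[OF F.M.a_closed[OF f g] S(1) _ S(2)]) (use c in auto)
  also have "\<dots> = finsum M (\<lambda>i. f i \<odot>\<^bsub>M\<^esub> u i \<oplus>\<^bsub>M\<^esub> g i \<odot>\<^bsub>M\<^esub> u i) ?S"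
    by (rule M.finsum_cong') (use cu c in \<open>simp_all add: smult_l_distr Pi_def\<close>)
  also have "\<dots> = finsum M (\<lambda>i. f i \<odot>\<^bsub>M\<^esub> u i) ?S \<oplus>\<^bsub>M\<^esub> finsum M (\<lambda>i. g i \<odot>\<^bsub>M\<^esub> u i) ?S"
    by (rule M.finsum_addf) (use cu in \<open>simp_all add: Pi_def\<close>)
  also have "\<dots> = feval R M u f \<oplus>\<^bsub>M\<^esub> feval R M u g"
    using feval_superset[OF f S(1) _ S(2)] feval_superset[OF g S(1) _ S(2)] by simp
  finally show ?thesis .
qed

lemma smult_finsum:
  assumes "a \<in> carrier R" "finite S" "\<And>i. i \<in> S \<Longrightarrow> g i \<in> carrier M"
  shows "a \<odot>\<^bsub>M\<^esub> finsum M g S = finsum M (\<lambda>i. a \<odot>\<^bsub>M\<^esub> g i) S"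
  using assms(2,3)
proof (induction S rule: finite_induct)
  case empty
  show ?case by (simp add: smult_zero_right assms(1))
next
  case (insert i S)
  then show ?case using assms(1) by (simp add: smult_r_distr smult_closed Pi_def)
qed

lemma feval_smult:
  assumes a: "a \<in> carrier R" and f: "f \<in> carrier (free_module R I)"
  shows "feval R M u (a \<odot>\<^bsub>free_module R I\<^esub> f) = a \<odot>\<^bsub>M\<^esub> feval R M u f"
proof -
  interpret F: left_module R "free_module R I" by (rule R.left_module_free)
  have S: "finite {i. f i \<noteq> \<zero>}" "{i. f i \<noteq> \<zero>} \<subseteq> I" using feval_support[OF f] by auto
  have c: "f i \<in> carrier R" for i using f by (auto simp: R.free_module_carrier)
  have "feval R M u (a \<odot>\<^bsub>free_module R I\<^esub> f) = finsum M (\<lambda>i. (a \<odot>\<^bsub>free_module R I\<^esub> f) i \<odot>\<^bsub>M\<^esub> u i) {i. f i \<noteq> \<zero>}"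
    by (rule feval_superset[OF F.smult_closed[OF a f] S(1) _ S(2)]) (use a in auto)
  also have "\<dots> = finsum M (\<lambda>i. a \<odot>\<^bsub>M\<^esub> (f i \<odot>\<^bsub>M\<^esub> u i)) {i. f i \<noteq> \<zero>}"
  proof (rule M.finsum_cong')
    show "(a \<odot>\<^bsub>free_module R I\<^esub> f) i \<odot>\<^bsub>M\<^esub> u i = a \<odot>\<^bsub>M\<^esub> (f i \<odot>\<^bsub>M\<^esub> u i)" if "i \<in> {i. f i \<noteq> \<zero>}" for i
      using subsetD[OF S(2) that] u c a by (simp add: smult_assoc)
  qed (use feval_term[OF f] a smult_closed in auto)
  also have "\<dots> = a \<odot>\<^bsub>M\<^esub> feval R M u f"
    unfolding feval_def by (rule smult_finsum[symmetric, OF a S(1)]) (use feval_term[OF f] in auto)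
  finally show ?thesis .
qed

lemma feval_fgen:
  assumes i: "i \<in> I" and h: "h \<in> carrier R"
  shows "feval R M u (fgen R i h) = h \<odot>\<^bsub>M\<^esub> u i"
proof -
  have "feval R M u (fgen R i h) = finsum M (\<lambda>j. fgen R i h j \<odot>\<^bsub>M\<^esub> u j) {i}"
    by (rule feval_superset[OF R.fgen_carrier[OF i h]]) (use i in \<open>auto simp: fgen_def\<close>)
  also have "\<dots> = h \<odot>\<^bsub>M\<^esub> u i" using u[OF i] h by (simp add: fgen_def smult_closed)
  finally show ?thesis .
qed

end

end

lemma (in ring) hom_free_eqI:
  assumes M: "left_module R M"
    and add: "\<And>f g. f \<in> carrier (free_module R I) \<Longrightarrow> g \<in> carrier (free_module R I) \<Longrightarrow> a (f \<oplus>\<^bsub>free_module R I\<^esub> g) = a f \<oplus>\<^bsub>M\<^esub> a g"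
      "\<And>f g. f \<in> carrier (free_module R I) \<Longrightarrow> g \<in> carrier (free_module R I) \<Longrightarrow> b (f \<oplus>\<^bsub>free_module R I\<^esub> g) = b f \<oplus>\<^bsub>M\<^esub> b g"
    and cl: "\<And>f. f \<in> carrier (free_module R I) \<Longrightarrow> a f \<in> carrier M" "\<And>f. f \<in> carrier (free_module R I) \<Longrightarrow> b f \<in> carrier M"
    and gen: "\<And>i h. i \<in> I \<Longrightarrow> h \<in> carrier R \<Longrightarrow> a (fgen R i h) = b (fgen R i h)"
    and f: "f \<in> carrier (free_module R I)"
  shows "a f = b f"
  using f
proof (rule free_module_induct)
  interpret M: left_module R M by fact
  interpret F: left_module R "free_module R I" by (rule left_module_free)
  note z = F.M.zero_closed
  have "a \<zero>\<^bsub>free_module R I\<^esub> = a \<zero>\<^bsub>free_module R I\<^esub> \<oplus>\<^bsub>M\<^esub> a \<zero>\<^bsub>free_module R I\<^esub>"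
    using add(1)[OF z z] by (simp only: F.M.l_zero[OF z])
  then have "a \<zero>\<^bsub>free_module R I\<^esub> = \<zero>\<^bsub>M\<^esub>" using cl(1)[OF z] by simp
  moreover have "b \<zero>\<^bsub>free_module R I\<^esub> = b \<zero>\<^bsub>free_module R I\<^esub> \<oplus>\<^bsub>M\<^esub> b \<zero>\<^bsub>free_module R I\<^esub>"
    using add(2)[OF z z] by (simp only: F.M.l_zero[OF z])
  then have "b \<zero>\<^bsub>free_module R I\<^esub> = \<zero>\<^bsub>M\<^esub>" using cl(2)[OF z] by simp
  ultimately show "a (\<lambda>_. \<zero>) = b (\<lambda>_. \<zero>)" by simp
next
  fix f g assume fg: "f \<in> carrier (free_module R I)" "g \<in> carrier (free_module R I)" "a f = b f" "a g = b g"
  show "a (\<lambda>i. f i \<oplus> g i) = b (\<lambda>i. f i \<oplus> g i)"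
    using add(1)[OF fg(1,2)] add(2)[OF fg(1,2)] fg(3,4) by simp
qed (fact gen)

text \<open>\<open>Ext\<close> is formed among modules carried by the type \<open>'m\<close>, so
  free modules have to be copied into it. Embedding the free module on the whole of
  \<open>'m\<close> suffices: it contains the free module on every subset, in particular on the
  carrier of any module.\<close>

locale free_embedded = ring R for R :: "('h, 'x) ring_scheme" (structure) +
  fixes \<tau> :: "('m \<Rightarrow> 'h) \<Rightarrow> 'm"
  assumes \<tau>: "inj_on \<tau> (carrier (free_module R UNIV))"
begin

definition Fr :: "'m set \<Rightarrow> ('h, 'm) module" where
  "Fr I = image_module (free_module R I) \<tau>"

lemma \<tau>_inj: "inj_on \<tau> (carrier (free_module R I))"
  by (rule inj_on_subset[OF \<tau>]) (auto simp: free_module_carrier)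

lemma Fr_quotient: "module_quotient R (free_module R I) \<tau>"
  using module_quotient_inj[OF left_module_free \<tau>_inj] .

lemma left_module_Fr: "left_module R (Fr I)"
  unfolding Fr_def by (rule module_quotient.left_module_image[OF Fr_quotient])

lemma Fr_carrier: "carrier (Fr I) = \<tau> ` carrier (free_module R I)"
  unfolding Fr_def by (rule module_quotient.image_carrier[OF Fr_quotient])

lemma Fr_add: "f \<in> carrier (free_module R I) \<Longrightarrow> g \<in> carrier (free_module R I) \<Longrightarrow>
    \<tau> f \<oplus>\<^bsub>Fr I\<^esub> \<tau> g = \<tau> (f \<oplus>\<^bsub>free_module R I\<^esub> g)"
  unfolding Fr_def by (rule module_quotient.image_add[OF Fr_quotient])

lemma Fr_smult: "a \<in> carrier R \<Longrightarrow> f \<in> carrier (free_module R I) \<Longrightarrow> a \<odot>\<^bsub>Fr I\<^esub> \<tau> f = \<tau> (a \<odot>\<^bsub>free_module R I\<^esub> f)"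
  unfolding Fr_def by (rule module_quotient.image_smult[OF Fr_quotient])

definition Frhom :: "'m set \<Rightarrow> ('h, 'm) module \<Rightarrow> ('m \<Rightarrow> 'm) \<Rightarrow> 'm \<Rightarrow> 'm" where
  "Frhom I M u = (\<lambda>x\<in>carrier (Fr I). feval R M u (inv_into (carrier (free_module R I)) \<tau> x))"

lemma Frhom_\<tau>: "f \<in> carrier (free_module R I) \<Longrightarrow> Frhom I M u (\<tau> f) = feval R M u f"
  by (simp add: Frhom_def Fr_carrier inv_into_f_f[OF \<tau>_inj])

lemma Frhom_hom:
  assumes M: "left_module R M" and u: "\<And>i. i \<in> I \<Longrightarrow> u i \<in> carrier M"
  shows "Frhom I M u \<in> module_hom R (Fr I) M"
proof -
  interpret M: left_module R M by fact
  interpret F: left_module R "free_module R I" by (rule left_module_free)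
  show ?thesis
    unfolding module_hom_def
  proof (intro CollectI conjI ballI)
    show "Frhom I M u \<in> carrier (Fr I) \<rightarrow>\<^sub>E carrier M"
      using M.feval_closed[OF u] Frhom_\<tau>[of _ I M u] by (auto simp: Fr_carrier Frhom_def)
  next
    fix x z assume "x \<in> carrier (Fr I)" "z \<in> carrier (Fr I)"
    then obtain f g where fg: "f \<in> carrier (free_module R I)" "x = \<tau> f" "g \<in> carrier (free_module R I)" "z = \<tau> g"
      unfolding Fr_carrier by (elim imageE)
    then show "Frhom I M u (x \<oplus>\<^bsub>Fr I\<^esub> z) = Frhom I M u x \<oplus>\<^bsub>M\<^esub> Frhom I M u z"
      using F.M.a_closed[OF fg(1,3)] M.feval_add[OF u fg(1,3)]
      by (simp only: Fr_add Frhom_\<tau>)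
  next
    fix a x assume a: "a \<in> carrier R" and "x \<in> carrier (Fr I)"
    then obtain f where f: "f \<in> carrier (free_module R I)" "x = \<tau> f"
      unfolding Fr_carrier by (elim imageE)
    then show "Frhom I M u (a \<odot>\<^bsub>Fr I\<^esub> x) = a \<odot>\<^bsub>M\<^esub> Frhom I M u x"
      using F.smult_closed[OF a f(1)] M.feval_smult[OF u a f(1)] a by (simp only: Fr_smult Frhom_\<tau>)
  qed
qed

lemma projective_Fr: "projective_module R (Fr I)"
  unfolding projective_module_def
proof (intro conjI allI ballI impI left_module_Fr)
  fix M N :: "('h, 'm) module" and g f
  assume g: "g \<in> module_hom R M N" and f: "f \<in> module_hom R (Fr I) N"
    and "left_module R M \<and> left_module R N \<and> g ` carrier M = carrier N"
  then have M: "left_module R M" and N: "left_module R N" and surj: "g ` carrier M = carrier N" by auto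
  interpret M: left_module R M by fact
  interpret N: left_module R N by fact
  interpret F: left_module R "free_module R I" by (rule left_module_free)
  note fD = module_homD[OF f] and gD = module_homD[OF g]
  let ?e = "\<lambda>i. \<tau> (fgen R i \<one>)"
  define u where "u i = inv_into (carrier M) g (f (?e i))" for i
  have e: "?e i \<in> carrier (Fr I)" if "i \<in> I" for i using fgen_carrier[OF that one_closed] by (simp add: Fr_carrier)
  have u: "u i \<in> carrier M" and gu: "g (u i) = f (?e i)" if "i \<in> I" for i
    using fD(1)[OF e[OF that]] unfolding u_def surj[symmetric] by (simp_all add: inv_into_into f_inv_into_f)
  let ?h = "Frhom I M u"
  have hom: "?h \<in> module_hom R (Fr I) M" by (rule Frhom_hom[OF M u])
  note hD = module_homD[OF hom]
  have eq: "g (?h (\<tau> p)) = f (\<tau> p)" if p: "p \<in> carrier (free_module R I)" for p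
  proof (rule hom_free_eqI[OF N, where a = "\<lambda>p. g (?h (\<tau> p))" and b = "\<lambda>p. f (\<tau> p)"])
    have t: "\<tau> q \<in> carrier (Fr I)" if "q \<in> carrier (free_module R I)" for q using that by (simp add: Fr_carrier)
    show "g (?h (\<tau> q)) \<in> carrier N" "f (\<tau> q) \<in> carrier N" if "q \<in> carrier (free_module R I)" for q
      using t[OF that] hD(1) gD(1) fD(1) by auto
    show "g (?h (\<tau> (q \<oplus>\<^bsub>free_module R I\<^esub> r))) = g (?h (\<tau> q)) \<oplus>\<^bsub>N\<^esub> g (?h (\<tau> r))"
      "f (\<tau> (q \<oplus>\<^bsub>free_module R I\<^esub> r)) = f (\<tau> q) \<oplus>\<^bsub>N\<^esub> f (\<tau> r)"
      if qr: "q \<in> carrier (free_module R I)" "r \<in> carrier (free_module R I)" for q r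
      using t[OF qr(1)] t[OF qr(2)] hD gD fD by (simp_all only: Fr_add[OF qr, symmetric])
    show "g (?h (\<tau> (fgen R i a))) = f (\<tau> (fgen R i a))" if i: "i \<in> I" and a: "a \<in> carrier R" for i a
    proof -
      have "g (?h (\<tau> (fgen R i a))) = a \<odot>\<^bsub>N\<^esub> f (?e i)"
        using Frhom_\<tau>[OF fgen_carrier[OF i a], of M u] M.feval_fgen[OF u i a] gD(3)[OF a u[OF i]] gu[OF i] by simp
      also have "\<dots> = f (a \<odot>\<^bsub>Fr I\<^esub> ?e i)" using fD(3)[OF a e[OF i]] by simp
      also have "a \<odot>\<^bsub>Fr I\<^esub> ?e i = \<tau> (a \<odot>\<^bsub>free_module R I\<^esub> fgen R i \<one>)"
        by (rule Fr_smult[OF a fgen_carrier[OF i one_closed]])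
      also have "a \<odot>\<^bsub>free_module R I\<^esub> fgen R i \<one> = fgen R i a" using a by (auto simp: fgen_def fun_eq_iff)
      finally show ?thesis .
    qed
  qed (fact p)
  have "compose (carrier (Fr I)) g ?h = f"
  proof
    fix x show "compose (carrier (Fr I)) g ?h x = f x"
    proof (cases "x \<in> carrier (Fr I)")
      case True
      then obtain p where "p \<in> carrier (free_module R I)" "x = \<tau> p" unfolding Fr_carrier by (elim imageE)
      then show ?thesis using eq[of p] True by (simp add: compose_def)
    next
      case False
      then show ?thesis using f by (auto simp: compose_def module_hom_def PiE_def extensional_def)
    qed
  qed
  then show "\<exists>h\<in>module_hom R (Fr I) M. compose (carrier (Fr I)) g h = f" using hom by blast
qed

definition cover :: "('h, 'm) module \<Rightarrow> 'm \<Rightarrow> 'm" where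
  "cover M = Frhom (carrier M) M (\<lambda>x. x)"

lemma cover_hom: "left_module R M \<Longrightarrow> cover M \<in> module_hom R (Fr (carrier M)) M"
  unfolding cover_def by (rule Frhom_hom)

lemma cover_surj:
  assumes M: "left_module R M" shows "cover M ` carrier (Fr (carrier M)) = carrier M"
proof
  interpret M: left_module R M by fact
  show "cover M ` carrier (Fr (carrier M)) \<subseteq> carrier M" using module_homD(1)[OF cover_hom[OF M]] by auto
  show "carrier M \<subseteq> cover M ` carrier (Fr (carrier M))"
  proof
    fix x assume x: "x \<in> carrier M"
    have "cover M (\<tau> (fgen R x \<one>)) = x"
      unfolding cover_def
      using Frhom_\<tau>[OF fgen_carrier[OF x one_closed], of M "\<lambda>x. x"] M.feval_fgen[of "carrier M" "\<lambda>x. x", OF _ x one_closed] M.smult_one[OF x]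
      by simp
    moreover have "\<tau> (fgen R x \<one>) \<in> carrier (Fr (carrier M))" using fgen_carrier[OF x one_closed] by (simp add: Fr_carrier)
    ultimately show "x \<in> cover M ` carrier (Fr (carrier M))" by (metis image_eqI)
  qed
qed

primrec syzygy :: "('h, 'm) module \<Rightarrow> nat \<Rightarrow> ('h, 'm) module" where
  "syzygy M 0 = M"
| "syzygy M (Suc n) = kernel_module (Fr (carrier (syzygy M n))) (syzygy M n) (cover (syzygy M n))"

lemma left_module_syzygy: "left_module R M \<Longrightarrow> left_module R (syzygy M n)"
  by (induction n) (auto intro!: left_module_kernel left_module_Fr cover_hom)

text \<open>Each syzygy is covered by the free module on all its elements, and the kernel of this
  cover is the next syzygy. \<open>Ext\<close> refers to a resolution picked by \<open>SOME\<close>;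
  existence is what makes the pick a resolution.\<close>

lemma resolution_exists:
  fixes M :: "('h, 'm) module"
  assumes M: "left_module R M"
  shows "\<exists>r. projective_resolution R M r"
proof -
  let ?K = "syzygy M" and ?P = "\<lambda>n. Fr (carrier (syzygy M n))" and ?d = "\<lambda>n. cover (syzygy M (Suc n))"
  \<comment> \<open>The cover of a syzygy is at the same time a map into the preceding free module,
    because a kernel keeps the operations and shrinks only the carrier.\<close>
  note K = left_module_syzygy[OF M]
  have d: "?d n \<in> module_hom R (?P (Suc n)) (?P n)" for n
    using cover_hom[OF K[of "Suc n"]] by (auto simp: module_hom_def PiE_def Pi_def)
  have im: "?d n ` carrier (?P (Suc n)) = {x \<in> carrier (?P n). cover (?K n) x = \<zero>\<^bsub>?K n\<^esub>}" for n
    using cover_surj[OF K[of "Suc n"]] by simp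
  have z: "\<zero>\<^bsub>?K (Suc n)\<^esub> = \<zero>\<^bsub>?P n\<^esub>" for n by simp
  have "projective_resolution R M (?P, ?d, cover M)"
    unfolding projective_resolution_def prod.case
  proof (intro conjI allI)
    show "projective_module R (?P n)" for n by (rule projective_Fr)
    show "?d n \<in> module_hom R (?P (Suc n)) (?P n)" for n by (rule d)
    show "cover M \<in> module_hom R (?P 0) M" using cover_hom[OF M] by simp
    show "cover M ` carrier (?P 0) = carrier M" using cover_surj[OF M] by simp
    show "?d 0 ` carrier (?P (Suc 0)) = {x \<in> carrier (?P 0). cover M x = \<zero>\<^bsub>M\<^esub>}" using im[of 0] by simp
    show "?d (Suc n) ` carrier (?P (Suc (Suc n))) = {x \<in> carrier (?P (Suc n)). ?d n x = \<zero>\<^bsub>?P n\<^esub>}" for n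
      using im[of "Suc n"] unfolding z .
  qed
  then show ?thesis by blast
qed

text \<open>The identity lifts along the cover by a free module. The lift is transferred from the
  embedded copy back to \<open>free_module\<close>, whose elements have components in the algebra
  and whose acyclicity is known.\<close>

lemma projective_retract:
  fixes P :: "('h, 'm) module"
  assumes P: "projective_module R P"
  obtains i r where "i \<in> module_hom R P (free_module R (carrier P))" "r \<in> module_hom R (free_module R (carrier P)) P"
    "\<And>p. p \<in> carrier P \<Longrightarrow> r (i p) = p"
proof -
  have lm: "left_module R P" using P by (simp add: projective_module_def)
  interpret P: left_module R P by fact
  let ?F = "free_module R (carrier P)"
  interpret F: left_module R ?F by (rule left_module_free)
  have "(\<lambda>x\<in>carrier P. x) \<in> module_hom R P P"
    by (auto simp: module_hom_def P.smult_closed)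
  then have "\<exists>h\<in>module_hom R P (Fr (carrier P)). compose (carrier P) (cover P) h = (\<lambda>x\<in>carrier P. x)"
    using P cover_hom[OF lm] cover_surj[OF lm] left_module_Fr lm unfolding projective_module_def by blast
  then obtain h where h: "h \<in> module_hom R P (Fr (carrier P))" and eq: "compose (carrier P) (cover P) h = (\<lambda>x\<in>carrier P. x)"
    by blast
  note hD = module_homD[OF h]
  let ?s = "inv_into (carrier ?F) \<tau>"
  have s: "?s x \<in> carrier ?F" "\<tau> (?s x) = x" if "x \<in> carrier (Fr (carrier P))" for x
    using that unfolding Fr_carrier by (simp_all add: inv_into_into f_inv_into_f)
  have s\<tau>: "?s (\<tau> f) = f" if "f \<in> carrier ?F" for f using inv_into_f_f[OF \<tau>_inj that] .
  have cD: "cover P (\<tau> (f \<oplus>\<^bsub>?F\<^esub> g)) = cover P (\<tau> f) \<oplus>\<^bsub>P\<^esub> cover P (\<tau> g)" if "f \<in> carrier ?F" "g \<in> carrier ?F" for f g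
    using module_homD(2)[OF cover_hom[OF lm], of "\<tau> f" "\<tau> g"] Fr_add[OF that] that by (simp add: Fr_carrier del: free_module_simps)
  have cS: "cover P (\<tau> (a \<odot>\<^bsub>?F\<^esub> f)) = a \<odot>\<^bsub>P\<^esub> cover P (\<tau> f)" if "a \<in> carrier R" "f \<in> carrier ?F" for a f
    using module_homD(3)[OF cover_hom[OF lm], of a "\<tau> f"] Fr_smult[OF that] that by (simp add: Fr_carrier del: free_module_simps)
  have sA: "?s (x \<oplus>\<^bsub>Fr (carrier P)\<^esub> z) = ?s x \<oplus>\<^bsub>?F\<^esub> ?s z" if "x \<in> carrier (Fr (carrier P))" "z \<in> carrier (Fr (carrier P))" for x z
    using Fr_add[OF s(1)[OF that(1)] s(1)[OF that(2)]] s\<tau>[OF F.M.a_closed[OF s(1)[OF that(1)] s(1)[OF that(2)]]]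
      s(2)[OF that(1)] s(2)[OF that(2)] by (simp del: free_module_simps)
  have sS: "?s (a \<odot>\<^bsub>Fr (carrier P)\<^esub> x) = a \<odot>\<^bsub>?F\<^esub> ?s x" if "a \<in> carrier R" "x \<in> carrier (Fr (carrier P))" for a x
    using Fr_smult[OF that(1) s(1)[OF that(2)]] s\<tau>[OF F.smult_closed[OF that(1) s(1)[OF that(2)]]] s(2)[OF that(2)]
    by (simp del: free_module_simps)
  show thesis
  proof (rule that)
    show "(\<lambda>p\<in>carrier P. ?s (h p)) \<in> module_hom R P ?F"
      unfolding module_hom_def
      using hD s(1) sA sS P.smult_closed by (auto simp del: free_module_simps)
    show "(\<lambda>f\<in>carrier ?F. cover P (\<tau> f)) \<in> module_hom R ?F P"
      unfolding module_hom_def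
      using cD cS F.smult_closed F.M.a_closed module_homD(1)[OF cover_hom[OF lm]]
      by (auto simp: Fr_carrier simp del: free_module_simps)
    show "(\<lambda>f\<in>carrier ?F. cover P (\<tau> f)) ((\<lambda>p\<in>carrier P. ?s (h p)) p) = p" if "p \<in> carrier P" for p
      using that hD(1)[OF that] s[of "h p"] fun_cong[OF eq, of p] by (simp add: compose_def)
  qed
qed

end

section \<open>The global dimension\<close>

lemma (in pbw_hecke) Mon_induct [consumes 1, case_names zero Suc]:
  assumes "m \<in> Mon B" "K (\<lambda>_. 0)" "\<And>m b. m \<in> Mon B \<Longrightarrow> b \<in> B \<Longrightarrow> K m \<Longrightarrow> K (m(b := Suc (m b)))"
  shows "K m"
  using assms(1)
proof (induction "\<Sum>b\<in>B. m b" arbitrary: m)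
  case 0
  then have "m b = 0" for b using B_fin by (cases "b \<in> B") (auto simp: Mon_def)
  then have "m = (\<lambda>_. 0)" by auto
  then show ?case using assms(2) by simp
next
  case (Suc n)
  then obtain b where b: "b \<in> B" "m b \<noteq> 0" by (metis Zero_not_Suc sum.neutral)
  then obtain k where k: "m b = Suc k" by (cases "m b") auto
  let ?m = "m(b := k)"
  have m: "?m \<in> Mon B" using Suc.prems b by (auto simp: Mon_def)
  have "(\<Sum>b\<in>B. m b) = Suc (\<Sum>b\<in>B. ?m b)"
    using B_fin b(1) k by (simp add: sum.remove[of B b])
  then have "K ?m" using Suc.hyps m by simp
  then have "K (?m(b := Suc (?m b)))" by (rule assms(3)[OF m b(1)])
  moreover have "?m(b := Suc (?m b)) = m" using k by (auto simp: fun_eq_iff)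
  ultimately show ?case by simp
qed

text \<open>\<open>\<iota>\<close> embeds the coefficient module into the type of values, and
  \<open>act_range\<close> says that only the image of \<open>\<iota>\<close> survives
  \<open>act \<one>\<close>. Hence the maps in \<open>VG\<close> take values in that image and can
  be read as maps to \<open>N\<close>.\<close>

locale pbw_coeff = pbw_rep H sca W S0 T av scl cr rt \<kappa> y B Y cf act
  for H :: "('h, 'x) ring_scheme" (structure) and sca
    and W S0 :: "('a \<Rightarrow> 'a) set" and T
    and av :: "('a \<Rightarrow> 'a) \<Rightarrow> 't::ab_group_add \<Rightarrow> 't" and scl cr rt \<kappa> y B Y cf
    and act :: "'h \<Rightarrow> 'n::ab_group_add \<Rightarrow> 'n" +
  fixes N :: "('h, 'm) module" and \<iota> :: "'m \<Rightarrow> 'n"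
  assumes N: "left_module H N" and \<iota>_inj: "inj_on \<iota> (carrier N)"
    and \<iota>_add: "n \<in> carrier N \<Longrightarrow> n' \<in> carrier N \<Longrightarrow> \<iota> (n \<oplus>\<^bsub>N\<^esub> n') = \<iota> n + \<iota> n'"
    and \<iota>_act: "h \<in> carrier H \<Longrightarrow> n \<in> carrier N \<Longrightarrow> \<iota> (h \<odot>\<^bsub>N\<^esub> n) = act h (\<iota> n)"
    and act_range: "act \<one> v \<in> \<iota> ` carrier N"
begin

interpretation N: left_module H N by (rule N)

lemma \<iota>_zero: "\<iota> \<zero>\<^bsub>N\<^esub> = 0"
  using \<iota>_add[OF N.M.zero_closed N.M.zero_closed] by simp

lemma \<iota>_unital: "n \<in> carrier N \<Longrightarrow> act \<one> (\<iota> n) = \<iota> n"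
  using \<iota>_act[of \<one> n] N.smult_one by simp

definition hom_form :: "('h, 'p) module \<Rightarrow> ('p \<Rightarrow> 'm) \<Rightarrow> 't list \<Rightarrow> 'p \<Rightarrow> 'n" where
  "hom_form P f = (\<lambda>xs p. if xs = [] \<and> p \<in> carrier P then \<iota> (f p) else 0)"

lemma hom_form_forms:
  assumes P: "left_module H P" and f: "f \<in> module_hom H P N"
  shows "hom_form P f \<in> forms P 0" "closed_form P (hom_form P f)"
proof -
  interpret P: left_module H P by fact
  interpret K: koszul scl "VG P" vsc "VD P" by (rule koszul_VG[OF P])
  note fD = module_homD[OF f]
  have "hom_form P f [] \<in> VG P"
    by (auto simp: VG_def hom_form_def fD \<iota>_add \<iota>_act \<iota>_unital act_zero P.smult_closed)
  moreover have z: "hom_form P f (x # xs) = 0" for x xs by (auto simp: hom_form_def)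
  ultimately have "K.alt 0 (hom_form P f)" by simp
  moreover have "equi P (hom_form P f)"
    by (auto simp: equi_def hom_form_def fD \<iota>_act T_closed act_zero P.smult_closed)
  ultimately show "hom_form P f \<in> forms P 0" by (simp add: forms_def)
  have z': "(\<lambda>ys. hom_form P f (x # ys)) = (\<lambda>_. 0)" for x by (simp add: z)
  have "kd (VD P) xs (hom_form P f) = 0" for xs
  proof (cases xs)
    case (Cons x ys)
    have "VD P x (hom_form P f ys) = 0"
    proof (cases ys)
      case Nil
      then show ?thesis by (auto simp: VD_def hom_form_def fD \<iota>_act y_closed P.smult_closed fun_eq_iff)
    next
      case (Cons x' zs)
      then show ?thesis using K.D_zero z by simp
    qed
    then show ?thesis using Cons K.kd_null[of ys] z' by simp
  qed simp
  then show "closed_form P (hom_form P f)" by (simp add: closed_form_def)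
qed

text \<open>The algebra elements that commute with the value at the empty list are closed under sums
  and products. They contain the scalars by linearity, the \<open>T w\<close> by equivariance and
  the \<open>y x\<close> by closedness, and therefore everything.\<close>

lemma form_hom:
  assumes P: "left_module H P" and \<phi>: "\<phi> \<in> forms P 0" "closed_form P \<phi>"
  shows "\<exists>f\<in>module_hom H P N. hom_form P f = \<phi>"
proof -
  interpret P: left_module H P by fact
  interpret K: koszul scl "VG P" vsc "VD P" by (rule koszul_VG[OF P])
  have alt: "K.alt 0 \<phi>" using \<phi> by (simp add: forms_def)
  have v: "\<phi> [] \<in> VG P" using forms_VG[OF P \<phi>(1)] .
  have z: "\<phi> (x # xs) = 0" for x xs using alt by simp
  let ?v = "\<phi> []"
  let ?K = "{h \<in> carrier H. \<forall>p\<in>carrier P. ?v (h \<odot>\<^bsub>P\<^esub> p) = act h (?v p)}"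
  have mult: "h \<otimes> h' \<in> ?K" if "h \<in> ?K" "h' \<in> ?K" for h h'
    using that by (auto simp: P.smult_assoc act_mult P.smult_closed)
  have sca: "sca c \<in> ?K" for c using VG_sca[OF v] by auto
  have T: "T w \<in> ?K" if w: "w \<in> W" for w
  proof -
    have "\<phi> (map (av w) []) (T w \<odot>\<^bsub>P\<^esub> p) = act (T w) (\<phi> [] p)" if "p \<in> carrier P" for p
      using \<phi>(1) w that unfolding forms_def equi_def by blast
    then show ?thesis using T_closed[OF w] by simp
  qed
  have y: "y x \<in> ?K" for x
  proof -
    have D: "VD P x ?v = 0"
      using \<phi>(2)[unfolded closed_form_def, rule_format, of "[x]"] by simp
    have "?v (y x \<odot>\<^bsub>P\<^esub> p) = act (y x) (?v p)" if "p \<in> carrier P" for p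
      using that fun_cong[OF D, of p] by (simp add: VD_def)
    then show ?thesis using y_closed by simp
  qed
  have Y: "Y m \<in> ?K" if "m \<in> Mon B" for m
    using that
  proof (induction rule: Mon_induct)
    case zero
    show ?case using v by (simp add: Y_zero P.smult_one VG_def)
  next
    case (Suc m b)
    have "y b \<otimes> Y m \<in> ?K" by (rule mult[OF y Suc(3)])
    then show ?case by (simp only: Y_Suc[OF Suc(1,2)])
  qed
  have "carrier H \<subseteq> ?K"
  proof (rule pbw_induct)
    show "h \<oplus> h' \<in> ?K" if "h \<in> ?K" "h' \<in> ?K" for h h'
      using that VG_add[OF v] by (auto simp: P.smult_l_distr act_ladd P.smult_closed)
    show "sca c \<otimes> (T w \<otimes> Y m) \<in> ?K" if "w \<in> W" "m \<in> Mon B" for c w m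
      by (rule mult[OF sca mult[OF T[OF that(1)] Y[OF that(2)]]])
  qed
  then have lin: "?v (h \<odot>\<^bsub>P\<^esub> p) = act h (?v p)" if "h \<in> carrier H" "p \<in> carrier P" for h p
    using that by blast
  have rng: "?v p \<in> \<iota> ` carrier N" for p using act_range[of "?v p"] v by (simp add: VG_def)
  let ?s = "inv_into (carrier N) \<iota>"
  have s: "?s (?v p) \<in> carrier N" "\<iota> (?s (?v p)) = ?v p" for p
    using rng[of p] by (simp_all add: inv_into_into f_inv_into_f)
  have seq: "?s u = n" if "u = \<iota> n" "n \<in> carrier N" for u n using that inv_into_f_f[OF \<iota>_inj] by simp
  let ?f = "\<lambda>p\<in>carrier P. ?s (?v p)"
  have "?f \<in> module_hom H P N"
    unfolding module_hom_def
  proof (intro CollectI conjI ballI)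
    show "?f \<in> carrier P \<rightarrow>\<^sub>E carrier N" using s by auto
    fix p q assume pq: "p \<in> carrier P" "q \<in> carrier P"
    have "?s (?v (p \<oplus>\<^bsub>P\<^esub> q)) = ?s (?v p) \<oplus>\<^bsub>N\<^esub> ?s (?v q)"
      by (rule seq) (use s pq VG_add[OF v pq] in \<open>simp_all add: \<iota>_add\<close>)
    then show "?f (p \<oplus>\<^bsub>P\<^esub> q) = ?f p \<oplus>\<^bsub>N\<^esub> ?f q" using pq by simp
  next
    fix a p assume ap: "a \<in> carrier H" "p \<in> carrier P"
    have "?s (?v (a \<odot>\<^bsub>P\<^esub> p)) = a \<odot>\<^bsub>N\<^esub> ?s (?v p)"
      by (rule seq) (use s ap lin N.smult_closed in \<open>simp_all add: \<iota>_act\<close>)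
    then show "?f (a \<odot>\<^bsub>P\<^esub> p) = a \<odot>\<^bsub>N\<^esub> ?f p" using ap P.smult_closed by simp
  qed
  moreover have "hom_form P ?f = \<phi>"
  proof
    fix xs show "hom_form P ?f xs = \<phi> xs"
      using s VG_outside[OF v] z by (cases xs) (auto simp: hom_form_def fun_eq_iff)
  qed
  ultimately show ?thesis by blast
qed

lemma hom_form_inj:
  assumes "f \<in> module_hom H P N" "g \<in> module_hom H P N" "hom_form P f = hom_form P g"
  shows "f = g"
proof
  fix p show "f p = g p"
  proof (cases "p \<in> carrier P")
    case True
    then have "\<iota> (f p) = \<iota> (g p)" using fun_cong[OF fun_cong[OF assms(3), of "[]"], of p] by (simp add: hom_form_def)
    then show ?thesis using inj_onD[OF \<iota>_inj] module_homD(1)[OF assms(1) True] module_homD(1)[OF assms(2) True] by blast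
  next
    case False
    then show ?thesis using assms by (auto simp: module_hom_def PiE_def extensional_def)
  qed
qed

lemma pull_hom_form:
  assumes "d \<in> module_hom H P P'"
  shows "pull P d (hom_form P' f) = hom_form P (compose (carrier P) f d)"
  using module_homD(1)[OF assms] by (auto simp: pull_def hom_form_def compose_def fun_eq_iff)

end

lemma compose_module_hom:
  assumes "left_module A P" "f \<in> module_hom A P Q" "g \<in> module_hom A Q N"
  shows "compose (carrier P) g f \<in> module_hom A P N"
proof -
  interpret P: left_module A P by fact
  note fD = module_homD[OF assms(2)] and gD = module_homD[OF assms(3)]
  show ?thesis using P.smult_closed by (auto simp: module_hom_def compose_def fD gD)
qed

section \<open>Realisation of a module inside a space of functions\<close>

context pbw_hecke
begin

text \<open>Evaluation embeds \<open>N\<close> into the complex functions on its dual, a type of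
  class \<open>ab_group_add\<close>. A linear retraction onto the image extends the action to the
  whole type, at the price that the unit acts as this retraction.\<close>

lemma rep_exists:
  fixes N :: "('h, 'm) module"
  assumes N: "left_module H N"
  obtains act :: "'h \<Rightarrow> (('m \<Rightarrow> complex) \<Rightarrow> complex) \<Rightarrow> ('m \<Rightarrow> complex) \<Rightarrow> complex" and \<iota>
  where "pbw_coeff H sca W S0 T av scl cr rt \<kappa> y B Y cf act N \<iota>"
proof -
  interpret N: left_module H N by fact
  let ?m = "\<lambda>c p. sca c \<odot>\<^bsub>N\<^esub> p"
  interpret C: complex_space N ?m by (rule module_complex_space[OF N])
  define L where "L = {f :: 'm \<Rightarrow> complex. (\<forall>p\<in>carrier N. \<forall>q\<in>carrier N. f (p \<oplus>\<^bsub>N\<^esub> q) = f p + f q) \<and>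
    (\<forall>c. \<forall>p\<in>carrier N. f (sca c \<odot>\<^bsub>N\<^esub> p) = c * f p)}"
  \<comment> \<open>Evaluation at \<open>n\<close>, cut off to zero at functions that are not linear
    on \<open>N\<close>; only with the cut is it additive in \<open>n\<close>.\<close>
  define \<iota> where "\<iota> n = (\<lambda>f. if f \<in> L then f n else 0)" for n
  have \<iota>_add: "\<iota> (n \<oplus>\<^bsub>N\<^esub> n') = \<iota> n + \<iota> n'" if "n \<in> carrier N" "n' \<in> carrier N" for n n'
    using that by (auto simp: \<iota>_def L_def)
  have \<iota>_sca: "\<iota> (sca c \<odot>\<^bsub>N\<^esub> n) = (\<lambda>f. c * \<iota> n f)" if "n \<in> carrier N" for n c
    using that by (auto simp: \<iota>_def L_def)
  have \<iota>_inj: "inj_on \<iota> (carrier N)"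
  proof (rule inj_onI, rule ccontr)
    fix n n' assume n: "n \<in> carrier N" "n' \<in> carrier N" "\<iota> n = \<iota> n'" "n \<noteq> n'"
    let ?z = "n \<oplus>\<^bsub>N\<^esub> sca (- 1) \<odot>\<^bsub>N\<^esub> n'"
    have z: "?z \<in> carrier N" using n C.m_closed by simp
    have "?z \<noteq> \<zero>\<^bsub>N\<^esub>"
    proof
      assume "?z = \<zero>\<^bsub>N\<^esub>"
      then have "n = \<ominus>\<^bsub>N\<^esub> (sca (- 1) \<odot>\<^bsub>N\<^esub> n')" using n C.m_closed N.M.minus_equality by metis
      then show False using n C.m_minus[of n'] by (simp add: N.M.minus_minus)
    qed
    then obtain f where f: "f ?z = 1" "\<And>p p'. p \<in> carrier N \<Longrightarrow> p' \<in> carrier N \<Longrightarrow> f (p \<oplus>\<^bsub>N\<^esub> p') = f p + f p'"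
      "\<And>c p. p \<in> carrier N \<Longrightarrow> f (sca c \<odot>\<^bsub>N\<^esub> p) = c * f p"
      using C.functional_exists[OF z] by metis
    have "f \<in> L" using f(2,3) by (simp add: L_def)
    then have "f n = f n'" using fun_cong[OF n(3), of f] by (simp add: \<iota>_def)
    moreover have "f ?z = f n + (- 1) * f n'" using f(2)[OF n(1) C.m_closed[OF n(2)]] f(3)[OF n(2)] by simp
    ultimately show False using f(1) by simp
  qed
  \<comment> \<open>The function type as a record, so that the retraction onto the image of
    \<open>\<iota>\<close> comes from the same argument on complements.\<close>
  define V :: "(('m \<Rightarrow> complex) \<Rightarrow> complex) ring"
    where "V = \<lparr>carrier = UNIV, monoid.mult = undefined, monoid.one = undefined, ring.zero = 0, ring.add = (+)\<rparr>"
  have V: "carrier V = UNIV" "\<zero>\<^bsub>V\<^esub> = 0" "u \<oplus>\<^bsub>V\<^esub> v = u + v" for u v by (simp_all add: V_def)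
  have "abelian_group V"
  proof (rule abelian_groupI)
    show "\<exists>v\<in>carrier V. v \<oplus>\<^bsub>V\<^esub> u = \<zero>\<^bsub>V\<^esub>" for u unfolding V by (intro bexI[of _ "- u"]) auto
  qed (auto simp: V add.assoc add.commute)
  then interpret V: complex_space V "\<lambda>c v f. c * v f"
    by (intro complex_space.intro complex_space_axioms.intro) (auto simp: V algebra_simps fun_eq_iff)
  have sub: "V.vsubspace (\<iota> ` carrier N)"
    unfolding V.vsubspace_def V
  proof (intro conjI ballI allI)
    have "\<iota> \<zero>\<^bsub>N\<^esub> = 0" using \<iota>_add[OF N.M.zero_closed N.M.zero_closed] by simp
    then show "0 \<in> \<iota> ` carrier N" by (metis N.M.zero_closed image_eqI)
    fix u v assume "u \<in> \<iota> ` carrier N" "v \<in> \<iota> ` carrier N"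
    then obtain n n' where "n \<in> carrier N" "n' \<in> carrier N" "u = \<iota> n" "v = \<iota> n'" by (elim imageE)
    then show "u + v \<in> \<iota> ` carrier N" using \<iota>_add[of n n'] N.M.a_closed[of n n'] by (metis image_eqI)
  next
    fix c u assume "u \<in> \<iota> ` carrier N"
    then obtain n where "n \<in> carrier N" "u = \<iota> n" by (elim imageE)
    then show "(\<lambda>f. c * u f) \<in> \<iota> ` carrier N" using \<iota>_sca[of n c] C.m_closed[of n c] by (metis image_eqI)
  qed simp
  have "\<exists>\<pi>. (\<forall>v. \<pi> v \<in> \<iota> ` carrier N) \<and> (\<forall>u\<in>\<iota> ` carrier N. \<pi> u = u) \<and> (\<forall>u v. \<pi> (u + v) = \<pi> u + \<pi> v)"
  proof (rule V.projection_exists[OF sub], goal_cases)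
    case (1 \<pi>)
    have "(\<forall>v. \<pi> v \<in> \<iota> ` carrier N) \<and> (\<forall>u\<in>\<iota> ` carrier N. \<pi> u = u) \<and> (\<forall>u v. \<pi> (u + v) = \<pi> u + \<pi> v)"
      using 1(1-3) unfolding V by simp
    then show ?case by (intro exI[of _ \<pi>])
  qed
  then obtain \<pi> where \<pi>': "(\<forall>v. \<pi> v \<in> \<iota> ` carrier N) \<and> (\<forall>u\<in>\<iota> ` carrier N. \<pi> u = u) \<and>
    (\<forall>u v. \<pi> (u + v) = \<pi> u + \<pi> v)" by (rule exE)
  have \<pi>: "\<pi> v \<in> \<iota> ` carrier N" "u \<in> \<iota> ` carrier N \<Longrightarrow> \<pi> u = u" "\<pi> (u + v) = \<pi> u + \<pi> v" for u v
    using \<pi>' by blast+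
  define s where "s v = inv_into (carrier N) \<iota> (\<pi> v)" for v
  have s: "s v \<in> carrier N" "\<iota> (s v) = \<pi> v" for v
    using \<pi>(1)[of v] unfolding s_def by (simp_all add: inv_into_into f_inv_into_f)
  have s\<iota>: "s (\<iota> n) = n" if "n \<in> carrier N" for n
    using that \<pi>(2)[of "\<iota> n"] inv_into_f_f[OF \<iota>_inj that] by (simp add: s_def)
  have s_add: "s (u + v) = s u \<oplus>\<^bsub>N\<^esub> s v" for u v
  proof -
    have "\<iota> (s (u + v)) = \<iota> (s u \<oplus>\<^bsub>N\<^esub> s v)" using s \<pi>(3) \<iota>_add by simp
    then show ?thesis using inj_onD[OF \<iota>_inj] s(1) N.M.a_closed by blast
  qed
  define act where "act h v = \<iota> (h \<odot>\<^bsub>N\<^esub> s v)" for h v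
  have "pbw_coeff H sca W S0 T av scl cr rt \<kappa> y B Y cf act N \<iota>"
  proof (intro pbw_coeff.intro pbw_rep.intro pbw_hecke_axioms pbw_rep_axioms.intro pbw_coeff_axioms.intro N \<iota>_inj)
    show "act (h \<oplus> h') v = act h v + act h' v" if "h \<in> carrier H" "h' \<in> carrier H" for h h' v
      using that s(1)[of v] N.smult_closed by (simp add: act_def N.smult_l_distr \<iota>_add)
    show "act h (u + v) = act h u + act h v" if "h \<in> carrier H" for h u v
      using that s(1) N.smult_closed by (simp add: act_def N.smult_r_distr \<iota>_add s_add)
    show "act (h \<otimes> h') v = act h (act h' v)" if "h \<in> carrier H" "h' \<in> carrier H" for h h' v
      using that s(1)[of v] N.smult_closed by (simp add: act_def N.smult_assoc s\<iota>)
    show "\<iota> (h \<odot>\<^bsub>N\<^esub> n) = act h (\<iota> n)" if "n \<in> carrier N" for h n using that by (simp add: act_def s\<iota>)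
    show "act \<one> v \<in> \<iota> ` carrier N" for v using s(1)[of v] N.smult_one by (simp add: act_def)
  qed (fact \<iota>_add)
  then show thesis by (rule that)
qed

end

section \<open>Cocycles modulo coboundaries\<close>

lemma module_hom_add:
  assumes P: "left_module A P" and N: "left_module A N" and f: "f \<in> module_hom A P N" and g: "g \<in> module_hom A P N"
  shows "(\<lambda>x\<in>carrier P. f x \<oplus>\<^bsub>N\<^esub> g x) \<in> module_hom A P N"
proof -
  interpret P: left_module A P by fact
  interpret N: left_module A N by fact
  note fD = module_homD[OF f] and gD = module_homD[OF g]
  show ?thesis
    unfolding module_hom_def
    by (auto simp: fD gD P.smult_closed N.smult_r_distr N.M.a_ac)
qed

lemma module_hom_minus:
  assumes P: "left_module A P" and N: "left_module A N" and f: "f \<in> module_hom A P N"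
  shows "(\<lambda>x\<in>carrier P. \<ominus>\<^bsub>N\<^esub> f x) \<in> module_hom A P N"
proof -
  interpret P: left_module A P by fact
  interpret N: left_module A N by fact
  note fD = module_homD[OF f]
  have sm: "a \<odot>\<^bsub>N\<^esub> (\<ominus>\<^bsub>N\<^esub> x) = \<ominus>\<^bsub>N\<^esub> (a \<odot>\<^bsub>N\<^esub> x)" if "a \<in> carrier A" "x \<in> carrier N" for a x
  proof -
    have "a \<odot>\<^bsub>N\<^esub> (\<ominus>\<^bsub>N\<^esub> x) \<oplus>\<^bsub>N\<^esub> a \<odot>\<^bsub>N\<^esub> x = \<zero>\<^bsub>N\<^esub>"
      using that N.smult_r_distr[of a "\<ominus>\<^bsub>N\<^esub> x" x] by (simp add: N.M.l_neg N.smult_zero_right)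
    then show ?thesis using N.M.minus_equality[of "a \<odot>\<^bsub>N\<^esub> (\<ominus>\<^bsub>N\<^esub> x)" "a \<odot>\<^bsub>N\<^esub> x"] that by (simp add: N.smult_closed)
  qed
  show ?thesis
    unfolding module_hom_def
    by (auto simp: fD P.smult_closed N.M.minus_add sm)
qed

lemma module_hom_zero_map:
  assumes P: "left_module A P" and N: "left_module A N"
  shows "(\<lambda>x\<in>carrier P. \<zero>\<^bsub>N\<^esub>) \<in> module_hom A P N"
proof -
  interpret P: left_module A P by fact
  interpret N: left_module A N by fact
  show ?thesis by (auto simp: module_hom_def P.smult_closed N.smult_zero_right)
qed

lemma carrier_FactGroup: "carrier (Z Mod B) = (\<lambda>f. B #>\<^bsub>Z\<^esub> f) ` carrier Z" "\<one>\<^bsub>Z Mod B\<^esub> = B"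
  by (auto simp: FactGroup_def RCOSETS_def)

text \<open>The elements of the factor group are cosets, and the coset of a coboundary is the set of
  coboundaries, because sums and differences of homomorphisms on \<open>P k\<close> are
  homomorphisms.\<close>

lemma coboundary_quotient_trivial:
  fixes P :: "nat \<Rightarrow> ('h, 'm) module"
  assumes P: "\<And>n. left_module A (P n)" and N: "left_module A N" and d: "\<And>n. d n \<in> module_hom A (P (Suc n)) (P n)"
    and all: "carrier (ext_cocycles A P d N (Suc k)) \<subseteq> ext_coboundaries A P d N (Suc k)"
  shows "carrier (ext_cocycles A P d N (Suc k) Mod ext_coboundaries A P d N (Suc k))
    = {\<one>\<^bsub>ext_cocycles A P d N (Suc k) Mod ext_coboundaries A P d N (Suc k)\<^esub>}"
proof -
  interpret N: left_module A N by fact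
  interpret Pk: left_module A "P k" by (rule P)
  let ?Z = "ext_cocycles A P d N (Suc k)" and ?B = "ext_coboundaries A P d N (Suc k)" and ?C = "carrier (P (Suc k))"
  note dD = module_homD[OF d]
  have mult: "f \<otimes>\<^bsub>?Z\<^esub> g = (\<lambda>x\<in>?C. f x \<oplus>\<^bsub>N\<^esub> g x)" for f g by (simp add: ext_cocycles_def)
  have coset: "?B #>\<^bsub>?Z\<^esub> f = ?B" if fB: "f \<in> ?B" for f
  proof -
    obtain g where g: "g \<in> module_hom A (P k) N" "f = compose ?C g (d k)" using fB by auto
    note gD = module_homD[OF g(1)]
    have "b \<otimes>\<^bsub>?Z\<^esub> f \<in> ?B" if bB: "b \<in> ?B" for b
    proof -
      obtain g' where g': "g' \<in> module_hom A (P k) N" "b = compose ?C g' (d k)" using bB by auto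
      have "b \<otimes>\<^bsub>?Z\<^esub> f = compose ?C (\<lambda>x\<in>carrier (P k). g' x \<oplus>\<^bsub>N\<^esub> g x) (d k)"
        unfolding mult using g(2) g'(2) dD(1) by (auto simp: compose_def)
      then show ?thesis using module_hom_add[OF P N g'(1) g(1)] by auto
    qed
    moreover have "b \<in> (\<lambda>b. b \<otimes>\<^bsub>?Z\<^esub> f) ` ?B" if bB: "b \<in> ?B" for b
    proof -
      obtain g' where g': "g' \<in> module_hom A (P k) N" "b = compose ?C g' (d k)" using bB by auto
      note g'D = module_homD[OF g'(1)]
      let ?g = "\<lambda>x\<in>carrier (P k). g' x \<oplus>\<^bsub>N\<^esub> (\<lambda>x\<in>carrier (P k). \<ominus>\<^bsub>N\<^esub> g x) x"
      have "?g \<in> module_hom A (P k) N" using module_hom_add[OF P N g'(1) module_hom_minus[OF P N g(1)]] .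
      then have "compose ?C ?g (d k) \<in> ?B" by auto
      moreover have "b = compose ?C ?g (d k) \<otimes>\<^bsub>?Z\<^esub> f"
        unfolding mult using g(2) g'(2) dD(1) g'D(1) gD(1) by (auto simp: compose_def N.M.a_assoc N.M.l_neg)
      ultimately show ?thesis by blast
    qed
    ultimately show ?thesis unfolding r_coset_def by blast
  qed
  have "(\<lambda>x\<in>?C. \<zero>\<^bsub>N\<^esub>) \<in> carrier ?Z"
    using module_hom_zero_map[OF P N] dD(1) by (auto simp: ext_cocycles_def)
  then show ?thesis unfolding carrier_FactGroup using coset all by blast
qed

text \<open>The zero map is a coboundary, so the coset of \<open>f\<close> contains
  \<open>f\<close>; were it the trivial coset, \<open>f\<close> would be a coboundary.\<close>

lemma coboundary_quotient_nontrivial: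
  fixes P :: "nat \<Rightarrow> ('h, 'm) module"
  assumes P: "\<And>n. left_module A (P n)" and N: "left_module A N" and d: "\<And>n. d n \<in> module_hom A (P (Suc n)) (P n)"
    and f: "f \<in> carrier (ext_cocycles A P d N n)" "f \<notin> ext_coboundaries A P d N n"
  shows "carrier (ext_cocycles A P d N n Mod ext_coboundaries A P d N n)
    \<noteq> {\<one>\<^bsub>ext_cocycles A P d N n Mod ext_coboundaries A P d N n\<^esub>}"
proof -
  interpret N: left_module A N by fact
  let ?Z = "ext_cocycles A P d N n" and ?B = "ext_coboundaries A P d N n" and ?z = "\<lambda>x\<in>carrier (P n). \<zero>\<^bsub>N\<^esub>"
  have "?z \<in> ?B"
  proof (cases n)
    case (Suc k)
    have "?z = compose (carrier (P (Suc k))) (\<lambda>x\<in>carrier (P k). \<zero>\<^bsub>N\<^esub>) (d k)"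
      using module_homD(1)[OF d] Suc by (auto simp: compose_def)
    then show ?thesis using module_hom_zero_map[OF P N] Suc by auto
  qed simp
  moreover have "?z \<otimes>\<^bsub>?Z\<^esub> f = f"
  proof
    fix x show "(?z \<otimes>\<^bsub>?Z\<^esub> f) x = f x"
      using f(1) by (cases "x \<in> carrier (P n)") (auto simp: ext_cocycles_def module_hom_def PiE_def extensional_def Pi_iff)
  qed
  ultimately have "f \<in> ?B #>\<^bsub>?Z\<^esub> f" unfolding r_coset_def by force
  then have "?B #>\<^bsub>?Z\<^esub> f \<noteq> ?B" using f(2) by auto
  then show ?thesis unfolding carrier_FactGroup using f(1) by blast
qed

section \<open>Vanishing and nonvanishing of Ext\<close>

locale pbw_universe = pbw_hecke H sca W S0 T av scl cr rt \<kappa> y B Y cf + free_embedded H \<tau>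
  for H :: "('h, 'x) ring_scheme" (structure) and sca
    and W S0 :: "('a \<Rightarrow> 'a) set" and T
    and av :: "('a \<Rightarrow> 'a) \<Rightarrow> 't::ab_group_add \<Rightarrow> 't" and scl cr rt \<kappa> y B Y cf
    and \<tau> :: "('m \<Rightarrow> 'h) \<Rightarrow> 'm"

locale pbw_coeff_universe = pbw_coeff H sca W S0 T av scl cr rt \<kappa> y B Y cf act N \<iota> + free_embedded H \<tau>
  for H :: "('h, 'x) ring_scheme" (structure) and sca
    and W S0 :: "('a \<Rightarrow> 'a) set" and T
    and av :: "('a \<Rightarrow> 'a) \<Rightarrow> 't::ab_group_add \<Rightarrow> 't" and scl cr rt \<kappa> y B Y cf
    and act :: "'h \<Rightarrow> 'n::ab_group_add \<Rightarrow> 'n" and N :: "('h, 'm) module" and \<iota> :: "'m \<Rightarrow> 'n"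
    and \<tau> :: "('m \<Rightarrow> 'h) \<Rightarrow> 'm"
begin

lemma acyclic_projective:
  fixes P :: "('h, 'm) module"
  assumes P: "projective_module H P"
  shows "acyclic_module P"
proof -
  have lm: "left_module H P" using P by (simp add: projective_module_def)
  show ?thesis
  proof (rule projective_retract[OF P])
    fix i r assume "i \<in> module_hom H P (free_module H (carrier P))" "r \<in> module_hom H (free_module H (carrier P)) P"
      "\<And>p. p \<in> carrier P \<Longrightarrow> r (i p) = p"
    then show "acyclic_module P" using acyclic_retract[OF lm left_module_free _ _ _ acyclic_free] by blast
  qed
qed

lemma resolution_acyclic:
  fixes M :: "('h, 'm) module"
  assumes M: "left_module H M" and r: "projective_resolution H M (P, d, e)"
  shows "acyclic_resolution (case_nat M P) (case_nat e d)"
proof -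
  have P: "projective_module H (P n)" and d: "d n \<in> module_hom H (P (Suc n)) (P n)" for n
    using r by (simp_all add: projective_resolution_def)
  have lm: "left_module H (P n)" for n using P by (simp add: projective_module_def)
  have ex: "d 0 ` carrier (P (Suc 0)) = {x \<in> carrier (P 0). e x = \<zero>\<^bsub>M\<^esub>}"
    "d (Suc n) ` carrier (P (Suc (Suc n))) = {x \<in> carrier (P (Suc n)). d n x = \<zero>\<^bsub>P n\<^esub>}" for n
    using r by (simp_all add: projective_resolution_def)
  have e: "e \<in> module_hom H (P 0) M" "e ` carrier (P 0) = carrier M" using r by (simp_all add: projective_resolution_def)
  show ?thesis
    unfolding acyclic_resolution_def
  proof (intro conjI allI)
    fix n
    show "left_module H (case_nat M P n)" using M lm by (cases n) auto
    show "case_nat e d n \<in> module_hom H (case_nat M P (Suc n)) (case_nat M P n)" using e d by (cases n) auto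
    show "case_nat e d (Suc n) ` carrier (case_nat M P (Suc (Suc n)))
        = {x \<in> carrier (case_nat M P (Suc n)). case_nat e d n x = \<zero>\<^bsub>case_nat M P n\<^esub>}"
      using ex by (cases n) auto
    show "acyclic_module (case_nat M P (Suc n))" using acyclic_projective[OF P] by simp
  qed (use e in auto)
qed

text \<open>A cocycle is a closed 0-form killed by the next pullback. The upper chase in form degree
  0 makes it the pullback of a closed 0-form, that is, a coboundary.\<close>

lemma Ext_above:
  fixes M :: "('h, 'm) module"
  assumes M: "left_module H M" and n: "card B < n"
  shows "carrier (Ext H n M N) = {\<one>\<^bsub>Ext H n M N\<^esub>}"
proof -
  obtain P d e where Pde: "(SOME r. projective_resolution H M r) = (P, d, e)" by (metis prod_cases3)
  have r: "projective_resolution H M (P, d, e)"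
    using someI_ex[OF resolution_exists[OF M]] Pde by simp
  have lm: "left_module H (P i)" and d: "d i \<in> module_hom H (P (Suc i)) (P i)" for i
    using r by (simp_all add: projective_resolution_def projective_module_def)
  note R = resolution_acyclic[OF M r]
  obtain k where k: "n = Suc k" using n by (cases n) auto
  have "carrier (ext_cocycles H P d N (Suc k)) \<subseteq> ext_coboundaries H P d N (Suc k)"
  proof
    fix f assume "f \<in> carrier (ext_cocycles H P d N (Suc k))"
    then have f: "f \<in> module_hom H (P (Suc k)) N" and fd: "\<And>x. x \<in> carrier (P (Suc (Suc k))) \<Longrightarrow> f (d (Suc k) x) = \<zero>\<^bsub>N\<^esub>"
      by (auto simp: ext_cocycles_def)
    have "pull (P (Suc (Suc k))) (d (Suc k)) (hom_form (P (Suc k)) f) = (\<lambda>_. 0)"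
      using module_homD(1)[OF d] by (auto simp: pull_def hom_form_def fd \<iota>_zero fun_eq_iff)
    \<comment> \<open>With the augmentation at index 0, \<open>P k\<close> has index
      \<open>Suc k\<close>; the bound of the chase then reads \<open>card B < Suc k\<close>, which
      is the hypothesis.\<close>
    then have "\<exists>\<psi>\<in>forms (P k) 0. closed_form (P k) \<psi> \<and> pull (P (Suc k)) (d k) \<psi> = hom_form (P (Suc k)) f"
      using chase_upper[OF R, of "Suc k" 0 "hom_form (P (Suc k)) f"] n k hom_form_forms[OF lm f] by simp
    then obtain \<psi> where \<psi>: "\<psi> \<in> forms (P k) 0" "closed_form (P k) \<psi>" "pull (P (Suc k)) (d k) \<psi> = hom_form (P (Suc k)) f"
      by blast
    obtain g where g: "g \<in> module_hom H (P k) N" "hom_form (P k) g = \<psi>" using form_hom[OF lm \<psi>(1,2)] by blast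
    have "compose (carrier (P (Suc k))) g (d k) = f"
      by (rule hom_form_inj[OF compose_module_hom[OF lm d g(1)] f])
        (use \<psi>(3) pull_hom_form[OF d, of k g] g(2) in simp)
    then show "f \<in> ext_coboundaries H P d N (Suc k)" using g(1) by auto
  qed
  from coboundary_quotient_trivial[where P = P and d = d, OF lm N d this] show ?thesis
    by (simp add: Ext_def Pde k)
qed

text \<open>If the group were trivial, the reverse zigzag would show the pullback of
  \<open>\<phi>\<close> to the first term to be the pullback of a Koszul differential on
  \<open>M\<close>. The augmentation is onto, so \<open>\<phi>\<close> would agree with that
  differential on \<open>M\<close>.\<close>

lemma Ext_top:
  fixes M :: "('h, 'm) module"
  assumes M: "left_module H M" and D: "card B = Suc j" and \<phi>: "\<phi> \<in> forms M (Suc j)"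
    and no: "\<And>\<psi>. \<psi> \<in> forms M j \<Longrightarrow> \<exists>xs. \<exists>m\<in>carrier M. kosz M \<psi> xs m \<noteq> \<phi> xs m"
  shows "carrier (Ext H (Suc j) M N) \<noteq> {\<one>\<^bsub>Ext H (Suc j) M N\<^esub>}"
proof -
  obtain P d e where Pde: "(SOME r. projective_resolution H M r) = (P, d, e)" by (metis prod_cases3)
  have r: "projective_resolution H M (P, d, e)"
    using someI_ex[OF resolution_exists[OF M]] Pde by simp
  have lm: "left_module H (P i)" and d: "d i \<in> module_hom H (P (Suc i)) (P i)" for i
    using r by (simp_all add: projective_resolution_def projective_module_def)
  have e: "e \<in> module_hom H (P 0) M" "e ` carrier (P 0) = carrier M" using r by (simp_all add: projective_resolution_def)
  note R = resolution_acyclic[OF M r]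
  let ?Z = "carrier (ext_cocycles H P d N (Suc j))" and ?B = "ext_coboundaries H P d N (Suc j)"
  have "\<exists>f. f \<in> ?Z \<and> f \<notin> ?B"
  proof (rule ccontr)
    assume "\<not> ?thesis"
    then have sub: "\<And>f. f \<in> ?Z \<Longrightarrow> f \<in> ?B" by blast
    \<comment> \<open>The assumption that all cocycles are coboundaries, translated from
      homomorphisms to closed 0-forms.\<close>
    have base: "\<exists>\<psi>\<in>forms (P j) 0. closed_form (P j) \<psi> \<and> pull (P (Suc j)) (d j) \<psi> = \<phi>"
      if \<phi>: "\<phi> \<in> forms (P (Suc j)) 0" "closed_form (P (Suc j)) \<phi>" "pull (P (Suc (Suc j))) (d (Suc j)) \<phi> = (\<lambda>_. 0)" for \<phi>
    proof -
      obtain f where f: "f \<in> module_hom H (P (Suc j)) N" "hom_form (P (Suc j)) f = \<phi>" using form_hom[OF lm \<phi>(1,2)] by blast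
      have "f (d (Suc j) x) = \<zero>\<^bsub>N\<^esub>" if x: "x \<in> carrier (P (Suc (Suc j)))" for x
      proof -
        have dx: "d (Suc j) x \<in> carrier (P (Suc j))" using module_homD(1)[OF d x] .
        have "\<phi> [] (d (Suc j) x) = 0" using fun_cong[OF fun_cong[OF \<phi>(3), of "[]"], of x] x by (simp add: pull_def)
        then have "\<iota> (f (d (Suc j) x)) = \<iota> \<zero>\<^bsub>N\<^esub>" using dx f(2)[symmetric] by (simp add: hom_form_def \<iota>_zero)
        moreover have "\<zero>\<^bsub>N\<^esub> \<in> carrier N" by (rule abelian_monoid.zero_closed[OF abelian_group.axioms(1)[OF left_module.axioms(2)[OF N]]])
        ultimately show ?thesis using inj_onD[OF \<iota>_inj] module_homD(1)[OF f(1) dx] by blast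
      qed
      then have "f \<in> ?Z" using f(1) by (simp add: ext_cocycles_def)
      then obtain g where g: "g \<in> module_hom H (P j) N" "f = compose (carrier (P (Suc j))) g (d j)" using sub by fastforce
      have "pull (P (Suc j)) (d j) (hom_form (P j) g) = \<phi>" using pull_hom_form[OF d, of j g] g(2) f(2) by simp
      then show ?thesis using hom_form_forms[OF lm g(1)] by blast
    qed
    let ?Q = "case_nat M P" and ?dl = "case_nat e d"
    have "\<exists>\<psi>\<in>forms (?Q 0) j. pull (?Q (Suc 0)) (?dl 0) (kosz (?Q 0) \<psi>) = pull (P 0) e \<phi>"
    proof (rule chase_lower[OF R, where d = "Suc j"])
      show "\<exists>\<psi>\<in>forms (?Q (Suc j)) 0. closed_form (?Q (Suc j)) \<psi> \<and> pull (?Q (Suc (Suc j))) (?dl (Suc j)) \<psi> = \<phi>"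
        if "\<phi> \<in> forms (?Q (Suc (Suc j))) 0" "closed_form (?Q (Suc (Suc j))) \<phi>"
          "pull (?Q (Suc (Suc (Suc j)))) (?dl (Suc (Suc j))) \<phi> = (\<lambda>_. 0)" for \<phi>
        using base[of \<phi>] that by simp
      show "0 + Suc j = Suc j" by simp
      show "pull (P 0) e \<phi> \<in> forms (?Q (Suc 0)) (Suc j)" using pull_forms[OF lm M e(1) \<phi>] by simp
      \<comment> \<open>The form has top degree, so its differential vanishes for degree
        reasons.\<close>
      have "closed_form M \<phi>"
        using fun_cong[OF forms_above_dim[OF M forms_kosz[OF M \<phi>]]] D by (simp add: closed_form_def)
      then show "closed_form (?Q (Suc 0)) (pull (P 0) e \<phi>)" using closed_pull[OF lm M e(1) \<phi>] by simp
      show "pull (?Q (Suc (Suc 0))) (?dl (Suc 0)) (pull (P 0) e \<phi>) = (\<lambda>_. 0)"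
        using pull_pull_zero[OF R, of \<phi> 0 "Suc j"] \<phi> by simp
    qed
    then obtain \<psi> where \<psi>: "\<psi> \<in> forms M j" "pull (P 0) e (kosz M \<psi>) = pull (P 0) e \<phi>" by auto
    obtain xs m where m: "m \<in> carrier M" "kosz M \<psi> xs m \<noteq> \<phi> xs m" using no[OF \<psi>(1)] by blast
    then obtain p where "p \<in> carrier (P 0)" "m = e p" using e(2) by blast
    then show False using pull_kosz_inj[OF \<psi>(2), of p xs] m(2) by simp
  qed
  then obtain f where "f \<in> ?Z" "f \<notin> ?B" by blast
  from coboundary_quotient_nontrivial[where P = P and d = d, OF lm N d this] show ?thesis by (simp add: Ext_def Pde)
qed

text \<open>The zigzag needs positive degree. In dimension zero the augmentation serves directly: it
  is a nonzero cocycle in degree 0, where the only coboundary is zero.\<close>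

lemma Ext_zero_self:
  assumes nz: "m \<in> carrier N" "m \<noteq> \<zero>\<^bsub>N\<^esub>"
  shows "carrier (Ext H 0 N N) \<noteq> {\<one>\<^bsub>Ext H 0 N N\<^esub>}"
proof -
  obtain P d e where Pde: "(SOME r. projective_resolution H N r) = (P, d, e)" by (metis prod_cases3)
  have r: "projective_resolution H N (P, d, e)"
    using someI_ex[OF resolution_exists[OF N]] Pde by simp
  have lm: "left_module H (P i)" and d: "d i \<in> module_hom H (P (Suc i)) (P i)" for i
    using r by (simp_all add: projective_resolution_def projective_module_def)
  have e: "e \<in> module_hom H (P 0) N" "e ` carrier (P 0) = carrier N"
    and ex: "d 0 ` carrier (P (Suc 0)) = {x \<in> carrier (P 0). e x = \<zero>\<^bsub>N\<^esub>}"
    using r by (simp_all add: projective_resolution_def)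
  have "e (d 0 x) = \<zero>\<^bsub>N\<^esub>" if "x \<in> carrier (P (Suc 0))" for x using ex that by blast
  then have "e \<in> carrier (ext_cocycles H P d N 0)" using e by (simp add: ext_cocycles_def)
  moreover have "e \<notin> ext_coboundaries H P d N 0"
  proof
    assume "e \<in> ext_coboundaries H P d N 0"
    then have "e = (\<lambda>x\<in>carrier (P 0). \<zero>\<^bsub>N\<^esub>)" by simp
    moreover obtain p where "p \<in> carrier (P 0)" "m = e p" using e(2) nz(1) by blast
    ultimately show False using nz(2) by simp
  qed
  ultimately show ?thesis using coboundary_quotient_nontrivial[of H P N d e 0, OF lm N d] by (simp add: Ext_def Pde)
qed

end

section \<open>The principal series module with trivial central character\<close>

context pbw_hecke
begin

lemma Y_mult: "n \<in> Mon B \<Longrightarrow> m \<in> Mon B \<Longrightarrow> Y n \<otimes> Y m = Y (\<lambda>b. n b + m b)"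
proof (induction n rule: Mon_induct)
  case zero
  then show ?case by (simp add: Y_zero Y_closed)
next
  case (Suc n b)
  have nm: "(\<lambda>b. n b + m b) \<in> Mon B" using Suc by (simp add: Mon_def)
  have "Y (n(b := Suc (n b))) \<otimes> Y m = y b \<otimes> Y (\<lambda>b. n b + m b)"
    using Suc by (simp add: Y_Suc[OF Suc(1,2)] m_assoc y_closed Y_closed)
  also have "\<dots> = Y ((\<lambda>b. n b + m b)(b := Suc (n b + m b)))" using Y_Suc[OF nm Suc(2)] by simp
  also have "(\<lambda>b. n b + m b)(b := Suc (n b + m b)) = (\<lambda>b'. (n(b := Suc (n b))) b' + m b')"
    by (auto simp: fun_eq_iff)
  finally show ?case .
qed

text \<open>The coordinates of \<open>h\<close> modulo the left ideal generated by the \<open>y x\<close>.\<close>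

definition c0 :: "'h \<Rightarrow> ('a \<Rightarrow> 'a) \<Rightarrow> complex" where
  "c0 h w = (if w \<in> W then cf h w (\<lambda>_. 0) else 0)"

lemma Mon_zero: "(\<lambda>_. 0) \<in> Mon B" by (simp add: Mon_def)

lemma c0_add: "h \<in> carrier H \<Longrightarrow> h' \<in> carrier H \<Longrightarrow> c0 (h \<oplus> h') w = c0 h w + c0 h' w"
  and c0_sca: "h \<in> carrier H \<Longrightarrow> c0 (sca c \<otimes> h) w = c * c0 h w"
  and c0_zero: "c0 \<zero> w = 0"
  by (simp_all add: c0_def cf_add cf_smult cf_zero)

lemma c0_basis: "u \<in> W \<Longrightarrow> m \<in> Mon B \<Longrightarrow> c0 (T u \<otimes> Y m) w = (if w = u \<and> m = (\<lambda>_. 0) then 1 else 0)"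
  using cf_basis[of u m w "\<lambda>_. 0"] Mon_zero by (auto simp: c0_def)

lemma c0_T: "u \<in> W \<Longrightarrow> c0 (T u) w = (if w = u then 1 else 0)"
  using c0_basis[of u "\<lambda>_. 0" w] Mon_zero T_closed by (simp add: Y_zero)

lemma c0_Y: 
  assumes m: "m \<in> Mon B" "m \<noteq> (\<lambda>_. 0)" and h: "h \<in> carrier H"
  shows "c0 (h \<otimes> Y m) w = 0"
proof -
  have Ym: "Y m \<in> carrier H" using Y_closed m by blast
  have "carrier H \<subseteq> {h \<in> carrier H. c0 (h \<otimes> Y m) w = 0}"
  proof (rule pbw_induct)
    show "h \<oplus> h' \<in> {h \<in> carrier H. c0 (h \<otimes> Y m) w = 0}"
      if "h \<in> {h \<in> carrier H. c0 (h \<otimes> Y m) w = 0}" "h' \<in> {h \<in> carrier H. c0 (h \<otimes> Y m) w = 0}" for h h'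
      using that Ym by (simp add: l_distr c0_add)
    show "sca c \<otimes> (T u \<otimes> Y n) \<in> {h \<in> carrier H. c0 (h \<otimes> Y m) w = 0}" if u: "u \<in> W" and n: "n \<in> Mon B" for c u n
    proof -
      have cl: "T u \<in> carrier H" "Y n \<in> carrier H" using T_closed u Y_closed n by auto
      have nm: "(\<lambda>b. n b + m b) \<in> Mon B" using n m by (simp add: Mon_def)
      have "(\<lambda>b. n b + m b) \<noteq> (\<lambda>_. 0)" using m(2) by (auto simp: fun_eq_iff)
      then have "c0 (T u \<otimes> Y (\<lambda>b. n b + m b)) w = 0" using c0_basis[OF u nm] by simp
      then show ?thesis using cl Ym Y_closed[OF nm] by (simp add: m_assoc Y_mult[OF n m(1)] c0_sca)
    qed
  qed
  then show ?thesis using h by auto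
qed

text \<open>Left multiplication descends to the quotient, as the right side involves
  \<open>h\<close> only through \<open>c0 h\<close>. On \<open>T w\<close> times a nontrivial
  monomial both sides are zero; on \<open>T w\<close> itself the sum has a single term.\<close>

lemma c0_mult:
  assumes a: "a \<in> carrier H" and h: "h \<in> carrier H"
  shows "c0 (a \<otimes> h) u = (\<Sum>w\<in>W. c0 h w * c0 (a \<otimes> T w) u)"
proof -
  let ?K = "{h \<in> carrier H. c0 (a \<otimes> h) u = (\<Sum>w\<in>W. c0 h w * c0 (a \<otimes> T w) u)}"
  have "carrier H \<subseteq> ?K"
  proof (rule pbw_induct)
    show "h \<oplus> h' \<in> ?K" if "h \<in> ?K" "h' \<in> ?K" for h h'
      using that a by (simp add: r_distr c0_add sum.distrib distrib_right)
    show "sca c \<otimes> (T w \<otimes> Y m) \<in> ?K" if w: "w \<in> W" and m: "m \<in> Mon B" for c w m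
    proof -
      have cl: "T w \<in> carrier H" "Y m \<in> carrier H" using T_closed w Y_closed m by auto
      have "a \<otimes> (sca c \<otimes> (T w \<otimes> Y m)) = sca c \<otimes> (a \<otimes> T w \<otimes> Y m)"
        using cl a sca_central[OF a, of c] by (simp add: m_assoc[symmetric])
      then have L: "c0 (a \<otimes> (sca c \<otimes> (T w \<otimes> Y m))) u = c * c0 (a \<otimes> T w \<otimes> Y m) u"
        using cl a by (simp add: c0_sca)
      have R: "(\<Sum>v\<in>W. c0 (sca c \<otimes> (T w \<otimes> Y m)) v * c0 (a \<otimes> T v) u)
          = (\<Sum>v\<in>W. if v = w then (if m = (\<lambda>_. 0) then c * c0 (a \<otimes> T w) u else 0) else 0)"
        by (intro sum.cong refl) (use cl in \<open>auto simp: c0_sca c0_basis[OF w m]\<close>)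
      show ?thesis
      proof (cases "m = (\<lambda>_. 0)")
        case True
        then show ?thesis using L R w W_fin cl a by (simp add: Y_zero)
      next
        case False
        then show ?thesis using L R c0_Y[OF m False, of "a \<otimes> T w" u] cl a by simp
      qed
    qed
  qed
  then show ?thesis using h by blast
qed

lemma c0_y: "c0 (y x) u = 0"
proof -
  have "x \<in> vec.span B" using B_span by simp
  then show ?thesis
  proof (induction rule: vec.span_induct_alt)
    case base
    have "y 0 \<oplus> y 0 = y 0" using y_add[of 0 0] by simp
    then have "y 0 = \<zero>" using y_closed[of 0] by simp
    then show ?case by (simp add: c0_zero)
  next
    case (step c b x)
    have "y b = T id \<otimes> Y ((\<lambda>_. 0)(b := Suc 0))"
      using Y_Suc[OF Mon_zero step(1)] T_id y_closed Y_zero by simp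
    moreover have "(\<lambda>_. 0 :: nat)(b := Suc 0) \<in> Mon B" using step(1) by (simp add: Mon_def)
    moreover have "(\<lambda>_. 0 :: nat)(b := Suc 0) \<noteq> (\<lambda>_. 0)" by (metis Zero_not_Suc fun_upd_same)
    ultimately have "c0 (y b) u = 0" using c0_basis[OF W_id] by simp
    then show ?case using step by (simp add: y_add y_scl c0_add c0_sca y_closed)
  qed
qed

text \<open>The elements of \<open>words l\<close> are products of fewer than \<open>l\<close> simple reflections; multiplication by
  \<open>y x\<close> lowers this filtration, so it acts nilpotently.\<close>

primrec words :: "nat \<Rightarrow> ('a \<Rightarrow> 'a) set" where
  "words 0 = {}"
| "words (Suc l) = insert id (\<Union>s\<in>S0. (\<lambda>w. s \<circ> w) ` words l)"

lemma words_W: "words l \<subseteq> W"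
  by (induction l) (auto simp: W_id subset_iff dest!: S0_W intro!: W_comp)

lemma words_mono: "words l \<subseteq> words (Suc l)"
proof (induction l)
  case (Suc l)
  show ?case
  proof
    fix w assume "w \<in> words (Suc l)"
    then consider "w = id" | s v where "s \<in> S0" "v \<in> words l" "w = s \<circ> v" by auto
    then show "w \<in> words (Suc (Suc l))"
    proof cases
      case 2
      then have "v \<in> words (Suc l)" using Suc by blast
      then show ?thesis using 2 words.simps(2)[of "Suc l"] by blast
    qed simp
  qed
qed simp

text \<open>The filtration is increasing, exhausts the finite group and begins with the empty set,
  so there is a last proper stage. A group element outside it witnesses that the \<open>y x\<close>
  do not reach the whole principal series module.\<close>

lemma words_top: "\<exists>l. words l \<noteq> W \<and> words (Suc l) = W"
proof -
  have un: "W \<subseteq> (\<Union>l. words l)"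
  proof (rule W_gen)
    have "id \<in> words (Suc 0)" by simp
    then show "id \<in> (\<Union>l. words l)" by blast
    fix s w assume "s \<in> S0" "w \<in> (\<Union>l. words l)"
    then obtain l where "s \<in> S0" "w \<in> words l" by blast
    then have "s \<circ> w \<in> words (Suc l)" by auto
    then show "s \<circ> w \<in> (\<Union>l. words l)" by blast
  qed
  have mono: "l \<le> l' \<Longrightarrow> words l \<subseteq> words l'" for l l'
    by (rule lift_Suc_mono_le[of words]) (use words_mono in auto)
  have "\<exists>L. F \<subseteq> words L" if "finite F" "F \<subseteq> W" for F
    using that
  proof (induction F rule: finite_induct)
    case (insert w F)
    then obtain L where L: "F \<subseteq> words L" by auto
    obtain k where k: "w \<in> words k" using insert.prems un by blast
    have "insert w F \<subseteq> words (max L k)" using L k mono[of L "max L k"] mono[of k "max L k"] by auto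
    then show ?case by blast
  qed simp
  then obtain L where L: "words L = W" using W_fin words_W by (metis order_refl subset_antisym)
  let ?l = "LEAST l. words l = W"
  have l: "words ?l = W" by (rule LeastI[of "\<lambda>l. words l = W", OF L])
  have "?l \<noteq> 0" using l W_id by (metis empty_iff words.simps(1))
  then obtain k where k: "?l = Suc k" by (cases ?l) auto
  have "words k \<noteq> W" using not_less_Least[of k "\<lambda>l. words l = W"] k by simp
  then show ?thesis using l k by auto
qed

lemma c0_simple:
  assumes s: "s \<in> S0" and h: "h \<in> carrier H"
  shows "c0 (T s \<otimes> h) u = c0 h (s \<circ> u)"
proof -
  have sW: "s \<in> W" using S0_W[OF s] .
  have ss: "s \<circ> (s \<circ> w) = w" for w using S0_inv[OF s] by (metis comp_assoc id_comp)
  show ?thesis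
  proof (cases "u \<in> W")
    case True
    then have su: "s \<circ> u \<in> W" using W_comp sW by blast
    have "c0 (T s \<otimes> T w) u = (if w = s \<circ> u then 1 else 0)" if "w \<in> W" for w
    proof -
      have "c0 (T (s \<circ> w)) u = (if u = s \<circ> w then 1 else 0)" using c0_T[OF W_comp[OF sW that]] .
      moreover have "u = s \<circ> w \<longleftrightarrow> w = s \<circ> u" using ss by metis
      ultimately show ?thesis by (simp add: T_comp[OF sW that])
    qed
    then have "c0 (T s \<otimes> h) u = (\<Sum>w\<in>W. if w = s \<circ> u then c0 h w else 0)"
      using c0_mult[OF T_closed[OF sW] h, of u] by (auto intro!: sum.cong)
    then show ?thesis using W_fin su by simp
  next
    case False
    then have "s \<circ> u \<notin> W" using W_comp[OF sW, of "s \<circ> u"] ss by metis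
    then show ?thesis using False by (simp add: c0_def)
  qed
qed

text \<open>Moving \<open>y x\<close> past the first letter \<open>s\<close> leaves
  \<open>T s\<close> times \<open>y (av s x)\<close> times the shorter word, plus a multiple of the
  shorter word. In the first term the shorter word loses a letter by induction before
  \<open>s\<close> is restored, in the second \<open>s\<close> is gone; on the empty word
  \<open>y x\<close> vanishes in the quotient. The parameter only weights the second term.\<close>

lemma c0_y_word: "w \<in> words (Suc l) \<Longrightarrow> u \<notin> words l \<Longrightarrow> c0 (y x \<otimes> T w) u = 0"
proof (induction l arbitrary: w u x)
  case 0
  then have w: "w = id" by simp
  show ?case unfolding w T_id by (simp add: y_closed c0_y)
next
  case (Suc l)
  have "w = id \<or> (\<exists>s\<in>S0. \<exists>v\<in>words (Suc l). w = s \<circ> v)"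
    using Suc.prems(1) unfolding words.simps(2)[of "Suc l"] by blast
  then consider "w = id" | s v where "s \<in> S0" "v \<in> words (Suc l)" "w = s \<circ> v" by blast
  then show ?case
  proof cases
    case 1
    show ?thesis unfolding 1 T_id by (simp add: y_closed c0_y)
  next
    case 2
    have sW: "s \<in> W" and vW: "v \<in> W" using 2 S0_W words_W by blast+
    have cl: "T s \<in> carrier H" "T v \<in> carrier H" using T_closed sW vW by auto
    have "y x \<otimes> T w = (y x \<otimes> T s) \<otimes> T v" using cl by (simp add: 2 T_comp[OF sW vW] m_assoc y_closed)
    also have "\<dots> = T s \<otimes> (y (av s x) \<otimes> T v) \<oplus> sca (\<kappa> s * cr s x) \<otimes> T v"
      using cl by (simp add: cross[OF 2(1)] l_distr m_assoc y_closed)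
    finally have "c0 (y x \<otimes> T w) u = c0 (y (av s x) \<otimes> T v) (s \<circ> u) + \<kappa> s * cr s x * c0 (T v) u"
      using cl by (simp add: c0_add c0_sca c0_simple[OF 2(1)] y_closed)
    moreover have "s \<circ> u \<notin> words l"
    proof
      assume "s \<circ> u \<in> words l"
      then have "s \<circ> (s \<circ> u) \<in> words (Suc l)" using 2(1) by auto
      moreover have "s \<circ> (s \<circ> u) = u" using S0_inv[OF 2(1)] by (metis comp_assoc id_comp)
      ultimately show False using Suc.prems(2) by simp
    qed
    moreover have "u \<noteq> v" using Suc.prems(2) 2(2) by auto
    ultimately show ?thesis using Suc.IH[OF 2(2)] by (simp add: c0_T[OF vW])
  qed
qed

lemma c0_y_lower:
  assumes h: "h \<in> carrier H" and sup: "\<And>u. u \<notin> words (Suc l) \<Longrightarrow> c0 h u = 0" and u: "u \<notin> words l"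
  shows "c0 (y x \<otimes> h) u = 0"
proof -
  have z: "c0 h w * c0 (y x \<otimes> T w) u = 0" for w
    using sup[of w] c0_y_word[OF _ u, of w x] by (cases "w \<in> words (Suc l)") auto
  show ?thesis by (simp only: c0_mult[OF y_closed h] z sum.neutral_const)
qed

definition regular_module :: "('h, 'h) module" where
  "regular_module = \<lparr>carrier = carrier H, monoid.mult = undefined, monoid.one = undefined, ring.zero = \<zero>,
     ring.add = (\<lambda>x z. x \<oplus> z), module.smult = (\<lambda>a x. a \<otimes> x)\<rparr>"

lemma regular_module_simps [simp]:
  "carrier regular_module = carrier H" "x \<oplus>\<^bsub>regular_module\<^esub> z = x \<oplus> z" "\<zero>\<^bsub>regular_module\<^esub> = \<zero>"
  "a \<odot>\<^bsub>regular_module\<^esub> x = a \<otimes> x"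
  by (simp_all add: regular_module_def)

lemma left_module_regular: "left_module H regular_module"
proof -
  have "abelian_group regular_module"
  proof (rule abelian_groupI)
    show "\<exists>z\<in>carrier regular_module. z \<oplus>\<^bsub>regular_module\<^esub> x = \<zero>\<^bsub>regular_module\<^esub>" if "x \<in> carrier regular_module" for x
      using that by (intro bexI[of _ "\<ominus> x"]) (auto simp: l_neg)
  qed (auto simp: a_ac)
  then show ?thesis
    by (intro left_module.intro left_module_axioms.intro ring_axioms) (auto simp: l_distr r_distr m_assoc)
qed

end

text \<open>An iterated wedge product of coordinate functionals. The induction also records that the
  form vanishes on basis vectors not yet used; contracting the next wedge with its own vector
  therefore returns the previous form, and the value stays 1.\<close>

lemma (in form_space) wedge_exists:
  assumes B: "finite B" "span B = UNIV" "independent B"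
  shows "\<exists>\<phi> xs. form_space.alt scl (UNIV :: complex set) (*) (card B) \<phi> \<and> \<phi> xs = 1"
proof -
  interpret C: form_space scl "UNIV :: complex set" "(*)" by unfold_locales (auto simp: algebra_simps)
  let ?c = "representation B"
  have add: "?c (x + x') b = ?c x b + ?c x' b" for x x' b
    using representation_add[of B x' x] B by simp
  have scl: "?c (scl k x) b = k * ?c x b" for k x b
    using representation_scale[of B x k] B by simp
  have bas: "?c b b' = (if b' = b then 1 else 0)" if "b \<in> B" for b b'
    using representation_basis[of B b] B that by auto
  have "\<exists>\<phi>. C.alt (length bs) \<phi> \<and> \<phi> bs = 1 \<and> (\<forall>b\<in>B - set bs. \<forall>ys. \<phi> (b # ys) = 0)"
    if "distinct bs" "set bs \<subseteq> B" for bs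
    using that
  proof (induction bs)
    case Nil
    show ?case by (rule exI[of _ "\<lambda>xs. if xs = [] then 1 else 0"]) simp
  next
    case (Cons b bs)
    then obtain \<phi> where \<phi>: "C.alt (length bs) \<phi>" "\<phi> bs = 1" "\<And>b ys. b \<in> B - set bs \<Longrightarrow> \<phi> (b # ys) = 0" by auto
    interpret K: koszul scl "UNIV :: complex set" "(*)" "\<lambda>x. (*) (?c x b)"
      by (rule C.koszul_wedge) (auto simp: add scl)
    let ?\<psi> = "\<lambda>xs. kd (\<lambda>x. (*) (?c x b)) xs \<phi>"
    have z: "(\<lambda>ys. \<phi> (b' # ys)) = (\<lambda>_. 0)" if "b' \<in> B - set bs" for b' using \<phi>(3)[OF that] by auto
    have "C.alt (length (b # bs)) ?\<psi>" using K.alt_kd[OF \<phi>(1)] by simp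
    moreover have "?\<psi> (b # bs) = 1"
      using bas[of b b] z[of b] Cons.prems \<phi>(2) K.kd_null by simp
    moreover have "?\<psi> (b' # ys) = 0" if "b' \<in> B - set (b # bs)" for b' ys
      using bas[of b' b] z[of b'] that K.kd_null by auto
    ultimately show ?case by blast
  qed
  moreover obtain bs where "set bs = B" "distinct bs" using finite_distinct_list[OF B(1)] by blast
  ultimately show ?thesis using distinct_card[of bs] by fastforce
qed

section \<open>The principal series module and its top self-extension\<close>

locale pbw_principal = pbw_universe H sca W S0 T av scl cr rt \<kappa> y B Y cf \<tau>
  for H :: "('h, 'x) ring_scheme" (structure) and sca
    and W S0 :: "('a \<Rightarrow> 'a) set" and T
    and av :: "('a \<Rightarrow> 'a) \<Rightarrow> 't::ab_group_add \<Rightarrow> 't" and scl cr rt \<kappa> y B Y cf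
    and \<tau> :: "('m \<Rightarrow> 'h) \<Rightarrow> 'm" +
  fixes \<eta> :: "'h \<Rightarrow> 'm"
  assumes \<eta>: "inj_on \<eta> (carrier H)"
begin

text \<open>The quotient map from the regular module, by the left ideal on which \<open>c0\<close>
  vanishes, to the module induced from the trivial character. The quotient has to be carried by
  \<open>'m\<close>, so a class is named by a chosen representative moved there by
  \<open>\<eta>\<close>.\<close>

definition pr :: "'h \<Rightarrow> 'm" where
  "pr h = \<eta> (SOME h'. h' \<in> carrier H \<and> c0 h' = c0 h)"

lemma pr_eq_iff: assumes "h \<in> carrier H" "h' \<in> carrier H" shows "pr h = pr h' \<longleftrightarrow> c0 h = c0 h'"
proof
  assume "c0 h = c0 h'"
  then show "pr h = pr h'" by (simp add: pr_def)
next
  define r where "r h = (SOME h'. h' \<in> carrier H \<and> c0 h' = c0 h)" for h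
  have s: "r h \<in> carrier H" "c0 (r h) = c0 h" if "h \<in> carrier H" for h
    using someI[of "\<lambda>h'. h' \<in> carrier H \<and> c0 h' = c0 h" h] that by (simp_all add: r_def)
  assume "pr h = pr h'"
  then have "\<eta> (r h) = \<eta> (r h')" by (simp add: pr_def r_def)
  then have "r h = r h'" by (rule inj_onD[OF \<eta>]) (use s assms in simp_all)
  then show "c0 h = c0 h'" using s(2)[OF assms(1)] s(2)[OF assms(2)] by simp
qed

lemma pr_quotient: "module_quotient H regular_module pr"
proof (intro module_quotient.intro left_module_regular module_quotient_axioms.intro)
  fix p q p' q' assume h: "p \<in> carrier regular_module" "q \<in> carrier regular_module" "p' \<in> carrier regular_module"
    "q' \<in> carrier regular_module" "pr p = pr p'" "pr q = pr q'"
  then have "c0 p = c0 p'" "c0 q = c0 q'" using pr_eq_iff by auto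
  then show "pr (p \<oplus>\<^bsub>regular_module\<^esub> q) = pr (p' \<oplus>\<^bsub>regular_module\<^esub> q')"
    using h by (simp add: pr_eq_iff c0_add fun_eq_iff)
next
  fix a p p' assume h: "a \<in> carrier H" "p \<in> carrier regular_module" "p' \<in> carrier regular_module" "pr p = pr p'"
  then have "c0 p = c0 p'" using pr_eq_iff by auto
  then show "pr (a \<odot>\<^bsub>regular_module\<^esub> p) = pr (a \<odot>\<^bsub>regular_module\<^esub> p')"
    using h by (simp add: pr_eq_iff c0_mult[of a p] c0_mult[of a p'] fun_eq_iff)
qed

definition PS :: "('h, 'm) module" where "PS = image_module regular_module pr"

lemma left_module_PS: "left_module H PS"
  unfolding PS_def by (rule module_quotient.left_module_image[OF pr_quotient])

lemma PS_carrier: "carrier PS = pr ` carrier H"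
  and PS_zero: "\<zero>\<^bsub>PS\<^esub> = pr \<zero>"
  and PS_add: "h \<in> carrier H \<Longrightarrow> h' \<in> carrier H \<Longrightarrow> pr h \<oplus>\<^bsub>PS\<^esub> pr h' = pr (h \<oplus> h')"
  and PS_smult: "a \<in> carrier H \<Longrightarrow> h \<in> carrier H \<Longrightarrow> a \<odot>\<^bsub>PS\<^esub> pr h = pr (a \<otimes> h)"
  using module_quotient.image_carrier[OF pr_quotient] module_quotient.image_zero[OF pr_quotient]
    module_quotient.image_add[OF pr_quotient] module_quotient.image_smult[OF pr_quotient]
  by (simp_all add: PS_def)

definition lam :: "('a \<Rightarrow> 'a) \<Rightarrow> 'm \<Rightarrow> complex" where
  "lam w m = c0 (inv_into (carrier H) pr m) w"

lemma lam_pr: "h \<in> carrier H \<Longrightarrow> lam w (pr h) = c0 h w"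
  using pr_eq_iff[of "inv_into (carrier H) pr (pr h)" h]
  by (simp add: lam_def inv_into_into f_inv_into_f)

lemma PS_nonzero: "pr \<one> \<in> carrier PS" "pr \<one> \<noteq> \<zero>\<^bsub>PS\<^esub>"
proof -
  have "c0 \<one> id = 1" using c0_T[OF W_id, of id] by (simp add: T_id)
  then have "c0 \<one> \<noteq> c0 \<zero>" by (metis c0_zero zero_neq_one)
  then show "pr \<one> \<noteq> \<zero>\<^bsub>PS\<^esub>" by (simp add: PS_zero pr_eq_iff)
qed (simp add: PS_carrier)

text \<open>The form is a volume form times the rank one map that sends the generator to a class in
  the last step of the filtration, made equivariant. It is no Koszul differential: the
  \<open>y x\<close> kill the generator, so there a differential takes only values that are sums of
  \<open>y x\<close> acting on something, and these stay in the previous step.\<close>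

lemma Ext_PS: "carrier (Ext H (card B) PS PS) \<noteq> {\<one>\<^bsub>Ext H (card B) PS PS\<^esub>}"
proof (rule rep_exists[OF left_module_PS])
  fix act :: "'h \<Rightarrow> (('m \<Rightarrow> complex) \<Rightarrow> complex) \<Rightarrow> ('m \<Rightarrow> complex) \<Rightarrow> complex" and \<iota>
  assume C: "pbw_coeff H sca W S0 T av scl cr rt \<kappa> y B Y cf act PS \<iota>"
  interpret C: pbw_coeff_universe H sca W S0 T av scl cr rt \<kappa> y B Y cf act PS \<iota> \<tau>
    by (intro pbw_coeff_universe.intro C free_embedded_axioms)
  interpret P: left_module H PS by (rule left_module_PS)
  interpret F: form_space scl "C.VG PS" C.vsc by (rule C.form_space_VG[OF left_module_PS])
  interpret U: form_space scl "UNIV :: complex set" "(*)" by unfold_locales (auto simp: algebra_simps)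
  show ?thesis
  proof (cases "card B")
    case 0
    then show ?thesis using C.Ext_zero_self[OF PS_nonzero] by simp
  next
    case (Suc j)
    obtain l where l: "words l \<noteq> W" "words (Suc l) = W" using words_top by blast
    obtain w0 where w0: "w0 \<in> W" "w0 \<notin> words l" using l words_W[of l] by blast
    let ?m0 = "pr \<one>" and ?n0 = "pr (T w0)"
    have n0: "?n0 \<in> carrier PS" using T_closed[OF w0(1)] by (simp add: PS_carrier)
    \<comment> \<open>The elements supported on \<open>words l\<close>, viewed among the values of
      forms. Every \<open>y x\<close> maps the module into this part, and the class of
      \<open>T w0\<close> lies outside it.\<close>
    define A where "A = \<iota> ` {m \<in> carrier PS. \<forall>u. u \<notin> words l \<longrightarrow> lam u m = 0}"
    have A_minus: "u - v \<in> A" if uv: "u \<in> A" "v \<in> A" for u v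
    proof -
      obtain h h' where h: "h \<in> carrier H" "u = \<iota> (pr h)" "\<And>w. w \<notin> words l \<Longrightarrow> c0 h w = 0"
        "h' \<in> carrier H" "v = \<iota> (pr h')" "\<And>w. w \<notin> words l \<Longrightarrow> c0 h' w = 0"
        using uv by (auto simp: A_def PS_carrier lam_pr)
      have pc: "pr h \<in> carrier PS" "pr h' \<in> carrier PS" using h by (auto simp: PS_carrier)
      have "\<iota> (pr (sca (- 1) \<otimes> h')) = - v"
        using C.\<iota>_act[OF sca_closed pc(2), of "- 1"] h(4,5) C.\<iota>_unital[OF pc(2)]
        by (simp add: PS_smult sca_minus sca_one C.act_lminus)
      then have "u - v = \<iota> (pr (h \<oplus> sca (- 1) \<otimes> h'))"
        using h C.\<iota>_add[of "pr h" "pr (sca (- 1) \<otimes> h')"] by (simp add: PS_add[symmetric] PS_carrier)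
      moreover have "lam w (pr (h \<oplus> sca (- 1) \<otimes> h')) = 0" if "w \<notin> words l" for w
        using h that by (simp add: lam_pr c0_add c0_sca)
      ultimately show ?thesis using h(1,4) unfolding A_def by (auto simp: PS_carrier intro!: imageI)
    qed
    have A_zero: "0 \<in> A"
      unfolding A_def using C.\<iota>_zero by (intro image_eqI[of _ _ "\<zero>\<^bsub>PS\<^esub>"]) (simp_all add: PS_zero lam_pr c0_zero PS_carrier)
    have A_y: "act (y x) v \<in> A" if v: "v \<in> \<iota> ` carrier PS" for x v
    proof -
      obtain h where h: "h \<in> carrier H" "v = \<iota> (pr h)" using v unfolding PS_carrier by (elim imageE) simp
      have "act (y x) v = \<iota> (pr (y x \<otimes> h))"
        using C.\<iota>_act[OF y_closed, of "pr h" x] h by (simp add: PS_carrier PS_smult y_closed)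
      moreover have sup: "c0 h u = 0" if "u \<notin> words (Suc l)" for u
        using that unfolding l(2) by (simp add: c0_def)
      have "lam u (pr (y x \<otimes> h)) = 0" if u: "u \<notin> words l" for u
        using c0_y_lower[OF h(1) sup u, of x] h(1) by (simp add: lam_pr y_closed)
      ultimately show ?thesis unfolding A_def using h(1) y_closed by (auto simp: PS_carrier intro!: imageI)
    qed
    have n0A: "\<iota> ?n0 \<notin> A"
    proof
      assume "\<iota> ?n0 \<in> A"
      then obtain m where m: "m \<in> carrier PS" "\<iota> ?n0 = \<iota> m" "lam w0 m = 0" using w0(2) by (auto simp: A_def)
      then have "?n0 = m" using inj_onD[OF C.\<iota>_inj _ n0] by blast
      then show False using m(3) lam_pr[OF T_closed[OF w0(1)], of w0] c0_T[OF w0(1), of w0] by simp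
    qed
    \<comment> \<open>In each operator the term with \<open>y x\<close> on the generator drops out
      and minus \<open>y x\<close> of a value remains; the recursion of \<open>kd\<close> only forms
      differences of such elements.\<close>
    have kA: "kd (C.VD PS) xs a ?m0 \<in> A" if "\<And>ys. a ys \<in> C.VG PS" for xs a
      using that
    proof (induction xs arbitrary: a)
      case Nil
      have "(0 :: 'm \<Rightarrow> ('m \<Rightarrow> complex) \<Rightarrow> complex) ?m0 = 0" by (rule ext) simp
      then show ?case unfolding kd.simps using A_zero by (simp only:)
    next
      case (Cons x xs)
      have v: "a xs \<in> C.VG PS" by (rule Cons.prems)
      have m0: "?m0 \<in> carrier PS" by (rule PS_nonzero(1))
      have "y x \<odot>\<^bsub>PS\<^esub> ?m0 = \<zero>\<^bsub>PS\<^esub>"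
        by (simp add: PS_smult PS_zero y_closed pr_eq_iff c0_y c0_zero fun_eq_iff)
      moreover have "a xs \<zero>\<^bsub>PS\<^esub> = 0"
        using C.VG_add[OF v P.M.zero_closed P.M.zero_closed] by simp
      ultimately have "C.VD PS x (a xs) ?m0 = 0 - act (y x) (a xs ?m0)" using m0 by (simp add: C.VD_def)
      moreover have "act \<one> (a xs ?m0) = a xs ?m0" using v by (simp add: C.VG_def)
      then have "a xs ?m0 \<in> \<iota> ` carrier PS" using C.act_range[of "a xs ?m0"] by simp
      ultimately have "C.VD PS x (a xs) ?m0 \<in> A" using A_minus[OF A_zero A_y] by simp
      moreover have "kd (C.VD PS) xs (\<lambda>ys. a (x # ys)) ?m0 \<in> A" by (rule Cons.IH) (rule Cons.prems)
      moreover have "kd (C.VD PS) (x # xs) a ?m0 = C.VD PS x (a xs) ?m0 - kd (C.VD PS) xs (\<lambda>ys. a (x # ys)) ?m0"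
        by (rule ext) simp
      ultimately show ?case using A_minus by (simp only:)
    qed
    obtain vol :: "'t list \<Rightarrow> complex" and xs0 where vol: "U.alt (card B) vol" "vol xs0 = 1"
      using F.wedge_exists[OF B_fin B_span B_indep] by blast
    have lam_add: "lam w (m \<oplus>\<^bsub>PS\<^esub> m') = lam w m + lam w m'" if "m \<in> carrier PS" "m' \<in> carrier PS" for w m m'
      using that by (auto simp: PS_carrier PS_add lam_pr c0_add)
    have lam_sca: "lam w (sca c \<odot>\<^bsub>PS\<^esub> m) = c * lam w m" if "m \<in> carrier PS" for w c m
      using that by (auto simp: PS_carrier PS_smult lam_pr c0_sca)
    have Tsca: "T w \<odot>\<^bsub>PS\<^esub> (sca c \<odot>\<^bsub>PS\<^esub> q) = sca c \<odot>\<^bsub>PS\<^esub> (T w \<odot>\<^bsub>PS\<^esub> q)" if "w \<in> W" "q \<in> carrier PS" for w c q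
      using that sca_central[OF T_closed, of w c] by (simp add: P.smult_assoc[symmetric] T_closed)
    note Tc = P.smult_closed[OF T_closed] P.smult_closed[OF sca_closed]
    \<comment> \<open>The summand at \<open>w\<close> of an orbit sum: a number, later the volume of
      the arguments moved by \<open>w\<close>, times the coordinate at \<open>id\<close>, times
      \<open>?n0\<close>. No division by the group order is made, because at the generator only
      \<open>w = id\<close> contributes.\<close>
    define fw where "fw w c = (\<lambda>m. if m \<in> carrier PS
      then act (sca (c * lam id (T w \<odot>\<^bsub>PS\<^esub> m))) (act (T (inv_into UNIV w)) (\<iota> ?n0)) else 0)" for w c
    define \<phi> where "\<phi> = (\<lambda>xs. \<Sum>w\<in>W. fw w (vol (map (av w) xs)))"
    have "F.alt (card B) (\<lambda>xs. fw w (vol (map (av w) xs)))" if w: "w \<in> W" for w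
    proof (rule alt_map[OF U.form_space_axioms F.form_space_axioms, where K = UNIV and f = "fw w"
          and \<phi> = "\<lambda>xs. vol (map (av w) xs)"])
      show "U.alt (card B) (\<lambda>xs. vol (map (av w) xs))"
        by (rule U.alt_comp_linear[OF av_add[OF w] av_scl[OF w] vol(1)])
      show "fw w c \<in> C.VG PS" for c
        unfolding C.VG_def
        by (auto simp: fw_def Tc w P.smult_r_distr T_closed lam_add lam_sca Tsca distrib_left sca_add C.act_ladd
            C.act_one_act C.act_zero C.act_mult[symmetric] sca_mult[symmetric] mult_ac)
      show "fw w (c + c') = fw w c + fw w c'" for c c'
        by (auto simp: fw_def distrib_right sca_add C.act_ladd fun_eq_iff)
      show "fw w (c * c') = C.vsc c (fw w c')" for c c'
        by (auto simp: fw_def C.vsc_def C.act_zero C.act_mult sca_mult m_assoc fun_eq_iff)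
      show "fw w 0 = 0" by (auto simp: fw_def sca_zero C.act_lzero)
    qed simp
    then have alt: "F.alt (card B) \<phi>" unfolding \<phi>_def by (rule F.alt_sum)
    have eq: "C.equi PS \<phi>"
      unfolding C.equi_def
    proof (intro ballI allI)
      fix u xs m assume u: "u \<in> W" and m: "m \<in> carrier PS"
      let ?t = "\<lambda>w. act (sca (vol (map (av w) xs) * lam id (T w \<odot>\<^bsub>PS\<^esub> m))) (act (T (inv_into UNIV w)) (\<iota> ?n0))"
      have "fw w (vol (map (av w) (map (av u) xs))) (T u \<odot>\<^bsub>PS\<^esub> m) = act (T u) (?t (w \<circ> u))" if w: "w \<in> W" for w
      proof -
        have wu: "w \<circ> u \<in> W" "inv_into UNIV (w \<circ> u) \<in> W" using W_comp[OF w u] inv_W by auto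
        have "T (inv_into UNIV w) = T u \<otimes> T (inv_into UNIV (w \<circ> u))"
          using T_comp[OF u wu(2)] C.inv_W_comp[OF u w] by simp
        moreover have "av (w \<circ> u) = av w \<circ> av u" using av_comp[OF w u] by auto
        moreover have "T (w \<circ> u) \<odot>\<^bsub>PS\<^esub> m = T w \<odot>\<^bsub>PS\<^esub> (T u \<odot>\<^bsub>PS\<^esub> m)"
          using T_comp[OF w u] m T_closed w u by (simp add: P.smult_assoc)
        ultimately show ?thesis
          using Tc(1)[OF u m] T_closed[OF u] T_closed[OF wu(2)] C.act_sca_comm[OF T_closed[OF u]] by (simp add: fw_def C.act_mult)
      qed
      then have "\<phi> (map (av u) xs) (T u \<odot>\<^bsub>PS\<^esub> m) = (\<Sum>w\<in>W. act (T u) (?t (w \<circ> u)))"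
        unfolding \<phi>_def sum_fun_app[where q = "T u \<odot>\<^bsub>PS\<^esub> m"] by (intro sum.cong refl)
      also have "\<dots> = (\<Sum>w\<in>W. act (T u) (?t w))" by (rule sum.reindex_bij_betw[OF C.bij_betw_W_right[OF u]])
      also have "\<dots> = act (T u) (\<phi> xs m)" using m by (simp only: \<phi>_def sum_fun_app[where q = m] fw_def C.act_sum[OF T_closed[OF u]] if_True)
      finally show "\<phi> (map (av u) xs) (T u \<odot>\<^bsub>PS\<^esub> m) = act (T u) (\<phi> xs m)" .
    qed
    have \<phi>0: "\<phi> xs0 ?m0 = \<iota> ?n0"
    proof -
      have "fw w (vol (map (av w) xs0)) ?m0 = (if w = id then \<iota> ?n0 else 0)" if w: "w \<in> W" for w
      proof -
        have "lam id (T w \<odot>\<^bsub>PS\<^esub> ?m0) = (if w = id then 1 else 0)"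
          using T_closed[OF w] c0_T[OF w, of id] by (simp add: PS_smult lam_pr eq_commute[of id])
        moreover have "map (av id) xs0 = xs0" by (simp add: map_idI av_id)
        moreover have "inv_into UNIV id = (id :: 'a \<Rightarrow> 'a)" by simp
        ultimately show ?thesis
          using PS_nonzero(1) vol(2) C.\<iota>_unital[OF n0] by (auto simp: fw_def sca_zero sca_one C.act_lzero T_id)
      qed
      then have "\<phi> xs0 ?m0 = (\<Sum>w\<in>W. if w = id then \<iota> ?n0 else 0)"
        unfolding \<phi>_def sum_fun_app[where q = ?m0] by (intro sum.cong refl)
      then show ?thesis using W_fin W_id by simp
    qed
    have "\<exists>xs. \<exists>m\<in>carrier PS. C.kosz PS \<psi> xs m \<noteq> \<phi> xs m" if \<psi>: "\<psi> \<in> C.forms PS j" for \<psi>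
    proof -
      have "C.kosz PS \<psi> xs0 ?m0 \<in> A" by (rule kA) (rule C.forms_VG[OF left_module_PS \<psi>])
      then have "C.kosz PS \<psi> xs0 ?m0 \<noteq> \<phi> xs0 ?m0" using n0A \<phi>0 by auto
      then show ?thesis using PS_nonzero(1) by blast
    qed
    moreover have "\<phi> \<in> C.forms PS (Suc j)" using alt eq Suc by (simp add: C.forms_def)
    ultimately show ?thesis using C.Ext_top[OF left_module_PS Suc] Suc by simp
  qed
qed

theorem global_dimension_pbw: "global_dimension TYPE('m) H = enat (card B)"
proof -
  have top: "Ext_not_zero TYPE('m) H (card B)"
    unfolding Ext_not_zero_def using Ext_PS left_module_PS by blast
  have above: "n \<le> card B" if nz: "Ext_not_zero TYPE('m) H n" for n
  proof (rule ccontr)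
    assume n: "\<not> n \<le> card B"
    obtain M N :: "('h, 'm) module" where MN: "left_module H M" "left_module H N"
      and ne: "carrier (Ext H n M N) \<noteq> {\<one>\<^bsub>Ext H n M N\<^esub>}"
      using nz unfolding Ext_not_zero_def by blast
    show False
    proof (rule rep_exists[OF MN(2)])
      fix act :: "'h \<Rightarrow> (('m \<Rightarrow> complex) \<Rightarrow> complex) \<Rightarrow> ('m \<Rightarrow> complex) \<Rightarrow> complex" and \<iota>
      assume C: "pbw_coeff H sca W S0 T av scl cr rt \<kappa> y B Y cf act N \<iota>"
      interpret C: pbw_coeff_universe H sca W S0 T av scl cr rt \<kappa> y B Y cf act N \<iota> \<tau>
        by (intro pbw_coeff_universe.intro C free_embedded_axioms)
      show False using C.Ext_above[OF MN(1)] n ne by simp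
    qed
  qed
  have "(GREATEST n. Ext_not_zero TYPE('m) H n) = card B" using top above by (rule Greatest_equality)
  then show ?thesis using top above unfolding global_dimension_def by auto
qed

end

section \<open>Polynomial coordinates on the symmetric algebra\<close>

lemma poly_mapping_add_induct:
  assumes "K 0" "\<And>k c p. K p \<Longrightarrow> K (Poly_Mapping.single k c + p)"
  shows "K (p :: 'k \<Rightarrow>\<^sub>0 'c::comm_monoid_add)"
proof (induction p rule: update_induct)
  case (update f k v)
  have "Poly_Mapping.update k v f = Poly_Mapping.single k v + f"
    using update(1) by (intro poly_mapping_eqI) (auto simp: lookup_update lookup_add lookup_single when_def in_keys_iff)
  then show ?case using assms(2)[OF update(3)] by simp
qed (fact assms(1))

lemma poly_mapping_sum_single: "p = (\<Sum>k\<in>Poly_Mapping.keys p. Poly_Mapping.single k (Poly_Mapping.lookup p k))"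
  by (rule poly_mapping_eqI)
    (simp add: lookup_sum lookup_single when_def sum.delta in_keys_iff)

lemma indet_power: "(indet v :: 'v free_comm) ^ k = Poly_Mapping.single (Poly_Mapping.single v k) 1"
  by (induction k) (auto simp: mult_single single_add[symmetric] single_one)

lemma free_comm_induct:
  fixes p :: "'v free_comm"
  assumes const: "\<And>c. K (const_poly c)" and indet: "\<And>v. K (indet v)"
    and add: "\<And>p q. K p \<Longrightarrow> K q \<Longrightarrow> K (p + q)" and mult: "\<And>p q. K p \<Longrightarrow> K q \<Longrightarrow> K (p * q)"
  shows "K p"
proof -
  have K1: "K 1" using const[of 1] by (simp add: single_one)
  have pow: "K (indet v ^ k)" for v k
  proof (induction k)
    case (Suc k)
    show ?case using mult[OF indet Suc] by (simp only: power_Suc)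
  qed (use K1 in simp)
  have mono: "K (Poly_Mapping.single m 1)" for m :: "'v \<Rightarrow>\<^sub>0 nat"
  proof (induction m rule: poly_mapping_add_induct)
    case 1
    show ?case using K1 by (simp add: single_one)
  next
    case (2 v k m)
    have "Poly_Mapping.single (Poly_Mapping.single v k + m) (1::complex) = indet v ^ k * Poly_Mapping.single m 1"
      by (simp only: indet_power mult_single mult_1)
    then show ?case using mult[OF pow 2] by simp
  qed
  show ?thesis
  proof (induction p rule: poly_mapping_add_induct)
    case 1
    show ?case using const[of 0] by simp
  next
    case (2 m c p)
    have "Poly_Mapping.single m c = const_poly c * Poly_Mapping.single m 1"
      by (simp add: mult_single)
    then show ?case using add[OF mult[OF const mono] 2] by simp
  qed
qed

locale sym_basis = vector_space scl
  for scl :: "complex \<Rightarrow> 'v::ab_group_add \<Rightarrow> 'v" +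
  fixes B :: "'v set"
  assumes B_fin: "finite B" and B_span: "span B = UNIV" and B_indep: "independent B"
begin

definition lin :: "'v \<Rightarrow> 'v free_comm" where
  "lin v = (\<Sum>b\<in>B. const_poly (representation B v b) * indet b)"

definition Emon :: "('v \<Rightarrow>\<^sub>0 nat) \<Rightarrow> 'v free_comm" where
  "Emon m = (\<Prod>v\<in>Poly_Mapping.keys m. lin v ^ Poly_Mapping.lookup m v)"

text \<open>The substitution of every vector by its expansion in the basis; its kernel is \<open>sym_ideal\<close>.\<close>

definition \<Phi> :: "'v free_comm \<Rightarrow> 'v free_comm" where
  "\<Phi> p = (\<Sum>m\<in>Poly_Mapping.keys p. const_poly (Poly_Mapping.lookup p m) * Emon m)"

lemma Emon_superset: "finite S \<Longrightarrow> Poly_Mapping.keys m \<subseteq> S \<Longrightarrow> Emon m = (\<Prod>v\<in>S. lin v ^ Poly_Mapping.lookup m v)"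
  unfolding Emon_def by (intro prod.mono_neutral_left) (auto simp: in_keys_iff)

lemma Emon_add: "Emon (m + m') = Emon m * Emon m'"
proof -
  let ?S = "Poly_Mapping.keys m \<union> Poly_Mapping.keys m'"
  have "Emon (m + m') = (\<Prod>v\<in>?S. lin v ^ Poly_Mapping.lookup (m + m') v)"
    using Poly_Mapping.keys_add[of m m'] by (intro Emon_superset) auto
  also have "\<dots> = Emon m * Emon m'"
    by (simp add: lookup_add power_add prod.distrib Emon_superset[of ?S m] Emon_superset[of ?S m'])
  finally show ?thesis .
qed

lemma Phi_superset: "finite S \<Longrightarrow> Poly_Mapping.keys p \<subseteq> S \<Longrightarrow> \<Phi> p = (\<Sum>m\<in>S. const_poly (Poly_Mapping.lookup p m) * Emon m)"
  unfolding \<Phi>_def by (intro sum.mono_neutral_left) (auto simp: in_keys_iff)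

lemma Phi_add: "\<Phi> (p + q) = \<Phi> p + \<Phi> q"
proof -
  let ?S = "Poly_Mapping.keys p \<union> Poly_Mapping.keys q"
  have "\<Phi> (p + q) = (\<Sum>m\<in>?S. const_poly (Poly_Mapping.lookup (p + q) m) * Emon m)"
    using Poly_Mapping.keys_add[of p q] by (intro Phi_superset) auto
  also have "\<dots> = \<Phi> p + \<Phi> q"
    by (simp add: lookup_add single_add distrib_right sum.distrib Phi_superset[of ?S p] Phi_superset[of ?S q])
  finally show ?thesis .
qed

lemma Phi_single: "\<Phi> (Poly_Mapping.single m c) = const_poly c * Emon m"
  by (cases "c = 0") (simp_all add: \<Phi>_def)

lemma Phi_zero: "\<Phi> 0 = 0"
  by (simp add: \<Phi>_def)

lemma Phi_diff: "\<Phi> (p - q) = \<Phi> p - \<Phi> q"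
  using Phi_add[of "p - q" q] by simp

lemma Phi_mult: "\<Phi> (p * q) = \<Phi> p * \<Phi> q"
proof (induction p rule: poly_mapping_add_induct)
  case (2 m c p)
  have "\<Phi> (Poly_Mapping.single m c * q) = \<Phi> (Poly_Mapping.single m c) * \<Phi> q"
  proof (induction q rule: poly_mapping_add_induct)
    case (2 m' c' q)
    have e: "const_poly (c * c') = (const_poly c * const_poly c' :: 'v free_comm)" by (simp add: mult_single)
    show ?case
      by (simp only: distrib_left Phi_add mult_single[of m] 2) (simp only: Phi_single Emon_add e, simp only: mult_ac)
  qed (simp add: Phi_zero)
  then show ?case using 2 by (simp add: distrib_right Phi_add)
qed (simp add: Phi_zero)

lemma Phi_const: "\<Phi> (const_poly c) = const_poly c"
  by (simp add: Phi_single Emon_def)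

lemma Phi_indet: "\<Phi> (indet v) = lin v"
  by (simp add: Phi_single Emon_def single_one)

lemmas Phi_indet_Suc = Phi_indet[unfolded One_nat_def]

lemma lin_add: "lin (u + v) = lin u + lin v"
  using representation_add[of B v u] B_indep B_span
  by (simp add: lin_def single_add distrib_right sum.distrib)

lemma lin_scl: "lin (scl c v) = const_poly c * lin v"
proof -
  have "const_poly (representation B (scl c v) b) = (const_poly c * const_poly (representation B v b) :: 'v free_comm)" for b
    using representation_scale[of B v c] B_indep B_span by (simp add: mult_single)
  then show ?thesis by (simp add: lin_def sum_distrib_left mult.assoc)
qed

lemma lin_basis: "b \<in> B \<Longrightarrow> lin b = indet b"
proof -
  assume b: "b \<in> B"
  have "const_poly (representation B b b') * indet b' = (if b' = b then indet b else 0 :: 'v free_comm)" for b'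
    using representation_basis[OF B_indep b] by (simp add: mult_single)
  then show "lin b = indet b" using b B_fin by (simp add: lin_def)
qed

abbreviation "P0 \<equiv> (ring_of_type_algebra :: 'v free_comm ring)"

lemma P0_simps [simp]: "carrier P0 = UNIV" "p \<oplus>\<^bsub>P0\<^esub> q = p + q" "p \<otimes>\<^bsub>P0\<^esub> q = p * q" "\<zero>\<^bsub>P0\<^esub> = 0" "\<one>\<^bsub>P0\<^esub> = 1"
  by (simp_all add: ring_of_type_algebra_def)

lemma P0_cring: "cring P0" by (rule cring_from_type_algebra)

lemma P0_minus: "\<ominus>\<^bsub>P0\<^esub> p = - p"
proof -
  interpret P: cring P0 by (rule P0_cring)
  show ?thesis using P.minus_equality[of "- p" p] by simp
qed

lemma P0_ideal: "ideal (sym_ideal scl) P0"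
proof -
  interpret P: cring P0 by (rule P0_cring)
  show ?thesis unfolding sym_ideal_def by (rule P.genideal_ideal) simp
qed

lemma sym_ideal_props:
  shows sym_ideal_add: "p \<in> sym_ideal scl \<Longrightarrow> q \<in> sym_ideal scl \<Longrightarrow> p + q \<in> sym_ideal scl"
    and sym_ideal_mult: "p \<in> sym_ideal scl \<Longrightarrow> q * p \<in> sym_ideal scl"
    and sym_ideal_zero: "0 \<in> sym_ideal scl"
    and sym_ideal_minus: "p \<in> sym_ideal scl \<Longrightarrow> - p \<in> sym_ideal scl"
proof -
  interpret I: ideal "sym_ideal scl" P0 by (rule P0_ideal)
  show "p \<in> sym_ideal scl \<Longrightarrow> q \<in> sym_ideal scl \<Longrightarrow> p + q \<in> sym_ideal scl" using additive_subgroup.a_closed[OF ideal.axioms(1)[OF P0_ideal], of p q] by simp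
  show m: "q * p \<in> sym_ideal scl" if "p \<in> sym_ideal scl" for p q using I.I_l_closed[OF that, of q] by simp
  show "0 \<in> sym_ideal scl" using additive_subgroup.zero_closed[OF ideal.axioms(1)[OF P0_ideal]] by simp
  show "p \<in> sym_ideal scl \<Longrightarrow> - p \<in> sym_ideal scl" using m[of p "- 1"] by simp
qed

lemma sym_ideal_gen:
  shows "indet (u + v) - (indet u + indet v) \<in> sym_ideal scl"
    and "indet (scl c v) - const_poly c * indet v \<in> sym_ideal scl"
proof -
  interpret P: cring P0 by (rule P0_cring)
  have s: "({indet (u + v) - (indet u + indet v) |u v. True} \<union>
      {indet (scl c v) - const_poly c * indet v |c v. True}) \<subseteq> sym_ideal scl"
    unfolding sym_ideal_def by (rule P.genideal_self) simp
  then show "indet (u + v) - (indet u + indet v) \<in> sym_ideal scl"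
    "indet (scl c v) - const_poly c * indet v \<in> sym_ideal scl" by blast+
qed

lemma sym_ideal_Phi: "p \<in> sym_ideal scl \<Longrightarrow> \<Phi> p = 0"
proof -
  interpret P: cring P0 by (rule P0_cring)
  have "ideal {p. \<Phi> p = 0} P0"
  proof (rule idealI[OF P.ring_axioms])
    show "subgroup {p. \<Phi> p = 0} (add_monoid P0)"
    proof (rule P.add.subgroupI)
      fix a assume "a \<in> {p. \<Phi> p = 0}"
      then have "\<Phi> (- a) = 0" using Phi_diff[of 0 a] by (simp add: Phi_zero)
      then show "\<ominus>\<^bsub>P0\<^esub> a \<in> {p. \<Phi> p = 0}" by (simp add: P0_minus)
    qed (use Phi_zero in \<open>auto simp: Phi_add\<close>)
  qed (auto simp: Phi_mult)
  moreover have "({indet (u + v) - (indet u + indet v) |u v. True} \<union>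
      {indet (scl c v) - const_poly c * indet v |c v. True}) \<subseteq> {p. \<Phi> p = 0}"
    by (auto simp: Phi_diff Phi_add Phi_mult Phi_const Phi_indet_Suc lin_add lin_scl)
  ultimately have "sym_ideal scl \<subseteq> {p. \<Phi> p = 0}" unfolding sym_ideal_def by (rule P.genideal_minimal)
  then show "p \<in> sym_ideal scl \<Longrightarrow> \<Phi> p = 0" by blast
qed

lemma indet_lin: "indet v - lin v \<in> sym_ideal scl"
proof -
  have "v \<in> span B" using B_span by simp
  then show ?thesis
  proof (induction rule: span_induct_alt)
    case base
    have "- (indet 0 :: 'v free_comm) \<in> sym_ideal scl" using sym_ideal_gen(1)[of 0 0] by simp
    then have "indet 0 \<in> sym_ideal scl" using sym_ideal_minus by fastforce
    moreover have "lin 0 = 0" using lin_add[of 0 0] by simp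
    ultimately show ?case by simp
  next
    case (step c b v)
    have eq: "indet (scl c b + v) - lin (scl c b + v)
        = (indet (scl c b + v) - (indet (scl c b) + indet v)) + (indet (scl c b) - const_poly c * indet b) + (indet v - lin v)"
      using step(1) by (simp add: lin_add lin_scl lin_basis)
    show ?case
      unfolding eq by (rule sym_ideal_add[OF sym_ideal_add[OF sym_ideal_gen(1)[of "scl c b" v] sym_ideal_gen(2)[of c b]] step(2)])
  qed
qed

text \<open>With \<open>sym_ideal_Phi\<close> this makes \<open>\<Phi>\<close> a normal form,
  constant on classes and picking a member of each. Elements of the symmetric algebra can then be
  handled as polynomials in the range of \<open>\<Phi>\<close> instead of cosets.\<close>

lemma Phi_congr: "p - \<Phi> p \<in> sym_ideal scl"
proof (induction p rule: free_comm_induct)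
  case (1 c)
  show ?case by (simp add: Phi_const sym_ideal_zero)
next
  case (2 v)
  show ?case using indet_lin by (simp add: Phi_indet_Suc)
next
  case (3 p q)
  have eq: "p + q - \<Phi> (p + q) = (p - \<Phi> p) + (q - \<Phi> q)" by (simp add: Phi_add)
  show ?case unfolding eq by (rule sym_ideal_add[OF 3])
next
  case (4 p q)
  have eq: "p * q - \<Phi> (p * q) = q * (p - \<Phi> p) + \<Phi> p * (q - \<Phi> q)" by (simp add: Phi_mult algebra_simps)
  show ?case unfolding eq by (rule sym_ideal_add[OF sym_ideal_mult[OF 4(1)] sym_ideal_mult[OF 4(2)]])
qed

lemma Phi_Phi: "\<Phi> (\<Phi> p) = \<Phi> p"
  using sym_ideal_Phi[OF Phi_congr[of p]] by (simp add: Phi_diff)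

definition pmB :: "('v \<Rightarrow> nat) \<Rightarrow> 'v \<Rightarrow>\<^sub>0 nat" where
  "pmB m = (\<Sum>b\<in>B. Poly_Mapping.single b (m b))"

lemma lookup_pmB: "m \<in> Mon B \<Longrightarrow> Poly_Mapping.lookup (pmB m) = m"
  using B_fin by (auto simp: pmB_def lookup_sum lookup_single when_def Mon_def fun_eq_iff)

lemma pmB_lookup: "Poly_Mapping.keys k \<subseteq> B \<Longrightarrow> Poly_Mapping.lookup k \<in> Mon B \<and> pmB (Poly_Mapping.lookup k) = k"
proof -
  assume "Poly_Mapping.keys k \<subseteq> B"
  then have "Poly_Mapping.lookup k \<in> Mon B" by (auto simp: Mon_def in_keys_iff)
  moreover from this have "Poly_Mapping.lookup (pmB (Poly_Mapping.lookup k)) = Poly_Mapping.lookup k" by (rule lookup_pmB)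
  then have "pmB (Poly_Mapping.lookup k) = k" by (simp only: poly_mapping_eq_iff)
  ultimately show ?thesis by blast
qed

text \<open>Normal forms involve only the indeterminates of the basis, which allows their monomials
  to be indexed by \<open>Mon B\<close>.\<close>

lemma Phi_keys: "k \<in> Poly_Mapping.keys (\<Phi> p) \<Longrightarrow> Poly_Mapping.keys k \<subseteq> B"
proof -
  have "\<forall>k\<in>Poly_Mapping.keys (\<Phi> p). Poly_Mapping.keys k \<subseteq> B"
  proof (induction p rule: free_comm_induct)
    case (2 v)
    show ?case
    proof
      fix k assume "k \<in> Poly_Mapping.keys (\<Phi> (indet v))"
      then have "k \<in> (\<Union>b\<in>B. Poly_Mapping.keys (const_poly (representation B v b) * (indet b :: 'v free_comm)))"
        using Poly_Mapping.keys_sum[of "\<lambda>b. const_poly (representation B v b) * (indet b :: 'v free_comm)" B]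
        unfolding Phi_indet lin_def by blast
      then show "Poly_Mapping.keys k \<subseteq> B" by (auto simp: mult_single split: if_splits)
    qed
  next
    case (3 p q)
    then show ?case using Poly_Mapping.keys_add[of "\<Phi> p" "\<Phi> q"] unfolding Phi_add by blast
  next
    case (4 p q)
    show ?case
    proof
      fix k assume "k \<in> Poly_Mapping.keys (\<Phi> (p * q))"
      then obtain a b where "k = a + b" "a \<in> Poly_Mapping.keys (\<Phi> p)" "b \<in> Poly_Mapping.keys (\<Phi> q)"
        using keys_mult[of "\<Phi> p" "\<Phi> q"] unfolding Phi_mult by blast
      then show "Poly_Mapping.keys k \<subseteq> B" using 4 Poly_Mapping.keys_add[of a b] by blast
    qed
  qed (auto simp: Phi_const split: if_splits)
  then show "k \<in> Poly_Mapping.keys (\<Phi> p) \<Longrightarrow> Poly_Mapping.keys k \<subseteq> B" by blast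
qed

lemma Phi_pmB: "\<Phi> (Poly_Mapping.single (pmB m) c) = Poly_Mapping.single (pmB m) c"
proof -
  have "Emon (\<Sum>b\<in>C. Poly_Mapping.single b (m b)) = Poly_Mapping.single (\<Sum>b\<in>C. Poly_Mapping.single b (m b)) 1"
    if "finite C" "C \<subseteq> B" for C
    using that
  proof (induction C rule: finite_induct)
    case empty
    show ?case by (simp add: Emon_def single_one)
  next
    case (insert b C)
    have "Emon (Poly_Mapping.single b (m b)) = Poly_Mapping.single (Poly_Mapping.single b (m b)) 1"
      using insert.prems by (cases "m b = 0") (simp_all add: Emon_def single_one lin_basis indet_power[unfolded One_nat_def])
    then show ?case using insert by (simp add: Emon_add mult_single)
  qed
  from this[OF B_fin] show ?thesis by (simp add: Phi_single pmB_def mult_single)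
qed

end

text \<open>The tensor decomposition with cosets replaced by normal forms: \<open>q\<close> stands
  for \<open>j\<close> after the quotient map, and the bijection is stated on families in the range
  of \<open>\<Phi>\<close>, where coefficients can be read off.\<close>

locale sym_hecke = ring H + sb: sym_basis scl B
  for H :: "('h, 'x) ring_scheme" (structure) and scl :: "complex \<Rightarrow> 'v::ab_group_add \<Rightarrow> 'v" and B +
  fixes sca :: "complex \<Rightarrow> 'h" and W :: "'w set" and T :: "'w \<Rightarrow> 'h" and q :: "'v free_comm \<Rightarrow> 'h"
  assumes W_fin: "finite W" and T_closed: "w \<in> W \<Longrightarrow> T w \<in> carrier H"
    and sca_central: "h \<in> carrier H \<Longrightarrow> h \<otimes> sca c = sca c \<otimes> h"
    and q_closed [simp, intro]: "q p \<in> carrier H"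
    and q_add: "q (p + p') = q p \<oplus> q p'" and q_mult: "q (p * p') = q p \<otimes> q p'"
    and q_const: "q (const_poly c) = sca c" and q_one: "q 1 = \<one>"
    and q_ideal: "p - p' \<in> sym_ideal scl \<Longrightarrow> q p = q p'"
    and tensor: "bij_betw (\<lambda>g. \<Oplus>w\<in>W. T w \<otimes> q (g w)) (W \<rightarrow>\<^sub>E range sb.\<Phi>) (carrier H)"
begin

definition tsum :: "('w \<Rightarrow> 'v free_comm) \<Rightarrow> 'h" where
  "tsum g = (\<Oplus>w\<in>W. T w \<otimes> q (g w))"

definition dec :: "'h \<Rightarrow> 'w \<Rightarrow> 'v free_comm" where
  "dec = inv_into (W \<rightarrow>\<^sub>E range sb.\<Phi>) tsum"

definition cf :: "'h \<Rightarrow> 'w \<Rightarrow> ('v \<Rightarrow> nat) \<Rightarrow> complex" where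
  "cf h w m = Poly_Mapping.lookup (dec h w) (sb.pmB m)"

definition Y :: "('v \<Rightarrow> nat) \<Rightarrow> 'h" where
  "Y m = q (Poly_Mapping.single (sb.pmB m) 1)"

definition y :: "'v \<Rightarrow> 'h" where
  "y x = q (indet x)"

lemma tsum_bij: "bij_betw tsum (W \<rightarrow>\<^sub>E range sb.\<Phi>) (carrier H)"
  using tensor by (simp add: tsum_def[abs_def])

lemma dec_tsum: "g \<in> W \<rightarrow>\<^sub>E range sb.\<Phi> \<Longrightarrow> dec (tsum g) = g"
  unfolding dec_def by (rule bij_betw_inv_into_left[OF tsum_bij])

lemma tsum_dec: "h \<in> carrier H \<Longrightarrow> tsum (dec h) = h"
  unfolding dec_def by (rule bij_betw_inv_into_right[OF tsum_bij])

lemma dec_range: "h \<in> carrier H \<Longrightarrow> dec h \<in> W \<rightarrow>\<^sub>E range sb.\<Phi>"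
  unfolding dec_def using bij_betw_imp_surj_on[OF tsum_bij] by (intro inv_into_into) simp

lemma term_closed: "w \<in> W \<Longrightarrow> T w \<otimes> q p \<in> carrier H"
  using T_closed by simp

lemma q_zero: "q 0 = \<zero>"
  using q_add[of 0 0] by simp

lemma sca_closed: "sca c \<in> carrier H"
  unfolding q_const[symmetric] by simp

lemma y_closed: "y x \<in> carrier H"
  by (simp add: y_def)

lemma y_add: "y (x + x') = y x \<oplus> y x'"
  unfolding y_def q_add[symmetric] by (rule q_ideal[OF sb.sym_ideal_gen(1)])

lemma y_scl: "y (scl c x) = sca c \<otimes> y x"
  unfolding y_def q_const[symmetric] q_mult[symmetric] by (rule q_ideal[OF sb.sym_ideal_gen(2)])

lemma y_comm: "y x \<otimes> y x' = y x' \<otimes> y x"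
  unfolding y_def q_mult[symmetric] by (simp only: mult.commute)

lemma Y_closed: "Y m \<in> carrier H"
  by (simp add: Y_def)

lemma Y_zero: "Y (\<lambda>_. 0) = \<one>"
  by (simp add: Y_def sb.pmB_def q_one single_one)

lemma Y_Suc:
  assumes "m \<in> Mon B" "b \<in> B" shows "Y (m(b := Suc (m b))) = y b \<otimes> Y m"
proof -
  have m': "m(b := Suc (m b)) \<in> Mon B" using assms by (auto simp: Mon_def)
  have "sb.pmB (m(b := Suc (m b))) = Poly_Mapping.single b 1 + sb.pmB m"
    by (rule poly_mapping_eqI) (simp add: sb.lookup_pmB[OF m'] sb.lookup_pmB[OF assms(1)] lookup_add lookup_single when_def)
  then show ?thesis
    unfolding Y_def y_def q_mult[symmetric] by (simp only: mult_single mult_1)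
qed

lemma cf_add:
  assumes h: "h \<in> carrier H" "h' \<in> carrier H" and w: "w \<in> W"
  shows "cf (h \<oplus> h') w m = cf h w m + cf h' w m"
proof -
  let ?g = "\<lambda>w\<in>W. dec h w + dec h' w"
  have g: "?g \<in> W \<rightarrow>\<^sub>E range sb.\<Phi>"
  proof
    fix w assume "w \<in> W"
    then have "dec h w \<in> range sb.\<Phi>" "dec h' w \<in> range sb.\<Phi>" using dec_range h by (auto simp: PiE_def)
    then obtain p p' where "dec h w = sb.\<Phi> p" "dec h' w = sb.\<Phi> p'" by blast
    then show "?g w \<in> range sb.\<Phi>" using \<open>w \<in> W\<close> sb.Phi_add[of p p'] by (metis rangeI restrict_apply')
  qed simp
  have "tsum ?g = (\<Oplus>w\<in>W. T w \<otimes> q (dec h w) \<oplus> T w \<otimes> q (dec h' w))"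
    unfolding tsum_def using T_closed by (intro finsum_cong') (auto simp: q_add r_distr)
  also have "\<dots> = tsum (dec h) \<oplus> tsum (dec h')"
    unfolding tsum_def by (rule finsum_addf) (auto intro: term_closed)
  finally have "tsum ?g = h \<oplus> h'" using tsum_dec h by simp
  then have "dec (h \<oplus> h') = ?g" using dec_tsum[OF g] by simp
  then show ?thesis using w by (simp add: cf_def lookup_add)
qed

lemma cf_sca:
  assumes h: "h \<in> carrier H" and w: "w \<in> W"
  shows "cf (sca c \<otimes> h) w m = c * cf h w m"
proof -
  let ?g = "\<lambda>w\<in>W. const_poly c * dec h w"
  have g: "?g \<in> W \<rightarrow>\<^sub>E range sb.\<Phi>"
  proof
    fix w assume "w \<in> W"
    then have "dec h w \<in> range sb.\<Phi>" using dec_range h by (auto simp: PiE_def)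
    then obtain p where "dec h w = sb.\<Phi> p" by blast
    then show "?g w \<in> range sb.\<Phi>" using \<open>w \<in> W\<close> sb.Phi_mult[of "const_poly c" p] by (metis sb.Phi_const rangeI restrict_apply')
  qed simp
  have "T w \<otimes> (sca c \<otimes> q p) = sca c \<otimes> (T w \<otimes> q p)" if "w \<in> W" for w p
    using sca_central[OF T_closed[OF that], of c] T_closed[OF that] sca_closed by (simp add: m_assoc[symmetric])
  then have "tsum ?g = (\<Oplus>w\<in>W. sca c \<otimes> (T w \<otimes> q (dec h w)))"
    unfolding tsum_def using T_closed sca_closed by (intro finsum_cong') (auto simp: q_mult q_const)
  also have "\<dots> = sca c \<otimes> tsum (dec h)"
    unfolding tsum_def by (rule finsum_rdistr[symmetric]) (auto intro: term_closed sca_closed W_fin)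
  finally have "tsum ?g = sca c \<otimes> h" using tsum_dec h by simp
  then have "dec (sca c \<otimes> h) = ?g" using dec_tsum[OF g] by simp
  moreover have "Poly_Mapping.lookup (const_poly c * p) k = c * Poly_Mapping.lookup p k" for p :: "'v free_comm" and k
    by (simp add: mult_map_scale_conv_mult[symmetric] map.rep_eq when_def)
  ultimately show ?thesis using w by (simp add: cf_def)
qed

lemma pmB_inj: "m \<in> Mon B \<Longrightarrow> n \<in> Mon B \<Longrightarrow> sb.pmB m = sb.pmB n \<longleftrightarrow> m = n"
  using sb.lookup_pmB by metis

lemma cf_fin:
  assumes h: "h \<in> carrier H" shows "finite {(w, m). w \<in> W \<and> m \<in> Mon B \<and> cf h w m \<noteq> 0}"
proof (rule finite_subset)
  show "{(w, m). w \<in> W \<and> m \<in> Mon B \<and> cf h w m \<noteq> 0}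
      \<subseteq> (SIGMA w:W. Poly_Mapping.lookup ` Poly_Mapping.keys (dec h w))"
  proof clarsimp
    fix w m assume "w \<in> W" "m \<in> Mon B" "cf h w m \<noteq> 0"
    then show "m \<in> Poly_Mapping.lookup ` Poly_Mapping.keys (dec h w)"
      by (intro image_eqI[of _ _ "sb.pmB m"]) (simp_all add: sb.lookup_pmB cf_def in_keys_iff)
  qed
qed (use W_fin in auto)

lemma cf_basis:
  assumes u: "u \<in> W" and n: "n \<in> Mon B" and w: "w \<in> W" and m: "m \<in> Mon B"
  shows "cf (T u \<otimes> Y n) w m = (if w = u \<and> m = n then 1 else 0)"
proof -
  let ?g = "\<lambda>w\<in>W. if w = u then Poly_Mapping.single (sb.pmB n) 1 else 0"
  have "Poly_Mapping.single (sb.pmB n) 1 \<in> range sb.\<Phi>" "0 \<in> range sb.\<Phi>"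
    using sb.Phi_pmB[of n 1] sb.Phi_zero by (metis rangeI)+
  then have g: "?g \<in> W \<rightarrow>\<^sub>E range sb.\<Phi>" by auto
  have "tsum ?g = (\<Oplus>w\<in>W. if u = w then T w \<otimes> Y n else \<zero>)"
    unfolding tsum_def using T_closed Y_closed by (intro finsum_cong') (auto simp: q_zero Y_def)
  also have "\<dots> = T u \<otimes> Y n"
    by (rule add.finprod_singleton[OF u W_fin]) (use T_closed Y_closed in auto)
  finally have "dec (T u \<otimes> Y n) = ?g" using dec_tsum[OF g] by simp
  then show ?thesis using w pmB_inj[OF n m] by (auto simp: cf_def lookup_single when_def)
qed

lemma pbw_induct:
  assumes add: "\<And>h h'. h \<in> K \<Longrightarrow> h' \<in> K \<Longrightarrow> h \<oplus> h' \<in> K"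
    and gen: "\<And>c w m. w \<in> W \<Longrightarrow> m \<in> Mon B \<Longrightarrow> sca c \<otimes> (T w \<otimes> Y m) \<in> K" and ne: "W \<noteq> {}"
  shows "carrier H \<subseteq> K"
proof
  fix h assume h: "h \<in> carrier H"
  have sca0: "sca 0 = \<zero>" using q_const[of 0] q_zero by simp
  \<comment> \<open>Closure under sums says nothing about the empty sum, so zero is obtained as a
    generator with scalar 0; here the index set must have an element.\<close>
  have "(\<lambda>_. 0) \<in> Mon B" by (simp add: Mon_def)
  moreover obtain w0 where "w0 \<in> W" using ne by blast
  ultimately have "sca 0 \<otimes> (T w0 \<otimes> Y (\<lambda>_. 0)) \<in> K" using gen by blast
  then have zero: "\<zero> \<in> K" using \<open>w0 \<in> W\<close> T_closed Y_closed by (simp add: sca0)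
  have poly: "T w \<otimes> q (\<Sum>k\<in>S. Poly_Mapping.single k (c k)) \<in> K"
    if w: "w \<in> W" and "finite S" "\<And>k. k \<in> S \<Longrightarrow> Poly_Mapping.keys k \<subseteq> B" for w S c
    using that(2,3)
  proof (induction S rule: finite_induct)
    case empty
    show ?case using w T_closed zero by (simp add: q_zero)
  next
    case (insert k S)
    have k: "Poly_Mapping.lookup k \<in> Mon B" "sb.pmB (Poly_Mapping.lookup k) = k" using sb.pmB_lookup[of k] insert.prems by auto
    have "Poly_Mapping.single k (c k) = const_poly (c k) * Poly_Mapping.single k 1" by (simp add: mult_single)
    then have "q (Poly_Mapping.single k (c k)) = sca (c k) \<otimes> Y (Poly_Mapping.lookup k)"
      unfolding Y_def k(2) by (simp only: q_mult q_const)
    then have "T w \<otimes> q (Poly_Mapping.single k (c k)) = sca (c k) \<otimes> (T w \<otimes> Y (Poly_Mapping.lookup k))"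
      using sca_central[OF T_closed[OF w], of "c k"] T_closed[OF w] sca_closed Y_closed by (simp add: m_assoc[symmetric])
    then have "T w \<otimes> q (Poly_Mapping.single k (c k)) \<in> K" using gen[OF w k(1)] by simp
    moreover have "T w \<otimes> q (\<Sum>k\<in>S. Poly_Mapping.single k (c k)) \<in> K" using insert by blast
    ultimately show ?case using add T_closed[OF w] insert.hyps by (simp add: q_add r_distr)
  qed
  have K: "T w \<otimes> q (dec h w) \<in> K" if w: "w \<in> W" for w
  proof -
    have "dec h w \<in> range sb.\<Phi>" using dec_range[OF h] w by (auto simp: PiE_def)
    then obtain p where "dec h w = sb.\<Phi> p" by (elim rangeE)
    then have "Poly_Mapping.keys k \<subseteq> B" if "k \<in> Poly_Mapping.keys (dec h w)" for k
      using that sb.Phi_keys[of k p] by simp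
    then have "T w \<otimes> q (\<Sum>k\<in>Poly_Mapping.keys (dec h w). Poly_Mapping.single k (Poly_Mapping.lookup (dec h w) k)) \<in> K"
      by (intro poly[OF w]) auto
    then show ?thesis by (simp only: poly_mapping_sum_single[symmetric])
  qed
  have fs: "(\<Oplus>w\<in>V. T w \<otimes> q (dec h w)) \<in> K" if "finite V" "V \<subseteq> W" for V
    using that
  proof (induction V rule: finite_induct)
    case empty
    show ?case using zero by simp
  next
    case (insert w V)
    then show ?case using add[OF K[of w]] term_closed by (simp add: Pi_def subset_iff)
  qed
  show "h \<in> K" using fs[OF W_fin order_refl] tsum_dec[OF h] unfolding tsum_def by simp
qed

end

section \<open>Root systems and Weyl groups\<close>

locale finite_dim_inner =
  fixes U :: "'a::real_inner itself"
  assumes finite_dim: "\<exists>B :: 'a set. finite B \<and> span B = UNIV"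
begin

text \<open>Projection coefficients for an orthogonal spanning set. The set may contain the zero
  vector, whose term is zero whatever the quotient.\<close>

lemma orthogonal_expansion:
  obtains C :: "'a set" where "finite C" "\<And>v. v = (\<Sum>c\<in>C. (inner c v / inner c c) *\<^sub>R c)"
proof -
  obtain B :: "'a set" where B: "finite B" "span B = UNIV" using finite_dim by blast
  obtain C where C': "finite C \<and> card C \<le> card B \<and> span C = span B \<and> pairwise orthogonal C"
    using basis_orthogonal[OF B(1)] by (rule exE)
  then have C: "finite C" "span C = UNIV" "pairwise orthogonal C" using B(2) by simp_all
  show thesis
  proof (rule that[OF C(1)])
    fix v
    define w where "w = v - (\<Sum>c\<in>C. (inner c v / inner c c) *\<^sub>R c)"
    have "inner c w = 0" if c: "c \<in> C" for c
    proof -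
      have "inner c (\<Sum>d\<in>C. (inner d v / inner d d) *\<^sub>R d) = (\<Sum>d\<in>C. if d = c then inner c v else 0)"
        unfolding inner_sum_right
      proof (rule sum.cong[OF refl])
        fix d assume "d \<in> C"
        then show "inner c ((inner d v / inner d d) *\<^sub>R d) = (if d = c then inner c v else 0)"
          using C(3) c by (auto simp: pairwise_def orthogonal_def)
      qed
      then show ?thesis using c C(1) by (simp add: w_def inner_diff_right)
    qed
    moreover have "w \<in> span C" using C(2) by simp
    ultimately have "inner w w = 0"
      using span_induct[of w C "\<lambda>x. inner x w = 0"] by (auto simp: subspace_def inner_add_left)
    then show "v = (\<Sum>c\<in>C. (inner c v / inner c c) *\<^sub>R c)" by (simp add: w_def)
  qed
qed

definition rz :: "('a \<Rightarrow>\<^sub>L real) \<Rightarrow> 'a" where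
  "rz \<alpha> = (THE a. \<forall>v. blinfun_apply \<alpha> v = inner a v)"

lemma rz: "blinfun_apply \<alpha> v = inner (rz \<alpha>) v"
proof (rule orthogonal_expansion)
  fix C :: "'a set" assume C: "finite C" "\<And>v. v = (\<Sum>c\<in>C. (inner c v / inner c c) *\<^sub>R c)"
  let ?a = "\<Sum>c\<in>C. (blinfun_apply \<alpha> c / inner c c) *\<^sub>R c"
  have "\<forall>v. blinfun_apply \<alpha> v = inner ?a v"
  proof
    fix v
    have "blinfun_apply \<alpha> v = blinfun_apply \<alpha> (\<Sum>c\<in>C. (inner c v / inner c c) *\<^sub>R c)" using C(2)[of v] by simp
    also have "\<dots> = inner ?a v"
      by (simp add: blinfun.sum_right blinfun.scaleR_right inner_sum_left mult.commute)
    finally show "blinfun_apply \<alpha> v = inner ?a v" .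
  qed
  then obtain a where a: "\<And>v. blinfun_apply \<alpha> v = inner a v" by blast
  have "rz \<alpha> = a"
    unfolding rz_def
  proof (rule the_equality)
    show "\<forall>v. blinfun_apply \<alpha> v = inner a v" using a by blast
    fix a' assume "\<forall>v. blinfun_apply \<alpha> v = inner a' v"
    then have "\<forall>v. inner a' v = inner a v" using a by metis
    then show "a' = a" by (simp only: vector_eq_rdot)
  qed
  then show ?thesis using a by simp
qed

lemma rz_eqI:
  assumes "\<And>v. blinfun_apply \<alpha> v = inner a v" shows "rz \<alpha> = a"
proof -
  have "\<forall>v. inner (rz \<alpha>) v = inner a v" using assms by (simp add: rz[symmetric])
  then show ?thesis by (simp only: vector_eq_rdot)
qed

lemma coroot: "coroot \<alpha> = (2 / inner (rz \<alpha>) (rz \<alpha>)) *\<^sub>R rz \<alpha>"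
  by (simp only: coroot_def rz_def Let_def)

lemma rz_nonzero: "\<alpha> \<noteq> 0 \<Longrightarrow> inner (rz \<alpha>) (rz \<alpha>) > 0"
proof -
  assume \<alpha>: "\<alpha> \<noteq> 0"
  have "rz \<alpha> \<noteq> 0"
  proof
    assume "rz \<alpha> = 0"
    then have "\<alpha> = 0" using rz[of \<alpha>] by (intro blinfun_eqI) simp
    then show False using \<alpha> by simp
  qed
  then show ?thesis by simp
qed

lemma reflection_eq: "reflection \<alpha> v = v - (2 * inner (rz \<alpha>) v / inner (rz \<alpha>) (rz \<alpha>)) *\<^sub>R rz \<alpha>"
  by (simp add: reflection_def coroot rz[of \<alpha> v] mult.commute)

lemma bounded_linear_reflection: "bounded_linear (reflection \<alpha>)"
  unfolding reflection_def[abs_def]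
  by (intro bounded_linear_sub bounded_linear_ident bounded_linear_scaleR_left[THEN bounded_linear_compose] blinfun.bounded_linear_right)

lemma coroot_pairing:
  fixes \<alpha> :: "'a \<Rightarrow>\<^sub>L real"
  shows "\<alpha> \<noteq> 0 \<Longrightarrow> blinfun_apply \<alpha> (coroot \<alpha>) = 2"
  using rz_nonzero[of \<alpha>] by (simp add: coroot rz[of \<alpha>])

lemma reflection_reflection:
  fixes \<alpha> :: "'a \<Rightarrow>\<^sub>L real"
  shows "reflection \<alpha> (reflection \<alpha> v) = v"
proof (cases "\<alpha> = 0")
  case True
  then show ?thesis by (simp add: reflection_def)
next
  case False
  then show ?thesis
    using coroot_pairing[OF False] by (simp add: reflection_def blinfun.diff_right blinfun.scaleR_right algebra_simps)
qed

lemma reflection_invol: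
  fixes \<alpha> :: "'a \<Rightarrow>\<^sub>L real"
  shows "reflection \<alpha> \<circ> reflection \<alpha> = id"
  by (auto simp: reflection_reflection)

lemma reflection_inv:
  fixes \<alpha> :: "'a \<Rightarrow>\<^sub>L real"
  shows "inv_into UNIV (reflection \<alpha>) = reflection \<alpha>"
  by (rule Hilbert_Choice.inv_unique_comp[OF reflection_invol reflection_invol])

lemma reflection_self_adjoint:
  fixes \<alpha> :: "'a \<Rightarrow>\<^sub>L real"
  shows "inner u (reflection \<alpha> v) = inner (reflection \<alpha> u) v"
  by (simp add: reflection_eq inner_diff_right inner_diff_left inner_commute mult_ac)

lemma reflection_isometry:
  fixes \<alpha> :: "'a \<Rightarrow>\<^sub>L real"
  shows "inner (reflection \<alpha> u) (reflection \<alpha> v) = inner u v"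
  using reflection_self_adjoint[of "reflection \<alpha> u" \<alpha> v] by (simp add: reflection_reflection)

lemma dual_reflection:
  fixes \<alpha> :: "'a \<Rightarrow>\<^sub>L real"
  shows "blinfun_apply (dual_action (reflection \<alpha>) x) v = blinfun_apply x (reflection \<alpha> v)"
proof -
  have "bounded_linear (\<lambda>v. blinfun_apply x (reflection \<alpha> v))"
    using bounded_linear_compose[OF blinfun.bounded_linear_right bounded_linear_reflection] .
  then show ?thesis by (simp add: dual_action_def reflection_inv bounded_linear_Blinfun_apply)
qed

lemma rz_dual: "rz (dual_action (reflection \<alpha>) \<beta>) = reflection \<alpha> (rz \<beta>)"
  by (rule rz_eqI) (simp add: dual_reflection rz[of \<beta>] reflection_self_adjoint)

text \<open>The reflection in \<alpha> is an isometry carrying the Riesz vector of \<beta> to that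
  of the reflected root, so it conjugates one reflection into the other.\<close>

lemma reflection_conj:
  fixes \<alpha> :: "'a \<Rightarrow>\<^sub>L real"
  shows "reflection (dual_action (reflection \<alpha>) \<beta>) = reflection \<alpha> \<circ> (reflection \<beta> \<circ> reflection \<alpha>)"
proof
  fix v
  interpret L: bounded_linear "reflection \<alpha>" by (rule bounded_linear_reflection)
  show "reflection (dual_action (reflection \<alpha>) \<beta>) v = (reflection \<alpha> \<circ> (reflection \<beta> \<circ> reflection \<alpha>)) v"
    by (simp add: reflection_eq[of "dual_action (reflection \<alpha>) \<beta>"] rz_dual reflection_isometry
        reflection_eq[of \<beta> "reflection \<alpha> v"] L.diff L.scaleR reflection_reflection reflection_self_adjoint)
qed

lemma reflection_uminus:
  fixes \<alpha> :: "'a \<Rightarrow>\<^sub>L real"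
  shows "reflection (- \<alpha>) = reflection \<alpha>"
proof -
  have "rz (- \<alpha>) = - rz \<alpha>" by (rule rz_eqI) (simp add: blinfun.minus_left rz[of \<alpha>])
  then show ?thesis by (auto simp: reflection_eq)
qed

section \<open>Weyl groups and their generation by simple reflections\<close>

lemma weyl_comp: "u \<in> weyl_group R \<Longrightarrow> w \<in> weyl_group R \<Longrightarrow> u \<circ> w \<in> weyl_group R"
  by (induction rule: weyl_group.induct) (auto simp: comp_assoc intro: weyl_group.intros)

lemma weyl_reflection: "\<alpha> \<in> R \<Longrightarrow> reflection \<alpha> \<in> weyl_group R"
  using weyl_group.intros(2)[OF _ weyl_group.intros(1), of \<alpha> R] by simp

lemma weyl_inverse:
  fixes R :: "('a \<Rightarrow>\<^sub>L real) set"
  shows "w \<in> weyl_group R \<Longrightarrow> \<exists>u\<in>weyl_group R. u \<circ> w = id \<and> w \<circ> u = id"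
proof (induction rule: weyl_group.induct)
  case 1
  show ?case using weyl_group.intros(1) by (intro bexI[of _ id]) auto
next
  case (2 \<alpha> w)
  then obtain u where u: "u \<in> weyl_group R" "u \<circ> w = id" "w \<circ> u = id" by blast
  have "(u \<circ> reflection \<alpha>) \<circ> (reflection \<alpha> \<circ> w) = id"
    using u(2) by (auto simp: fun_eq_iff reflection_reflection)
  moreover have "(reflection \<alpha> \<circ> w) \<circ> (u \<circ> reflection \<alpha>) = id"
    using u(3) by (auto simp: fun_eq_iff reflection_reflection)
  ultimately show ?case using weyl_comp[OF u(1) weyl_reflection[OF 2(1)]] by blast
qed

lemma weyl_bounded_linear: "w \<in> weyl_group R \<Longrightarrow> bounded_linear w"
proof (induction rule: weyl_group.induct)
  case 1
  show ?case using bounded_linear_ident by (simp add: id_def)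
next
  case (2 \<alpha> w)
  show ?case using bounded_linear_compose[OF bounded_linear_reflection 2(3)] by (simp add: comp_def)
qed

lemma weyl_dual:
  fixes x :: "'a \<Rightarrow>\<^sub>L 'b::real_normed_vector"
  assumes w: "w \<in> weyl_group R"
  shows "blinfun_apply (dual_action w x) v = blinfun_apply x (inv_into UNIV w v)"
proof -
  obtain u where u: "u \<in> weyl_group R" "u \<circ> w = id" "w \<circ> u = id" using weyl_inverse[OF w] by blast
  then have "inv_into UNIV w = u" by (metis Hilbert_Choice.inv_unique_comp)
  then show ?thesis
    using bounded_linear_compose[OF blinfun.bounded_linear_right[of x] weyl_bounded_linear[OF u(1)]]
    by (simp add: dual_action_def bounded_linear_Blinfun_apply)
qed

lemma weyl_inv_comp:
  fixes R :: "('a \<Rightarrow>\<^sub>L real) set"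
  assumes "u \<in> weyl_group R" "w \<in> weyl_group R"
  shows "inv_into UNIV (u \<circ> w) v = inv_into UNIV w (inv_into UNIV u v)"
proof -
  have "bij w" if "w \<in> weyl_group R" for w using weyl_inverse[OF that] by (metis o_bij)
  then show ?thesis using o_inv_distrib[of u w] assms by simp
qed

lemma dual_action_comp:
  fixes x :: "'a \<Rightarrow>\<^sub>L 'b::real_normed_vector"
  assumes "u \<in> weyl_group R" "w \<in> weyl_group R"
  shows "dual_action (u \<circ> w) x = dual_action u (dual_action w x)"
  by (rule blinfun_eqI)
    (simp add: weyl_dual[OF weyl_comp[OF assms]] weyl_dual[OF assms(1)] weyl_dual[OF assms(2)] weyl_inv_comp[OF assms])

text \<open>Every positive root is made simple by simple reflections that lower its height.\<close>

lemma reflection_in_simple: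
  fixes R :: "('a \<Rightarrow>\<^sub>L real) set"
  assumes RS: "reduced_root_system R" and bs: "root_basis R \<Delta>"
  shows "(\<Sum>\<alpha>\<in>\<Delta>. real (n \<alpha>) *\<^sub>R \<alpha>) \<in> R \<Longrightarrow> reflection (\<Sum>\<alpha>\<in>\<Delta>. real (n \<alpha>) *\<^sub>R \<alpha>) \<in> weyl_group \<Delta>"
proof (induction "\<Sum>\<alpha>\<in>\<Delta>. n \<alpha>" arbitrary: n rule: less_induct)
  case less
  have R: "finite R" "0 \<notin> R" "\<And>\<alpha>. \<alpha> \<in> R \<Longrightarrow> dual_action (reflection \<alpha>) ` R = R"
    "\<And>\<alpha> c. \<alpha> \<in> R \<Longrightarrow> c *\<^sub>R \<alpha> \<in> R \<Longrightarrow> c = 1 \<or> c = - 1"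
    using RS by (auto simp: reduced_root_system_def)
  have D: "\<Delta> \<subseteq> R" "independent \<Delta>"
    "\<And>\<beta>. \<beta> \<in> R \<Longrightarrow> \<exists>n :: ('a \<Rightarrow>\<^sub>L real) \<Rightarrow> nat. \<beta> = (\<Sum>\<alpha>\<in>\<Delta>. real (n \<alpha>) *\<^sub>R \<alpha>) \<or> \<beta> = - (\<Sum>\<alpha>\<in>\<Delta>. real (n \<alpha>) *\<^sub>R \<alpha>)"
    using bs by (auto simp: root_basis_def)
  have fD: "finite \<Delta>" using D(1) R(1) finite_subset by blast
  have coef: "c \<alpha> = d \<alpha>" if "(\<Sum>\<alpha>\<in>\<Delta>. c \<alpha> *\<^sub>R \<alpha>) = (\<Sum>\<alpha>\<in>\<Delta>. d \<alpha> *\<^sub>R \<alpha>)" "\<alpha> \<in> \<Delta>" for c d \<alpha>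
  proof -
    have "(\<Sum>\<alpha>\<in>\<Delta>. (c \<alpha> - d \<alpha>) *\<^sub>R \<alpha>) = 0" using that(1) by (simp add: scaleR_diff_left sum_subtractf)
    then have "c \<alpha> - d \<alpha> = 0" using real_vector.independentD[OF D(2) fD order_refl, of "\<lambda>\<alpha>. c \<alpha> - d \<alpha>" \<alpha>] that(2) by simp
    then show ?thesis by simp
  qed
  define \<beta> where "\<beta> = (\<Sum>\<alpha>\<in>\<Delta>. real (n \<alpha>) *\<^sub>R \<alpha>)"
  have \<beta>R: "\<beta> \<in> R" using less.prems by (simp add: \<beta>_def)
  show ?case unfolding \<beta>_def[symmetric]
  proof (cases "\<beta> \<in> \<Delta>")
    case True
    then show "reflection \<beta> \<in> weyl_group \<Delta>" by (rule weyl_reflection)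
  next
    case False
    have nz: "\<gamma> \<noteq> 0" if "\<gamma> \<in> R" for \<gamma> using that R(2) by metis
    \<comment> \<open>Expanding the square length of \<beta> in simple roots, some summand must be
      positive; the reflection in that simple root will lower the height.\<close>
    have "0 < inner (rz \<beta>) (rz \<beta>)" by (rule rz_nonzero[OF nz[OF \<beta>R]])
    also have "\<dots> = (\<Sum>\<alpha>\<in>\<Delta>. real (n \<alpha>) * inner (rz \<alpha>) (rz \<beta>))"
    proof -
      have "blinfun_apply \<beta> v = (\<Sum>\<alpha>\<in>\<Delta>. real (n \<alpha>) * blinfun_apply \<alpha> v)" for v
        by (simp add: \<beta>_def blinfun.sum_left blinfun.scaleR_left)
      from this[of "rz \<beta>"] show ?thesis by (simp only: rz)
    qed
    finally have sum_pos: "0 < (\<Sum>\<alpha>\<in>\<Delta>. real (n \<alpha>) * inner (rz \<alpha>) (rz \<beta>))" .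
    have "\<exists>\<alpha>\<in>\<Delta>. 0 < real (n \<alpha>) * inner (rz \<alpha>) (rz \<beta>)"
    proof (rule ccontr)
      assume "\<not> ?thesis"
      then have "(\<Sum>\<alpha>\<in>\<Delta>. real (n \<alpha>) * inner (rz \<alpha>) (rz \<beta>)) \<le> 0" by (intro sum_nonpos) (auto simp: not_less)
      then show False using sum_pos by simp
    qed
    then obtain \<alpha> where \<alpha>: "\<alpha> \<in> \<Delta>" "0 < real (n \<alpha>) * inner (rz \<alpha>) (rz \<beta>)" by (elim bexE)
    have n\<alpha>: "0 < n \<alpha>" and ip: "0 < inner (rz \<alpha>) (rz \<beta>)" using \<alpha>(2) by (auto simp: zero_less_mult_iff)
    have \<alpha>R: "\<alpha> \<in> R" "\<alpha> \<noteq> 0" using subsetD[OF D(1) \<alpha>(1)] nz by simp_all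
    define k where "k = blinfun_apply \<beta> (coroot \<alpha>)"
    have k: "0 < k" using ip rz_nonzero[OF \<alpha>R(2)] by (simp add: k_def coroot rz[of \<beta>] inner_commute)
    define \<beta>' where "\<beta>' = dual_action (reflection \<alpha>) \<beta>"
    have \<beta>'R: "\<beta>' \<in> R" using imageI[OF \<beta>R, of "dual_action (reflection \<alpha>)"] unfolding R(3)[OF \<alpha>R(1)] \<beta>'_def .
    have "\<beta>' = \<beta> - k *\<^sub>R \<alpha>"
      by (rule blinfun_eqI)
        (simp add: \<beta>'_def dual_reflection reflection_def k_def blinfun.diff_right blinfun.diff_left blinfun.scaleR_left blinfun.scaleR_right)
    also have "\<dots> = (\<Sum>\<gamma>\<in>\<Delta>. (real (n \<gamma>) - (if \<gamma> = \<alpha> then k else 0)) *\<^sub>R \<gamma>)"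
    proof -
      have "(\<Sum>\<gamma>\<in>\<Delta>. (if \<gamma> = \<alpha> then k else 0) *\<^sub>R \<gamma>) = (\<Sum>\<gamma>\<in>\<Delta>. if \<gamma> = \<alpha> then k *\<^sub>R \<alpha> else 0)"
        by (intro sum.cong) auto
      then show ?thesis using fD \<alpha>(1) by (simp add: \<beta>_def scaleR_diff_left sum_subtractf)
    qed
    finally have \<beta>': "\<beta>' = (\<Sum>\<gamma>\<in>\<Delta>. (real (n \<gamma>) - (if \<gamma> = \<alpha> then k else 0)) *\<^sub>R \<gamma>)" .
    obtain m :: "('a \<Rightarrow>\<^sub>L real) \<Rightarrow> nat" where m: "\<beta>' = (\<Sum>\<alpha>\<in>\<Delta>. real (m \<alpha>) *\<^sub>R \<alpha>) \<or> \<beta>' = - (\<Sum>\<alpha>\<in>\<Delta>. real (m \<alpha>) *\<^sub>R \<alpha>)"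
      using D(3)[OF \<beta>'R] by (rule exE)
    \<comment> \<open>The system is reduced and \<beta> is not simple, so \<beta> is no multiple of
      \<alpha>. The coefficient at \<gamma> is untouched by the reflection in \<alpha>; the
      reflected root keeps a positive coefficient and is therefore a nonnegative
      combination.\<close>
    have "\<exists>\<gamma>\<in>\<Delta>. \<gamma> \<noteq> \<alpha> \<and> 0 < n \<gamma>"
    proof (rule ccontr)
      assume no: "\<not> ?thesis"
      have "\<beta> = (\<Sum>\<gamma>\<in>\<Delta>. if \<gamma> = \<alpha> then real (n \<alpha>) *\<^sub>R \<alpha> else 0)"
        unfolding \<beta>_def using no by (intro sum.cong) auto
      then have \<beta>n: "\<beta> = real (n \<alpha>) *\<^sub>R \<alpha>" using fD \<alpha>(1) by simp
      then have "real (n \<alpha>) = 1" using R(4)[OF \<alpha>R(1), of "real (n \<alpha>)"] \<beta>R by auto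
      then show False using False \<alpha>(1) \<beta>n by simp
    qed
    then obtain \<gamma> where \<gamma>: "\<gamma> \<in> \<Delta>" "\<gamma> \<noteq> \<alpha>" "0 < n \<gamma>" by (elim bexE conjE)
    have pos: "\<beta>' = (\<Sum>\<alpha>\<in>\<Delta>. real (m \<alpha>) *\<^sub>R \<alpha>)"
    proof (rule ccontr)
      assume "\<not> ?thesis"
      then have "\<beta>' = (\<Sum>\<alpha>\<in>\<Delta>. (- real (m \<alpha>)) *\<^sub>R \<alpha>)" using m by (simp add: sum_negf)
      then have "real (n \<gamma>) - (if \<gamma> = \<alpha> then k else 0) = - real (m \<gamma>)"
        by (intro coef[OF trans[OF \<beta>'[symmetric]] \<gamma>(1)])
      then show False using \<gamma> by simp
    qed
    have mn: "real (n \<delta>) - (if \<delta> = \<alpha> then k else 0) = real (m \<delta>)" if "\<delta> \<in> \<Delta>" for \<delta>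
      by (rule coef[OF trans[OF \<beta>'[symmetric] pos] that])
    have lt: "(\<Sum>\<alpha>\<in>\<Delta>. m \<alpha>) < (\<Sum>\<alpha>\<in>\<Delta>. n \<alpha>)"
    proof (rule sum_strict_mono_ex1[OF fD])
      show "\<forall>x\<in>\<Delta>. m x \<le> n x"
      proof
        fix \<delta> assume "\<delta> \<in> \<Delta>"
        then show "m \<delta> \<le> n \<delta>" using mn[of \<delta>] k by (simp split: if_splits)
      qed
      show "\<exists>a\<in>\<Delta>. m a < n a" using mn[OF \<alpha>(1)] k \<alpha>(1) by (intro bexI[of _ \<alpha>]) auto
    qed
    have "reflection \<beta>' \<in> weyl_group \<Delta>"
      unfolding pos by (rule less.hyps[OF lt]) (use \<beta>'R pos in simp)
    then have "reflection \<alpha> \<circ> (reflection \<beta>' \<circ> reflection \<alpha>) \<in> weyl_group \<Delta>"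
      by (intro weyl_comp weyl_reflection[OF \<alpha>(1)])
    moreover have "reflection \<alpha> \<circ> (reflection \<beta>' \<circ> reflection \<alpha>) = reflection \<beta>"
      by (auto simp: \<beta>'_def reflection_conj reflection_reflection fun_eq_iff)
    ultimately show "reflection \<beta> \<in> weyl_group \<Delta>" by simp
  qed
qed

lemma weyl_group_simple:
  fixes R :: "('a \<Rightarrow>\<^sub>L real) set"
  assumes "reduced_root_system R" "root_basis R \<Delta>"
  shows "weyl_group R = weyl_group \<Delta>"
proof
  have refl: "reflection \<beta> \<in> weyl_group \<Delta>" if \<beta>: "\<beta> \<in> R" for \<beta>
  proof -
    obtain n :: "('a \<Rightarrow>\<^sub>L real) \<Rightarrow> nat" where n: "\<beta> = (\<Sum>\<alpha>\<in>\<Delta>. real (n \<alpha>) *\<^sub>R \<alpha>) \<or> \<beta> = - (\<Sum>\<alpha>\<in>\<Delta>. real (n \<alpha>) *\<^sub>R \<alpha>)"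
      using assms(2) \<beta> unfolding root_basis_def by blast
    have neg: "- \<beta> \<in> R"
    proof -
      have b: "\<beta> \<noteq> 0" using assms(1) \<beta> unfolding reduced_root_system_def by metis
      have "dual_action (reflection \<beta>) \<beta> = - \<beta>"
        by (rule blinfun_eqI) (use coroot_pairing[OF b] in
            \<open>simp add: dual_reflection reflection_def blinfun.diff_right blinfun.scaleR_right blinfun.minus_left\<close>)
      moreover have "dual_action (reflection \<beta>) ` R = R" using assms(1) \<beta> unfolding reduced_root_system_def by blast
      then have "dual_action (reflection \<beta>) \<beta> \<in> R" using \<beta> by (metis image_eqI)
      ultimately show ?thesis by simp
    qed
    from n show ?thesis
    proof
      assume "\<beta> = (\<Sum>\<alpha>\<in>\<Delta>. real (n \<alpha>) *\<^sub>R \<alpha>)"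
      then show ?thesis using reflection_in_simple[OF assms, of n] \<beta> by simp
    next
      assume "\<beta> = - (\<Sum>\<alpha>\<in>\<Delta>. real (n \<alpha>) *\<^sub>R \<alpha>)"
      then have e: "(\<Sum>\<alpha>\<in>\<Delta>. real (n \<alpha>) *\<^sub>R \<alpha>) = - \<beta>" by simp
      have "reflection (- \<beta>) \<in> weyl_group \<Delta>"
        using reflection_in_simple[OF assms, of n] neg unfolding e by blast
      then show ?thesis by (simp only: reflection_uminus)
    qed
  qed
  show "weyl_group R \<subseteq> weyl_group \<Delta>"
  proof
    fix w assume "w \<in> weyl_group R"
    then show "w \<in> weyl_group \<Delta>"
    proof (induction rule: weyl_group.induct)
      case 1
      show ?case by (rule weyl_group.intros(1))
    next
      case (2 \<alpha> w)
      show ?case by (rule weyl_comp[OF refl[OF 2(1)] 2(3)])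
    qed
  qed
  show "weyl_group \<Delta> \<subseteq> weyl_group R"
  proof
    fix w assume "w \<in> weyl_group \<Delta>"
    then show "w \<in> weyl_group R"
    proof (induction rule: weyl_group.induct)
      case 1
      show ?case by (rule weyl_group.intros(1))
    next
      case (2 \<alpha> w)
      have "\<alpha> \<in> R" using assms(2) 2(1) unfolding root_basis_def by blast
      then show ?case by (rule weyl_group.intros(2)) (rule 2(3))
    qed
  qed
qed

text \<open>Applying a functional to the orthogonal expansion writes it as the sum of the dual
  functionals \<open>d c\<close> with complex coefficients, its values on \<open>C\<close>.\<close>

lemma cspace_finite:
  "\<exists>S :: ('a \<Rightarrow>\<^sub>L complex) set. finite S \<and> Modules.module.span cscale S = UNIV"
proof (rule orthogonal_expansion)
  fix C :: "'a set" assume C: "finite C" "\<And>v. v = (\<Sum>c\<in>C. (inner c v / inner c c) *\<^sub>R c)"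
  interpret vector_space cscale by (rule vector_space_cscale)
  define d where "d c = Blinfun (\<lambda>v. complex_of_real (inner c v / inner c c))" for c :: 'a
  have d: "blinfun_apply (d c) v = complex_of_real (inner c v / inner c c)" for c v
  proof -
    have "bounded_linear (\<lambda>v. inner c v *\<^sub>R complex_of_real (1 / inner c c))"
      by (rule bounded_linear_compose[OF bounded_linear_scaleR_left bounded_linear_inner_right])
    moreover have "(\<lambda>v. inner c v *\<^sub>R complex_of_real (1 / inner c c)) = (\<lambda>v. complex_of_real (inner c v / inner c c))"
      by (auto simp: scaleR_conv_of_real)
    ultimately have "bounded_linear (\<lambda>v. complex_of_real (inner c v / inner c c))" by simp
    then show ?thesis by (simp add: d_def bounded_linear_Blinfun_apply)
  qed
  have ex: "x = (\<Sum>c\<in>C. cscale (blinfun_apply x c) (d c))" for x :: "'a \<Rightarrow>\<^sub>L complex"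
  proof (rule blinfun_eqI)
    fix v
    have "blinfun_apply x v = blinfun_apply x (\<Sum>c\<in>C. (inner c v / inner c c) *\<^sub>R c)" using C(2)[of v] by simp
    also have "\<dots> = blinfun_apply (\<Sum>c\<in>C. cscale (blinfun_apply x c) (d c)) v"
      by (simp add: blinfun.sum_right blinfun.sum_left blinfun.scaleR_right cscale_def d scaleR_conv_of_real mult.commute)
    finally show "blinfun_apply x v = blinfun_apply (\<Sum>c\<in>C. cscale (blinfun_apply x c) (d c)) v" .
  qed
  have "x \<in> span (d ` C)" for x
  proof -
    have "(\<Sum>c\<in>C. cscale (blinfun_apply x c) (d c)) \<in> span (d ` C)"
      by (intro span_sum span_scale span_base imageI)
    then show ?thesis by (simp only: ex[symmetric])
  qed
  then have "span (d ` C) = UNIV" by blast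
  moreover have "finite (d ` C)" using C(1) by simp
  ultimately show ?thesis by blast
qed

end

section \<open>Graded Hecke algebras\<close>

text \<open>A function of finite support is encoded by its graph over the support, a finite set of
  pairs in \<open>'m\<close>. An infinite set has as many pairs, and as many finite subsets, as
  elements.\<close>

lemma (in ring) free_embedding_exists:
  fixes \<eta> :: "'a \<Rightarrow> 'm"
  assumes \<eta>: "inj_on \<eta> (carrier R)" and inf: "infinite (UNIV :: 'm set)"
  shows "\<exists>\<tau> :: ('m \<Rightarrow> 'a) \<Rightarrow> 'm. inj_on \<tau> (carrier (free_module R UNIV))"
proof -
  let ?F = "carrier (free_module R (UNIV :: 'm set))"
  define g where "g f = (\<lambda>i. (i, \<eta> (f i))) ` {i. f i \<noteq> \<zero>}" for f :: "'m \<Rightarrow> 'a"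
  have cl: "f i \<in> carrier R" if "f \<in> ?F" for f i using that by (simp add: free_module_carrier)
  have sub: "f i = f' i" if f: "f \<in> ?F" "f' \<in> ?F" "g f = g f'" "f i \<noteq> \<zero>" for f f' i
  proof -
    have "(i, \<eta> (f i)) \<in> g f" using f(4) by (simp add: g_def)
    then have "(i, \<eta> (f i)) \<in> g f'" using f(3) by simp
    then have "\<eta> (f i) = \<eta> (f' i)" by (auto simp: g_def)
    then show ?thesis by (rule inj_onD[OF \<eta>]) (use cl f in simp_all)
  qed
  have inj: "inj_on g ?F"
  proof (rule inj_onI)
    fix f f' assume f: "f \<in> ?F" "f' \<in> ?F" "g f = g f'"
    show "f = f'"
    proof
      fix i show "f i = f' i"
      proof (rule ccontr)
        assume ne: "f i \<noteq> f' i"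
        then have "f i \<noteq> \<zero> \<or> f' i \<noteq> \<zero>" by auto
        then show False
        proof
          assume "f i \<noteq> \<zero>"
          then show False using sub[OF f] ne by blast
        next
          assume "f' i \<noteq> \<zero>"
          then have "f' i = f i" by (rule sub[OF f(2,1) f(3)[symmetric]])
          then show False using ne by simp
        qed
      qed
    qed
  qed
  have img: "g ` ?F \<subseteq> Fpow UNIV"
    by (auto simp: g_def Fpow_def free_module_carrier)
  have infp: "infinite (UNIV \<times> UNIV :: ('m \<times> 'm) set)" 
  proof
    assume "finite (UNIV \<times> UNIV :: ('m \<times> 'm) set)"
    then have "finite (UNIV :: 'm set)" by (rule finite_cartesian_productD1) simp
    then show False using inf by simp
  qed
  have "Fpow (UNIV \<times> UNIV :: ('m \<times> 'm) set) \<approx> (UNIV \<times> UNIV :: ('m \<times> 'm) set)" by (rule eqpoll_Fpow[OF infp])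
  moreover have "(UNIV \<times> UNIV :: ('m \<times> 'm) set) \<approx> (UNIV :: 'm set)"
    unfolding eqpoll_iff_card_of_ordIso by (rule card_of_Times_same_infinite[OF inf])
  ultimately have "Fpow (UNIV \<times> UNIV :: ('m \<times> 'm) set) \<approx> (UNIV :: 'm set)" by (rule eqpoll_trans)
  then obtain b :: "('m \<times> 'm) set \<Rightarrow> 'm" where b: "bij_betw b (Fpow (UNIV \<times> UNIV)) UNIV" unfolding eqpoll_def by (rule exE)
  have "inj_on b (g ` ?F)" by (rule inj_on_subset[OF bij_betw_imp_inj_on[OF b]]) (use img in simp)
  then have "inj_on (b \<circ> g) ?F" using inj by (rule comp_inj_on[rotated])
  then show ?thesis by (intro exI[of _ "b \<circ> g"])
qed

lemma (in pbw_hecke) inj_sca: "inj sca"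
proof (rule injI, rule ccontr)
  fix c d assume e: "sca c = sca d" and ne: "c \<noteq> d"
  have "sca (c + - d) = sca d \<oplus> \<ominus> sca d" by (simp only: sca_add sca_minus e)
  then have z: "sca (c - d) = \<zero>" by (simp add: r_neg)
  have "\<one> = sca (1 / (c - d)) \<otimes> sca (c - d)" using ne by (simp add: sca_mult[symmetric] sca_one)
  then show False using z one_not_zero by simp
qed

text \<open>The decomposition over families of cosets is composed with the bijection from normal
  forms to cosets, taken componentwise.\<close>

lemma sym_hecke_graded_hecke:
  fixes R \<Delta> :: "('a::real_inner \<Rightarrow>\<^sub>L real) set" and H :: "(complex, 'h) module"
  assumes hecke: "graded_hecke_algebra R \<Delta> k H T j"
    and B: "finite B" "Modules.module.span cscale B = UNIV" "\<not> Modules.module.dependent cscale B"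
  shows "sym_hecke H cscale B (\<lambda>c. c \<odot>\<^bsub>H\<^esub> \<one>\<^bsub>H\<^esub>) (weyl_group R) T
    (\<lambda>p. j (sym_ideal cscale +>\<^bsub>ring_of_type_algebra\<^esub> p))"
proof -
  have ca: "complex_algebra H" using hecke by (simp add: graded_hecke_algebra_def)
  interpret Hr: ring H using ca by (simp add: complex_algebra_def)
  have modH: "Module.module (ring_of_type_algebra :: complex ring) H" using ca by (simp add: complex_algebra_def)
  have sbB: "sym_basis cscale B" by (intro sym_basis.intro vector_space_cscale sym_basis_axioms.intro B)
  interpret sb: sym_basis cscale B by (rule sbB)
  interpret P: cring sb.P0 by (rule sb.P0_cring)
  let ?I = "sym_ideal cscale :: ('a \<Rightarrow>\<^sub>L complex) free_comm set" and ?W = "weyl_group R"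
  let ?S = "symmetric_algebra cscale :: ('a \<Rightarrow>\<^sub>L complex) free_comm set ring"
  let ?co = "\<lambda>p. ?I +>\<^bsub>sb.P0\<^esub> p"
  define q where "q p = j (?co p)" for p
  have co_eq: "?co p = ?co p' \<longleftrightarrow> p - p' \<in> ?I" for p p'
    using P.quotient_eq_iff_same_a_r_cos[OF sb.P0_ideal, of p p'] by (simp add: a_minus_def sb.P0_minus)
  have co_hom: "?co \<in> ring_hom sb.P0 ?S"
    unfolding symmetric_algebra_def by (rule ideal.rcos_ring_hom[OF sb.P0_ideal])
  have jh: "j \<in> ring_hom ?S H" using hecke by (simp add: graded_hecke_algebra_def graded_hecke_algebra_axioms_def)
  have qh: "q \<in> ring_hom sb.P0 H"
    using ring_hom_trans[OF co_hom jh] by (simp add: q_def[abs_def] comp_def)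
  have jc: "j (sym_const cscale c) = c \<odot>\<^bsub>H\<^esub> \<one>\<^bsub>H\<^esub>" for c
    using hecke by (simp add: graded_hecke_algebra_def graded_hecke_algebra_axioms_def)
  have Tc: "T w \<in> carrier H" if "w \<in> ?W" for w
    using hecke that by (simp add: graded_hecke_algebra_def graded_hecke_algebra_axioms_def)
  define F where "F f = (\<Oplus>\<^bsub>H\<^esub>w\<in>?W. T w \<otimes>\<^bsub>H\<^esub> j (f w))" for f
  have Fb: "bij_betw F (?W \<rightarrow>\<^sub>E carrier ?S) (carrier H)"
    using hecke by (simp add: graded_hecke_algebra_def graded_hecke_algebra_axioms_def F_def[abs_def])
  have carS: "carrier ?S = range ?co"
    by (auto simp: symmetric_algebra_def FactRing_def A_RCOSETS_def' sb.P0_simps)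
  have Wid: "id \<in> ?W" by (rule weyl_group.intros(1))
  \<comment> \<open>The tensor decomposition forces finiteness: a sum over an infinite index set is
    zero by convention, so the decomposition map would be constant, while 0 and 1 differ in the
    symmetric algebra.\<close>
  have Wfin: "finite ?W"
  proof (rule ccontr)
    assume "infinite ?W"
    then have F0: "F f = \<zero>\<^bsub>H\<^esub>" for f unfolding F_def by simp
    have c: "(\<lambda>w\<in>?W. ?co p) \<in> ?W \<rightarrow>\<^sub>E carrier ?S" for p by (auto simp: carS)
    have "(\<lambda>w\<in>?W. ?co 1) = (\<lambda>w\<in>?W. ?co 0)"
      using inj_onD[OF bij_betw_imp_inj_on[OF Fb] _ c c] F0 by simp
    from fun_cong[OF this, of id] have "?co 1 = ?co 0" using Wid by simp
    then have "1 \<in> ?I" by (simp add: co_eq)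
    then have "sb.\<Phi> 1 = 0" by (rule sb.sym_ideal_Phi)
    then show False using sb.Phi_const[of 1] by (simp add: single_one)
  qed
  have "bij_betw (\<lambda>g. \<Oplus>\<^bsub>H\<^esub>w\<in>?W. T w \<otimes>\<^bsub>H\<^esub> q (g w)) (?W \<rightarrow>\<^sub>E range sb.\<Phi>) (carrier H)"
  proof -
    let ?L = "\<lambda>g. \<lambda>w\<in>?W. ?co (g w)"
    have Lb: "bij_betw ?L (?W \<rightarrow>\<^sub>E range sb.\<Phi>) (?W \<rightarrow>\<^sub>E carrier ?S)"
    proof (rule bij_betw_imageI)
      show "inj_on ?L (?W \<rightarrow>\<^sub>E range sb.\<Phi>)"
      proof (rule inj_onI)
        fix g g' assume g: "g \<in> ?W \<rightarrow>\<^sub>E range sb.\<Phi>" "g' \<in> ?W \<rightarrow>\<^sub>E range sb.\<Phi>" "?L g = ?L g'"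
        show "g = g'"
        proof (rule PiE_ext[OF g(1,2)])
          fix w assume w: "w \<in> ?W"
          have "?co (g w) = ?co (g' w)" using fun_cong[OF g(3), of w] w by simp
          then have "sb.\<Phi> (g w - g' w) = 0" unfolding co_eq by (rule sb.sym_ideal_Phi)
          moreover have "g w \<in> range sb.\<Phi>" "g' w \<in> range sb.\<Phi>" using PiE_mem[OF g(1) w] PiE_mem[OF g(2) w] by auto
          then have "sb.\<Phi> (g w) = g w" "sb.\<Phi> (g' w) = g' w" using sb.Phi_Phi by (elim rangeE, simp)+
          ultimately show "g w = g' w" by (simp add: sb.Phi_diff)
        qed
      qed
      show "?L ` (?W \<rightarrow>\<^sub>E range sb.\<Phi>) = ?W \<rightarrow>\<^sub>E carrier ?S"
      proof
        show "?L ` (?W \<rightarrow>\<^sub>E range sb.\<Phi>) \<subseteq> ?W \<rightarrow>\<^sub>E carrier ?S" by (auto simp: carS)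
        show "?W \<rightarrow>\<^sub>E carrier ?S \<subseteq> ?L ` (?W \<rightarrow>\<^sub>E range sb.\<Phi>)"
        proof
          fix f assume f: "f \<in> ?W \<rightarrow>\<^sub>E carrier ?S"
          define r where "r w = (SOME p. ?co p = f w)" for w
          have r: "?co (r w) = f w" if w: "w \<in> ?W" for w
          proof -
            have "f w \<in> range ?co" using PiE_mem[OF f w] by (simp add: carS)
            then have "\<exists>p. ?co p = f w" by auto
            then show ?thesis unfolding r_def by (rule someI_ex)
          qed
          have Phi_co: "?co (sb.\<Phi> p) = ?co p" for p
            using sb.Phi_congr[of p] co_eq[of p "sb.\<Phi> p"] by simp
          have "f = ?L (\<lambda>w\<in>?W. sb.\<Phi> (r w))"
          proof
            fix w show "f w = ?L (\<lambda>w\<in>?W. sb.\<Phi> (r w)) w"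
              using f by (cases "w \<in> ?W") (auto simp: Phi_co r PiE_def extensional_def)
          qed
          moreover have "(\<lambda>w\<in>?W. sb.\<Phi> (r w)) \<in> ?W \<rightarrow>\<^sub>E range sb.\<Phi>" by auto
          ultimately show "f \<in> ?L ` (?W \<rightarrow>\<^sub>E range sb.\<Phi>)" by (rule image_eqI)
        qed
      qed
    qed
    have "F (?L g) = (\<Oplus>\<^bsub>H\<^esub>w\<in>?W. T w \<otimes>\<^bsub>H\<^esub> q (g w))" for g
      unfolding F_def
    proof (rule Hr.finsum_cong')
      show "(\<lambda>w. T w \<otimes>\<^bsub>H\<^esub> q (g w)) \<in> ?W \<rightarrow> carrier H" using Tc ring_hom_closed[OF qh] by (auto simp: sb.P0_simps)
    qed (auto simp: q_def)
    then show ?thesis using bij_betw_trans[OF Lb Fb] by (simp add: comp_def)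
  qed
  moreover have "h \<otimes>\<^bsub>H\<^esub> (c \<odot>\<^bsub>H\<^esub> \<one>\<^bsub>H\<^esub>) = (c \<odot>\<^bsub>H\<^esub> \<one>\<^bsub>H\<^esub>) \<otimes>\<^bsub>H\<^esub> h" if "h \<in> carrier H" for h c
    using complex_algebra.smult_mult_left[OF ca, of "\<one>\<^bsub>H\<^esub>" h c] complex_algebra.smult_mult_right[OF ca, of h "\<one>\<^bsub>H\<^esub>" c] that by simp
  moreover have "q p \<in> carrier H" "q (p + p') = q p \<oplus>\<^bsub>H\<^esub> q p'" "q (p * p') = q p \<otimes>\<^bsub>H\<^esub> q p'" "q 1 = \<one>\<^bsub>H\<^esub>" for p p'
    using ring_hom_closed[OF qh, of p] ring_hom_add[OF qh, of p p'] ring_hom_mult[OF qh, of p p'] ring_hom_one[OF qh]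
    by (simp_all add: sb.P0_simps)
  moreover have "q (const_poly c) = c \<odot>\<^bsub>H\<^esub> \<one>\<^bsub>H\<^esub>" for c using jc[of c] by (simp add: q_def sym_const_def)
  moreover have "q p = q p'" if "p - p' \<in> ?I" for p p' using that co_eq[of p p'] by (simp add: q_def)
  ultimately have "sym_hecke H cscale B (\<lambda>c. c \<odot>\<^bsub>H\<^esub> \<one>\<^bsub>H\<^esub>) ?W T q"
    by (intro sym_hecke.intro Hr.ring_axioms sbB sym_hecke_axioms.intro Wfin Tc)
  then show ?thesis by (simp add: q_def[abs_def])
qed

theorem theorem5p4:
  fixes R \<Delta> :: "('a::real_inner \<Rightarrow>\<^sub>L real) set"
    and k :: "('a \<Rightarrow>\<^sub>L real) \<Rightarrow> complex"
    and H :: "(complex, 'h) module"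
    and T :: "('a \<Rightarrow> 'a) \<Rightarrow> 'h"
    and j :: "('a \<Rightarrow>\<^sub>L complex) free_comm set \<Rightarrow> 'h"
  assumes finite_dim: "\<exists>B :: 'a set. finite B \<and> span B = UNIV"
    and root_system: "reduced_root_system R"
    and basis: "root_basis R \<Delta>"
    and k_invariant: "\<And>\<alpha> \<beta> w. \<lbrakk>\<alpha> \<in> \<Delta>; \<beta> \<in> \<Delta>; w \<in> weyl_group R; \<beta> = dual_action w \<alpha>\<rbrakk> \<Longrightarrow> k \<alpha> = k \<beta>"
    and hecke: "graded_hecke_algebra R \<Delta> k H T j"
    and universe: "\<exists>f :: 'h \<Rightarrow> 'm. inj_on f (carrier H)"
  shows "global_dimension TYPE('m) H =
    enat (vector_space.dim cscale (UNIV :: ('a \<Rightarrow>\<^sub>L complex) set))"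
proof -
  have ca: "complex_algebra H" using hecke by (simp add: graded_hecke_algebra_def)
  interpret Hr: ring H using ca by (simp add: complex_algebra_def)
  interpret FD: finite_dim_inner "TYPE('a)" by unfold_locales (rule finite_dim)
  interpret vs: vector_space "cscale :: complex \<Rightarrow> ('a \<Rightarrow>\<^sub>L complex) \<Rightarrow> _" by (rule vector_space_cscale)
  obtain S :: "('a \<Rightarrow>\<^sub>L complex) set" where S: "finite S" "vs.span S = UNIV" using FD.cspace_finite by (elim exE conjE)
  obtain B :: "('a \<Rightarrow>\<^sub>L complex) set" where
    B: "B \<subseteq> UNIV" "vs.independent B" "UNIV \<subseteq> vs.span B" "card B = vs.dim UNIV" by (rule vs.basis_exists[of UNIV])
  have Bfin: "finite B" using vs.independent_span_bound[OF S(1) B(2)] S(2) by simp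
  have Bsp: "vs.span B = UNIV" using B(3) by (rule top.extremum_uniqueI)
  let ?W = "weyl_group R"
  define sca where "sca c = c \<odot>\<^bsub>H\<^esub> \<one>\<^bsub>H\<^esub>" for c
  define q where "q p = j (sym_ideal cscale +>\<^bsub>ring_of_type_algebra\<^esub> p)" for p
  interpret SH: sym_hecke H cscale B sca ?W T q
    unfolding sca_def[abs_def] q_def[abs_def] by (rule sym_hecke_graded_hecke[OF hecke Bfin Bsp B(2)])
  \<comment> \<open>The abstract setting attaches root, coroot functional and parameter to a
    reflection, so a simple root is chosen for every simple reflection.\<close>
  define ro where "ro s = (SOME \<alpha>. \<alpha> \<in> \<Delta> \<and> reflection \<alpha> = s)" for s
  have ro: "ro s \<in> \<Delta> \<and> reflection (ro s) = s" if s: "s \<in> reflection ` \<Delta>" for s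
  proof -
    from s have "\<exists>\<alpha>. \<alpha> \<in> \<Delta> \<and> reflection \<alpha> = s" by auto
    then show ?thesis unfolding ro_def by (rule someI_ex)
  qed
  have DR: "\<Delta> \<subseteq> R" using basis by (simp add: root_basis_def)
  have nz: "\<alpha> \<noteq> 0" if "\<alpha> \<in> \<Delta>" for \<alpha> using root_system DR that by (auto simp: reduced_root_system_def)
  define rt where "rt s = Blinfun (\<lambda>v. complex_of_real (blinfun_apply (ro s) v))" for s
  have rt: "blinfun_apply (rt s) v = complex_of_real (blinfun_apply (ro s) v)" for s v
    unfolding rt_def
    by (subst bounded_linear_Blinfun_apply)
      (rule bounded_linear_compose[OF bounded_linear_of_real blinfun.bounded_linear_right], rule refl)
  have cs: "blinfun_apply (cscale c x) v = c * blinfun_apply x v" for c and x :: "'a \<Rightarrow>\<^sub>L complex" and v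
    by (simp add: cscale_def)
  have Wid: "id \<in> ?W" by (rule weyl_group.intros(1))
  define cr where "cr s x = blinfun_apply x (coroot (ro s))" for s and x :: "'a \<Rightarrow>\<^sub>L complex"
  have sW: "s \<in> ?W" if s: "s \<in> reflection ` \<Delta>" for s
    using FD.weyl_reflection[of "ro s" R] ro[OF s] DR by auto
  have sav: "dual_action s x = x - cscale (cr s x) (rt s)" if s: "s \<in> reflection ` \<Delta>" for s and x :: "'a \<Rightarrow>\<^sub>L complex"
  proof (rule blinfun_eqI)
    fix v
    have "blinfun_apply (dual_action (reflection (ro s)) x) v = blinfun_apply (x - cscale (cr s x) (rt s)) v"
      by (simp add: FD.dual_reflection reflection_def cr_def rt cs blinfun.diff_right blinfun.diff_left
          blinfun.scaleR_right scaleR_conv_of_real)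
    then show "blinfun_apply (dual_action s x) v = blinfun_apply (x - cscale (cr s x) (rt s)) v" using ro[OF s] by simp
  qed
  have crav: "cr s (dual_action s x) = - cr s x" if s: "s \<in> reflection ` \<Delta>" for s and x :: "'a \<Rightarrow>\<^sub>L complex"
  proof -
    have "blinfun_apply (ro s) (coroot (ro s)) = 2" using FD.coroot_pairing[OF nz] ro[OF s] by simp
    then show ?thesis by (simp add: sav[OF s] blinfun.diff_left cs rt cr_def)
  qed
  have yj: "SH.y x = j (sym_incl cscale x)" for x by (simp only: SH.y_def q_def sym_incl_def)
  have crs: "SH.y x \<otimes>\<^bsub>H\<^esub> T s = T s \<otimes>\<^bsub>H\<^esub> SH.y (dual_action s x) \<oplus>\<^bsub>H\<^esub> sca (k (ro s) * cr s x)"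
    if s: "s \<in> reflection ` \<Delta>" for s x
  proof -
    let ?a = "SH.y x \<otimes>\<^bsub>H\<^esub> T s" and ?b = "T s \<otimes>\<^bsub>H\<^esub> SH.y (dual_action s x)"
    have cl: "?a \<in> carrier H" "?b \<in> carrier H"
      using SH.y_closed SH.T_closed[OF sW[OF s]] by (simp_all only: Hr.m_closed)
    have e: "?a \<ominus>\<^bsub>H\<^esub> ?b = sca (k (ro s) * cr s x)"
      using graded_hecke_algebra.cross_relation[OF hecke, of "ro s" x] ro[OF s] by (simp only: yj sca_def cr_def)
    have "?b \<oplus>\<^bsub>H\<^esub> (?a \<ominus>\<^bsub>H\<^esub> ?b) = ?a \<oplus>\<^bsub>H\<^esub> (?b \<oplus>\<^bsub>H\<^esub> \<ominus>\<^bsub>H\<^esub> ?b)"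
      unfolding Hr.minus_eq by (rule Hr.a_lcomm[OF cl(2,1) Hr.a_inv_closed[OF cl(2)]])
    also have "\<dots> = ?a" unfolding Hr.r_neg[OF cl(2)] by (rule Hr.r_zero[OF cl(1)])
    finally show ?thesis unfolding e by (rule sym)
  qed
  \<comment> \<open>Off the group the decomposition has the default value \<open>undefined\<close>,
    whose coefficients need not be additive in \<open>h\<close>; they are replaced by zero.\<close>
  define cf where "cf h w m = (if w \<in> ?W then SH.cf h w m else 0)" for h w m
  have pbw: "pbw_hecke H sca ?W (reflection ` \<Delta>) T dual_action cscale cr rt (\<lambda>s. k (ro s)) SH.y B SH.Y cf"
  proof (intro pbw_hecke.intro Hr.ring_axioms pbw_hecke_axioms.intro)
    show "vector_space (cscale :: complex \<Rightarrow> ('a \<Rightarrow>\<^sub>L complex) \<Rightarrow> _)" by (rule vector_space_cscale)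
    show "sca c \<in> carrier H" for c by (rule SH.sca_closed)
    show "sca (c + d) = sca c \<oplus>\<^bsub>H\<^esub> sca d" for c d
      by (simp only: SH.q_const[symmetric] SH.q_add[symmetric] single_add)
    show "sca (c * d) = sca c \<otimes>\<^bsub>H\<^esub> sca d" for c d
      by (simp only: SH.q_const[symmetric] SH.q_mult[symmetric] mult_single add_0_left)
    show "sca 1 = \<one>\<^bsub>H\<^esub>" by (simp only: SH.q_const[symmetric] single_one SH.q_one)
    show "h \<otimes>\<^bsub>H\<^esub> sca c = sca c \<otimes>\<^bsub>H\<^esub> h" if "h \<in> carrier H" for h c using that by (rule SH.sca_central)
    show "finite ?W" by (rule SH.W_fin)
    show "id \<in> ?W" by (rule Wid)
    show "u \<circ> w \<in> ?W" if "u \<in> ?W" "w \<in> ?W" for u w using that by (rule FD.weyl_comp)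
    show "\<exists>u\<in>?W. u \<circ> w = id \<and> w \<circ> u = id" if "w \<in> ?W" for w using that by (rule FD.weyl_inverse)
    show "T w \<in> carrier H" if "w \<in> ?W" for w using that by (rule SH.T_closed)
    show "T id = \<one>\<^bsub>H\<^esub>" by (rule graded_hecke_algebra.T_id[OF hecke])
    show "T (u \<circ> w) = T u \<otimes>\<^bsub>H\<^esub> T w" if "u \<in> ?W" "w \<in> ?W" for u w
      using that by (rule graded_hecke_algebra.T_comp[OF hecke])
    show "dual_action id x = x" for x :: "'a \<Rightarrow>\<^sub>L complex"
      by (rule blinfun_eqI) (simp add: FD.weyl_dual[OF Wid])
    show "dual_action (u \<circ> w) x = dual_action u (dual_action w x)" if "u \<in> ?W" "w \<in> ?W" for u w and x :: "'a \<Rightarrow>\<^sub>L complex"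
      using that by (rule FD.dual_action_comp)
    show "dual_action w (x + x') = dual_action w x + dual_action w x'" if w: "w \<in> ?W" for w and x x' :: "'a \<Rightarrow>\<^sub>L complex"
      by (rule blinfun_eqI) (simp add: FD.weyl_dual[OF w] blinfun.add_left)
    show "dual_action w (cscale c x) = cscale c (dual_action w x)" if w: "w \<in> ?W" for w c and x :: "'a \<Rightarrow>\<^sub>L complex"
      by (rule blinfun_eqI) (simp add: FD.weyl_dual[OF w] cs)
    show "s \<in> ?W" if "s \<in> reflection ` \<Delta>" for s using that by (rule sW)
    show "s \<circ> s = id" if s: "s \<in> reflection ` \<Delta>" for s
      using FD.reflection_invol[of "ro s"] ro[OF s] by simp
    show "dual_action s x = x - cscale (cr s x) (rt s)" if "s \<in> reflection ` \<Delta>" for s x using that by (rule sav)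
    show "cr s (x + x') = cr s x + cr s x'" for s x x' by (simp add: cr_def blinfun.add_left)
    show "cr s (cscale c x) = c * cr s x" for s c x by (simp add: cr_def cs)
    show "cr s (dual_action s x) = - cr s x" if "s \<in> reflection ` \<Delta>" for s x using that by (rule crav)
    \<comment> \<open>The group is defined by the reflections in all roots; generation by the simple
      ones is the point at which the root system axioms and the basis enter.\<close>
    show "?W \<subseteq> K" if K: "id \<in> K" "\<And>s w. s \<in> reflection ` \<Delta> \<Longrightarrow> w \<in> ?W \<Longrightarrow> w \<in> K \<Longrightarrow> s \<circ> w \<in> K" for K
    proof
      note simple = FD.weyl_group_simple[OF root_system basis]
      fix w assume "w \<in> ?W"
      then have "w \<in> weyl_group \<Delta>" unfolding simple .
      then show "w \<in> K"
      proof (induction rule: weyl_group.induct)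
        case 1 show ?case by (rule K(1))
      next
        case (2 \<alpha> w)
        have "w \<in> ?W" unfolding simple by (rule 2(2))
        then show ?case by (rule K(2)[OF imageI[OF 2(1)] _ 2(3)])
      qed
    qed
    show "SH.y x \<in> carrier H" for x by (rule SH.y_closed)
    show "SH.y (x + x') = SH.y x \<oplus>\<^bsub>H\<^esub> SH.y x'" for x x' by (rule SH.y_add)
    show "SH.y (cscale c x) = sca c \<otimes>\<^bsub>H\<^esub> SH.y x" for c x by (rule SH.y_scl)
    show "SH.y x \<otimes>\<^bsub>H\<^esub> SH.y x' = SH.y x' \<otimes>\<^bsub>H\<^esub> SH.y x" for x x' by (rule SH.y_comm)
    show "SH.y x \<otimes>\<^bsub>H\<^esub> T s = T s \<otimes>\<^bsub>H\<^esub> SH.y (dual_action s x) \<oplus>\<^bsub>H\<^esub> sca (k (ro s) * cr s x)"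
      if "s \<in> reflection ` \<Delta>" for s x using that by (rule crs)
    show "finite B" by (rule Bfin)
    show "vs.span B = UNIV" by (rule Bsp)
    show "vs.independent B" by (rule B(2))
    show "SH.Y m \<in> carrier H" if "m \<in> Mon B" for m by (rule SH.Y_closed)
    show "SH.Y (\<lambda>_. 0) = \<one>\<^bsub>H\<^esub>" by (rule SH.Y_zero)
    show "SH.Y (m(b := Suc (m b))) = SH.y b \<otimes>\<^bsub>H\<^esub> SH.Y m" if "m \<in> Mon B" "b \<in> B" for m b using that by (rule SH.Y_Suc)
    show "cf (h \<oplus>\<^bsub>H\<^esub> h') w m = cf h w m + cf h' w m" if "h \<in> carrier H" "h' \<in> carrier H" for h h' w m
      using SH.cf_add[OF that, of w m] by (simp add: cf_def)
    show "cf (sca c \<otimes>\<^bsub>H\<^esub> h) w m = c * cf h w m" if "h \<in> carrier H" for h c w m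
      using SH.cf_sca[OF that, of w c m] by (simp add: cf_def)
    show "finite {(w, m). w \<in> ?W \<and> m \<in> Mon B \<and> cf h w m \<noteq> 0}" if h: "h \<in> carrier H" for h
      by (rule finite_subset[OF _ SH.cf_fin[OF h]]) (auto simp: cf_def)
    show "cf (T u \<otimes>\<^bsub>H\<^esub> SH.Y n) w m = (if w = u \<and> m = n then 1 else 0)"
      if "u \<in> ?W" "n \<in> Mon B" "w \<in> ?W" "m \<in> Mon B" for u n w m
      using SH.cf_basis[OF that] that(3) by (simp only: cf_def if_True)
    show "carrier H \<subseteq> K" if K: "\<And>h h'. h \<in> K \<Longrightarrow> h' \<in> K \<Longrightarrow> h \<oplus>\<^bsub>H\<^esub> h' \<in> K"
      "\<And>c w m. w \<in> ?W \<Longrightarrow> m \<in> Mon B \<Longrightarrow> sca c \<otimes>\<^bsub>H\<^esub> (T w \<otimes>\<^bsub>H\<^esub> SH.Y m) \<in> K" for K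
    proof (rule SH.pbw_induct)
      show "?W \<noteq> {}" using Wid by auto
    qed (fact K)+
  qed
  obtain f :: "'h \<Rightarrow> 'm" where f: "inj_on f (carrier H)" using universe by (rule exE)
  \<comment> \<open>The scalars embed the complex numbers into the algebra and thus into
    \<open>'m\<close>, which is therefore infinite and has room for the free modules.\<close>
  have "inj_on f (range sca)" by (rule inj_on_subset[OF f]) (use SH.sca_closed in auto)
  then have inj: "inj (f \<circ> sca)" by (rule comp_inj_on[OF pbw_hecke.inj_sca[OF pbw]])
  have inf: "infinite (UNIV :: 'm set)"
  proof
    assume "finite (UNIV :: 'm set)"
    then have "finite (range (f \<circ> sca))" by (rule finite_subset[OF subset_UNIV])
    then have "finite (UNIV :: complex set)" using inj by (rule finite_imageD)
    then show False by (rule notE[OF infinite_UNIV_char_0])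
  qed
  obtain \<tau> :: "('m \<Rightarrow> 'h) \<Rightarrow> 'm" where \<tau>: "inj_on \<tau> (carrier (free_module H UNIV))"
    using Hr.free_embedding_exists[OF f inf] by (rule exE)
  have "pbw_principal H sca ?W (reflection ` \<Delta>) T dual_action cscale cr rt (\<lambda>s. k (ro s)) SH.y B SH.Y cf \<tau> f"
    by (intro pbw_principal.intro pbw_universe.intro pbw free_embedded.intro free_embedded_axioms.intro
        pbw_principal_axioms.intro Hr.ring_axioms \<tau> f)
  then have "global_dimension TYPE('m) H = enat (card B)" by (rule pbw_principal.global_dimension_pbw)
  then show ?thesis by (simp only: B(4))
qed

end
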